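(* Let $\Omega \subset \mathbb{R}^N$ be a bounded domain containing the origin, let $1 < p < N$ and $0 < s < p$, and put $p^\ast(s) = (N-s)p/(N-p)$. Let $\lambda_1 > 0$ be the first Dirichlet eigenvalue of $-\Delta_p$ on $\Omega$. If $$\lambda_1 - \frac{\mu_s}{V_s(\Omega)^{(p-s)/(N-s)}} < \lambda < \lambda_1,$$ then the problem $$-\Delta_p u = \lambda |u|^{p-2}u + \frac{|u|^{p^\ast(s)-2}}{|x|^s}\,u \ \text{ in } \Omega, \qquad u = 0 \ \text{ on } \partial\Omega$$ has a pair of nontrivial solutions $\pm u^\lambda$ such that $u^\lambda \to 0$ as $\lambda \nearrow \lambda_1$.
   Context: $\lambda > 0$ is a parameter and $\Delta_p u = \operatorname{div}(|\nabla u|^{p-2}\nabla u)$. Solutions are weak solutions in $W^{1,p}_0(\Omega)$, i.e. critical points of the $C^1$-functional $I_\lambda(u) = \int_\Omega \big[\frac1p(|\nabla u|^p - \lambda |u|^p) - \frac{1}{p^\ast(s)}\frac{|u|^{p^\ast(s)}}{|x|^s}\big]dx$ on $W^{1,p}_0(\Omega)$; convergence $u^\lambda \to 0$ is in $W^{1,p}_0(\Omega)$. The first eigenvalue $\lambda_1$ is the smallest $\lambda$ for which $-\Delta_p u = \lambda|u|^{p-2}u$ in $\Omega$, $u=0$ on $\partial\Omega$ has a nontrivial weak solution in $W^{1,p}_0(\Omega)$. The best constant in the Hardy-Sobolev inequality is $$\mu_s = \inf_{u \in W^{1,p}_0(\Omega)\setminus\{0\}} \frac{\int_\Omega |\nabla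 u|^p\,dx}{\left(\int_\Omega \frac{|u|^{p^\ast(s)}}{|x|^s}\,dx\right)^{p/p^\ast(s)}},$$ which is independent of $\Omega$, and $$V_s(\Omega) = \int_\Omega |x|^{(N-p)s/(p-s)}\,dx.$$ *)

theory Defs
  imports "HOL-Analysis.Analysis"
begin

text \<open>
  Functions on an open set \<open>\<Omega>\<close> are represented by total functions on the ambient Euclidean space.
  Only their restrictions to \<open>\<Omega>\<close>, up to Lebesgue-null sets, matter. The space dimension
  \<open>N\<close> is \<open>DIM('a)\<close>.
\<close>

primrec C_k :: "nat \<Rightarrow> ('a::euclidean_space \<Rightarrow> real) \<Rightarrow> bool" where
  "C_k 0 f \<longleftrightarrow> continuous_on UNIV f"
| "C_k (Suc k) f \<longleftrightarrow>
     (\<forall>x. f differentiable (at x)) \<and>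
     (\<forall>b\<in>Basis. C_k k (\<lambda>x. frechet_derivative f (at x) b))"

definition test_function :: "'a::euclidean_space set \<Rightarrow> ('a \<Rightarrow> real) \<Rightarrow> bool" where
  "test_function \<Omega> \<phi> \<longleftrightarrow>
     (\<forall>k. C_k k \<phi>) \<and> compact (closure {x. \<phi> x \<noteq> 0}) \<and> closure {x. \<phi> x \<noteq> 0} \<subseteq> \<Omega>"

definition locally_integrable :: "'a::euclidean_space set \<Rightarrow> ('a \<Rightarrow> 'b::euclidean_space) \<Rightarrow> bool" where
  "locally_integrable \<Omega> f \<longleftrightarrow> (\<forall>K. compact K \<and> K \<subseteq> \<Omega> \<longrightarrow> integrable (lebesgue_on K) f)"

definition has_weak_gradient ::
  "'a::euclidean_space set \<Rightarrow> ('a \<Rightarrow> real) \<Rightarrow> ('a \<Rightarrow> 'a) \<Rightarrow> bool" where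
  "has_weak_gradient \<Omega> u g \<longleftrightarrow>
     locally_integrable \<Omega> u \<and> locally_integrable \<Omega> g \<and>
     (\<forall>\<phi>. test_function \<Omega> \<phi> \<longrightarrow> (\<forall>b\<in>Basis.
        (LINT x|lebesgue_on \<Omega>. u x * frechet_derivative \<phi> (at x) b)
          = - (LINT x|lebesgue_on \<Omega>. (g x \<bullet> b) * \<phi> x)))"

text \<open>A weak gradient is unique up to a null set, so the integrals below do not depend on the choice.\<close>

definition weak_gradient :: "'a::euclidean_space set \<Rightarrow> ('a \<Rightarrow> real) \<Rightarrow> 'a \<Rightarrow> 'a" where
  "weak_gradient \<Omega> u = (SOME g. has_weak_gradient \<Omega> u g)"

definition Lp :: "real \<Rightarrow> 'a::euclidean_space set \<Rightarrow> ('a \<Rightarrow> 'b::euclidean_space) set" where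
  "Lp p \<Omega> = {f. f \<in> borel_measurable (lebesgue_on \<Omega>) \<and>
                integrable (lebesgue_on \<Omega>) (\<lambda>x. norm (f x) powr p)}"

definition sobolev_W1 :: "real \<Rightarrow> 'a::euclidean_space set \<Rightarrow> ('a \<Rightarrow> real) set" where
  "sobolev_W1 p \<Omega> = {u \<in> Lp p \<Omega>. \<exists>g \<in> Lp p \<Omega>. has_weak_gradient \<Omega> u g}"

definition sobolev_norm :: "real \<Rightarrow> 'a::euclidean_space set \<Rightarrow> ('a \<Rightarrow> real) \<Rightarrow> real" where
  "sobolev_norm p \<Omega> u =
     ((LINT x|lebesgue_on \<Omega>. \<bar>u x\<bar> powr p)
      + (LINT x|lebesgue_on \<Omega>. norm (weak_gradient \<Omega> u x) powr p)) powr (1 / p)"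

definition sobolev_W1_0 :: "real \<Rightarrow> 'a::euclidean_space set \<Rightarrow> ('a \<Rightarrow> real) set" where
  "sobolev_W1_0 p \<Omega> = {u \<in> sobolev_W1 p \<Omega>.
     \<forall>\<epsilon>>0. \<exists>\<phi>. test_function \<Omega> \<phi> \<and> sobolev_norm p \<Omega> (\<lambda>x. u x - \<phi> x) < \<epsilon>}"

definition nontrivial_on :: "'a::euclidean_space set \<Rightarrow> ('a \<Rightarrow> real) \<Rightarrow> bool" where
  "nontrivial_on \<Omega> u \<longleftrightarrow> \<not> (AE x in lebesgue_on \<Omega>. u x = 0)"

text \<open>
  Weak solutions in \<open>W\<^sub>0\<^sup>1\<^sup>,\<^sup>p(\<Omega>)\<close> of \<open>- \<Delta>\<^sub>p u = F x u\<close> in \<open>\<Omega>\<close>, \<open>u = 0\<close> on \<open>\<partial>\<Omega>\<close>. The left-hand integrand is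
  integrable by Hoelder's inequality; for the right-hand one this is required, since a Bochner
  integral that does not exist has the value 0. Here and below \<open>0 powr a = 0\<close> gives
  \<open>|t| powr (q - 2) * t\<close> its intended value 0 at \<open>t = 0\<close> also when \<open>q < 2\<close>.
\<close>

definition weak_solution ::
  "real \<Rightarrow> 'a::euclidean_space set \<Rightarrow> ('a \<Rightarrow> real \<Rightarrow> real) \<Rightarrow> ('a \<Rightarrow> real) \<Rightarrow> bool" where
  "weak_solution p \<Omega> F u \<longleftrightarrow>
     u \<in> sobolev_W1_0 p \<Omega> \<and>
     (\<forall>v \<in> sobolev_W1_0 p \<Omega>.
        integrable (lebesgue_on \<Omega>) (\<lambda>x. F x (u x) * v x) \<and>
        (LINT x|lebesgue_on \<Omega>.
           norm (weak_gradient \<Omega> u x) powr (p - 2) * (weak_gradient \<Omega> u x \<bullet> weak_gradient \<Omega> v x))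
          = (LINT x|lebesgue_on \<Omega>. F x (u x) * v x))"

definition p_laplace_eigenvalue :: "real \<Rightarrow> 'a::euclidean_space set \<Rightarrow> real \<Rightarrow> bool" where
  "p_laplace_eigenvalue p \<Omega> lam \<longleftrightarrow>
     (\<exists>u. weak_solution p \<Omega> (\<lambda>x t. lam * (\<bar>t\<bar> powr (p - 2) * t)) u \<and> nontrivial_on \<Omega> u)"

definition first_eigenvalue :: "real \<Rightarrow> 'a::euclidean_space set \<Rightarrow> real" where
  "first_eigenvalue p \<Omega> = (LEAST lam. p_laplace_eigenvalue p \<Omega> lam)"

definition hs_exponent :: "'a::euclidean_space itself \<Rightarrow> real \<Rightarrow> real \<Rightarrow> real" where
  "hs_exponent _ p s = (real DIM('a) - s) * p / (real DIM('a) - p)"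

text \<open>The singular weight at the origin is 0 here (division by zero), which affects only a null set.\<close>

definition hs_constant :: "real \<Rightarrow> real \<Rightarrow> 'a::euclidean_space set \<Rightarrow> real" where
  "hs_constant p s \<Omega> =
     (INF u \<in> {u \<in> sobolev_W1_0 p \<Omega>. nontrivial_on \<Omega> u}.
        (LINT x|lebesgue_on \<Omega>. norm (weak_gradient \<Omega> u x) powr p) /
        (LINT x|lebesgue_on \<Omega>. \<bar>u x\<bar> powr hs_exponent TYPE('a) p s / norm x powr s)
          powr (p / hs_exponent TYPE('a) p s))"

definition hs_volume :: "real \<Rightarrow> real \<Rightarrow> 'a::euclidean_space set \<Rightarrow> real" where
  "hs_volume p s \<Omega> = (LINT x|lebesgue_on \<Omega>. norm x powr ((real DIM('a) - p) * s / (p - s)))"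

definition hs_energy ::
  "real \<Rightarrow> real \<Rightarrow> 'a::euclidean_space set \<Rightarrow> real \<Rightarrow> ('a \<Rightarrow> real) \<Rightarrow> real" where
  "hs_energy p s \<Omega> lam u =
     (LINT x|lebesgue_on \<Omega>.
        1 / p * (norm (weak_gradient \<Omega> u x) powr p - lam * \<bar>u x\<bar> powr p)
        - 1 / hs_exponent TYPE('a) p s * (\<bar>u x\<bar> powr hs_exponent TYPE('a) p s / norm x powr s))"

text \<open>\<open>J\<close> has the Frechet derivative 0 at \<open>u\<close> in the normed space \<open>W\<^sub>0\<^sup>1\<^sup>,\<^sup>p(\<Omega>)\<close>.\<close>

definition critical_point ::
  "real \<Rightarrow> 'a::euclidean_space set \<Rightarrow> (('a \<Rightarrow> real) \<Rightarrow> real) \<Rightarrow> ('a \<Rightarrow> real) \<Rightarrow> bool" where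
  "critical_point p \<Omega> J u \<longleftrightarrow>
     u \<in> sobolev_W1_0 p \<Omega> \<and>
     (\<forall>\<epsilon>>0. \<exists>\<delta>>0. \<forall>v \<in> sobolev_W1_0 p \<Omega>. sobolev_norm p \<Omega> v < \<delta> \<longrightarrow>
        \<bar>J (\<lambda>x. u x + v x) - J u\<bar> \<le> \<epsilon> * sobolev_norm p \<Omega> v)"

text \<open>
  The two conjuncts are equivalent, because the energy is continuously differentiable and the weak
  formulation says that its derivative vanishes at \<open>u\<close>. Solutions are understood in both senses.
\<close>

definition hs_solution ::
  "real \<Rightarrow> real \<Rightarrow> 'a::euclidean_space set \<Rightarrow> real \<Rightarrow> ('a \<Rightarrow> real) \<Rightarrow> bool" where
  "hs_solution p s \<Omega> lam u \<longleftrightarrow>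
     weak_solution p \<Omega>
       (\<lambda>x t. lam * (\<bar>t\<bar> powr (p - 2) * t)
              + \<bar>t\<bar> powr (hs_exponent TYPE('a) p s - 2) / norm x powr s * t) u \<and>
     critical_point p \<Omega> (hs_energy p s \<Omega> lam) u"

end

theory Submission
  imports Defs "HOL-Complex_Analysis.Great_Picard" "HOL-Computational_Algebra.Polynomial"
begin

text \<open>
  Write \<open>q = p\<^sup>*(s)\<close>, \<open>B(u) = \<integral> |u|\<^sup>q/|x|\<^sup>s\<close> and \<open>E(u) = \<integral> |\<nabla>u|\<^sup>p - \<lambda> \<integral> |u|\<^sup>p\<close>. The solution is a multiple of a minimiser of
  \<open>E(u)\<close> under the constraint \<open>B(u) = 1\<close>. Let \<open>S\<close> be the infimum. For \<open>\<lambda> < \<lambda>\<^sub>1\<close> it is positive, because \<open>E\<close>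
  controls \<open>\<integral> |\<nabla>u|\<^sup>p\<close>. Hoelder's inequality with the weight \<open>|x|\<^sup>s\<close> gives
  \<open>\<integral> |u|\<^sup>p \<le> V B(u)\<^bsup>p/q\<^esup>\<close> with \<open>V = V\<^sub>s(\<Omega>)\<^bsup>(p-s)/(N-s)\<^esup>\<close>, and inserting the first eigenfunction yields
  \<open>S \<le> (\<lambda>\<^sub>1 - \<lambda>) V\<close>. So the assumption on \<open>\<lambda>\<close> implies that \<open>S < \<mu>\<^sub>s\<close>.

  This strict inequality makes the infimum attained. A minimising sequence \<open>v\<^sub>n\<close> has a limit \<open>u\<close> in \<open>L\<^sup>p\<close> and in
  \<open>L\<^sup>q\<close>, since \<open>q\<close> is subcritical for the unweighted Sobolev embedding (lemma \<open>rellich_W0\<close>). Hence mass of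
  \<open>|v\<^sub>n|\<^sup>q/|x|\<^sup>s\<close> can be lost only at the origin. Cutting off near the origin and applying the Hardy-Sobolev
  inequality there shows that the loss costs energy \<open>\<mu>\<^sub>s (1 - B(u))\<^bsup>p/q\<^esup>\<close> (lemma \<open>concentration_bound\<close>):
  \<open>S \<ge> E(u) + \<mu>\<^sub>s (1 - B(u))\<^bsup>p/q\<^esup> \<ge> S B(u)\<^bsup>p/q\<^esup> + \<mu>\<^sub>s (1 - B(u))\<^bsup>p/q\<^esup>\<close>. As \<open>p/q < 1\<close> and \<open>S < \<mu>\<^sub>s\<close>, this forces
  \<open>B(u) = 1\<close> (lemma \<open>minimiser_exists\<close>).

  For \<open>U = S\<^bsup>1/(q-p)\<^esup> u\<close> one has \<open>E(U) = B(U) = S\<^bsup>q/(q-p)\<^esup>\<close>, and minimality along lines \<open>U + t v\<close> is the weak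
  equation (lemma \<open>hs_solution_of_optimal\<close>). Both \<open>\<integral> |\<nabla>U|\<^sup>p\<close> and \<open>\<integral> |U|\<^sup>p\<close> are bounded by powers of
  \<open>S \<le> (\<lambda>\<^sub>1 - \<lambda>) V\<close>, which gives \<open>U \<rightarrow> 0\<close> as \<open>\<lambda>\<close> increases to \<open>\<lambda>\<^sub>1\<close>.

  Three points keep the argument elementary. The Hardy-Sobolev inequality holds by the definition of \<open>\<mu>\<^sub>s\<close> as soon
  as \<open>\<mu>\<^sub>s > 0\<close>; if \<open>\<mu>\<^sub>s \<le> 0\<close> there is no admissible \<open>\<lambda>\<close>. Weak compactness is replaced by uniform convexity: almost
  optimal elements in the midpoint hulls of the tails of a sequence converge strongly (lemma
  \<open>strong_limit_of_midpoints\<close>). Compactness in \<open>L\<^sup>r\<close> is obtained from averages over dyadic cells, whose error is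
  bounded by the gradient (lemma \<open>cell_avg_error\<close>).
\<close>

section \<open>Pointwise inequalities for powers of the norm\<close>

lemma norm_add_powr_le:
  fixes a b :: "'b::real_normed_vector"
  assumes "0 \<le> p"
  shows "norm (a + b) powr p \<le> 2 powr p * (norm a powr p + norm b powr p)"
proof -
  have "norm (a + b) \<le> 2 * max (norm a) (norm b)"
    using norm_triangle_ineq[of a b] by linarith
  then have "norm (a + b) powr p \<le> (2 * max (norm a) (norm b)) powr p"
    by (intro powr_mono2) (use assms in auto)
  also have "\<dots> = 2 powr p * max (norm a) (norm b) powr p"
    by (simp add: powr_mult)
  also have "max (norm a) (norm b) powr p \<le> norm a powr p + norm b powr p"
    by (simp add: max_def)
  finally show ?thesis by (simp add: mult_left_mono)
qed

text \<open>
  Where \<open>b\<close> is small compared with \<open>a\<close>, adding it costs only the factor \<open>1 + \<epsilon>\<close>; elsewhere \<open>a\<close> is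
  itself bounded by a multiple of \<open>b\<close>.
\<close>

lemma norm_add_powr_eps:
  assumes "0 < p" "0 < \<epsilon>"
  obtains C where "0 \<le> C"
    "\<And>a b::'b::real_normed_vector. norm (a + b) powr p \<le> (1 + \<epsilon>) * norm a powr p + C * norm b powr p"
proof -
  define \<eta> where "\<eta> = (1 + \<epsilon>) powr (1 / p) - 1"
  have "1 < (1 + \<epsilon>) powr (1 / p)" using assms by (intro gr_one_powr) auto
  then have \<eta>: "0 < \<eta>" by (simp add: \<eta>_def)
  have \<eta>p: "(1 + \<eta>) powr p = 1 + \<epsilon>" using assms by (simp add: \<eta>_def powr_powr)
  show ?thesis
  proof
    show "0 \<le> (1 + 1/\<eta>) powr p" by simp
    fix a b :: 'b
    show "norm (a + b) powr p \<le> (1 + \<epsilon>) * norm a powr p + (1 + 1/\<eta>) powr p * norm b powr p"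
    proof (cases "norm b \<le> \<eta> * norm a")
      case True
      then have "norm (a + b) \<le> (1 + \<eta>) * norm a"
        using norm_triangle_ineq[of a b] by (simp add: algebra_simps)
      then have "norm (a + b) powr p \<le> ((1 + \<eta>) * norm a) powr p"
        using assms by (intro powr_mono2) auto
      also have "\<dots> = (1 + \<epsilon>) * norm a powr p"
        using \<eta> \<eta>p by (simp add: powr_mult)
      finally show ?thesis by (smt (verit) mult_nonneg_nonneg powr_ge_zero)
    next
      case False
      then have "norm a \<le> 1/\<eta> * norm b" using \<eta> by (simp add: field_simps)
      then have "norm (a + b) \<le> (1 + 1/\<eta>) * norm b"
        using norm_triangle_ineq[of a b] by (simp add: algebra_simps)
      then have "norm (a + b) powr p \<le> ((1 + 1/\<eta>) * norm b) powr p"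
        using assms by (intro powr_mono2) auto
      also have "\<dots> = (1 + 1/\<eta>) powr p * norm b powr p"
        using \<eta> by (simp add: powr_mult)
      finally show ?thesis using assms by (smt (verit) mult_nonneg_nonneg powr_ge_zero)
    qed
  qed
qed

text \<open>
  After division by the midpoint the points are \<open>1 - t\<close> and \<open>1 + t\<close>, and \<open>(1 + t)\<^sup>p + (1 - t)\<^sup>p\<close> is strictly
  increasing in \<open>t\<close>.
\<close>

lemma powr_midpoint_less:
  fixes x y :: real
  assumes "1 < p" "0 \<le> x" "0 \<le> y" "x \<noteq> y"
  shows "((x + y) / 2) powr p < (x powr p + y powr p) / 2"
proof -
  have main: "((x + y) / 2) powr p < (x powr p + y powr p) / 2" if "0 \<le> x" "x < y" for x y :: real
  proof -
    define m where "m = (x + y) / 2"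
    define t where "t = (y - x) / (x + y)"
    have m: "0 < m" and t: "0 < t" "t \<le> 1" and xy: "x = m * (1 - t)" "y = m * (1 + t)"
      using that by (auto simp: m_def t_def field_simps)
    define f where "f = (\<lambda>t::real. (1 + t) powr p + (1 - t) powr p)"
    have "f 0 < f t"
    proof (rule DERIV_pos_imp_increasing_open[OF t(1)])
      fix u :: real assume u: "0 < u" "u < t"
      have "(f has_real_derivative p * (1 + u) powr (p - 1) - p * (1 - u) powr (p - 1)) (at u)"
        unfolding f_def using u t by (auto intro!: derivative_eq_intros)
      moreover have "(1 - u) powr (p - 1) < (1 + u) powr (p - 1)"
        using u t assms(1) by (intro powr_less_mono2) auto
      ultimately show "\<exists>y. (f has_real_derivative y) (at u) \<and> 0 < y"
        using assms(1) by (intro exI[of _ "p * (1 + u) powr (p - 1) - p * (1 - u) powr (p - 1)"]) simp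
    next
      show "continuous_on {0..t} f" unfolding f_def
        using t assms(1) by (intro continuous_intros continuous_on_powr') auto
    qed
    then have "2 < (1 + t) powr p + (1 - t) powr p" by (simp add: f_def)
    then have "m powr p * 2 < m powr p * ((1 + t) powr p + (1 - t) powr p)"
      using m by (intro mult_strict_left_mono) auto
    also have "\<dots> = x powr p + y powr p"
      using m t by (simp only: xy powr_mult) (simp add: distrib_left)
    finally show ?thesis by (simp add: m_def)
  qed
  show ?thesis
    using main[of x y] main[of y x] assms by (cases "x < y") (auto simp: add.commute)
qed

lemma norm_midpoint_powr_less:
  fixes a b :: "'b::real_inner"
  assumes "1 < p" "a \<noteq> b"
  shows "norm ((a + b) /\<^sub>R 2) powr p < (norm a powr p + norm b powr p) / 2"
proof (cases "norm a = norm b")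
  case True
  have "norm ((a + b) /\<^sub>R 2) < norm a"
  proof -
    have "(norm (a + b))\<^sup>2 + (norm (a - b))\<^sup>2 = 2 * (norm a)\<^sup>2 + 2 * (norm b)\<^sup>2"
      by (simp add: power2_norm_eq_inner algebra_simps inner_commute)
    moreover have "0 < (norm (a - b))\<^sup>2" using assms(2) by simp
    moreover have "(2 * norm a)\<^sup>2 = 2 * (norm a)\<^sup>2 + 2 * (norm b)\<^sup>2" using True by (simp add: power_mult_distrib)
    ultimately have "(norm (a + b))\<^sup>2 < (2 * norm a)\<^sup>2" by linarith
    then have "norm (a + b) < 2 * norm a" by (rule power2_less_imp_less) simp
    then show ?thesis by simp
  qed
  then show ?thesis using assms True by (simp add: powr_less_mono2)
next
  case False
  have "norm ((a + b) /\<^sub>R 2) \<le> (norm a + norm b) / 2"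
    using norm_triangle_ineq[of a b] by simp
  then have "norm ((a + b) /\<^sub>R 2) powr p \<le> ((norm a + norm b) / 2) powr p"
    using assms by (intro powr_mono2) auto
  also have "\<dots> < (norm a powr p + norm b powr p) / 2"
    using False assms by (intro powr_midpoint_less) auto
  finally show ?thesis .
qed

lemma norm_midpoint_powr_le:
  fixes a b :: "'b::real_inner"
  assumes "1 < p"
  shows "norm ((a + b) /\<^sub>R 2) powr p \<le> (norm a powr p + norm b powr p) / 2"
proof (cases "a = b")
  case True
  then have "(a + b) /\<^sub>R 2 = a" by (simp flip: scaleR_2)
  then show ?thesis using True by simp
qed (use norm_midpoint_powr_less[OF assms, of a b] in simp)

text \<open>
  Both sides are homogeneous of degree \<open>p\<close>, so it suffices to treat \<open>|a|\<^sup>p + |b|\<^sup>p = 1\<close>. Among such pairs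
  those with \<open>|a - b|\<^sup>p \<ge> \<epsilon>\<close> form a compact set, on which the convexity gap has a positive minimum. This takes the place
  of Clarkson's inequalities and treats all \<open>p > 1\<close> alike.
\<close>

lemma uniform_convexity_pointwise:
  assumes "1 < p" "0 < \<epsilon>"
  obtains C where "0 \<le> C"
    "\<And>a b::'b::euclidean_space. norm (a - b) powr p \<le> \<epsilon> * (norm a powr p + norm b powr p)
        + C * ((norm a powr p + norm b powr p) / 2 - norm ((a + b) /\<^sub>R 2) powr p)"
proof -
  define N where "N = (\<lambda>z::'b \<times> 'b. norm (fst z) powr p + norm (snd z) powr p)"
  define D where "D = (\<lambda>z::'b \<times> 'b. norm (fst z - snd z) powr p)"
  define g where "g = (\<lambda>z::'b \<times> 'b. N z / 2 - norm ((fst z + snd z) /\<^sub>R 2) powr p)"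
  define K where "K = (cball 0 1 \<times> cball 0 1) \<inter> {z::'b\<times>'b. N z = 1} \<inter> {z. \<epsilon> \<le> D z}"
  have cont: "continuous_on UNIV N" "continuous_on UNIV D" "continuous_on UNIV g"
    unfolding N_def D_def g_def using assms by (auto intro!: continuous_intros continuous_on_powr')
  have "compact K" unfolding K_def
    using cont by (intro compact_Int_closed compact_Times closed_Collect_eq closed_Collect_le) (auto intro!: continuous_intros)
  have gpos: "0 < g z" if "z \<in> K" for z
  proof -
    have "fst z \<noteq> snd z" using that assms by (auto simp: K_def D_def)
    then show ?thesis using norm_midpoint_powr_less[OF assms(1), of "fst z" "snd z"] by (simp add: g_def N_def)
  qed
  obtain \<delta> where \<delta>: "0 < \<delta>" "\<And>z. z \<in> K \<Longrightarrow> \<delta> \<le> g z"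
  proof (cases "K = {}")
    case False
    then obtain z where "z \<in> K" "\<And>w. w \<in> K \<Longrightarrow> g z \<le> g w"
      using continuous_attains_inf[OF \<open>compact K\<close>, of g] cont(3) continuous_on_subset by blast
    then show ?thesis using that gpos by blast
  qed (use that[of 1] in auto)
  have g0: "0 \<le> g z" for z
    using norm_midpoint_powr_le[OF assms(1), of "fst z" "snd z"] by (simp add: g_def N_def)
  have unit: "D z \<le> \<epsilon> * N z + 2 powr p / \<delta> * g z" if "N z = 1" for z
  proof (cases "\<epsilon> \<le> D z")
    case True
    have le1: "norm c \<le> 1" if "norm c powr p \<le> 1" for c :: 'b
    proof (rule ccontr)
      assume "\<not> norm c \<le> 1"
      then have "1 < norm c powr p" using assms by (intro gr_one_powr) auto
      with that show False by simp
    qed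
    have "norm (fst z) powr p \<le> 1" "norm (snd z) powr p \<le> 1"
      using that by (auto simp: N_def) (smt (verit) powr_ge_zero)+
    then have "z \<in> K" using le1 True that by (cases z) (auto simp: K_def)
    have "D z \<le> 2 powr p * N z"
      using norm_add_powr_le[of p "fst z" "- snd z"] assms by (simp add: D_def N_def)
    also have "\<dots> = 2 powr p / \<delta> * \<delta>" using \<delta> that by simp
    also have "\<dots> \<le> 2 powr p / \<delta> * g z" using \<delta> \<open>z \<in> K\<close> by (intro mult_left_mono) auto
    finally show ?thesis using that assms by simp
  next
    case False
    have "0 \<le> 2 powr p / \<delta> * g z" using \<delta>(1) g0 by (intro mult_nonneg_nonneg) auto
    then show ?thesis using that False by simp
  qed
  show ?thesis
  proof
    show "0 \<le> 2 powr p / \<delta>" using \<delta> by simp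
    fix a b :: 'b
    define r where "r = N (a, b) powr (1/p)"
    show "norm (a - b) powr p \<le> \<epsilon> * (norm a powr p + norm b powr p)
        + 2 powr p / \<delta> * ((norm a powr p + norm b powr p) / 2 - norm ((a + b) /\<^sub>R 2) powr p)"
    proof (cases "a = 0 \<and> b = 0")
      case True
      then show ?thesis by simp
    next
      case False
      then have Npos: "0 < N (a, b)"
        by (auto simp: N_def intro: add_pos_nonneg add_nonneg_pos)
      then have r: "0 < r" "r powr p = N (a, b)" using assms by (auto simp: r_def powr_powr)
      define z where "z = (a /\<^sub>R r, b /\<^sub>R r)"
      have sc: "norm (c /\<^sub>R r) powr p = norm c powr p / N (a, b)" for c :: 'b
        using r by (simp add: powr_divide divide_inverse[symmetric] mult.commute[of "inverse r"])
      have "N z = (norm a powr p + norm b powr p) / N (a, b)"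
        unfolding z_def add_divide_distrib sc[symmetric] by (simp add: N_def)
      then have Nz: "N z = 1" using Npos by (simp add: N_def)
      have Dz: "D z = norm (a - b) powr p / N (a,b)"
        using sc[of "a - b"] by (simp add: z_def D_def scaleR_diff_right)
      have "(fst z + snd z) /\<^sub>R 2 = ((a + b) /\<^sub>R 2) /\<^sub>R r" by (simp add: z_def algebra_simps)
      then have gz: "g z = (N (a,b) / 2 - norm ((a + b) /\<^sub>R 2) powr p) / N (a,b)"
        using Npos Nz sc[of "(a + b) /\<^sub>R 2"] by (simp only: g_def diff_divide_distrib) simp
      have "D z * N (a,b) \<le> (\<epsilon> * N z + 2 powr p / \<delta> * g z) * N (a,b)"
        using unit[OF Nz] Npos by (intro mult_right_mono) auto
      also have "D z * N (a,b) = norm (a - b) powr p" using Npos by (simp add: Dz)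
      also have "(\<epsilon> * N z + 2 powr p / \<delta> * g z) * N (a,b)
          = \<epsilon> * N (a,b) + 2 powr p / \<delta> * (N (a,b) / 2 - norm ((a + b) /\<^sub>R 2) powr p)"
        using Npos by (simp only: Nz gz distrib_right mult.assoc nonzero_eq_divide_eq) simp
      finally show ?thesis by (simp only: N_def fst_conv snd_conv)
    qed
  qed
qed

text \<open>
  The gradient of \<open>|a|\<^sup>p/p\<close>, that is the nonlinearity of the p-Laplacian.
\<close>

definition power_flux :: "real \<Rightarrow> 'b::real_normed_vector \<Rightarrow> 'b" where
  "power_flux p a = norm a powr (p - 2) *\<^sub>R a"

lemma norm_power_flux: "norm (power_flux p a) = norm a powr (p - 1)"
proof (cases "a = 0")
  case False
  then have "norm a powr (p - 2) * norm a = norm a powr (p - 2) * norm a powr 1" by simp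
  also have "\<dots> = norm a powr (p - 1)" by (subst powr_add[symmetric]) simp
  finally show ?thesis by (simp add: power_flux_def)
qed (simp add: power_flux_def)

lemma inner_power_flux_self: "power_flux p a \<bullet> a = norm a powr p" for a :: "'b::real_inner"
proof (cases "a = 0")
  case False
  then have "norm a powr (p - 2) * (norm a)\<^sup>2 = norm a powr (p - 2) * norm a powr 2"
    by simp
  also have "\<dots> = norm a powr p" by (subst powr_add[symmetric]) simp
  finally show ?thesis by (simp add: power_flux_def power2_norm_eq_inner)
qed (simp add: power_flux_def)

lemma power_flux_scaleR:
  "0 < r \<Longrightarrow> power_flux p (r *\<^sub>R a) = r powr (p - 1) *\<^sub>R power_flux p a"
  for a :: "'b::real_normed_vector"
  by (simp add: power_flux_def powr_mult powr_diff) (simp add: powr_numeral power2_eq_square field_simps)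

lemma borel_measurable_power_flux [measurable]:
  "power_flux p \<in> borel_measurable (borel :: 'b::euclidean_space measure)"
  unfolding power_flux_def by measurable

text \<open>
  For \<open>|a| = 1\<close> and \<open>|b| \<le> 1/2\<close> the segment from \<open>a\<close> to \<open>a + b\<close> stays in an annulus. There the mean value
  theorem applies and the gradient of \<open>|a|\<^sup>p\<close> is uniformly continuous.
\<close>

lemma norm_powr_remainder_near_unit:
  assumes "0 < \<eta>"
  obtains \<delta> where "0 < \<delta>" "\<delta> \<le> 1/2"
    "\<And>a b::'b::euclidean_space. norm a = 1 \<Longrightarrow> norm b \<le> \<delta> \<Longrightarrow>
       \<bar>norm (a + b) powr p - norm a powr p - p * (power_flux p a \<bullet> b)\<bar> \<le> \<eta> * norm b"
proof -
  define A where "A = cball (0::'b) 2 - ball 0 (1/2)"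
  have "compact A" by (simp add: A_def compact_diff)
  have "continuous_on A (power_flux p)"
    unfolding power_flux_def A_def by (intro continuous_intros) auto
  then have "uniformly_continuous_on A (power_flux p)"
    using \<open>compact A\<close> compact_uniformly_continuous by blast
  moreover have "0 < \<eta> / (\<bar>p\<bar> + 1)" using assms by simp
  ultimately obtain d where d: "0 < d" "\<And>x y. x \<in> A \<Longrightarrow> y \<in> A \<Longrightarrow> dist y x < d \<Longrightarrow>
      dist (power_flux p y) (power_flux p x) < \<eta> / (\<bar>p\<bar> + 1)"
    unfolding uniformly_continuous_on_def by meson
  show ?thesis
  proof
    show "0 < min (1/2) (d/2)" "min (1/2) (d/2) \<le> 1/2" using d by auto
    fix a b :: 'b assume ab: "norm a = 1" "norm b \<le> min (1/2) (d/2)"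
    define f where "f = (\<lambda>t::real. ((a + t *\<^sub>R b) \<bullet> (a + t *\<^sub>R b)) powr (p/2))"
    have nz: "a + t *\<^sub>R b \<in> A" if "0 \<le> t" "t \<le> 1" for t
    proof -
      have "norm (t *\<^sub>R b) \<le> norm b" using that by (simp add: mult_left_le_one_le)
      then have "norm (t *\<^sub>R b) \<le> 1/2" using ab by linarith
      moreover have "norm a - norm (t *\<^sub>R b) \<le> norm (a + t *\<^sub>R b)" by (rule norm_diff_ineq)
      ultimately show ?thesis using ab norm_triangle_ineq[of a "t *\<^sub>R b"] by (simp add: A_def)
    qed
    have np: "(c \<bullet> c) powr e = norm c powr (2 * e)" if "c \<noteq> 0" for c :: 'b and e
    proof -
      have "c \<bullet> c = norm c powr 2"
        using that by (simp add: power2_norm_eq_inner)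
      then show ?thesis by (simp only: powr_powr)
    qed
    have der: "(f has_real_derivative p * (power_flux p (a + t *\<^sub>R b) \<bullet> b)) (at t)" if "0 \<le> t" "t \<le> 1" for t
    proof -
      have ne: "a + t *\<^sub>R b \<noteq> 0" using nz[OF that] by (auto simp: A_def)
      have "((\<lambda>t. (a + t *\<^sub>R b) \<bullet> (a + t *\<^sub>R b)) has_real_derivative 2 * ((a + t *\<^sub>R b) \<bullet> b)) (at t)"
        unfolding has_field_derivative_def
        by (auto intro!: derivative_eq_intros simp: algebra_simps inner_commute)
      from DERIV_fun_powr[OF this, of "p/2"] ne
      have "(f has_real_derivative p * (((a + t *\<^sub>R b) \<bullet> (a + t *\<^sub>R b)) powr (p/2 - 1) * ((a + t *\<^sub>R b) \<bullet> b))) (at t)"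
        by (simp add: f_def mult_ac)
      then show ?thesis using np[OF ne, of "p/2 - 1"] by (simp add: power_flux_def)
    qed
    obtain t where t: "0 < t" "t < 1" "f 1 - f 0 = (1 - 0) * (p * (power_flux p (a + t *\<^sub>R b) \<bullet> b))"
      using MVT2[of 0 1 f "\<lambda>t. p * (power_flux p (a + t *\<^sub>R b) \<bullet> b)"] der by auto
    have f01: "f 0 = norm a powr p" "f 1 = norm (a + b) powr p"
      using np[of a "p/2"] np[of "a + b" "p/2"] nz[of 0] nz[of 1]
      by (cases "a = 0"; cases "a + b = 0"; simp add: f_def A_def)+
    have "dist (a + t *\<^sub>R b) a < d"
    proof -
      have "norm (t *\<^sub>R b) \<le> norm b" using t by (simp add: mult_left_le_one_le)
      then show ?thesis using ab d(1) by (simp add: dist_norm)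
    qed
    then have "norm (power_flux p (a + t *\<^sub>R b) - power_flux p a) \<le> \<eta> / (\<bar>p\<bar> + 1)"
      using d(2)[of a "a + t *\<^sub>R b"] nz[of 0] nz[of t] t by (simp add: dist_norm)
    then have "\<bar>(power_flux p (a + t *\<^sub>R b) - power_flux p a) \<bullet> b\<bar> \<le> \<eta> / (\<bar>p\<bar> + 1) * norm b"
      by (meson Cauchy_Schwarz_ineq2 mult_right_mono norm_ge_zero order_trans)
    then have "\<bar>p\<bar> * \<bar>(power_flux p (a + t *\<^sub>R b) - power_flux p a) \<bullet> b\<bar> \<le> \<bar>p\<bar> * (\<eta> / (\<bar>p\<bar> + 1) * norm b)"
      by (intro mult_left_mono) auto
    also have "\<dots> \<le> \<eta> * norm b"
      using assms by (simp add: field_simps mult_left_mono)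
    finally show "\<bar>norm (a + b) powr p - norm a powr p - p * (power_flux p a \<bullet> b)\<bar> \<le> \<eta> * norm b"
      using t f01 by (simp add: inner_diff_left abs_mult[symmetric] right_diff_distrib)
  qed
qed

text \<open>
  By homogeneity \<open>|a| = 1\<close>; if \<open>|b|\<close> is bounded below, every term on the left is at most a multiple of
  \<open>|b|\<^sup>p\<close>. The form of the bound is the one that Hoelder's inequality turns into Frechet differentiability of
  \<open>\<integral> |f|\<^sup>p\<close>.
\<close>

lemma norm_powr_remainder:
  assumes "1 < p" "0 < \<eta>"
  obtains C where "0 \<le> C"
    "\<And>a b::'b::euclidean_space. \<bar>norm (a + b) powr p - norm a powr p - p * (power_flux p a \<bullet> b)\<bar>
       \<le> \<eta> * (norm a powr (p - 1) * norm b) + C * norm b powr p"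
proof -
  obtain \<delta> where \<delta>: "0 < \<delta>" "\<delta> \<le> 1/2"
    "\<And>a b::'b. norm a = 1 \<Longrightarrow> norm b \<le> \<delta> \<Longrightarrow>
       \<bar>norm (a + b) powr p - norm a powr p - p * (power_flux p a \<bullet> b)\<bar> \<le> \<eta> * norm b"
    using norm_powr_remainder_near_unit[OF assms(2), of p] by metis
  define C where "C = 2 powr p * (1 + 1 / \<delta> powr p) + 1 / \<delta> powr p + p * (1 / \<delta> powr (p-1))"
  have C1: "1 \<le> C"
  proof -
    have "1 \<le> 2 powr p" using assms by (simp add: ge_one_powr_ge_zero)
    then have "1 * 1 \<le> 2 powr p * (1 + 1 / \<delta> powr p)"
      by (intro mult_mono) auto
    moreover have "0 \<le> 1 / \<delta> powr p + p * (1 / \<delta> powr (p-1))" using assms by (intro add_nonneg_nonneg mult_nonneg_nonneg) auto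
    ultimately show ?thesis unfolding C_def by linarith
  qed
  have unit: "\<bar>norm (a + b) powr p - norm a powr p - p * (power_flux p a \<bullet> b)\<bar>
       \<le> \<eta> * norm b + C * norm b powr p" if a: "norm a = 1" for a b :: 'b
  proof (cases "norm b \<le> \<delta>")
    case True
    have "0 \<le> C * norm b powr p" using C1 by simp
    then show ?thesis using \<delta>(3)[OF a True] by linarith
  next
    case False
    define B where "B = norm b powr p"
    have Bd: "1 \<le> B / \<delta> powr p" using False \<delta>(1) assms by (simp add: B_def powr_mono2)
    have 1: "norm (a + b) powr p \<le> 2 powr p * (B / \<delta> powr p + B)"
      using norm_add_powr_le[of p a b] a assms Bd
      by (smt (verit, best) B_def mult_left_mono powr_ge_zero powr_one_eq_one)
    have nb: "norm b \<le> B / \<delta> powr (p-1)"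
    proof -
      have "norm b * \<delta> powr (p-1) \<le> norm b * norm b powr (p-1)"
        using False \<delta>(1) assms by (intro mult_left_mono powr_mono2) auto
      also have "\<dots> = B"
        using False \<delta>(1) by (simp add: B_def powr_diff)
      finally show ?thesis using \<delta>(1) by (simp add: field_simps)
    qed
    have "\<bar>power_flux p a \<bullet> b\<bar> \<le> norm b"
      using Cauchy_Schwarz_ineq2[of "power_flux p a" b] a by (simp add: norm_power_flux)
    then have 2: "\<bar>p * (power_flux p a \<bullet> b)\<bar> \<le> p * (B / \<delta> powr (p-1))"
      using nb assms by (simp add: abs_mult) (metis less_eq_real_def mult_left_mono order_trans times_divide_eq_right zero_le_one)
    have "C * B = 2 powr p * (B / \<delta> powr p + B) + B / \<delta> powr p + p * (B / \<delta> powr (p-1))"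
      by (simp add: C_def algebra_simps)
    then have "\<bar>norm (a + b) powr p - norm a powr p - p * (power_flux p a \<bullet> b)\<bar> \<le> C * B"
      using 1 2 Bd a by (smt (verit) powr_ge_zero powr_one_eq_one)
    moreover have "0 \<le> \<eta> * norm b" using assms by simp
    ultimately show ?thesis by (simp add: B_def)
  qed
  show ?thesis
  proof
    show "0 \<le> C" using C1 by simp
    fix a b :: 'b
    show "\<bar>norm (a + b) powr p - norm a powr p - p * (power_flux p a \<bullet> b)\<bar>
       \<le> \<eta> * (norm a powr (p - 1) * norm b) + C * norm b powr p"
    proof (cases "a = 0")
      case True
      then show ?thesis using C1 mult_right_mono[OF C1, of "norm b powr p"] by (simp add: power_flux_def)
    next
      case False
      define r where "r = norm a"
      have r: "0 < r" using False by (simp add: r_def)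
      define a' b' where "a' = a /\<^sub>R r" and "b' = b /\<^sub>R r"
      have ab: "a = r *\<^sub>R a'" "b = r *\<^sub>R b'" "norm a' = 1" using r by (auto simp: a'_def b'_def) (simp add: r_def)
      have sc: "norm (r *\<^sub>R c) powr p = r powr p * norm c powr p" for c :: 'b
        using r by (simp add: powr_mult)
      have rp: "r powr (p - 1) * r = r powr p" using r by (simp add: powr_diff)
      have "\<bar>norm (a + b) powr p - norm a powr p - p * (power_flux p a \<bullet> b)\<bar>
         = r powr p * \<bar>norm (a' + b') powr p - norm a' powr p - p * (power_flux p a' \<bullet> b')\<bar>"
      proof -
        have "norm (a + b) powr p = r powr p * norm (a' + b') powr p"
          using sc[of "a' + b'"] by (simp add: ab(1,2) scaleR_add_right)
        moreover have "norm a powr p = r powr p * norm a' powr p" using sc[of a'] ab by simp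
        moreover have "power_flux p a \<bullet> b = r powr p * (power_flux p a' \<bullet> b')"
          using r rp by (simp add: ab(1,2) power_flux_scaleR) (metis mult.assoc mult.commute)
        ultimately have "norm (a + b) powr p - norm a powr p - p * (power_flux p a \<bullet> b)
          = r powr p * (norm (a' + b') powr p - norm a' powr p - p * (power_flux p a' \<bullet> b'))"
          by (simp only: right_diff_distrib mult.left_commute)
        then show ?thesis by (simp only: abs_mult) simp
      qed
      also have "\<dots> \<le> r powr p * (\<eta> * norm b' + C * norm b' powr p)"
        using unit[OF ab(3)] by (intro mult_left_mono) auto
      also have "\<dots> = \<eta> * (norm a powr (p - 1) * norm b) + C * norm b powr p"
      proof -
        have "norm a powr (p - 1) = r powr (p - 1)" by (simp add: r_def)
        moreover have "norm b = r * norm b'" using r by (simp add: ab(2))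
        moreover have "norm b powr p = r powr p * norm b' powr p" using sc[of b'] by (simp add: ab(2))
        ultimately show ?thesis by (simp add: rp[symmetric] algebra_simps)
      qed
      finally show ?thesis .
    qed
  qed
qed

section \<open>Lebesgue spaces over an arbitrary measure\<close>

text \<open>
  The measure is arbitrary because the functions of interest live on the domain, whereas their averages live on
  the whole space.
\<close>

definition lp_space :: "real \<Rightarrow> 'm measure \<Rightarrow> ('m \<Rightarrow> 'b::euclidean_space) set" where
  "lp_space p M = {f \<in> borel_measurable M. integrable M (\<lambda>x. norm (f x) powr p)}"

text \<open>
  The \<open>p\<close>-th power of the norm. It is additive over disjoint supports, and the quasi-triangle inequalities below
  replace Minkowski's inequality throughout.
\<close>

definition lp_mass :: "real \<Rightarrow> 'm measure \<Rightarrow> ('m \<Rightarrow> 'b::euclidean_space) \<Rightarrow> real" where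
  "lp_mass p M f = (LINT x|M. norm (f x) powr p)"

lemma lp_spaceI:
  "f \<in> borel_measurable M \<Longrightarrow> integrable M (\<lambda>x. norm (f x) powr p) \<Longrightarrow> f \<in> lp_space p M"
  by (simp add: lp_space_def)

lemma lp_space_measurable: "f \<in> lp_space p M \<Longrightarrow> f \<in> borel_measurable M"
  by (simp add: lp_space_def)

lemma lp_space_integrable: "f \<in> lp_space p M \<Longrightarrow> integrable M (\<lambda>x. norm (f x) powr p)"
  by (simp add: lp_space_def)

lemma lp_mass_nonneg: "0 \<le> lp_mass p M f"
  by (simp add: lp_mass_def)

lemma nn_integral_lp_mass:
  "f \<in> lp_space p M \<Longrightarrow> (\<integral>\<^sup>+x. ennreal (norm (f x) powr p) \<partial>M) = ennreal (lp_mass p M f)"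
  unfolding lp_mass_def by (intro nn_integral_eq_integral) (auto simp: lp_space_def)

lemma lp_space_cong_AE:
  assumes "f \<in> lp_space p M" "g \<in> borel_measurable M" "AE x in M. f x = g x"
  shows "g \<in> lp_space p M" "lp_mass p M g = lp_mass p M f"
proof -
  have "AE x in M. norm (f x) powr p = norm (g x) powr p" using assms(3) by eventually_elim simp
  then show "g \<in> lp_space p M" "lp_mass p M g = lp_mass p M f"
    using assms(1,2) unfolding lp_space_def lp_mass_def
    by (auto intro!: integral_cong_AE elim: Bochner_Integration.integrable_cong_AE_imp)
qed

lemma lp_space_bounded:
  assumes "g \<in> borel_measurable M" "integrable M h" "AE x in M. norm (g x) powr p \<le> h x"
  shows "g \<in> lp_space p M" "lp_mass p M g \<le> (LINT x|M. h x)"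
proof -
  have meas [measurable]: "g \<in> borel_measurable M" by fact
  have int: "integrable M (\<lambda>x. norm (g x) powr p)"
    using assms(2) by (rule Bochner_Integration.integrable_bound) (use assms(3) in \<open>measurable, auto elim: eventually_mono\<close>)
  then show "g \<in> lp_space p M" by (simp add: lp_space_def)
  show "lp_mass p M g \<le> (LINT x|M. h x)" unfolding lp_mass_def
    by (rule integral_mono_AE[OF int assms(2,3)])
qed

lemma lp_space_scaleR:
  assumes "f \<in> lp_space p M" "0 < p"
  shows "(\<lambda>x. c *\<^sub>R f x) \<in> lp_space p M" "lp_mass p M (\<lambda>x. c *\<^sub>R f x) = \<bar>c\<bar> powr p * lp_mass p M f"
proof -
  have [measurable]: "f \<in> borel_measurable M" using assms by (simp add: lp_space_def)
  show "(\<lambda>x. c *\<^sub>R f x) \<in> lp_space p M" "lp_mass p M (\<lambda>x. c *\<^sub>R f x) = \<bar>c\<bar> powr p * lp_mass p M f"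
    using assms by (auto simp: lp_space_def lp_mass_def powr_mult)
qed

lemma lp_space_add:
  assumes "f \<in> lp_space p M" "g \<in> lp_space p M" "0 \<le> p"
  shows "(\<lambda>x. f x + g x) \<in> lp_space p M"
    "lp_mass p M (\<lambda>x. f x + g x) \<le> 2 powr p * (lp_mass p M f + lp_mass p M g)"
proof -
  have [measurable]: "f \<in> borel_measurable M" "g \<in> borel_measurable M"
    using assms by (auto simp: lp_space_def)
  have int: "integrable M (\<lambda>x. 2 powr p * (norm (f x) powr p + norm (g x) powr p))"
    using assms by (auto simp: lp_space_def)
  have ae: "AE x in M. norm (f x + g x) powr p \<le> 2 powr p * (norm (f x) powr p + norm (g x) powr p)"
    using norm_add_powr_le[OF assms(3)] by auto
  show "(\<lambda>x. f x + g x) \<in> lp_space p M" by (rule lp_space_bounded[OF _ int ae]) simp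
  have "lp_mass p M (\<lambda>x. f x + g x) \<le> (LINT x|M. 2 powr p * (norm (f x) powr p + norm (g x) powr p))"
    by (rule lp_space_bounded[OF _ int ae]) simp
  also have "\<dots> = 2 powr p * (lp_mass p M f + lp_mass p M g)"
    using assms by (simp add: lp_mass_def lp_space_def)
  finally show "lp_mass p M (\<lambda>x. f x + g x) \<le> 2 powr p * (lp_mass p M f + lp_mass p M g)" .
qed

lemma lp_space_diff:
  assumes "f \<in> lp_space p M" "g \<in> lp_space p M" "0 < p"
  shows "(\<lambda>x. f x - g x) \<in> lp_space p M"
    "lp_mass p M (\<lambda>x. f x - g x) \<le> 2 powr p * (lp_mass p M f + lp_mass p M g)"
proof -
  have g: "(\<lambda>x. - g x) \<in> lp_space p M" "lp_mass p M (\<lambda>x. - g x) = lp_mass p M g"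
    using lp_space_scaleR[OF assms(2,3), of "-1"] by auto
  show "(\<lambda>x. f x - g x) \<in> lp_space p M"
    "lp_mass p M (\<lambda>x. f x - g x) \<le> 2 powr p * (lp_mass p M f + lp_mass p M g)"
    using lp_space_add[OF assms(1) g(1)] assms(3) g(2) by auto
qed

lemma lp_mass_minus_commute: "lp_mass p M (\<lambda>x. f x - g x) = lp_mass p M (\<lambda>x. g x - f x)"
  unfolding lp_mass_def by (simp add: norm_minus_commute)

lemma lp_mass_eq_0_iff:
  assumes "f \<in> lp_space p M"
  shows "lp_mass p M f = 0 \<longleftrightarrow> (AE x in M. f x = 0)"
  unfolding lp_mass_def using integral_nonneg_eq_0_iff_AE[OF lp_space_integrable[OF assms]] by simp

lemma lp_mass_triangle_eps:
  fixes M :: "'m measure"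
  assumes "0 < p" "0 < \<epsilon>"
  obtains C where "0 \<le> C"
    "\<And>f g::'m \<Rightarrow> 'b::euclidean_space. f \<in> lp_space p M \<Longrightarrow> g \<in> lp_space p M \<Longrightarrow>
       lp_mass p M (\<lambda>x. f x + g x) \<le> (1 + \<epsilon>) * lp_mass p M f + C * lp_mass p M g"
proof -
  obtain C where C: "0 \<le> C"
    "\<And>a b::'b. norm (a + b) powr p \<le> (1 + \<epsilon>) * norm a powr p + C * norm b powr p"
    by (rule norm_add_powr_eps[OF assms]) (rule that)
  show ?thesis
  proof
    fix f g :: "'m \<Rightarrow> 'b" assume fg: "f \<in> lp_space p M" "g \<in> lp_space p M"
    then have [measurable]: "f \<in> borel_measurable M" "g \<in> borel_measurable M"
      by (auto simp: lp_space_def)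
    have "lp_mass p M (\<lambda>x. f x + g x) \<le> (LINT x|M. (1 + \<epsilon>) * norm (f x) powr p + C * norm (g x) powr p)"
      using fg by (intro lp_space_bounded) (auto simp: lp_space_def C)
    also have "\<dots> = (1 + \<epsilon>) * lp_mass p M f + C * lp_mass p M g"
      using fg by (simp add: lp_mass_def lp_space_def)
    finally show "lp_mass p M (\<lambda>x. f x + g x) \<le> (1 + \<epsilon>) * lp_mass p M f + C * lp_mass p M g" .
  qed (rule C(1))
qed

lemma lp_mass_tendsto:
  fixes f :: "'m \<Rightarrow> 'b::euclidean_space"
  assumes F: "\<And>n. F n \<in> lp_space p M" and f: "f \<in> lp_space p M" and p: "0 < p"
    and lim: "(\<lambda>n. lp_mass p M (\<lambda>x. F n x - f x)) \<longlonglongrightarrow> 0"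
  shows "(\<lambda>n. lp_mass p M (F n)) \<longlonglongrightarrow> lp_mass p M f"
proof (rule LIMSEQ_I)
  fix r :: real assume r: "0 < r"
  let ?L = "lp_mass p M f"
  have L: "0 \<le> ?L" by (rule lp_mass_nonneg)
  \<comment> \<open>Both \<open>e * ?L\<close> and \<open>e * (?L + r)\<close> have to stay below \<open>r / 4\<close>.\<close>
  define e where "e = r / (4 * (?L + r + 1))"
  have e: "0 < e" using r L by (simp add: e_def)
  have eL: "e * ?L < r / 4" "e * (?L + r) \<le> r / 4"
  proof -
    have "?L + r + 1 \<noteq> 0" using r L by linarith
    then have "e * (?L + r + 1) = r / 4" by (simp only: e_def times_divide_eq_left nonzero_divide_eq_eq divide_divide_eq_left[symmetric] mult.commute[of 4] nonzero_mult_div_cancel_right) simp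
    then have s: "e * ?L + e * r + e = r / 4" by (simp add: distrib_left)
    have "0 < e * r" using e r by simp
    then show "e * ?L < r / 4" "e * (?L + r) \<le> r / 4" using s e by (simp_all add: distrib_left)
  qed
  obtain C where C: "0 \<le> C" "\<And>f g::'m \<Rightarrow> 'b. f \<in> lp_space p M \<Longrightarrow> g \<in> lp_space p M \<Longrightarrow>
       lp_mass p M (\<lambda>x. f x + g x) \<le> (1 + e) * lp_mass p M f + C * lp_mass p M g"
    by (rule lp_mass_triangle_eps[OF p e, of M]) (rule that)
  have "0 < r / (4 * (C + 1))" using r C by simp
  then obtain N where N: "\<And>n. n \<ge> N \<Longrightarrow> norm (lp_mass p M (\<lambda>x. F n x - f x) - 0) < r / (4 * (C + 1))"
    using LIMSEQ_D[OF lim] by blast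
  show "\<exists>no. \<forall>n\<ge>no. norm (lp_mass p M (F n) - ?L) < r"
  proof (intro exI allI impI)
    fix n assume "n \<ge> N"
    define d where "d = lp_mass p M (\<lambda>x. F n x - f x)"
    have d: "0 \<le> d" "d < r / (4 * (C + 1))" using N[OF \<open>n \<ge> N\<close>] lp_mass_nonneg[of p M] by (auto simp: d_def)
    have "C * d \<le> C * (r / (4 * (C + 1)))" using d C by (intro mult_left_mono) auto
    also have "\<dots> \<le> r / 4" using C r by (simp add: field_simps)
    finally have Cd: "C * d \<le> r / 4" .
    have 1: "lp_mass p M (F n) \<le> (1 + e) * ?L + C * d"
      using C(2)[OF f lp_space_diff(1)[OF F[of n] f p]] by (simp add: d_def)
    have 2: "?L \<le> (1 + e) * lp_mass p M (F n) + C * d"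
      using C(2)[OF F[of n] lp_space_diff(1)[OF f F[of n] p]] by (simp add: d_def lp_mass_minus_commute)
    have up: "lp_mass p M (F n) < ?L + r" using 1 eL Cd r by (simp add: algebra_simps)
    then have "e * lp_mass p M (F n) \<le> e * (?L + r)" using e by (intro mult_left_mono) auto
    then have "?L < lp_mass p M (F n) + r" using 2 eL Cd r by (simp add: algebra_simps)
    then show "norm (lp_mass p M (F n) - ?L) < r" using up by auto
  qed
qed

text \<open>
  Young's inequality applied to the functions normalised to mass 1.
\<close>

lemma lp_holder:
  assumes f: "f \<in> lp_space a M" and g: "g \<in> lp_space b M"
    and ab: "1 < a" "1 < b" "1 / a + 1 / b = 1"
  shows "integrable M (\<lambda>x. norm (f x) * norm (g x))"
    "(LINT x|M. norm (f x) * norm (g x)) \<le> lp_mass a M f powr (1 / a) * lp_mass b M g powr (1 / b)"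
proof -
  have [measurable]: "f \<in> borel_measurable M" "g \<in> borel_measurable M"
    using f g by (auto simp: lp_space_def)
  have young: "norm (f x) * norm (g x) \<le> norm (f x) powr a / a + norm (g x) powr b / b" for x
    using Youngs_inequality[OF ab] by simp
  have intb: "integrable M (\<lambda>x. norm (f x) powr a / a + norm (g x) powr b / b)"
    using f g by (auto simp: lp_space_def)
  show int: "integrable M (\<lambda>x. norm (f x) * norm (g x))"
    using intb by (rule Bochner_Integration.integrable_bound) (use young ab in \<open>auto intro!: add_nonneg_nonneg\<close>)
  define A where "A = lp_mass a M f powr (1/a)"
  define B where "B = lp_mass b M g powr (1/b)"
  show "(LINT x|M. norm (f x) * norm (g x)) \<le> lp_mass a M f powr (1 / a) * lp_mass b M g powr (1 / b)"
  proof (cases "lp_mass a M f = 0 \<or> lp_mass b M g = 0")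
    case True
    then have "(AE x in M. f x = 0) \<or> (AE x in M. g x = 0)"
      by (simp only: lp_mass_eq_0_iff[OF f] lp_mass_eq_0_iff[OF g])
    then have "AE x in M. norm (f x) * norm (g x) = 0" by (auto elim: eventually_mono)
    then have "(LINT x|M. norm (f x) * norm (g x)) = (LINT x|M. 0)"
      by (intro integral_cong_AE) auto
    then show ?thesis by simp
  next
    case False
    then have pos: "0 < lp_mass a M f" "0 < lp_mass b M g"
      using lp_mass_nonneg[of a M f] lp_mass_nonneg[of b M g] by auto
    then have AB: "0 < A" "0 < B" "A powr a = lp_mass a M f" "B powr b = lp_mass b M g"
      using ab by (auto simp: A_def B_def powr_powr)
    have pw: "norm (f x) * norm (g x) \<le> A * B * (norm (f x) powr a / (a * A powr a) + norm (g x) powr b / (b * B powr b))" for x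
    proof -
      have "(norm (f x) / A) * (norm (g x) / B) \<le> (norm (f x) / A) powr a / a + (norm (g x) / B) powr b / b"
        using AB by (intro Youngs_inequality[OF ab]) auto
      also have "\<dots> = norm (f x) powr a / (a * A powr a) + norm (g x) powr b / (b * B powr b)"
        using AB by (simp add: powr_divide mult.commute)
      finally show ?thesis using AB by (simp add: field_simps)
    qed
    have "(LINT x|M. norm (f x) * norm (g x)) \<le> (LINT x|M. A * B * (norm (f x) powr a / (a * A powr a) + norm (g x) powr b / (b * B powr b)))"
      using f g by (intro integral_mono int pw) (auto simp: lp_space_def)
    also have "\<dots> = A * B * (lp_mass a M f / (a * A powr a) + lp_mass b M g / (b * B powr b))"
      using f g by (simp add: lp_space_def lp_mass_def)
    also have "\<dots> = A * B" using AB pos ab by simp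
    finally show ?thesis by (simp add: A_def B_def)
  qed
qed

lemma power_flux_pairing:
  assumes f: "f \<in> lp_space p M" and h: "h \<in> lp_space p M" and p: "1 < p"
  shows "integrable M (\<lambda>x. norm (f x) powr (p - 1) * norm (h x))"
    "(LINT x|M. norm (f x) powr (p - 1) * norm (h x)) \<le> lp_mass p M f powr (1 - 1/p) * lp_mass p M h powr (1/p)"
    "integrable M (\<lambda>x. power_flux p (f x) \<bullet> h x)"
proof -
  have [measurable]: "f \<in> borel_measurable M" "h \<in> borel_measurable M"
    using f h by (auto simp: lp_space_def)
  define a where "a = p / (p - 1)"
  have a: "1 < a" "1 / a + 1 / p = 1" "1 / a = 1 - 1/p" "(p - 1) * a = p" using p by (auto simp: a_def field_simps)
  have fl: "(\<lambda>x. norm (f x) powr (p - 1)) \<in> lp_space a M" "lp_mass a M (\<lambda>x. norm (f x) powr (p - 1)) = lp_mass p M f"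
    using f a by (auto simp: lp_space_def lp_mass_def powr_powr)
  show int: "integrable M (\<lambda>x. norm (f x) powr (p - 1) * norm (h x))"
    and "(LINT x|M. norm (f x) powr (p - 1) * norm (h x)) \<le> lp_mass p M f powr (1 - 1/p) * lp_mass p M h powr (1/p)"
    using lp_holder[OF fl(1) h a(1) p a(2)] fl(2) a(3) by auto
  show "integrable M (\<lambda>x. power_flux p (f x) \<bullet> h x)"
    using int by (rule Bochner_Integration.integrable_bound)
      (auto intro!: Cauchy_Schwarz_ineq2[THEN order_trans] simp: norm_power_flux)
qed

text \<open>
  The pointwise remainder bound is integrated; its first term is estimated by Hoelder's inequality, and its
  second is of order \<open>p > 1\<close> in the norm of \<open>h\<close>.
\<close>

lemma lp_mass_frechet:
  fixes f :: "'m \<Rightarrow> 'b::euclidean_space"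
  assumes f: "f \<in> lp_space p M" and p: "1 < p" and e: "0 < \<epsilon>"
  obtains \<delta> where "0 < \<delta>"
    "\<And>h. h \<in> lp_space p M \<Longrightarrow> lp_mass p M h powr (1/p) < \<delta> \<Longrightarrow>
       \<bar>lp_mass p M (\<lambda>x. f x + h x) - lp_mass p M f - p * (LINT x|M. power_flux p (f x) \<bullet> h x)\<bar>
         \<le> \<epsilon> * lp_mass p M h powr (1/p)"
proof -
  define L where "L = lp_mass p M f powr (1 - 1/p)"
  have L: "0 \<le> L" by (simp add: L_def)
  define \<eta> where "\<eta> = \<epsilon> / (2 * (L + 1))"
  have \<eta>: "0 < \<eta>" "\<eta> * L \<le> \<epsilon> / 2" using e L by (auto simp: \<eta>_def field_simps)
  obtain C where C: "0 \<le> C"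
    "\<And>a b::'b. \<bar>norm (a + b) powr p - norm a powr p - p * (power_flux p a \<bullet> b)\<bar>
       \<le> \<eta> * (norm a powr (p - 1) * norm b) + C * norm b powr p"
    by (rule norm_powr_remainder[OF p \<eta>(1)]) (rule that)
  define \<delta> where "\<delta> = (\<epsilon> / (2 * (C + 1))) powr (1 / (p - 1))"
  have \<delta>: "0 < \<delta>" "\<delta> powr (p - 1) = \<epsilon> / (2 * (C + 1))" using e C p by (auto simp: \<delta>_def powr_powr)
  have C\<delta>: "C * \<delta> powr (p - 1) \<le> \<epsilon> / 2" using C e by (simp add: \<delta>(2) field_simps)
  show ?thesis
  proof
    fix h :: "'m \<Rightarrow> 'b" assume h: "h \<in> lp_space p M"
    define s where "s = lp_mass p M h powr (1/p)"
    assume "lp_mass p M h powr (1/p) < \<delta>"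
    then have s: "0 \<le> s" "s < \<delta>" by (auto simp: s_def)
    have sp: "lp_mass p M h = s powr (p - 1) * s"
    proof (cases "s = 0")
      case False
      then have "s powr (p - 1) * s = s powr p" using s p by (simp add: powr_diff)
      then show ?thesis using p lp_mass_nonneg[of p M h] by (simp add: s_def powr_powr)
    qed (simp add: s_def)
    have [measurable]: "f \<in> borel_measurable M" "h \<in> borel_measurable M"
      using f h by (auto simp: lp_space_def)
    note pair = power_flux_pairing[OF f h p]
    have fh: "(\<lambda>x. f x + h x) \<in> lp_space p M" using lp_space_add f h p by fastforce
    have "lp_mass p M (\<lambda>x. f x + h x) - lp_mass p M f - p * (LINT x|M. power_flux p (f x) \<bullet> h x)
       = (LINT x|M. norm (f x + h x) powr p - norm (f x) powr p - p * (power_flux p (f x) \<bullet> h x))"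
      using pair(3) f fh by (simp add: lp_mass_def lp_space_def)
    also have "\<bar>\<dots>\<bar> \<le> (LINT x|M. \<eta> * (norm (f x) powr (p - 1) * norm (h x)) + C * norm (h x) powr p)"
      using C(2) pair f h fh
      by (intro integral_abs_bound[THEN order_trans] integral_mono integrable_abs)
        (auto simp: lp_space_def)
    also have "\<dots> = \<eta> * (LINT x|M. norm (f x) powr (p - 1) * norm (h x)) + C * lp_mass p M h"
      using pair(1) h by (simp add: lp_mass_def lp_space_def)
    also have "\<dots> \<le> \<eta> * (L * s) + C * (s powr (p - 1) * s)"
    proof -
      have "(LINT x|M. norm (f x) powr (p - 1) * norm (h x)) \<le> L * s"
        using pair(2) by (simp only: L_def s_def)
      from mult_left_mono[OF this less_imp_le[OF \<eta>(1)]] show ?thesis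
        by (simp only: sp add_right_mono)
    qed
    also have "\<dots> \<le> \<epsilon> / 2 * s + C * (\<delta> powr (p - 1) * s)"
    proof (rule add_mono)
      show "\<eta> * (L * s) \<le> \<epsilon> / 2 * s"
        using mult_right_mono[OF \<eta>(2) s(1)] by (simp only: mult.assoc)
      have "s powr (p - 1) \<le> \<delta> powr (p - 1)" using s p by (intro powr_mono2) simp_all
      then show "C * (s powr (p - 1) * s) \<le> C * (\<delta> powr (p - 1) * s)"
        using C(1) s(1) by (intro mult_left_mono mult_right_mono)
    qed
    also have "\<dots> \<le> \<epsilon> / 2 * s + \<epsilon> / 2 * s"
      using mult_right_mono[OF C\<delta> s(1)] by (simp only: mult.assoc add_left_mono)
    finally show "\<bar>lp_mass p M (\<lambda>x. f x + h x) - lp_mass p M f - p * (LINT x|M. power_flux p (f x) \<bullet> h x)\<bar>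
         \<le> \<epsilon> * lp_mass p M h powr (1/p)" by (simp add: s_def)
  qed (rule \<delta>(1))
qed

lemma lp_mass_directional_derivative:
  fixes f :: "'m \<Rightarrow> 'b::euclidean_space"
  assumes f: "f \<in> lp_space p M" and h: "h \<in> lp_space p M" and p: "1 < p"
  shows "((\<lambda>t. lp_mass p M (\<lambda>x. f x + t *\<^sub>R h x)) has_real_derivative
            p * (LINT x|M. power_flux p (f x) \<bullet> h x)) (at 0)"
proof -
  let ?\<Phi> = "\<lambda>t. lp_mass p M (\<lambda>x. f x + t *\<^sub>R h x)"
  let ?D = "p * (LINT x|M. power_flux p (f x) \<bullet> h x)"
  define s where "s = lp_mass p M h powr (1/p)"
  have s: "0 \<le> s" by (simp add: s_def)
  have hs: "lp_mass p M (\<lambda>x. t *\<^sub>R h x) powr (1/p) = \<bar>t\<bar> * s" for t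
    using p lp_mass_nonneg[of p M h] by (simp add: lp_space_scaleR(2)[OF h] powr_mult powr_powr s_def)
  have lin: "(LINT x|M. power_flux p (f x) \<bullet> t *\<^sub>R h x) = t * (LINT x|M. power_flux p (f x) \<bullet> h x)" for t by simp
  show ?thesis unfolding DERIV_def
  proof (rule LIM_I)
    fix r :: real assume r: "0 < r"
    have "0 < r / (2 * (s + 1))" using r s by simp
    then obtain \<delta> where \<delta>: "0 < \<delta>" "\<And>g. g \<in> lp_space p M \<Longrightarrow> lp_mass p M g powr (1/p) < \<delta> \<Longrightarrow>
       \<bar>lp_mass p M (\<lambda>x. f x + g x) - lp_mass p M f - p * (LINT x|M. power_flux p (f x) \<bullet> g x)\<bar>
         \<le> r / (2 * (s + 1)) * lp_mass p M g powr (1/p)"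
      by (rule lp_mass_frechet[OF f p]) (rule that)
    show "\<exists>d>0. \<forall>t. t \<noteq> 0 \<and> norm (t - 0) < d \<longrightarrow> norm ((?\<Phi> (0 + t) - ?\<Phi> 0) / t - ?D) < r"
    proof (intro exI conjI allI impI)
      show "0 < \<delta> / (s + 1)" using \<delta> s by simp
      fix t :: real assume t: "t \<noteq> 0 \<and> norm (t - 0) < \<delta> / (s + 1)"
      have "\<bar>t\<bar> * s \<le> \<bar>t\<bar> * (s + 1)" by (simp add: mult_left_mono)
      also have "\<dots> < \<delta>" using t s by (simp add: field_simps)
      finally have "\<bar>t\<bar> * s < \<delta>" .
      then have "\<bar>?\<Phi> t - ?\<Phi> 0 - t * ?D\<bar> \<le> r / (2 * (s + 1)) * (\<bar>t\<bar> * s)"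
        using \<delta>(2)[of "\<lambda>x. t *\<^sub>R h x"] lp_space_scaleR(1)[OF h, of t] p
        by (simp only: hs lin) (simp add: mult.left_commute)
      also have "\<dots> = \<bar>t\<bar> * (r * s / (2 * (s + 1)))" by simp
      also have "\<dots> < \<bar>t\<bar> * r"
      proof (rule mult_strict_left_mono)
        have "r * s < r * (2 * (s + 1))" using r s by simp
        moreover have "0 < 2 * (s + 1)" using s by simp
        ultimately show "r * s / (2 * (s + 1)) < r" by (simp only: pos_divide_less_eq)
      qed (use t in auto)
      finally have "\<bar>?\<Phi> t - ?\<Phi> 0 - t * ?D\<bar> / \<bar>t\<bar> < r" using t by (simp add: pos_divide_less_eq mult.commute del: scaleR_zero_left)
      then have "\<bar>(?\<Phi> t - ?\<Phi> 0 - t * ?D) / t\<bar> < r" by (simp only: abs_divide)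
      then show "norm ((?\<Phi> (0 + t) - ?\<Phi> 0) / t - ?D) < r" using t by (simp add: diff_divide_distrib)
    qed
  qed
qed

lemma lp_uniform_convexity:
  fixes M :: "'m measure"
  assumes "1 < p" "0 < \<epsilon>"
  obtains C where "0 \<le> C"
    "\<And>f g::'m \<Rightarrow> 'b::euclidean_space. f \<in> lp_space p M \<Longrightarrow> g \<in> lp_space p M \<Longrightarrow>
       lp_mass p M (\<lambda>x. f x - g x) \<le> \<epsilon> * (lp_mass p M f + lp_mass p M g)
        + C * ((lp_mass p M f + lp_mass p M g) / 2 - lp_mass p M (\<lambda>x. (f x + g x) /\<^sub>R 2))"
proof -
  obtain C where C: "0 \<le> C"
    "\<And>a b::'b. norm (a - b) powr p \<le> \<epsilon> * (norm a powr p + norm b powr p)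
        + C * ((norm a powr p + norm b powr p) / 2 - norm ((a + b) /\<^sub>R 2) powr p)"
    by (rule uniform_convexity_pointwise[OF assms]) (rule that)
  show ?thesis
  proof
    fix f g :: "'m \<Rightarrow> 'b" assume fg: "f \<in> lp_space p M" "g \<in> lp_space p M"
    then have [measurable]: "f \<in> borel_measurable M" "g \<in> borel_measurable M"
      by (auto simp: lp_space_def)
    have mid: "(\<lambda>x. (f x + g x) /\<^sub>R 2) \<in> lp_space p M"
      using fg assms by (intro lp_space_scaleR lp_space_add) auto
    have "lp_mass p M (\<lambda>x. f x - g x) \<le> (LINT x|M. \<epsilon> * (norm (f x) powr p + norm (g x) powr p)
        + C * ((norm (f x) powr p + norm (g x) powr p) / 2 - norm ((f x + g x) /\<^sub>R 2) powr p))"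
      using fg mid[THEN lp_space_integrable] by (intro lp_space_bounded AE_I2 C(2)) (auto simp: lp_space_def simp del: norm_scaleR)
    also have "\<dots> = \<epsilon> * (lp_mass p M f + lp_mass p M g)
        + C * ((lp_mass p M f + lp_mass p M g) / 2 - lp_mass p M (\<lambda>x. (f x + g x) /\<^sub>R 2))"
      using fg mid[THEN lp_space_integrable] by (simp add: lp_mass_def lp_space_def del: norm_scaleR)
    finally show "lp_mass p M (\<lambda>x. f x - g x) \<le> \<epsilon> * (lp_mass p M f + lp_mass p M g)
        + C * ((lp_mass p M f + lp_mass p M g) / 2 - lp_mass p M (\<lambda>x. (f x + g x) /\<^sub>R 2))" .
  qed (rule C(1))
qed

lemma lp_mass_midpoint_le:
  assumes fg: "f \<in> lp_space p M" "g \<in> lp_space p M" and "1 < p"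
  shows "lp_mass p M (\<lambda>x. (f x + g x) /\<^sub>R 2) \<le> (lp_mass p M f + lp_mass p M g) / 2"
proof -
  have [measurable]: "f \<in> borel_measurable M" "g \<in> borel_measurable M"
    using fg by (auto simp: lp_space_def)
  have "lp_mass p M (\<lambda>x. (f x + g x) /\<^sub>R 2) \<le> (LINT x|M. (norm (f x) powr p + norm (g x) powr p) / 2)"
    using fg assms(3) by (intro lp_space_bounded AE_I2 norm_midpoint_powr_le) (auto simp: lp_space_def)
  also have "\<dots> = (lp_mass p M f + lp_mass p M g) / 2"
    using fg by (simp add: lp_mass_def lp_space_def)
  finally show ?thesis .
qed

text \<open>
  Fatou's lemma in the form in which limits inherit bounds.
\<close>

lemma lp_fatou:
  assumes F: "\<And>n. F n \<in> lp_space p M" and bd: "\<And>n. lp_mass p M (F n) \<le> c"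
    and f [measurable]: "f \<in> borel_measurable M" and p: "0 < p"
    and lim: "AE x in M. (\<lambda>n. F n x) \<longlonglongrightarrow> f x"
  shows "f \<in> lp_space p M" "lp_mass p M f \<le> c"
proof -
  have [measurable]: "F n \<in> borel_measurable M" for n using F by (auto simp: lp_space_def)
  have c: "0 \<le> c" using bd[of 0] lp_mass_nonneg[of p M "F 0"] by linarith
  have "(\<integral>\<^sup>+x. ennreal (norm (f x) powr p) \<partial>M) = (\<integral>\<^sup>+x. liminf (\<lambda>n. ennreal (norm (F n x) powr p)) \<partial>M)"
  proof (rule nn_integral_cong_AE, use lim in eventually_elim)
    case (elim x)
    have "(\<lambda>n. ennreal (norm (F n x) powr p)) \<longlonglongrightarrow> ennreal (norm (f x) powr p)"
      using elim p by (intro tendsto_ennrealI tendsto_powr' tendsto_norm) auto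
    then show ?case by (simp add: lim_imp_Liminf[symmetric])
  qed
  also have "\<dots> \<le> liminf (\<lambda>n. \<integral>\<^sup>+x. ennreal (norm (F n x) powr p) \<partial>M)"
    by (rule nn_integral_liminf) simp
  also have "\<dots> = liminf (\<lambda>n. ennreal (lp_mass p M (F n)))"
    by (simp add: nn_integral_lp_mass[OF F])
  also have "\<dots> \<le> liminf (\<lambda>n::nat. ennreal c)"
    by (intro Liminf_mono always_eventually allI ennreal_leI bd)
  also have "\<dots> = ennreal c" by (simp add: Liminf_const)
  finally have le: "(\<integral>\<^sup>+x. ennreal (norm (f x) powr p) \<partial>M) \<le> ennreal c" .
  then have int: "integrable M (\<lambda>x. norm (f x) powr p)"
    by (intro integrableI_bounded) (auto simp: le_less_trans[OF le])
  then show f': "f \<in> lp_space p M" by (simp add: lp_space_def)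
  show "lp_mass p M f \<le> c" using le nn_integral_lp_mass[OF f'] c by simp
qed

text \<open>
  The functions \<open>(2\<^sup>k |F\<^sub>k\<^sub>+\<^sub>1 - F\<^sub>k|)\<^sup>p\<close> have a finite sum almost everywhere, so eventually
  \<open>|F\<^sub>k\<^sub>+\<^sub>1 - F\<^sub>k| \<le> 2\<^sup>-\<^sup>k\<close>.
\<close>

lemma lp_rapid_imp_AE_convergent:
  fixes F :: "nat \<Rightarrow> 'm \<Rightarrow> 'b::euclidean_space"
  assumes F: "\<And>n. F n \<in> lp_space p M" and p: "0 < p"
    and rapid: "\<And>k. lp_mass p M (\<lambda>x. F (Suc k) x - F k x) \<le> (1/4) powr (real k * p)"
  shows "AE x in M. convergent (\<lambda>k. F k x)"
proof -
  have [measurable]: "F n \<in> borel_measurable M" for n using F by (auto simp: lp_space_def)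
  define h where "h = (\<lambda>k x. (2 ^ k * norm (F (Suc k) x - F k x)) powr p)"
  have [measurable]: "h k \<in> borel_measurable M" for k unfolding h_def by measurable
  have q: "0 < (1/2) powr p" "(1/2) powr p < 1" using p powr_less_mono2[of p "1/2" 1] by auto
  have hk: "(\<integral>\<^sup>+x. ennreal (h k x) \<partial>M) \<le> ennreal (((1/2) powr p) ^ k)" for k
  proof -
    have d: "(\<lambda>x. F (Suc k) x - F k x) \<in> lp_space p M" by (intro lp_space_diff F p)
    have sc: "(\<lambda>x. (2 ^ k) *\<^sub>R (F (Suc k) x - F k x)) \<in> lp_space p M"
      "lp_mass p M (\<lambda>x. (2 ^ k) *\<^sub>R (F (Suc k) x - F k x)) = (2^k) powr p * lp_mass p M (\<lambda>x. F (Suc k) x - F k x)"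
      using lp_space_scaleR[OF d p, of "2^k"] by auto
    have "(\<integral>\<^sup>+x. ennreal (h k x) \<partial>M) = ennreal ((2^k) powr p * lp_mass p M (\<lambda>x. F (Suc k) x - F k x))"
      using nn_integral_lp_mass[OF sc(1)] sc(2) by (simp add: h_def)
    also have "\<dots> \<le> ennreal ((2^k) powr p * (1/4) powr (real k * p))"
      by (intro ennreal_leI mult_left_mono rapid) auto
    also have "(2^k) powr p * (1/4) powr (real k * p) = ((1/2) powr p) ^ k"
    proof -
      have "(2^k::real) powr p = 2 powr (real k * p)" by (simp add: powr_realpow[symmetric] powr_powr)
      moreover have "(2::real) powr (real k * p) * (1/4) powr (real k * p) = (1/2) powr (real k * p)"
        by (subst powr_mult[symmetric]) simp_all
      moreover have "((1/2::real) powr p) ^ k = (1/2) powr (real k * p)"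
        by (simp add: powr_realpow[symmetric] powr_powr mult.commute)
      ultimately show ?thesis by simp
    qed
    finally show ?thesis .
  qed
  have "(\<integral>\<^sup>+x. (\<Sum>k. ennreal (h k x)) \<partial>M) = (\<Sum>k. \<integral>\<^sup>+x. ennreal (h k x) \<partial>M)"
    by (rule nn_integral_suminf) simp
  also have "\<dots> \<le> (\<Sum>k. ennreal (((1/2) powr p) ^ k))" by (intro suminf_le hk) auto
  also have "\<dots> = ennreal (\<Sum>k. ((1/2) powr p) ^ k)"
    using q by (intro suminf_ennreal2) (auto intro: summable_geometric)
  finally have "(\<integral>\<^sup>+x. (\<Sum>k. ennreal (h k x)) \<partial>M) \<noteq> \<infinity>"
    by (metis ennreal_neq_top infinity_ennreal_def top.extremum_unique)
  then have "AE x in M. (\<Sum>k. ennreal (h k x)) \<noteq> \<infinity>"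
    by (intro nn_integral_PInf_AE) auto
  then show ?thesis
  proof eventually_elim
    case (elim x)
    have "summable (\<lambda>k. h k x)"
      using elim by (intro summable_suminf_not_top) (auto simp: h_def)
    then have "(\<lambda>k. h k x) \<longlonglongrightarrow> 0" by (rule summable_LIMSEQ_zero)
    then have "\<forall>\<^sub>F k in sequentially. h k x < 1" by (rule order_tendstoD) simp
    then obtain K where K: "\<And>k. k \<ge> K \<Longrightarrow> h k x < 1" by (auto simp: eventually_sequentially)
    have bd: "norm (F (Suc k) x - F k x) \<le> (1/2) ^ k" if "k \<ge> K" for k
    proof (rule ccontr)
      assume "\<not> ?thesis"
      then have "1 \<le> 2 ^ k * norm (F (Suc k) x - F k x)" by (simp add: field_simps power_divide)
      then have "1 \<le> h k x" unfolding h_def using p by (intro ge_one_powr_ge_zero) auto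
      with K[OF that] show False by simp
    qed
    have "summable (\<lambda>k. F (Suc k) x - F k x)"
      by (rule summable_comparison_test'[where g = "\<lambda>k. (1/2)^k" and N = K]) (use bd in \<open>auto intro: summable_geometric\<close>)
    then have "convergent (\<lambda>n. (\<Sum>k<n. F (Suc k) x - F k x) + F 0 x)"
      unfolding summable_iff_convergent by (intro convergent_add convergent_const)
    moreover have "(\<Sum>k<n. F (Suc k) x - F k x) + F 0 x = F n x" for n
      using sum_lessThan_telescope[of "\<lambda>k. F k x" n] by simp
    ultimately show "convergent (\<lambda>k. F k x)" by (simp only:)
  qed
qed

text \<open>
  The Riesz-Fischer theorem, together with an almost everywhere convergent subsequence.
\<close>

lemma lp_complete:
  fixes F :: "nat \<Rightarrow> 'm \<Rightarrow> 'b::euclidean_space"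
  assumes F: "\<And>n. F n \<in> lp_space p M" and p: "0 < p"
    and cauchy: "\<And>\<epsilon>. 0 < \<epsilon> \<Longrightarrow> \<exists>N. \<forall>m\<ge>N. \<forall>n\<ge>N. lp_mass p M (\<lambda>x. F m x - F n x) < \<epsilon>"
  obtains f r where "f \<in> lp_space p M" "(\<lambda>n. lp_mass p M (\<lambda>x. F n x - f x)) \<longlonglongrightarrow> 0"
    "strict_mono (r :: nat \<Rightarrow> nat)" "AE x in M. (\<lambda>k. F (r k) x) \<longlonglongrightarrow> f x"
proof -
  have [measurable]: "F n \<in> borel_measurable M" for n using F by (auto simp: lp_space_def)
  have "\<exists>N. \<forall>m\<ge>N. \<forall>n\<ge>N. lp_mass p M (\<lambda>x. F m x - F n x) < (1/4) powr (real k * p)" for k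
    by (rule cauchy) simp
  then obtain N where N: "\<And>k m n. m \<ge> N k \<Longrightarrow> n \<ge> N k \<Longrightarrow> lp_mass p M (\<lambda>x. F m x - F n x) < (1/4) powr (real k * p)"
    by metis
  \<comment> \<open>The sum dominates every earlier threshold, and the summand \<open>k\<close> makes the sequence strictly increasing.\<close>
  define r where "r = (\<lambda>k. (\<Sum>j\<le>k. N j) + k)"
  have r: "strict_mono r" "N k \<le> r k" for k
    by (auto simp: r_def strict_mono_Suc_iff intro: trans_le_add1 member_le_sum)
  have "AE x in M. convergent (\<lambda>k. F (r k) x)"
  proof (rule lp_rapid_imp_AE_convergent[OF F p])
    fix k
    have "N k \<le> r (Suc k)" using r by (meson lessI less_imp_le order_trans strict_monoD)
    then show "lp_mass p M (\<lambda>x. F (r (Suc k)) x - F (r k) x) \<le> (1/4) powr (real k * p)"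
      using N r(2) by (simp add: less_imp_le)
  qed
  define f where "f = (\<lambda>x. lim (\<lambda>k. F (r k) x))"
  have f [measurable]: "f \<in> borel_measurable M" unfolding f_def by measurable
  have lim: "AE x in M. (\<lambda>k. F (r k) x) \<longlonglongrightarrow> f x"
    using \<open>AE x in M. convergent _\<close> by eventually_elim (simp add: f_def convergent_LIMSEQ_iff)
  have close: "(\<lambda>x. f x - F n x) \<in> lp_space p M \<and> lp_mass p M (\<lambda>x. F n x - f x) \<le> \<epsilon>"
    if n: "\<And>m. m \<ge> N' \<Longrightarrow> lp_mass p M (\<lambda>x. F m x - F n x) \<le> \<epsilon>" for N' n \<epsilon>
  proof -
    define k0 where "k0 = N'"
    have k0: "N' \<le> r (k + k0)" for k using seq_suble[OF r(1), of "k + k0"] by (simp add: k0_def)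
    have G: "(\<lambda>x. F (r (k + k0)) x - F n x) \<in> lp_space p M" "lp_mass p M (\<lambda>x. F (r (k + k0)) x - F n x) \<le> \<epsilon>" for k
      by (intro lp_space_diff F p) (rule n[OF k0])
    have "AE x in M. (\<lambda>k. F (r (k + k0)) x - F n x) \<longlonglongrightarrow> f x - F n x"
      using lim by eventually_elim (intro tendsto_intros LIMSEQ_ignore_initial_segment)
    from lp_fatou[OF G _ p this] show ?thesis by (simp add: lp_mass_minus_commute)
  qed
  have "f \<in> lp_space p M"
  proof -
    obtain N' where N': "\<And>m n. m \<ge> N' \<Longrightarrow> n \<ge> N' \<Longrightarrow> lp_mass p M (\<lambda>x. F m x - F n x) < 1"
      using cauchy[of 1] by auto
    have "(\<lambda>x. f x - F N' x) \<in> lp_space p M"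
      using close[of N' N' 1] N' by (auto intro: less_imp_le)
    from lp_space_add(1)[OF this F[of N']] p show ?thesis by simp
  qed
  moreover have "(\<lambda>n. lp_mass p M (\<lambda>x. F n x - f x)) \<longlonglongrightarrow> 0"
  proof (rule LIMSEQ_I)
    fix \<epsilon> :: real assume "0 < \<epsilon>"
    then obtain N' where N': "\<And>m n. m \<ge> N' \<Longrightarrow> n \<ge> N' \<Longrightarrow> lp_mass p M (\<lambda>x. F m x - F n x) < \<epsilon> / 2"
      using cauchy[of "\<epsilon> / 2"] by auto
    have "lp_mass p M (\<lambda>x. F n x - f x) \<le> \<epsilon> / 2" if "n \<ge> N'" for n
      using close[of N' n "\<epsilon> / 2"] N' that by (auto intro: less_imp_le)
    moreover have "\<epsilon> / 2 < \<epsilon>" using \<open>0 < \<epsilon>\<close> by simp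
    ultimately have "\<forall>n\<ge>N'. norm (lp_mass p M (\<lambda>x. F n x - f x) - 0) < \<epsilon>"
      by (simp only: diff_zero real_norm_def abs_of_nonneg[OF lp_mass_nonneg]) (blast intro: le_less_trans)
    then show "\<exists>no. \<forall>n\<ge>no. norm (lp_mass p M (\<lambda>x. F n x - f x) - 0) < \<epsilon>" ..
  qed
  ultimately show ?thesis using that r(1) lim by blast
qed

lemma lp_convergent_AE_subseq:
  fixes F :: "nat \<Rightarrow> 'm \<Rightarrow> 'b::euclidean_space"
  assumes F: "\<And>n. F n \<in> lp_space p M" and f: "f \<in> lp_space p M" and p: "0 < p"
    and lim: "(\<lambda>n. lp_mass p M (\<lambda>x. F n x - f x)) \<longlonglongrightarrow> 0"
  obtains r where "strict_mono (r :: nat \<Rightarrow> nat)" "AE x in M. (\<lambda>k. F (r k) x) \<longlonglongrightarrow> f x"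
proof -
  have cauchy: "\<exists>N. \<forall>m\<ge>N. \<forall>n\<ge>N. lp_mass p M (\<lambda>x. F m x - F n x) < \<epsilon>" if "0 < \<epsilon>" for \<epsilon>
  proof -
    have "0 < \<epsilon> / (2 * 2 powr p)" using that by simp
    then obtain N where N: "\<And>n. n \<ge> N \<Longrightarrow> norm (lp_mass p M (\<lambda>x. F n x - f x) - 0) < \<epsilon> / (2 * 2 powr p)"
      using LIMSEQ_D[OF lim] by blast
    show ?thesis
    proof (intro exI allI impI)
      fix m n assume mn: "N \<le> m" "N \<le> n"
      have "lp_mass p M (\<lambda>x. (F m x - f x) - (F n x - f x))
          \<le> 2 powr p * (lp_mass p M (\<lambda>x. F m x - f x) + lp_mass p M (\<lambda>x. F n x - f x))"
        by (intro lp_space_diff F f p)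
      also have "\<dots> < 2 powr p * (\<epsilon> / (2 * 2 powr p) + \<epsilon> / (2 * 2 powr p))"
        using N[OF mn(1)] N[OF mn(2)] by (intro mult_strict_left_mono add_strict_mono) auto
      also have "\<dots> = \<epsilon>" by (simp add: field_simps)
      finally show "lp_mass p M (\<lambda>x. F m x - F n x) < \<epsilon>" by simp
    qed
  qed
  obtain g r where g: "g \<in> lp_space p M" "(\<lambda>n. lp_mass p M (\<lambda>x. F n x - g x)) \<longlonglongrightarrow> 0"
    "strict_mono (r :: nat \<Rightarrow> nat)" "AE x in M. (\<lambda>k. F (r k) x) \<longlonglongrightarrow> g x"
    using lp_complete[OF F p cauchy] by blast
  have "lp_mass p M (\<lambda>x. f x - g x) \<le> 0"
  proof (rule tendsto_lowerbound[OF _ _ sequentially_bot])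
    show "(\<lambda>n. 2 powr p * (lp_mass p M (\<lambda>x. F n x - g x) + lp_mass p M (\<lambda>x. F n x - f x))) \<longlonglongrightarrow> 0"
      using tendsto_mult_left[OF tendsto_add[OF g(2) lim], of "2 powr p"] by simp
    show "\<forall>\<^sub>F n in sequentially. lp_mass p M (\<lambda>x. f x - g x)
        \<le> 2 powr p * (lp_mass p M (\<lambda>x. F n x - g x) + lp_mass p M (\<lambda>x. F n x - f x))"
    proof (intro always_eventually allI)
      fix n
      have "lp_mass p M (\<lambda>x. (F n x - g x) - (F n x - f x))
          \<le> 2 powr p * (lp_mass p M (\<lambda>x. F n x - g x) + lp_mass p M (\<lambda>x. F n x - f x))"
        by (intro lp_space_diff F f p g)
      then show "lp_mass p M (\<lambda>x. f x - g x) \<le> 2 powr p * (lp_mass p M (\<lambda>x. F n x - g x) + lp_mass p M (\<lambda>x. F n x - f x))"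
        by simp
    qed
  qed
  then have "lp_mass p M (\<lambda>x. f x - g x) = 0"
    using lp_mass_nonneg[of p M "\<lambda>x. f x - g x"] by linarith
  then have "AE x in M. f x - g x = 0"
    using lp_mass_eq_0_iff lp_space_diff(1)[OF f g(1) p] by blast
  then have "AE x in M. (\<lambda>k. F (r k) x) \<longlonglongrightarrow> f x" using g(4) by eventually_elim simp
  with g(3) that show ?thesis by blast
qed

lemma lp_finite_measure:
  assumes f: "f \<in> lp_space p M" and p: "1 < p" and fin: "finite_measure M"
  shows "integrable M f"
    "(LINT x|M. norm (f x)) powr p \<le> measure M (space M) powr (p - 1) * lp_mass p M f"
proof -
  interpret finite_measure M by (rule fin)
  have [measurable]: "f \<in> borel_measurable M" using f by (simp add: lp_space_def)
  define b where "b = p / (p - 1)"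
  have b: "1 < b" "1 / p + 1 / b = 1" "p / b = p - 1" using p by (auto simp: b_def field_simps)
  have one: "(\<lambda>x. 1::real) \<in> lp_space b M" "lp_mass b M (\<lambda>x. 1::real) = measure M (space M)"
    by (auto simp: lp_space_def lp_mass_def)
  note H = lp_holder[OF f one(1) p b(1,2)]
  show "integrable M f" using H(1) by (simp add: integrable_norm_iff)
  have "(LINT x|M. norm (f x)) powr p \<le> (lp_mass p M f powr (1/p) * measure M (space M) powr (1/b)) powr p"
    using H(2) one(2) p by (intro powr_mono2) auto
  also have "\<dots> = measure M (space M) powr (p - 1) * lp_mass p M f"
    using p b lp_mass_nonneg[of p M f] by (simp add: powr_mult powr_powr)
  finally show "(LINT x|M. norm (f x)) powr p \<le> measure M (space M) powr (p - 1) * lp_mass p M f" .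
qed

section \<open>Test functions\<close>

definition smooth :: "('a::euclidean_space \<Rightarrow> real) \<Rightarrow> bool" where
  "smooth f \<longleftrightarrow> (\<forall>k. C_k k f)"

definition gradient :: "('a::euclidean_space \<Rightarrow> real) \<Rightarrow> 'a \<Rightarrow> 'a" where
  "gradient f x = (\<Sum>b\<in>Basis. frechet_derivative f (at x) b *\<^sub>R b)"

lemma C_k_SucI:
  assumes "\<And>x. (f has_derivative D x) (at x)" "\<And>b. b \<in> Basis \<Longrightarrow> C_k k (\<lambda>x. D x b)"
  shows "C_k (Suc k) f"
proof -
  have "frechet_derivative f (at x) = D x" for x using frechet_derivative_at[OF assms(1)] by simp
  then show ?thesis using assms by (auto simp: differentiable_def)
qed

lemma C_k_SucD:
  assumes "C_k (Suc k) f"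
  shows "(f has_derivative frechet_derivative f (at x)) (at x)"
    "b \<in> Basis \<Longrightarrow> C_k k (\<lambda>x. frechet_derivative f (at x) b)"
  using assms by (auto simp: frechet_derivative_works)

declare C_k.simps(2) [simp del]

lemma C_k_Suc_imp: "C_k (Suc k) f \<Longrightarrow> C_k k f"
proof (induction k arbitrary: f)
  case 0
  then show ?case
    by (auto simp: C_k.simps(2) continuous_on_eq_continuous_at differentiable_imp_continuous_within)
next
  case (Suc k)
  show ?case
    by (rule C_k_SucI, rule C_k_SucD(1)[OF Suc.prems], rule Suc.IH, rule C_k_SucD(2)[OF Suc.prems])
qed

lemma C_k_const: "C_k k (\<lambda>x. c)"
proof (induction k arbitrary: c)
  case (Suc k)
  show ?case by (rule C_k_SucI[of _ "\<lambda>x h. 0"]) (auto intro: Suc)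
qed auto

lemma C_k_inner: "C_k k (\<lambda>x. x \<bullet> b)"
proof (cases k)
  case (Suc j)
  show ?thesis unfolding Suc
    by (rule C_k_SucI[of _ "\<lambda>x h. h \<bullet> b"]) (auto intro!: derivative_eq_intros C_k_const)
qed (auto intro!: continuous_intros)

lemma C_k_add: "C_k k f \<Longrightarrow> C_k k g \<Longrightarrow> C_k k (\<lambda>x. f x + g x)"
proof (induction k arbitrary: f g)
  case (Suc k)
  note D = C_k_SucD[OF Suc.prems(1)] C_k_SucD[OF Suc.prems(2)]
  show ?case by (rule C_k_SucI, rule has_derivative_add[OF D(1,3)]) (auto intro!: Suc.IH D(2,4))
qed (auto intro: continuous_on_add)

lemma C_k_mult: "C_k k f \<Longrightarrow> C_k k g \<Longrightarrow> C_k k (\<lambda>x. f x * g x)"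
proof (induction k arbitrary: f g)
  case (Suc k)
  note D = C_k_SucD[OF Suc.prems(1)] C_k_SucD[OF Suc.prems(2)]
  note S = C_k_Suc_imp[OF Suc.prems(1)] C_k_Suc_imp[OF Suc.prems(2)]
  show ?case
    by (rule C_k_SucI, rule has_derivative_mult[OF D(1,3)]) (intro C_k_add Suc.IH D(2,4) S)
qed (auto intro: continuous_on_mult)

lemma C_k_diff: "C_k k f \<Longrightarrow> C_k k g \<Longrightarrow> C_k k (\<lambda>x. f x - g x)"
  using C_k_add[of k f "\<lambda>x. -1 * g x"] C_k_mult[OF C_k_const, of k g "-1"] by simp

lemma C_k_sum: "(\<And>i. i \<in> I \<Longrightarrow> C_k k (f i)) \<Longrightarrow> C_k k (\<lambda>x. \<Sum>i\<in>I. f i x)"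
  by (induction I rule: infinite_finite_induct) (auto intro: C_k_add C_k_const)

lemma C_k_prod: "(\<And>i. i \<in> I \<Longrightarrow> C_k k (f i)) \<Longrightarrow> C_k k (\<lambda>x. \<Prod>i\<in>I. f i x)"
  by (induction I rule: infinite_finite_induct) (auto intro: C_k_mult C_k_const)

lemma C_k_inner_self: "C_k k (\<lambda>x. x \<bullet> x)"
proof -
  have "C_k k (\<lambda>x::'a. \<Sum>b\<in>Basis. (x \<bullet> b) * (x \<bullet> b))" by (intro C_k_sum C_k_mult C_k_inner)
  then show ?thesis by (simp add: euclidean_inner[symmetric])
qed

lemma C_k_inverse:
  assumes "smooth f" "\<And>x. f x \<noteq> 0" shows "C_k k (\<lambda>x. inverse (f x))"
proof (induction k)
  case 0
  have "C_k 0 f" using assms(1) unfolding smooth_def by blast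
  then show ?case using assms(2) by (auto intro: continuous_on_inverse)
next
  case (Suc k)
  have S: "C_k (Suc k) f" using assms by (simp add: smooth_def)
  note D = C_k_SucD[OF S]
  have "C_k k (\<lambda>x. -1 * (inverse (f x) * frechet_derivative f (at x) b * inverse (f x)))" if "b \<in> Basis" for b
    by (intro C_k_mult C_k_const Suc D(2) that)
  then show ?case
    by (intro C_k_SucI[OF Deriv.has_derivative_inverse[OF assms(2) D(1)]]) simp
qed

lemma C_k_scaled: "C_k k f \<Longrightarrow> C_k k (\<lambda>x. f (c *\<^sub>R x))"
proof (induction k arbitrary: f)
  case 0
  then have "continuous_on UNIV f" by simp
  then have "continuous_on UNIV (f \<circ> (\<lambda>x. c *\<^sub>R x))"
    by (intro continuous_on_compose continuous_intros) (auto elim: continuous_on_subset)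
  then show ?case by (simp add: o_def)
next
  case (Suc k)
  note D = C_k_SucD[OF Suc.prems]
  have der: "((\<lambda>x. f (c *\<^sub>R x)) has_derivative (\<lambda>h. frechet_derivative f (at (c *\<^sub>R x)) (c *\<^sub>R h))) (at x)" for x
    using has_derivative_compose[OF has_derivative_scaleR_right[OF has_derivative_ident] D(1)[of "c *\<^sub>R x"]] by simp
  have lin: "linear (frechet_derivative f (at y))" for y
    using D(1) has_derivative_linear by blast
  have "C_k k (\<lambda>x. c * frechet_derivative f (at (c *\<^sub>R x)) b)" if "b \<in> Basis" for b
    by (intro C_k_mult C_k_const Suc.IH[OF D(2)] that)
  then show ?case by (intro C_k_SucI[OF der]) (simp add: linear_scale[OF lin])
qed

text \<open>
  The functions \<open>P(1/t) e\<^bsup>-1/t\<^esup>\<close> for \<open>t > 0\<close>, extended by 0. The family is closed under differentiation, so that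
  smoothness of all its members follows by one induction.
\<close>

definition exp_poly :: "real poly \<Rightarrow> real \<Rightarrow> real" where
  "exp_poly P t = (if 0 < t then poly P (inverse t) * exp (- inverse t) else 0)"

lemma exp_poly_tendsto_0: "(exp_poly P \<longlongrightarrow> 0) (at_right 0)"
proof -
  have "((\<lambda>y. poly P y * exp (- y)) \<longlongrightarrow> 0) at_top"
  proof -
    have "((\<lambda>y::real. (\<Sum>i\<le>degree P. coeff P i * (y ^ i / exp y))) \<longlongrightarrow> (\<Sum>i\<le>degree P. coeff P i * 0)) at_top"
      by (intro tendsto_intros tendsto_power_div_exp_0)
    moreover have "(\<Sum>i\<le>degree P. coeff P i * (y ^ i / exp y)) = poly P y * exp (- y)" for y :: real
      by (simp add: poly_altdef sum_distrib_right exp_minus divide_inverse mult.assoc)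
    ultimately show ?thesis by simp
  qed
  then have "((\<lambda>t. poly P (inverse t) * exp (- inverse t)) \<longlongrightarrow> 0) (at_right 0)"
    by (rule filterlim_compose) (rule filterlim_inverse_at_top_right)
  then show ?thesis
    by (rule filterlim_cong[THEN iffD1, rotated -1, OF _ refl refl])
      (auto simp: exp_poly_def eventually_at_right_field intro: exI[of _ 1])
qed

lemma exp_poly_has_derivative:
  "(exp_poly P has_real_derivative exp_poly ([:0,0,1:] * (P - pderiv P)) t) (at t)"
proof -
  consider "0 < t" | "t < 0" | "t = 0" by linarith
  then show ?thesis
  proof cases
    case 1
    have "((\<lambda>t. poly P (inverse t) * exp (- inverse t)) has_real_derivative
        exp_poly ([:0,0,1:] * (P - pderiv P)) t) (at t)"
      using 1 by (auto intro!: derivative_eq_intros DERIV_chain2[OF poly_DERIV] simp: exp_poly_def)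
        (simp add: field_simps power2_eq_square)
    moreover have "\<forall>\<^sub>F x in nhds t. poly P (inverse x) * exp (- inverse x) = exp_poly P x"
      using 1 eventually_nhds_in_open[of "{0<..}" t] by (auto elim!: eventually_mono simp: exp_poly_def)
    ultimately show ?thesis by (simp add: DERIV_cong_ev)
  next
    case 2
    have "((\<lambda>t. 0) has_real_derivative 0) (at t)" by simp
    moreover have "\<forall>\<^sub>F x in nhds t. 0 = exp_poly P x"
      using 2 eventually_nhds_in_open[of "{..<0}" t] by (auto elim!: eventually_mono simp: exp_poly_def)
    ultimately show ?thesis using 2 by (simp add: DERIV_cong_ev exp_poly_def)
  next
    case 3
    have "((\<lambda>h. (exp_poly P h - exp_poly P 0) / h) \<longlongrightarrow> 0) (at_right 0)"
    proof (rule filterlim_cong[THEN iffD1, rotated -1, OF exp_poly_tendsto_0[of "[:0,1:] * P"] refl refl])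
      show "\<forall>\<^sub>F h in at_right 0. exp_poly ([:0,1:] * P) h = (exp_poly P h - exp_poly P 0) / h"
        by (auto simp: exp_poly_def eventually_at_right_field divide_inverse intro!: exI[of _ 1])
    qed
    moreover have "((\<lambda>h. (exp_poly P h - exp_poly P 0) / h) \<longlongrightarrow> 0) (at_left 0)"
    proof (rule filterlim_cong[THEN iffD1, rotated -1, OF tendsto_const refl refl])
      show "\<forall>\<^sub>F h in at_left 0. 0 = (exp_poly P h - exp_poly P 0) / h"
        by (auto simp: exp_poly_def eventually_at_left_field intro!: exI[of _ "-1"])
    qed
    ultimately have "((\<lambda>h. (exp_poly P (0 + h) - exp_poly P 0) / h) \<longlongrightarrow> 0) (at 0)"
      by (simp add: filterlim_split_at)
    then show ?thesis using 3 by (simp add: DERIV_def exp_poly_def)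
  qed
qed

lemma C_k_exp_poly:
  assumes "smooth g" shows "C_k k (\<lambda>x. exp_poly P (g x))"
proof (induction k arbitrary: P)
  case 0
  have "continuous_on UNIV g" using assms by (auto simp: smooth_def dest: spec[of _ 0])
  moreover have "continuous_on UNIV (exp_poly P)"
    using exp_poly_has_derivative DERIV_isCont continuous_at_imp_continuous_on by blast
  ultimately show ?case
    by (simp add: continuous_on_compose2)
next
  case (Suc k)
  have S: "C_k (Suc k) g" using assms by (simp add: smooth_def)
  note D = C_k_SucD[OF S]
  let ?Q = "[:0,0,1:] * (P - pderiv P)"
  have "((\<lambda>x. exp_poly P (g x)) has_derivative (\<lambda>h. exp_poly ?Q (g x) * frechet_derivative g (at x) h)) (at x)" for x
    using has_derivative_compose[OF D(1) exp_poly_has_derivative[unfolded has_field_derivative_def]] by (simp add: o_def)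
  then show ?case
    by (rule C_k_SucI) (intro C_k_mult Suc D(2))
qed

definition flat_step :: "real \<Rightarrow> real" where
  "flat_step t = exp_poly 1 t"

lemma flat_step_bounds: "0 \<le> flat_step t" "flat_step t \<le> 1" "0 < flat_step t \<longleftrightarrow> 0 < t" "t \<le> 0 \<Longrightarrow> flat_step t = 0"
  by (auto simp: flat_step_def exp_poly_def)

lemma smooth_flat_step: "smooth g \<Longrightarrow> smooth (\<lambda>x. flat_step (g x))"
  unfolding flat_step_def smooth_def using C_k_exp_poly[unfolded smooth_def] by blast

lemma flat_step_tendsto:
  "0 < t \<Longrightarrow> (\<lambda>n. flat_step (real (Suc n) * t)) \<longlonglongrightarrow> 1"
proof -
  assume t: "0 < t"
  have "(\<lambda>n. exp (- (inverse (real (Suc n)) * inverse t))) \<longlonglongrightarrow> exp (- (0 * inverse t))"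
    by (intro tendsto_intros LIMSEQ_inverse_real_of_nat)
  then show ?thesis using t by (simp add: flat_step_def exp_poly_def mult.commute)
qed

text \<open>
  Test functions that converge pointwise to the indicator of a box.
\<close>

definition box_bump :: "'a::euclidean_space \<Rightarrow> 'a \<Rightarrow> nat \<Rightarrow> 'a \<Rightarrow> real" where
  "box_bump c d n x = (\<Prod>b\<in>Basis. flat_step (real (Suc n) * (x \<bullet> b - c \<bullet> b)) * flat_step (real (Suc n) * (d \<bullet> b - x \<bullet> b)))"

lemma smooth_box_bump: "smooth (box_bump c d n)"
proof -
  have "smooth (\<lambda>x. flat_step (real (Suc n) * (x \<bullet> b - c \<bullet> b)))"
    "smooth (\<lambda>x. flat_step (real (Suc n) * (d \<bullet> b - x \<bullet> b)))" for b
    by (rule smooth_flat_step; simp only: smooth_def; intro allI C_k_mult C_k_diff C_k_const C_k_inner)+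
  then show ?thesis unfolding smooth_def box_bump_def[abs_def]
    by (intro allI C_k_prod C_k_mult) auto
qed

lemma box_bump_bounds:
  "0 \<le> box_bump c d n x" "box_bump c d n x \<le> 1" "0 < box_bump c d n x \<longleftrightarrow> x \<in> box c d"
proof -
  show "0 \<le> box_bump c d n x" unfolding box_bump_def by (intro prod_nonneg) (simp add: flat_step_bounds)
  show "box_bump c d n x \<le> 1" unfolding box_bump_def
    by (intro prod_le_1) (simp add: flat_step_bounds mult_le_one)
  show "0 < box_bump c d n x \<longleftrightarrow> x \<in> box c d"
  proof
    assume "x \<in> box c d"
    then show "0 < box_bump c d n x" unfolding box_bump_def
      by (intro prod_pos) (auto simp: flat_step_bounds mem_box zero_less_mult_iff)
  next
    assume pos: "0 < box_bump c d n x"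
    show "x \<in> box c d" unfolding mem_box
    proof
      fix b :: 'a assume b: "b \<in> Basis"
      have "flat_step (real (Suc n) * (x \<bullet> b - c \<bullet> b)) * flat_step (real (Suc n) * (d \<bullet> b - x \<bullet> b)) \<noteq> 0"
        using less_imp_neq[OF pos, symmetric] b unfolding box_bump_def prod_zero_iff[OF finite_Basis] by blast
      then have "0 < real (Suc n) * (x \<bullet> b - c \<bullet> b)" "0 < real (Suc n) * (d \<bullet> b - x \<bullet> b)"
        using flat_step_bounds(4) by (metis linorder_not_less mult_zero_left mult_zero_right)+
      then show "c \<bullet> b < x \<bullet> b \<and> x \<bullet> b < d \<bullet> b" by (simp add: zero_less_mult_iff)
    qed
  qed
qed

lemma box_bump_tendsto: "(\<lambda>n. box_bump c d n x) \<longlonglongrightarrow> indicator (box c d) x"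
proof (cases "x \<in> box c d")
  case True
  have "(\<lambda>n. box_bump c d n x) \<longlonglongrightarrow> (\<Prod>b\<in>(Basis::'a set). 1 * 1)"
    unfolding box_bump_def using True
    by (intro tendsto_intros flat_step_tendsto) (auto simp: mem_box)
  then show ?thesis using True by simp
next
  case False
  then have "box_bump c d n x = 0" for n using box_bump_bounds(1,3)[of c d n x] by linarith
  then show ?thesis using False by simp
qed

lemma test_function_box_bump:
  assumes "cbox c d \<subseteq> \<Omega>" shows "test_function \<Omega> (box_bump c d n)"
proof -
  have "{x. box_bump c d n x \<noteq> 0} \<subseteq> cbox c d"
  proof
    fix x assume "x \<in> {x. box_bump c d n x \<noteq> 0}"
    then have "0 < box_bump c d n x" using box_bump_bounds(1)[of c d n x] by simp
    then show "x \<in> cbox c d" using box_bump_bounds(3)[of c d n x] box_subset_cbox by blast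
  qed
  then have sub: "closure {x. box_bump c d n x \<noteq> 0} \<subseteq> cbox c d"
    by (rule closure_minimal) (rule closed_cbox)
  then have "compact (closure {x. box_bump c d n x \<noteq> 0})"
    using compact_Int_closed[OF compact_cbox, of "closure {x. box_bump c d n x \<noteq> 0}" c d]
    by (simp add: Int_absorb1)
  then show ?thesis using smooth_box_bump[of c d n] sub assms by (auto simp: test_function_def smooth_def)
qed

lemma smooth_imp_C_k: "smooth f \<Longrightarrow> C_k k f"
  by (simp add: smooth_def)

lemma test_function_smooth: "test_function \<Omega> \<phi> \<Longrightarrow> smooth \<phi>"
  by (simp add: test_function_def smooth_def)

lemma inner_gradient: "b \<in> Basis \<Longrightarrow> gradient f x \<bullet> b = frechet_derivative f (at x) b"
  by (simp add: gradient_def inner_sum_left inner_Basis if_distrib cong: if_cong)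

lemma smooth_has_gradient:
  assumes "smooth f" shows "(f has_derivative (\<lambda>h. gradient f x \<bullet> h)) (at x)"
proof -
  have D: "(f has_derivative frechet_derivative f (at x)) (at x)"
    using C_k_SucD(1)[of 0 f x] smooth_imp_C_k[OF assms, of "Suc 0"] by blast
  have lin: "linear (frechet_derivative f (at x))" using D has_derivative_linear by blast
  have "frechet_derivative f (at x) = (\<lambda>h. gradient f x \<bullet> h)"
  proof
    fix h
    have "frechet_derivative f (at x) h = frechet_derivative f (at x) (\<Sum>b\<in>Basis. (h \<bullet> b) *\<^sub>R b)"
      by (simp only: euclidean_representation)
    also have "\<dots> = (\<Sum>b\<in>Basis. (h \<bullet> b) * frechet_derivative f (at x) b)"
      by (simp only: linear_sum[OF lin] linear_scale[OF lin] real_scaleR_def)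
    also have "\<dots> = gradient f x \<bullet> h"
      by (simp add: gradient_def inner_sum_left inner_commute[of h] mult.commute)
    finally show "frechet_derivative f (at x) h = gradient f x \<bullet> h" .
  qed
  with D show ?thesis by (simp only:)
qed

lemma gradient_eqI:
  assumes "(f has_derivative (\<lambda>h. v \<bullet> h)) (at x)" shows "gradient f x = v"
proof -
  have "frechet_derivative f (at x) = (\<lambda>h. v \<bullet> h)" by (rule frechet_derivative_at[OF assms, symmetric])
  then show ?thesis by (intro euclidean_eqI[of "gradient f x" v]) (simp only: inner_gradient)
qed

lemma smooth_continuous: "smooth f \<Longrightarrow> continuous_on S f"
  using smooth_imp_C_k[of f 0] continuous_on_subset by fastforce

lemma smooth_gradient_continuous:
  assumes "smooth f" shows "continuous_on S (gradient f)"
proof -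
  have "continuous_on UNIV (\<lambda>x. frechet_derivative f (at x) b)" if "b \<in> Basis" for b
    using smooth_imp_C_k[OF assms, of "Suc 0"] that by (auto simp: C_k.simps(2))
  then have "continuous_on UNIV (gradient f)" unfolding gradient_def[abs_def]
    by (intro continuous_intros)
  then show ?thesis using continuous_on_subset by blast
qed

lemma smooth_mult: "smooth f \<Longrightarrow> smooth g \<Longrightarrow> smooth (\<lambda>x. f x * g x)"
  by (simp add: smooth_def C_k_mult)

lemma gradient_mult:
  assumes "smooth f" "smooth g"
  shows "gradient (\<lambda>x. f x * g x) x = f x *\<^sub>R gradient g x + g x *\<^sub>R gradient f x"
  using has_derivative_mult[OF smooth_has_gradient[OF assms(1)] smooth_has_gradient[OF assms(2)]]
  by (intro gradient_eqI) (simp add: inner_add_left mult.commute)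

lemma gradient_linear:
  assumes "smooth f" "smooth g"
  shows "gradient (\<lambda>x. f x + c * g x) x = gradient f x + c *\<^sub>R gradient g x"
  using has_derivative_add[OF smooth_has_gradient[OF assms(1)] has_derivative_mult_right[OF smooth_has_gradient[OF assms(2)]]]
  by (intro gradient_eqI) (simp add: inner_add_left)

lemma gradient_outside_support:
  assumes "x \<notin> closure {x. f x \<noteq> 0}" shows "gradient f x = 0"
proof (rule gradient_eqI)
  have "\<forall>\<^sub>F y in nhds x. f y = 0"
    using assms eventually_nhds_in_open[of "- closure {x. f x \<noteq> 0}" x] closure_subset
    by (force elim!: eventually_mono)
  then have "\<forall>\<^sub>F y in at x. 0 = f y" "f x = 0"
    by (auto simp: eventually_at_filter elim: eventually_mono dest: eventually_nhds_x_imp_x)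
  then have "(f has_derivative (\<lambda>h. 0)) (at x)"
    by (intro has_derivative_transform_eventually[OF has_derivative_const]) auto
  then show "(f has_derivative (\<lambda>h. 0 \<bullet> h)) (at x)" by simp
qed

lemma compact_closure_within: "compact K \<Longrightarrow> closure A \<subseteq> K \<Longrightarrow> compact (closure A)"
  for K :: "'a::euclidean_space set"
  using compact_Int_closed[of K "closure A"] by (simp add: Int_absorb1)

lemma test_function_linear:
  assumes "test_function \<Omega> f" "test_function \<Omega> g"
  shows "test_function \<Omega> (\<lambda>x. f x + c * g x)"
proof -
  let ?S = "closure {x. f x \<noteq> 0} \<union> closure {x. g x \<noteq> 0}"
  have c: "compact ?S" "?S \<subseteq> \<Omega>" using assms by (auto simp: test_function_def)
  have "closure {x. f x + c * g x \<noteq> 0} \<subseteq> ?S"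
  proof (rule closure_minimal)
    have "{x. f x + c * g x \<noteq> 0} \<subseteq> {x. f x \<noteq> 0} \<union> {x. g x \<noteq> 0}" by auto
    also have "\<dots> \<subseteq> ?S" by (intro Un_mono closure_subset)
    finally show "{x. f x + c * g x \<noteq> 0} \<subseteq> ?S" .
  qed auto
  then have "compact (closure {x. f x + c * g x \<noteq> 0})" "closure {x. f x + c * g x \<noteq> 0} \<subseteq> \<Omega>"
    using c compact_closure_within[OF c(1)] by blast+
  then show ?thesis using assms by (auto simp: test_function_def intro!: C_k_add C_k_mult C_k_const)
qed

lemma test_function_mult:
  assumes "test_function \<Omega> f" "smooth g"
  shows "test_function \<Omega> (\<lambda>x. g x * f x)"
proof -
  let ?S = "closure {x. f x \<noteq> 0}"
  have c: "compact ?S" "?S \<subseteq> \<Omega>" using assms by (auto simp: test_function_def)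
  have "closure {x. g x * f x \<noteq> 0} \<subseteq> ?S" by (intro closure_mono) auto
  then have "compact (closure {x. g x * f x \<noteq> 0})" "closure {x. g x * f x \<noteq> 0} \<subseteq> \<Omega>"
    using c compact_closure_within[OF c(1)] by blast+
  then show ?thesis using assms by (auto simp: test_function_def smooth_def intro!: C_k_mult)
qed

lemma continuous_compact_support_bounded:
  fixes f :: "'a::euclidean_space \<Rightarrow> 'b::real_normed_vector"
  assumes "continuous_on UNIV f" "compact K" "\<And>x. x \<notin> K \<Longrightarrow> f x = 0"
  obtains B where "0 \<le> B" "\<And>x. norm (f x) \<le> B"
proof -
  have "bounded (f ` K)"
    using assms by (intro compact_imp_bounded compact_continuous_image) (auto elim: continuous_on_subset)
  then obtain B where B: "\<And>x. x \<in> K \<Longrightarrow> norm (f x) \<le> B" by (auto simp: bounded_iff)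
  show ?thesis
    by (rule that[of "max B 0"]) (use B assms(3) in \<open>fastforce simp: le_max_iff_disj\<close>)+
qed

text \<open>
  The quotient \<open>A/(A + B)\<close>, with \<open>A\<close> positive on \<open>|x| < 2\<close> and \<open>B\<close> positive on \<open>|x| > 1\<close>, is 1 on the unit
  ball and 0 outside its double. Scaling by \<open>r\<close> multiplies the gradient by \<open>1/r\<close>, so \<open>G\<close> serves all \<open>r\<close>.
\<close>

lemma cutoff_exists:
  obtains G where "0 \<le> G" "\<And>r. 0 < r \<Longrightarrow> \<exists>\<eta>::'a::euclidean_space \<Rightarrow> real. smooth \<eta> \<and>
    (\<forall>x. 0 \<le> \<eta> x \<and> \<eta> x \<le> 1 \<and> norm (gradient \<eta> x) \<le> G / r) \<and>
    (\<forall>x. norm x \<le> r \<longrightarrow> \<eta> x = 1) \<and> (\<forall>x. 2 * r \<le> norm x \<longrightarrow> \<eta> x = 0 \<and> gradient \<eta> x = 0)"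
proof -
  define A where "A = (\<lambda>x::'a. flat_step (4 - x \<bullet> x))"
  define B where "B = (\<lambda>x::'a. flat_step (x \<bullet> x - 1))"
  define \<kappa> where "\<kappa> = (\<lambda>x. A x * inverse (A x + B x))"
  have AB: "smooth A" "smooth B" unfolding A_def B_def
    by (rule smooth_flat_step, simp add: smooth_def C_k_diff C_k_const C_k_inner_self)+
  have nn: "0 \<le> A x" "0 \<le> B x" for x by (auto simp: A_def B_def flat_step_bounds)
  have pos: "0 < A x + B x" for x
  proof (cases "x \<bullet> x < 4")
    case True
    then have "0 < A x" by (simp add: A_def flat_step_bounds)
    then show ?thesis using nn(2)[of x] by simp
  next
    case False
    then have "0 < B x" by (simp add: B_def flat_step_bounds)
    then show ?thesis using nn(1)[of x] by simp
  qed
  have sm: "smooth \<kappa>" unfolding \<kappa>_def smooth_def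
  proof (intro allI C_k_mult C_k_inverse)
    show "C_k k A" for k using AB by (simp add: smooth_def)
    show "smooth (\<lambda>x. A x + B x)" using AB by (simp add: smooth_def C_k_add)
    show "A x + B x \<noteq> 0" for x using pos[of x] by simp
  qed
  have rng: "0 \<le> \<kappa> x" "\<kappa> x \<le> 1" for x
    using nn[of x] pos[of x] by (auto simp: \<kappa>_def divide_inverse[symmetric])
  have in1: "\<kappa> x = 1" if "norm x \<le> 1" for x
  proof -
    have "x \<bullet> x \<le> 1" using that by (simp add: norm_le_square)
    then have "B x = 0" by (simp add: B_def flat_step_bounds)
    then show ?thesis using pos[of x] by (simp add: \<kappa>_def)
  qed
  have out: "\<kappa> x = 0" if "2 \<le> norm x" for x
  proof -
    have "2\<^sup>2 \<le> (norm x)\<^sup>2" using that by (intro power_mono) auto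
    then have "4 \<le> x \<bullet> x" by (simp add: power2_norm_eq_inner)
    then show ?thesis by (simp add: \<kappa>_def A_def flat_step_bounds)
  qed
  have cont: "continuous_on UNIV (gradient \<kappa>)" using smooth_gradient_continuous[OF sm] .
  have "{x. \<kappa> x \<noteq> 0} \<subseteq> cball 0 2" using out by (force simp: not_le[symmetric])
  then have "closure {x. \<kappa> x \<noteq> 0} \<subseteq> cball 0 2" by (rule closure_minimal) simp
  then have g0: "gradient \<kappa> x = 0" if "2 < norm x" for x
    using that by (intro gradient_outside_support) auto
  obtain G where G: "0 \<le> G" "\<And>x. norm (gradient \<kappa> x) \<le> G"
    by (rule continuous_compact_support_bounded[OF cont compact_cball[of 0 2]]) (use g0 in auto)
  have gout: "gradient \<kappa> x = 0" if x: "2 \<le> norm x" for x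
  proof (rule ccontr)
    assume ne: "gradient \<kappa> x \<noteq> 0"
    have "(\<lambda>n. gradient \<kappa> ((1 + inverse (real (Suc n))) *\<^sub>R x)) \<longlonglongrightarrow> gradient \<kappa> ((1 + 0) *\<^sub>R x)"
      using cont by (intro continuous_on_tendsto_compose[of UNIV "gradient \<kappa>"] tendsto_intros LIMSEQ_inverse_real_of_nat) auto
    moreover have "gradient \<kappa> ((1 + inverse (real (Suc n))) *\<^sub>R x) = 0" for n
    proof (rule g0)
      have "2 < (1 + inverse (real (Suc n))) * 2" by simp
      also have "\<dots> \<le> (1 + inverse (real (Suc n))) * norm x" using x by (intro mult_left_mono) auto
      finally show "2 < norm ((1 + inverse (real (Suc n))) *\<^sub>R x)" by simp
    qed
    ultimately have "(\<lambda>n. 0) \<longlonglongrightarrow> gradient \<kappa> x" by simp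
    then show False using ne by (simp add: LIMSEQ_const_iff)
  qed
  show ?thesis
  proof (rule that[OF G(1)])
    fix r :: real assume r: "0 < r"
    let ?\<eta> = "\<lambda>x. \<kappa> (inverse r *\<^sub>R x)"
    have grad: "gradient ?\<eta> x = inverse r *\<^sub>R gradient \<kappa> (inverse r *\<^sub>R x)" for x
      using has_derivative_compose[OF has_derivative_scaleR_right[OF has_derivative_ident] smooth_has_gradient[OF sm]]
      by (intro gradient_eqI) simp
    have "smooth ?\<eta>" using sm by (simp add: smooth_def C_k_scaled)
    moreover have "norm (gradient ?\<eta> x) \<le> G / r" for x
    proof -
      have "norm (gradient ?\<eta> x) = inverse r * norm (gradient \<kappa> (inverse r *\<^sub>R x))"
        using r by (simp only: grad norm_scaleR) simp
      also have "\<dots> \<le> inverse r * G" using r by (intro mult_left_mono G) simp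
      finally show ?thesis by (simp add: divide_inverse mult.commute)
    qed
    moreover have "2 * r \<le> norm x \<Longrightarrow> ?\<eta> x = 0 \<and> gradient ?\<eta> x = 0" "norm x \<le> r \<Longrightarrow> ?\<eta> x = 1" for x
      using r unfolding grad by (auto simp: field_simps intro!: in1 out gout)
    ultimately show "\<exists>\<eta>::'a \<Rightarrow> real. smooth \<eta> \<and>
      (\<forall>x. 0 \<le> \<eta> x \<and> \<eta> x \<le> 1 \<and> norm (gradient \<eta> x) \<le> G / r) \<and>
      (\<forall>x. norm x \<le> r \<longrightarrow> \<eta> x = 1) \<and> (\<forall>x. 2 * r \<le> norm x \<longrightarrow> \<eta> x = 0 \<and> gradient \<eta> x = 0)"
      using rng by (intro exI[of _ ?\<eta>]) blast
  qed
qed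

section \<open>Integration by parts and the fundamental lemma\<close>

lemma integrable_continuous_compact_support:
  fixes f :: "'a::euclidean_space \<Rightarrow> 'b::euclidean_space"
  assumes "continuous_on UNIV f" "compact K" "\<And>x. x \<notin> K \<Longrightarrow> f x = 0"
  shows "integrable lborel f"
proof -
  have "integrable lborel (\<lambda>x. indicator K x *\<^sub>R f x)"
    using assms by (intro borel_integrable_compact) (auto elim: continuous_on_subset)
  moreover have "(\<lambda>x. indicator K x *\<^sub>R f x) = f" using assms(3) by (auto simp: indicator_def)
  ultimately show ?thesis by simp
qed

lemma lborel_integral_translate:
  fixes f :: "'a::euclidean_space \<Rightarrow> 'b::euclidean_space"
  assumes "f \<in> borel_measurable borel"
  shows "(LINT x|lborel. f (c + x)) = (LINT x|lborel. f x)"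
proof -
  have "(LINT x|lborel. f x) = (LINT x|distr lborel borel ((+) c). f x)" by (simp add: lborel_distr_plus)
  also have "\<dots> = (LINT x|lborel. f (c + x))" using assms by (intro integral_distr) auto
  finally show ?thesis by simp
qed

lemma integrable_lborel_translate:
  fixes f :: "'a::euclidean_space \<Rightarrow> 'b::euclidean_space"
  assumes "integrable lborel f"
  shows "integrable lborel (\<lambda>x. f (c + x))"
proof -
  have "f \<in> borel_measurable borel" using assms by auto
  moreover have "integrable (distr lborel borel ((+) c)) f" using assms by (simp add: lborel_distr_plus)
  ultimately show ?thesis by (subst (asm) integrable_distr_eq) auto
qed

lemma smooth_mvt:
  assumes "smooth f"
  obtains t where "0 < t" "t < 1" "f (x + h) - f x = gradient f (x + t *\<^sub>R h) \<bullet> h"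
proof -
  have der: "((\<lambda>t. f (x + t *\<^sub>R h)) has_real_derivative gradient f (x + t *\<^sub>R h) \<bullet> h) (at t)" for t
  proof -
    have "((\<lambda>t. x + t *\<^sub>R h) has_derivative (\<lambda>s. s *\<^sub>R h)) (at t)"
      by (auto intro!: derivative_eq_intros)
    from has_derivative_compose[OF this smooth_has_gradient[OF assms]]
    show ?thesis by (simp add: has_field_derivative_def mult_commute_abs)
  qed
  obtain t where "0 < t" "t < 1" "f (x + 1 *\<^sub>R h) - f (x + 0 *\<^sub>R h) = (1 - 0) * (gradient f (x + t *\<^sub>R h) \<bullet> h)"
    using MVT2[of 0 1 "\<lambda>t. f (x + t *\<^sub>R h)" "\<lambda>t. gradient f (x + t *\<^sub>R h) \<bullet> h"] der by auto
  then show ?thesis by (intro that) auto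
qed

text \<open>
  Difference quotients have integral 0 by translation invariance, and they converge boundedly to the
  derivative.
\<close>

lemma integral_gradient_eq_0:
  assumes sm: "smooth f" and K: "compact K" "closure {x. f x \<noteq> 0} \<subseteq> K" and b: "b \<in> Basis"
  shows "(LINT x|lborel. gradient f x \<bullet> b) = 0"
proof -
  have f0: "f x = 0" if "x \<notin> K" for x using K(2) closure_subset[of "{x. f x \<noteq> 0}"] that by auto
  have g0: "gradient f x = 0" if "x \<notin> K" for x using gradient_outside_support K(2) that by blast
  obtain B where B: "0 \<le> B" "\<And>x. norm (gradient f x) \<le> B"
    by (rule continuous_compact_support_bounded[OF smooth_gradient_continuous[OF sm] K(1) g0]) (assumption, rule that)
  obtain R where R: "K \<subseteq> cball 0 R" using compact_imp_bounded[OF K(1)] by (fastforce simp: bounded_iff)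
  have bK: "f \<in> borel_measurable borel"
    using smooth_continuous[OF sm, of UNIV] by (rule borel_measurable_continuous_onI)
  have intf: "integrable lborel f" by (rule integrable_continuous_compact_support[OF smooth_continuous[OF sm] K(1) f0])
  define t where "t = (\<lambda>n. inverse (real (Suc n)))"
  define F where "F = (\<lambda>n x. (f (t n *\<^sub>R b + x) - f x) / t n)"
  have t: "0 < t n" "t n \<le> 1" for n by (auto simp: t_def field_simps)
  have Fint: "(LINT x|lborel. F n x) = 0" for n
    using lborel_integral_translate[OF bK, of "t n *\<^sub>R b"] intf integrable_lborel_translate[OF intf]
    by (simp add: F_def)
  have "(\<lambda>n. LINT x|lborel. F n x) \<longlonglongrightarrow> (LINT x|lborel. gradient f x \<bullet> b)"
  proof (rule integral_dominated_convergence[where w = "\<lambda>x. indicator (cball 0 (R + 1)) x *\<^sub>R B"])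
    show "(\<lambda>x. gradient f x \<bullet> b) \<in> borel_measurable lborel"
      using smooth_gradient_continuous[OF sm, of UNIV] by (auto intro!: borel_measurable_continuous_onI continuous_intros)
    show "F n \<in> borel_measurable lborel" for n using bK unfolding F_def by measurable
    show "integrable lborel (\<lambda>x. indicator (cball 0 (R + 1)) x *\<^sub>R B)"
      by (intro borel_integrable_compact) auto
    show "AE x in lborel. (\<lambda>n. F n x) \<longlonglongrightarrow> gradient f x \<bullet> b"
    proof (rule AE_I2)
      fix x
      have "((\<lambda>s. f (s *\<^sub>R b + x)) has_derivative (\<lambda>s. gradient f x \<bullet> (s *\<^sub>R b))) (at 0)"
      proof -
        have "((\<lambda>s. s *\<^sub>R b + x) has_derivative (\<lambda>s. s *\<^sub>R b)) (at 0)"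
          by (auto intro!: derivative_eq_intros)
        from has_derivative_compose[OF this, of f "\<lambda>h. gradient f x \<bullet> h"] smooth_has_gradient[OF sm, of x]
        show ?thesis by simp
      qed
      then have "((\<lambda>s. (f (s *\<^sub>R b + x) - f x) / s) \<longlongrightarrow> gradient f x \<bullet> b) (at 0)"
        by (simp add: has_field_derivative_def[symmetric] DERIV_def mult_commute_abs)
      moreover have "filterlim t (at 0) sequentially"
        unfolding filterlim_at t_def using LIMSEQ_inverse_real_of_nat by auto
      ultimately show "(\<lambda>n. F n x) \<longlonglongrightarrow> gradient f x \<bullet> b"
        unfolding F_def by (rule filterlim_compose)
    qed
    show "AE x in lborel. norm (F n x) \<le> indicator (cball 0 (R + 1)) x *\<^sub>R B" for n
    proof (rule AE_I2)
      fix x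
      show "norm (F n x) \<le> indicator (cball 0 (R + 1)) x *\<^sub>R B"
      proof (cases "norm x \<le> R + 1")
        case True
        obtain s where s: "f (x + t n *\<^sub>R b) - f x = gradient f (x + s *\<^sub>R t n *\<^sub>R b) \<bullet> (t n *\<^sub>R b)"
          using smooth_mvt[OF sm] by blast
        have "\<bar>gradient f (x + s *\<^sub>R t n *\<^sub>R b) \<bullet> b\<bar> \<le> B * norm b"
          by (intro order_trans[OF Cauchy_Schwarz_ineq2] mult_right_mono B) auto
        moreover have "F n x = gradient f (x + s *\<^sub>R t n *\<^sub>R b) \<bullet> b"
          using s t[of n] by (simp add: F_def add.commute)
        ultimately show ?thesis using True b by simp
      next
        case False
        have "norm (t n *\<^sub>R b) \<le> 1" using t[of n] b by simp
        then have "R < norm (t n *\<^sub>R b + x)"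
          using False norm_diff_ineq[of x "t n *\<^sub>R b"] by (simp add: add.commute)
        then have "t n *\<^sub>R b + x \<notin> K" "x \<notin> K" using R False by auto
        then show ?thesis using f0 False by (simp add: F_def)
      qed
    qed
  qed
  then show ?thesis by (simp add: Fint LIMSEQ_const_iff)
qed

lemma lebesgue_on_integral_eq_lborel:
  fixes f :: "'a::euclidean_space \<Rightarrow> 'b::euclidean_space"
  assumes "open \<Omega>" "f \<in> borel_measurable borel" "\<And>x. x \<notin> \<Omega> \<Longrightarrow> f x = 0"
  shows "(LINT x|lebesgue_on \<Omega>. f x) = (LINT x|lborel. f x)"
    "integrable (lebesgue_on \<Omega>) f \<longleftrightarrow> integrable lborel f"
proof -
  have eq: "(\<lambda>x. indicator \<Omega> x *\<^sub>R f x) = f" using assms(3) by (auto simp: indicator_def)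
  have \<Omega>: "\<Omega> \<inter> space lebesgue \<in> sets lebesgue" using assms(1) by (simp add: lmeasurable_iff_integrable borel_open sets_completionI_sets)
  show "(LINT x|lebesgue_on \<Omega>. f x) = (LINT x|lborel. f x)"
    using integral_restrict_space[OF \<Omega>, of f] assms(2) by (simp add: eq integral_completion)
  show "integrable (lebesgue_on \<Omega>) f \<longleftrightarrow> integrable lborel f"
    using integrable_restrict_space[OF \<Omega>, of f] assms(2) by (simp add: eq integrable_completion)
qed

lemma smooth_borel_measurable:
  "smooth f \<Longrightarrow> f \<in> borel_measurable borel" "smooth f \<Longrightarrow> gradient f \<in> borel_measurable borel"
  using smooth_continuous[of f UNIV] smooth_gradient_continuous[of f UNIV]
  by (auto intro: borel_measurable_continuous_onI)

lemma test_function_outside: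
  assumes "test_function \<Omega> \<phi>" "x \<notin> \<Omega>" shows "\<phi> x = 0" "gradient \<phi> x = 0"
  using assms closure_subset[of "{x. \<phi> x \<noteq> 0}"] gradient_outside_support[of x \<phi>]
  by (auto simp: test_function_def)

lemma test_integration_by_parts:
  assumes "open \<Omega>" "test_function \<Omega> \<phi>" "test_function \<Omega> \<psi>" "b \<in> Basis"
  shows "(LINT x|lebesgue_on \<Omega>. \<phi> x * frechet_derivative \<psi> (at x) b) = - (LINT x|lebesgue_on \<Omega>. (gradient \<phi> x \<bullet> b) * \<psi> x)"
proof -
  note sm = assms(2,3)[THEN test_function_smooth]
  note meas = smooth_borel_measurable[OF sm(1)] smooth_borel_measurable[OF sm(2)]
  let ?K = "closure {x. \<phi> x \<noteq> 0}"
  have K: "compact ?K" using assms(2) by (simp add: test_function_def)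
  have out: "\<phi> x = 0" "gradient \<phi> x = 0" if "x \<notin> ?K" for x
    using that closure_subset[of "{x. \<phi> x \<noteq> 0}"] gradient_outside_support by auto
  have int: "integrable lborel (\<lambda>x. \<phi> x * (gradient \<psi> x \<bullet> b))" "integrable lborel (\<lambda>x. (gradient \<phi> x \<bullet> b) * \<psi> x)"
  proof -
    note s = smooth_continuous[OF sm(1)] smooth_continuous[OF sm(2)]
      smooth_gradient_continuous[OF sm(1)] smooth_gradient_continuous[OF sm(2)]
    have c: "continuous_on UNIV (\<lambda>x. \<phi> x * (gradient \<psi> x \<bullet> b))" "continuous_on UNIV (\<lambda>x. (gradient \<phi> x \<bullet> b) * \<psi> x)"
      by (rule continuous_on_mult[OF s(1) continuous_on_inner[OF s(4) continuous_on_const]],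
          rule continuous_on_mult[OF continuous_on_inner[OF s(3) continuous_on_const] s(2)])
    show "integrable lborel (\<lambda>x. \<phi> x * (gradient \<psi> x \<bullet> b))"
      by (rule integrable_continuous_compact_support[OF c(1) K]) (drule out(1), simp only: mult_zero_left)
    show "integrable lborel (\<lambda>x. (gradient \<phi> x \<bullet> b) * \<psi> x)"
      by (rule integrable_continuous_compact_support[OF c(2) K]) (drule out(2), simp only: inner_zero_left mult_zero_left)
  qed
  have "{x. \<phi> x * \<psi> x \<noteq> 0} \<subseteq> {x. \<phi> x \<noteq> 0}" by auto
  then have "(LINT x|lborel. gradient (\<lambda>x. \<phi> x * \<psi> x) x \<bullet> b) = 0"
    by (intro integral_gradient_eq_0[OF smooth_mult[OF sm] K] closure_mono assms(4))
  then have "(LINT x|lborel. \<phi> x * (gradient \<psi> x \<bullet> b)) + (LINT x|lborel. (gradient \<phi> x \<bullet> b) * \<psi> x) = 0"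
    using int by (simp add: gradient_mult[OF sm] inner_add_left mult.commute)
  moreover have "(LINT x|lebesgue_on \<Omega>. \<phi> x * frechet_derivative \<psi> (at x) b) = (LINT x|lborel. \<phi> x * (gradient \<psi> x \<bullet> b))"
    using assms meas by (simp add: inner_gradient[symmetric]) (intro lebesgue_on_integral_eq_lborel, auto simp: test_function_outside)
  moreover have "(LINT x|lebesgue_on \<Omega>. (gradient \<phi> x \<bullet> b) * \<psi> x) = (LINT x|lborel. (gradient \<phi> x \<bullet> b) * \<psi> x)"
    using assms meas by (intro lebesgue_on_integral_eq_lborel) (auto simp: test_function_outside)
  ultimately show ?thesis by linarith
qed

text \<open>Averages over small cubes recover a locally integrable function almost everywhere.\<close>

lemma zero_on_boxes_imp_AE_zero:
  fixes f :: "'a::euclidean_space \<Rightarrow> real"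
  assumes f: "integrable lebesgue f"
    and zero: "\<And>c d. cbox c d \<subseteq> box a b \<Longrightarrow> (LINT x|lebesgue. indicator (cbox c d) x * f x) = 0"
  shows "AE x in lebesgue. x \<in> box a b \<longrightarrow> f x = 0"
proof -
  have abs: "f absolutely_integrable_on UNIV" using f by (simp add: set_integrable_def)
  have io: "f integrable_on cbox c d" for c d
    using absolutely_integrable_on_subcbox[OF abs] by (auto intro: set_lebesgue_integral_eq_integral)
  obtain N where N: "negligible N" "\<And>x e. \<lbrakk>x \<notin> N; 0 < e\<rbrakk> \<Longrightarrow>
       \<exists>d>0. \<forall>h. 0 < h \<and> h < d \<longrightarrow> norm (integral (cbox x (x + h *\<^sub>R One)) f /\<^sub>R h ^ DIM('a) - f x) < e"
    using integrable_ccontinuous_explicit[OF io] by metis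
  have "f x = 0" if x: "x \<in> box a b" "x \<notin> N" for x
  proof (rule ccontr)
    assume "f x \<noteq> 0"
    then obtain d where d: "d > 0" "\<And>h. 0 < h \<Longrightarrow> h < d \<Longrightarrow>
        norm (integral (cbox x (x + h *\<^sub>R One)) f /\<^sub>R h ^ DIM('a) - f x) < \<bar>f x\<bar>"
      using N(2)[OF x(2), of "\<bar>f x\<bar>"] by auto
    obtain e where e: "0 < e" "cball x e \<subseteq> box a b"
      using x(1) open_box open_contains_cball by blast
    define h where "h = min (d / 2) (e / (1 + real DIM('a)))"
    have h: "0 < h" "h < d" "h * real DIM('a) \<le> e"
    proof -
      show "0 < h" using d e by (simp add: h_def add_pos_nonneg)
      have "h \<le> d / 2" unfolding h_def by (rule min.cobounded1)
      then show "h < d" using d(1) by linarith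
      have "h * real DIM('a) \<le> e / (1 + real DIM('a)) * real DIM('a)" by (intro mult_right_mono) (auto simp: h_def)
      also have "\<dots> \<le> e" using e by (simp add: field_simps)
      finally show "h * real DIM('a) \<le> e" .
    qed
    have sub: "cbox x (x + h *\<^sub>R One) \<subseteq> box a b"
    proof
      fix y assume y: "y \<in> cbox x (x + h *\<^sub>R One)"
      have "norm (x - y) \<le> (\<Sum>b\<in>Basis. \<bar>(x - y) \<bullet> b\<bar>)" by (rule norm_le_l1)
      also have "\<dots> \<le> (\<Sum>b\<in>(Basis::'a set). h)"
      proof (rule sum_mono)
        fix b :: 'a assume "b \<in> Basis"
        then have "x \<bullet> b \<le> y \<bullet> b" "y \<bullet> b \<le> (x + h *\<^sub>R One) \<bullet> b" "One \<bullet> b = (1::real)"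
          using y by (auto simp: mem_box)
        then show "\<bar>(x - y) \<bullet> b\<bar> \<le> h" by (simp add: inner_add_left inner_diff_left)
      qed
      also have "\<dots> \<le> e" using h(3) by (simp add: mult.commute)
      finally show "y \<in> box a b" using e(2) by (auto simp: dist_norm)
    qed
    have "integral (cbox x (x + h *\<^sub>R One)) f = (LINT y:cbox x (x + h *\<^sub>R One)|lebesgue. f y)"
      by (rule set_lebesgue_integral_eq_integral(2)[symmetric]) (rule absolutely_integrable_on_subcbox[OF abs], simp)
    also have "\<dots> = 0" using zero[OF sub] by (simp add: set_lebesgue_integral_def)
    finally show False using d(2)[OF h(1,2)] by simp
  qed
  then have "{x. \<not> (x \<in> box a b \<longrightarrow> f x = 0)} \<subseteq> N" by auto
  then have "negligible {x. \<not> (x \<in> box a b \<longrightarrow> f x = 0)}" using N(1) negligible_subset by blast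
  then show ?thesis by (simp add: completion.AE_iff_null_sets negligible_iff_null_sets)
qed

text \<open>
  Testing with functions that converge to the indicator of a box shows that \<open>g\<close> has integral 0 over every
  box whose closure lies in the domain. Countably many boxes cover the domain.
\<close>

lemma fundamental_lemma_variations:
  fixes g :: "'a::euclidean_space \<Rightarrow> real"
  assumes \<Omega>: "open \<Omega>" and g: "locally_integrable \<Omega> g"
    and zero: "\<And>\<phi>. test_function \<Omega> \<phi> \<Longrightarrow> (LINT x|lebesgue_on \<Omega>. g x * \<phi> x) = 0"
  shows "AE x in lebesgue_on \<Omega>. g x = 0"
proof -
  have \<Omega>m: "\<Omega> \<in> sets lebesgue" using \<Omega> by (simp add: borel_open sets_completionI_sets)
  have box0: "AE x in lebesgue. x \<in> box a b \<longrightarrow> g x = 0" if ab: "cbox a b \<subseteq> \<Omega>" for a b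
  proof -
    define G where "G = (\<lambda>x. indicator (cbox a b) x * g x)"
    have "integrable (lebesgue_on (cbox a b)) g" using g ab by (auto simp: locally_integrable_def)
    then have Gint: "integrable lebesgue G"
      by (subst (asm) integrable_restrict_space) (auto simp: G_def)
    have Gm [measurable]: "G \<in> borel_measurable lebesgue" using Gint by blast
    have G0: "(LINT x|lebesgue. indicator (box c d) x * G x) = 0" if cd: "cbox c d \<subseteq> cbox a b" for c d
    proof -
      have eq: "(LINT x|lebesgue. box_bump c d n x * G x) = 0" for n
      proof -
        have "0 = (LINT x|lebesgue_on \<Omega>. g x * box_bump c d n x)"
          using zero[OF test_function_box_bump[of c d \<Omega> n]] cd ab by simp
        also have "\<dots> = (LINT x|lebesgue. indicator \<Omega> x *\<^sub>R (g x * box_bump c d n x))"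
          using \<Omega>m by (subst integral_restrict_space) auto
        also have "\<dots> = (LINT x|lebesgue. box_bump c d n x * G x)"
        proof (rule Bochner_Integration.integral_cong[OF refl])
          fix x
          have "box_bump c d n x = 0" if "x \<notin> cbox a b"
            using that cd box_bump_bounds(1,3)[of c d n x] box_subset_cbox[of c d] by force
          then show "indicator \<Omega> x *\<^sub>R (g x * box_bump c d n x) = box_bump c d n x * G x"
            using ab by (cases "x \<in> cbox a b") (auto simp: G_def)
        qed
        finally show ?thesis by simp
      qed
      have bm: "box_bump c d n \<in> borel_measurable lebesgue" for n
        using smooth_borel_measurable(1)[OF smooth_box_bump, of c d n] by (intro measurable_completion) simp
      have "(\<lambda>n. LINT x|lebesgue. box_bump c d n x * G x) \<longlonglongrightarrow> (LINT x|lebesgue. indicator (box c d) x * G x)"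
      proof (rule integral_dominated_convergence[where w = "\<lambda>x. \<bar>G x\<bar>"])
        show "AE x in lebesgue. norm (box_bump c d n x * G x) \<le> \<bar>G x\<bar>" for n
          using box_bump_bounds(1,2)[of c d n] by (auto simp: abs_mult intro!: AE_I2 mult_left_le_one_le)
        show "AE x in lebesgue. (\<lambda>n. box_bump c d n x * G x) \<longlonglongrightarrow> indicator (box c d) x * G x"
          by (intro AE_I2 tendsto_mult box_bump_tendsto tendsto_const)
        show "(\<lambda>x. indicator (box c d) x * G x) \<in> borel_measurable lebesgue"
          by (intro borel_measurable_times borel_measurable_indicator Gm) auto
      qed (use Gint bm in auto)
      then show ?thesis by (simp add: eq LIMSEQ_const_iff)
    qed
    have "AE x in lebesgue. x \<in> box a b \<longrightarrow> G x = 0"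
    proof (rule zero_on_boxes_imp_AE_zero[OF Gint])
      fix c d assume cd: "cbox c d \<subseteq> box a b"
      have "AE x in lebesgue. indicator (cbox c d) x * G x = indicator (box c d) x * G x"
      proof (rule AE_I'[of "cbox c d - box c d"])
        show "cbox c d - box c d \<in> null_sets lebesgue"
          using negligible_frontier_interval negligible_iff_null_sets by blast
      qed (use box_subset_cbox[of c d] in \<open>auto simp: indicator_def split: if_splits\<close>)
      then have "(LINT x|lebesgue. indicator (cbox c d) x * G x) = (LINT x|lebesgue. indicator (box c d) x * G x)"
        by (intro integral_cong_AE borel_measurable_times borel_measurable_indicator Gm) auto
      also have "\<dots> = 0" using cd box_subset_cbox[of a b] by (intro G0) auto
      finally show "(LINT x|lebesgue. indicator (cbox c d) x * G x) = 0" .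
    qed
    then show ?thesis
      using box_subset_cbox[of a b] by (auto elim!: eventually_mono simp: G_def)
  qed
  obtain \<D> where \<D>: "countable \<D>" "\<D> \<subseteq> Pow \<Omega>" "\<And>X. X \<in> \<D> \<Longrightarrow> \<exists>a b. X = box a b \<and> cbox a b \<subseteq> \<Omega>" "\<Union>\<D> = \<Omega>"
  proof -
    let ?F = "{box a b | a b. cbox a b \<subseteq> \<Omega>}"
    have "\<Union>?F = \<Omega>"
    proof (intro equalityI subsetI)
      fix x assume "x \<in> \<Omega>"
      then obtain a b where "x \<in> box a b" "cbox a b \<subseteq> \<Omega>"
        using open_contains_cbox[OF \<Omega>] by metis
      then show "x \<in> \<Union>?F" by blast
    next
      fix x assume "x \<in> \<Union>?F"
      then obtain a b where "x \<in> box a b" "cbox a b \<subseteq> \<Omega>" by auto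
      then show "x \<in> \<Omega>" using box_subset_cbox[of a b] by (meson subsetD)
    qed
    moreover obtain \<D> where "\<D> \<subseteq> ?F" "countable \<D>" "\<Union>\<D> = \<Union>?F"
      by (rule Lindelof[of ?F]) auto
    ultimately show ?thesis by (intro that[of \<D>]) auto
  qed
  have "AE x in lebesgue. \<forall>X\<in>\<D>. x \<in> X \<longrightarrow> g x = 0"
    using \<D>(1,3) box0 by (subst AE_ball_countable) metis+
  then have "AE x in lebesgue. x \<in> \<Omega> \<longrightarrow> g x = 0" using \<D>(4) by (auto elim!: eventually_mono)
  then show ?thesis using \<Omega>m by (subst AE_restrict_space_iff) auto
qed

section \<open>Weak gradients and the space \<open>W\<^sub>0\<^sup>1\<^sup>,\<^sup>p\<close>\<close>

locale sobolev_setting =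
  fixes \<Omega> :: "'a::euclidean_space set" and p :: real
  assumes open_dom: "open \<Omega>" and bounded_dom: "bounded \<Omega>" and p_gt_1: "1 < p"
begin

abbreviation "M \<equiv> lebesgue_on \<Omega>"
abbreviation "wgrad \<equiv> weak_gradient \<Omega>"
abbreviation "W1 \<equiv> sobolev_W1 p \<Omega>"
abbreviation "W0 \<equiv> sobolev_W1_0 p \<Omega>"
abbreviation "dirichlet u \<equiv> lp_mass p M (wgrad u)"

lemma p_pos: "0 < p" using p_gt_1 by simp

lemma dom_lebesgue: "\<Omega> \<in> sets lebesgue"
  using open_dom by (simp add: borel_open sets_completionI_sets)

lemma finite_dom: "finite_measure M"
proof
  have "\<Omega> \<in> lmeasurable" using open_dom bounded_dom by (rule lmeasurable_open[rotated])
  then have "emeasure lebesgue \<Omega> \<noteq> \<infinity>" by (simp only: infinity_ennreal_def) (rule fmeasurableD2)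
  moreover have "emeasure M (space M) = emeasure lebesgue \<Omega>"
    using dom_lebesgue by (subst emeasure_restrict_space) (auto simp: space_restrict_space)
  ultimately show "emeasure M (space M) \<noteq> \<infinity>" by simp
qed

lemma Lp_eq: "Lp p \<Omega> = lp_space p M"
  by (simp add: Lp_def lp_space_def)

lemma space_M: "space M = \<Omega>" by (simp add: space_restrict_space)

lemma borel_imp_measurable_M:
  fixes f :: "'a \<Rightarrow> 'b::euclidean_space"
  shows "f \<in> borel_measurable borel \<Longrightarrow> f \<in> borel_measurable M"
  by (intro measurable_restrict_space1 measurable_completion) simp

lemma bounded_in_lp:
  fixes f :: "'a \<Rightarrow> 'b::euclidean_space"
  assumes "f \<in> borel_measurable M" "\<And>x. norm (f x) \<le> B" "0 < r"
  shows "f \<in> lp_space r M"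
proof -
  interpret finite_measure M by (rule finite_dom)
  show ?thesis by (rule lp_space_bounded[of _ _ "\<lambda>x. B powr r"]) (use assms in \<open>auto intro!: powr_mono2\<close>)
qed

lemma lp_imp_locally_integrable:
  fixes f :: "'a \<Rightarrow> 'b::euclidean_space"
  assumes "f \<in> lp_space p M" shows "locally_integrable \<Omega> f"
proof -
  have "integrable M f" using lp_finite_measure(1)[OF assms p_gt_1 finite_dom] .
  then have int: "set_integrable lebesgue \<Omega> f"
    using dom_lebesgue by (simp add: integrable_restrict_space set_integrable_def)
  show ?thesis unfolding locally_integrable_def
  proof (intro allI impI)
    fix K assume K: "compact K \<and> K \<subseteq> \<Omega>"
    then have Km: "K \<in> sets lebesgue" by (simp add: borel_compact sets_completionI_sets)
    then have "set_integrable lebesgue K f" using set_integrable_subset[OF int] K by blast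
    then show "integrable (lebesgue_on K) f"
      using Km by (simp add: integrable_restrict_space set_integrable_def)
  qed
qed

lemma locally_integrable_times_test:
  fixes g :: "'a \<Rightarrow> real"
  assumes g: "locally_integrable \<Omega> g" and K: "compact K" "K \<subseteq> \<Omega>"
    and \<phi>: "continuous_on UNIV \<phi>" "\<And>x. x \<notin> K \<Longrightarrow> \<phi> x = 0"
  shows "integrable M (\<lambda>x. g x * \<phi> x)"
proof -
  have Km: "K \<in> sets lebesgue" using K by (simp add: borel_compact sets_completionI_sets)
  obtain B where B: "0 \<le> B" "\<And>x. norm (\<phi> x) \<le> B"
    by (rule continuous_compact_support_bounded[OF \<phi>(1) K(1)]) (use \<phi>(2) in auto)
  have "integrable (lebesgue_on K) g" using g K by (auto simp: locally_integrable_def)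
  then have i: "integrable lebesgue (\<lambda>x. indicator K x * g x)"
    using Km by (simp add: integrable_restrict_space)
  have bm: "\<phi> \<in> borel_measurable lebesgue"
    using borel_measurable_continuous_onI[OF \<phi>(1)] by (intro measurable_completion) simp
  have "integrable lebesgue (\<lambda>x. (indicator K x * g x) * \<phi> x)"
  proof (rule Bochner_Integration.integrable_bound[OF integrable_mult_left[OF i, of B]])
    show "AE x in lebesgue. norm ((indicator K x * g x) * \<phi> x) \<le> norm ((indicator K x * g x) * B)"
    proof (rule AE_I2)
      fix x
      have "\<bar>indicator K x * g x\<bar> * \<bar>\<phi> x\<bar> \<le> \<bar>indicator K x * g x\<bar> * \<bar>B\<bar>"
        using B(2)[of x] by (intro mult_left_mono) auto
      then show "norm ((indicator K x * g x) * \<phi> x) \<le> norm ((indicator K x * g x) * B)"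
        by (simp only: real_norm_def abs_mult)
    qed
  qed (use i bm in auto)
  moreover have "(\<lambda>x. (indicator K x * g x) * \<phi> x) = (\<lambda>x. indicator \<Omega> x *\<^sub>R (g x * \<phi> x))"
  proof
    fix x
    show "(indicator K x * g x) * \<phi> x = indicator \<Omega> x *\<^sub>R (g x * \<phi> x)"
      using \<phi>(2)[of x] K(2) by (cases "x \<in> K") auto
  qed
  ultimately show ?thesis using dom_lebesgue by (simp add: integrable_restrict_space)
qed

lemma locally_integrable_inner:
  fixes g :: "'a \<Rightarrow> 'a"
  shows "locally_integrable \<Omega> g \<Longrightarrow> locally_integrable \<Omega> (\<lambda>x. g x \<bullet> b)"
  unfolding locally_integrable_def by auto

lemma locally_integrable_lincomb:
  fixes f g :: "'a \<Rightarrow> 'b::euclidean_space"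
  shows "locally_integrable \<Omega> f \<Longrightarrow> locally_integrable \<Omega> g \<Longrightarrow> locally_integrable \<Omega> (\<lambda>x. f x + c *\<^sub>R g x)"
  unfolding locally_integrable_def by auto

lemma integrable_times_test:
  fixes g :: "'a \<Rightarrow> real"
  assumes "locally_integrable \<Omega> g" "test_function \<Omega> \<phi>"
  shows "integrable M (\<lambda>x. g x * \<phi> x)"
    "b \<in> Basis \<Longrightarrow> integrable M (\<lambda>x. g x * frechet_derivative \<phi> (at x) b)"
proof -
  let ?K = "closure {x. \<phi> x \<noteq> 0}"
  have K: "compact ?K" "?K \<subseteq> \<Omega>" using assms(2) by (auto simp: test_function_def)
  have sm: "smooth \<phi>" using assms(2) by (rule test_function_smooth)
  show "integrable M (\<lambda>x. g x * \<phi> x)"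
    using closure_subset[of "{x. \<phi> x \<noteq> 0}"]
    by (intro locally_integrable_times_test[OF assms(1) K smooth_continuous[OF sm]]) auto
  assume b: "b \<in> Basis"
  have "integrable M (\<lambda>x. g x * (gradient \<phi> x \<bullet> b))"
  proof (rule locally_integrable_times_test[OF assms(1) K])
    show "continuous_on UNIV (\<lambda>x. gradient \<phi> x \<bullet> b)"
      by (intro continuous_intros smooth_gradient_continuous sm)
  qed (simp add: gradient_outside_support)
  then show "integrable M (\<lambda>x. g x * frechet_derivative \<phi> (at x) b)" using b by (simp add: inner_gradient)
qed

text \<open>
  By uniqueness the gradient chosen by \<open>weak_gradient\<close> may be replaced by any other one under an integral.
\<close>

lemma weak_gradient_unique:
  assumes "has_weak_gradient \<Omega> u g" "has_weak_gradient \<Omega> u g'"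
  shows "AE x in M. g x = g' x"
proof -
  have li: "locally_integrable \<Omega> g" "locally_integrable \<Omega> g'"
    using assms by (auto simp: has_weak_gradient_def)
  have "AE x in M. g x \<bullet> b + (-1) *\<^sub>R (g' x \<bullet> b) = 0" if b: "b \<in> Basis" for b
  proof (rule fundamental_lemma_variations[OF open_dom])
    show "locally_integrable \<Omega> (\<lambda>x. g x \<bullet> b + (-1) *\<^sub>R (g' x \<bullet> b))"
      by (intro locally_integrable_lincomb locally_integrable_inner li)
    fix \<phi> assume \<phi>: "test_function \<Omega> \<phi>"
    have "(LINT x|M. u x * frechet_derivative \<phi> (at x) b) = - (LINT x|M. (g x \<bullet> b) * \<phi> x)"
      "(LINT x|M. u x * frechet_derivative \<phi> (at x) b) = - (LINT x|M. (g' x \<bullet> b) * \<phi> x)"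
      using assms b \<phi> unfolding has_weak_gradient_def by blast+
    then have "(LINT x|M. (g x \<bullet> b) * \<phi> x) = (LINT x|M. (g' x \<bullet> b) * \<phi> x)" by linarith
    then show "(LINT x|M. (g x \<bullet> b + (-1) *\<^sub>R (g' x \<bullet> b)) * \<phi> x) = 0"
      using integrable_times_test(1)[OF locally_integrable_inner[OF li(1)] \<phi>, of b]
        integrable_times_test(1)[OF locally_integrable_inner[OF li(2)] \<phi>, of b]
      by (simp add: left_diff_distrib)
  qed
  then have "AE x in M. \<forall>b\<in>Basis. g x \<bullet> b + (-1) *\<^sub>R (g' x \<bullet> b) = 0"
    by (simp add: AE_ball_countable countable_finite)
  then show ?thesis
  proof eventually_elim
    case (elim x)
    then show "g x = g' x" by (intro euclidean_eqI[of "g x" "g' x"]) simp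
  qed
qed

lemma has_weak_gradient_wgrad: "has_weak_gradient \<Omega> u g \<Longrightarrow> has_weak_gradient \<Omega> u (wgrad u)"
  unfolding weak_gradient_def by (rule someI[where P = "has_weak_gradient \<Omega> u"])

lemma wgrad_AE_eq: "has_weak_gradient \<Omega> u g \<Longrightarrow> AE x in M. wgrad u x = g x"
  by (rule weak_gradient_unique[OF has_weak_gradient_wgrad])

text \<open>
  Lebesgue measure on the domain is complete, so measurability passes to almost everywhere equal functions. In
  particular the gradient selected by choice is measurable.
\<close>

lemma measurable_AE_cong:
  fixes f g :: "'a \<Rightarrow> 'b::euclidean_space"
  assumes "f \<in> borel_measurable M" "AE x in M. f x = g x"
  shows "g \<in> borel_measurable M"
proof -
  have "(\<lambda>x. indicator \<Omega> x *\<^sub>R f x) \<in> borel_measurable lebesgue"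
    using assms(1) dom_lebesgue by (simp add: borel_measurable_restrict_space_iff)
  moreover have "AE x in lebesgue. indicator \<Omega> x *\<^sub>R f x = indicator \<Omega> x *\<^sub>R g x"
    using assms(2) dom_lebesgue by (subst (asm) AE_restrict_space_iff) (auto elim!: eventually_mono simp: indicator_def)
  ultimately have "(\<lambda>x. indicator \<Omega> x *\<^sub>R g x) \<in> borel_measurable lebesgue"
    by (rule borel_measurable_AE)
  then show ?thesis using dom_lebesgue by (simp add: borel_measurable_restrict_space_iff)
qed

lemma lp_AE_cong:
  assumes "f \<in> lp_space r M" "AE x in M. g x = f x"
  shows "g \<in> lp_space r M" "lp_mass r M g = lp_mass r M f"
proof -
  have ae: "AE x in M. f x = g x" using assms(2) by eventually_elim simp
  note m = measurable_AE_cong[OF lp_space_measurable[OF assms(1)] ae]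
  show "g \<in> lp_space r M" "lp_mass r M g = lp_mass r M f"
    using lp_space_cong_AE[OF assms(1) m ae] by auto
qed

lemma W1D:
  assumes "u \<in> W1"
  shows "u \<in> lp_space p M" "has_weak_gradient \<Omega> u (wgrad u)" "wgrad u \<in> lp_space p M"
proof -
  obtain g where g: "g \<in> lp_space p M" "has_weak_gradient \<Omega> u g"
    using assms by (auto simp: sobolev_W1_def Lp_eq)
  show "u \<in> lp_space p M" using assms by (simp add: sobolev_W1_def Lp_eq)
  show "has_weak_gradient \<Omega> u (wgrad u)" by (rule has_weak_gradient_wgrad[OF g(2)])
  show "wgrad u \<in> lp_space p M" by (rule lp_AE_cong(1)[OF g(1) wgrad_AE_eq[OF g(2)]])
qed

lemma W1I:
  assumes "u \<in> lp_space p M" "g \<in> lp_space p M" "has_weak_gradient \<Omega> u g"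
  shows "u \<in> W1" "AE x in M. wgrad u x = g x"
  using assms wgrad_AE_eq by (auto simp: sobolev_W1_def Lp_eq)

lemma has_weak_gradient_lincomb:
  assumes "has_weak_gradient \<Omega> u g" "has_weak_gradient \<Omega> v h"
  shows "has_weak_gradient \<Omega> (\<lambda>x. u x + c * v x) (\<lambda>x. g x + c *\<^sub>R h x)"
proof -
  have li: "locally_integrable \<Omega> u" "locally_integrable \<Omega> v" "locally_integrable \<Omega> g" "locally_integrable \<Omega> h"
    using assms by (auto simp: has_weak_gradient_def)
  show ?thesis unfolding has_weak_gradient_def
  proof (intro conjI allI impI ballI)
    show "locally_integrable \<Omega> (\<lambda>x. u x + c * v x)" using locally_integrable_lincomb[OF li(1,2), of c] by simp
    show "locally_integrable \<Omega> (\<lambda>x. g x + c *\<^sub>R h x)" by (rule locally_integrable_lincomb[OF li(3,4)])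
    fix \<phi> and b :: 'a assume \<phi>: "test_function \<Omega> \<phi>" and b: "b \<in> Basis"
    have e: "(LINT x|M. u x * frechet_derivative \<phi> (at x) b) = - (LINT x|M. (g x \<bullet> b) * \<phi> x)"
      "(LINT x|M. v x * frechet_derivative \<phi> (at x) b) = - (LINT x|M. (h x \<bullet> b) * \<phi> x)"
      using assms \<phi> b unfolding has_weak_gradient_def by blast+
    note i = integrable_times_test(2)[OF li(1) \<phi> b] integrable_times_test(2)[OF li(2) \<phi> b]
      integrable_times_test(1)[OF locally_integrable_inner[OF li(3)] \<phi>, of b]
      integrable_times_test(1)[OF locally_integrable_inner[OF li(4)] \<phi>, of b]
    have "(LINT x|M. (u x + c * v x) * frechet_derivative \<phi> (at x) b)
        = (LINT x|M. u x * frechet_derivative \<phi> (at x) b + c * (v x * frechet_derivative \<phi> (at x) b))"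
      by (simp add: algebra_simps)
    also have "\<dots> = - (LINT x|M. (g x \<bullet> b) * \<phi> x) + c * - (LINT x|M. (h x \<bullet> b) * \<phi> x)"
      using i by (simp add: e)
    also have "\<dots> = - (LINT x|M. (g x \<bullet> b) * \<phi> x + c * ((h x \<bullet> b) * \<phi> x))"
      using i by simp
    also have "\<dots> = - (LINT x|M. ((g x + c *\<^sub>R h x) \<bullet> b) * \<phi> x)"
      by (simp add: algebra_simps inner_add_left)
    finally show "(LINT x|M. (u x + c * v x) * frechet_derivative \<phi> (at x) b)
        = - (LINT x|M. ((g x + c *\<^sub>R h x) \<bullet> b) * \<phi> x)" .
  qed
qed

lemma lp_lincomb:
  fixes f g :: "'a \<Rightarrow> 'b::euclidean_space"
  assumes "f \<in> lp_space p M" "g \<in> lp_space p M"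
  shows "(\<lambda>x. f x + c *\<^sub>R g x) \<in> lp_space p M"
  using assms p_pos by (intro lp_space_add lp_space_scaleR) auto

lemma W1_lincomb:
  assumes "u \<in> W1" "v \<in> W1"
  shows "(\<lambda>x. u x + c * v x) \<in> W1" "AE x in M. wgrad (\<lambda>x. u x + c * v x) x = wgrad u x + c *\<^sub>R wgrad v x"
proof -
  have l: "(\<lambda>x. u x + c * v x) \<in> lp_space p M"
    using lp_lincomb[OF W1D(1)[OF assms(1)] W1D(1)[OF assms(2)], of c] by simp
  note W1I[OF l lp_lincomb[OF W1D(3)[OF assms(1)] W1D(3)[OF assms(2)]] has_weak_gradient_lincomb[OF W1D(2)[OF assms(1)] W1D(2)[OF assms(2)]]]
  then show "(\<lambda>x. u x + c * v x) \<in> W1" "AE x in M. wgrad (\<lambda>x. u x + c * v x) x = wgrad u x + c *\<^sub>R wgrad v x"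
    by blast+
qed

lemma test_lp:
  assumes "test_function \<Omega> \<phi>" "0 < r"
  shows "\<phi> \<in> lp_space r M" "gradient \<phi> \<in> lp_space r M"
proof -
  let ?K = "closure {x. \<phi> x \<noteq> 0}"
  have K: "compact ?K" using assms by (simp add: test_function_def)
  have sm: "smooth \<phi>" using assms by (simp add: test_function_smooth)
  obtain B where "\<And>x. norm (\<phi> x) \<le> B"
    by (rule continuous_compact_support_bounded[OF smooth_continuous[OF sm] K])
      (use closure_subset[of "{x. \<phi> x \<noteq> 0}"] in auto)
  then show "\<phi> \<in> lp_space r M"
    using assms(2) by (intro bounded_in_lp borel_imp_measurable_M smooth_borel_measurable sm)
  obtain B' where "\<And>x. norm (gradient \<phi> x) \<le> B'"
    by (rule continuous_compact_support_bounded[OF smooth_gradient_continuous[OF sm] K])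
      (auto simp: gradient_outside_support)
  then show "gradient \<phi> \<in> lp_space r M"
    using assms(2) by (intro bounded_in_lp borel_imp_measurable_M smooth_borel_measurable sm)
qed

lemma has_weak_gradient_test:
  assumes "test_function \<Omega> \<phi>" shows "has_weak_gradient \<Omega> \<phi> (gradient \<phi>)"
  unfolding has_weak_gradient_def
  using test_lp[OF assms p_pos] test_integration_by_parts[OF open_dom assms]
  by (auto intro: lp_imp_locally_integrable)

lemma test_W1:
  assumes "test_function \<Omega> \<phi>"
  shows "\<phi> \<in> W1" "AE x in M. wgrad \<phi> x = gradient \<phi> x"
  using W1I[OF test_lp[OF assms p_pos] has_weak_gradient_test[OF assms]] by auto

lemma sobolev_norm_eq: "sobolev_norm p \<Omega> u = (lp_mass p M u + dirichlet u) powr (1/p)"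
  by (simp add: sobolev_norm_def lp_mass_def)

lemma sobolev_norm_less_iff:
  assumes "0 < \<epsilon>"
  shows "sobolev_norm p \<Omega> u < \<epsilon> \<longleftrightarrow> lp_mass p M u + dirichlet u < \<epsilon> powr p"
proof -
  let ?S = "lp_mass p M u + dirichlet u"
  have S: "0 \<le> ?S" by (simp add: lp_mass_nonneg)
  have "?S < \<epsilon> powr p \<longleftrightarrow> ?S powr (1/p) < (\<epsilon> powr p) powr (1/p)"
  proof
    show "?S < \<epsilon> powr p \<Longrightarrow> ?S powr (1/p) < (\<epsilon> powr p) powr (1/p)"
      using S p_pos by (intro powr_less_mono2) auto
    assume l: "?S powr (1/p) < (\<epsilon> powr p) powr (1/p)"
    show "?S < \<epsilon> powr p"
    proof (rule ccontr)
      assume "\<not> ?S < \<epsilon> powr p"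
      then have "(\<epsilon> powr p) powr (1/p) \<le> ?S powr (1/p)" using p_pos by (intro powr_mono2) auto
      with l show False by simp
    qed
  qed
  also have "(\<epsilon> powr p) powr (1/p) = \<epsilon>" using assms p_pos by (simp add: powr_powr)
  finally show ?thesis by (simp add: sobolev_norm_eq)
qed

lemma W1_minus_test:
  assumes u: "u \<in> W1" and \<phi>: "test_function \<Omega> \<phi>"
  shows "dirichlet (\<lambda>x. u x - \<phi> x) = lp_mass p M (\<lambda>x. wgrad u x - gradient \<phi> x)"
proof -
  note L = W1_lincomb[OF u test_W1(1)[OF \<phi>], of "-1"]
  have "AE x in M. wgrad (\<lambda>x. u x - \<phi> x) x = wgrad u x - gradient \<phi> x"
    using L(2) test_W1(2)[OF \<phi>] by eventually_elim simp
  moreover have "(\<lambda>x. wgrad u x - gradient \<phi> x) \<in> lp_space p M"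
    by (intro lp_space_diff W1D(3)[OF u] test_lp[OF \<phi> p_pos] p_pos)
  ultimately show ?thesis by (intro lp_AE_cong(2))
qed

text \<open>
  The approximation condition in terms of masses and the classical gradients of the test functions.
\<close>

lemma W0_iff:
  "u \<in> W0 \<longleftrightarrow> u \<in> W1 \<and> (\<forall>\<epsilon>>0. \<exists>\<phi>. test_function \<Omega> \<phi> \<and>
     lp_mass p M (\<lambda>x. u x - \<phi> x) + lp_mass p M (\<lambda>x. wgrad u x - gradient \<phi> x) < \<epsilon>)"
proof (cases "u \<in> W1")
  case True
  have eq: "sobolev_norm p \<Omega> (\<lambda>x. u x - \<phi> x) < \<epsilon> \<longleftrightarrow>
     lp_mass p M (\<lambda>x. u x - \<phi> x) + lp_mass p M (\<lambda>x. wgrad u x - gradient \<phi> x) < \<epsilon> powr p"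
    if "0 < \<epsilon>" "test_function \<Omega> \<phi>" for \<epsilon> \<phi>
    using sobolev_norm_less_iff[OF that(1)] W1_minus_test[OF True that(2)] by simp
  have "(\<forall>\<epsilon>>0. \<exists>\<phi>. test_function \<Omega> \<phi> \<and> sobolev_norm p \<Omega> (\<lambda>x. u x - \<phi> x) < \<epsilon>) \<longleftrightarrow>
     (\<forall>\<epsilon>>0. \<exists>\<phi>. test_function \<Omega> \<phi> \<and>
     lp_mass p M (\<lambda>x. u x - \<phi> x) + lp_mass p M (\<lambda>x. wgrad u x - gradient \<phi> x) < \<epsilon>)" (is "?L \<longleftrightarrow> ?R")
  proof
    assume L: ?L
    show ?R
    proof (intro allI impI)
      fix \<epsilon> :: real assume e: "0 < \<epsilon>"
      then have e': "0 < \<epsilon> powr (1/p)" "(\<epsilon> powr (1/p)) powr p = \<epsilon>" using p_pos by (auto simp: powr_powr)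
      then obtain \<phi> where "test_function \<Omega> \<phi>" "sobolev_norm p \<Omega> (\<lambda>x. u x - \<phi> x) < \<epsilon> powr (1/p)" using L by blast
      then show "\<exists>\<phi>. test_function \<Omega> \<phi> \<and>
        lp_mass p M (\<lambda>x. u x - \<phi> x) + lp_mass p M (\<lambda>x. wgrad u x - gradient \<phi> x) < \<epsilon>"
        using eq[OF e'(1)] e'(2) by auto
    qed
  next
    assume R: ?R
    show ?L
    proof (intro allI impI)
      fix \<epsilon> :: real assume e: "0 < \<epsilon>"
      then have "0 < \<epsilon> powr p" by simp
      then obtain \<phi> where "test_function \<Omega> \<phi>"
        "lp_mass p M (\<lambda>x. u x - \<phi> x) + lp_mass p M (\<lambda>x. wgrad u x - gradient \<phi> x) < \<epsilon> powr p" using R by blast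
      then show "\<exists>\<phi>. test_function \<Omega> \<phi> \<and> sobolev_norm p \<Omega> (\<lambda>x. u x - \<phi> x) < \<epsilon>"
        using eq[OF e] by auto
    qed
  qed
  then show ?thesis using True by (simp add: sobolev_W1_0_def)
qed (simp add: sobolev_W1_0_def)

lemma W0_imp_W1: "u \<in> W0 \<Longrightarrow> u \<in> W1"
  by (simp add: W0_iff)

lemmas W0D = W0_imp_W1[THEN W1D(1)] W0_imp_W1[THEN W1D(2)] W0_imp_W1[THEN W1D(3)]

lemma test_W0:
  assumes "test_function \<Omega> \<phi>" shows "\<phi> \<in> W0"
  unfolding W0_iff
proof (intro conjI allI impI)
  show "\<phi> \<in> W1" by (rule test_W1[OF assms])
  fix \<epsilon> :: real assume "0 < \<epsilon>"
  have "AE x in M. wgrad \<phi> x - gradient \<phi> x = 0" using test_W1(2)[OF assms] by eventually_elim simp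
  then have "lp_mass p M (\<lambda>x. wgrad \<phi> x - gradient \<phi> x) = 0"
    by (subst lp_mass_eq_0_iff) (auto intro!: lp_space_diff W1D(3) test_W1 test_lp assms p_pos)
  then show "\<exists>\<psi>. test_function \<Omega> \<psi> \<and>
     lp_mass p M (\<lambda>x. \<phi> x - \<psi> x) + lp_mass p M (\<lambda>x. wgrad \<phi> x - gradient \<psi> x) < \<epsilon>"
    using assms \<open>0 < \<epsilon>\<close> by (intro exI[of _ \<phi>]) (simp add: lp_mass_def)
qed

lemma W0_test_sequence:
  assumes "u \<in> W0"
  obtains \<phi> where "\<And>n::nat. test_function \<Omega> (\<phi> n)" "(\<lambda>n. lp_mass p M (\<lambda>x. \<phi> n x - u x)) \<longlonglongrightarrow> 0"
    "(\<lambda>n. lp_mass p M (\<lambda>x. gradient (\<phi> n) x - wgrad u x)) \<longlonglongrightarrow> 0"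
proof -
  have "\<exists>\<phi>. test_function \<Omega> \<phi> \<and> lp_mass p M (\<lambda>x. u x - \<phi> x) + lp_mass p M (\<lambda>x. wgrad u x - gradient \<phi> x)
      < inverse (real (Suc n))" for n
    using assms unfolding W0_iff by simp
  then obtain \<phi> where \<phi>: "\<And>n. test_function \<Omega> (\<phi> n)"
    "\<And>n. lp_mass p M (\<lambda>x. u x - \<phi> n x) + lp_mass p M (\<lambda>x. wgrad u x - gradient (\<phi> n) x) < inverse (real (Suc n))"
    by metis
  have b: "lp_mass p M (\<lambda>x. \<phi> n x - u x) \<le> inverse (real (Suc n))"
    "lp_mass p M (\<lambda>x. gradient (\<phi> n) x - wgrad u x) \<le> inverse (real (Suc n))" for n
    using \<phi>(2)[of n] lp_mass_nonneg[of p M "\<lambda>x. u x - \<phi> n x"] lp_mass_nonneg[of p M "\<lambda>x. wgrad u x - gradient (\<phi> n) x"]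
      lp_mass_minus_commute[of p M "\<phi> n" u] lp_mass_minus_commute[of p M "gradient (\<phi> n)" "wgrad u"] by linarith+
  show ?thesis
  proof (rule that[of \<phi>])
    show "(\<lambda>n. lp_mass p M (\<lambda>x. \<phi> n x - u x)) \<longlonglongrightarrow> 0"
      by (rule tendsto_sandwich[OF _ _ tendsto_const LIMSEQ_inverse_real_of_nat])
        (intro always_eventually allI lp_mass_nonneg b)+
    show "(\<lambda>n. lp_mass p M (\<lambda>x. gradient (\<phi> n) x - wgrad u x)) \<longlonglongrightarrow> 0"
      by (rule tendsto_sandwich[OF _ _ tendsto_const LIMSEQ_inverse_real_of_nat])
        (intro always_eventually allI lp_mass_nonneg b)+
  qed (rule \<phi>(1))
qed

lemma lp_limit_integral_times_bounded:
  fixes F :: "nat \<Rightarrow> 'a \<Rightarrow> real"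
  assumes F: "\<And>n. F n \<in> lp_space p M" and f: "f \<in> lp_space p M"
    and lim: "(\<lambda>n. lp_mass p M (\<lambda>x. F n x - f x)) \<longlonglongrightarrow> 0"
    and \<psi>: "\<psi> \<in> borel_measurable M" "\<And>x. \<bar>\<psi> x\<bar> \<le> B"
  shows "(\<lambda>n. LINT x|M. F n x * \<psi> x) \<longlonglongrightarrow> (LINT x|M. f x * \<psi> x)"
proof -
  have B: "0 \<le> B" using \<psi>(2)[of undefined] by linarith
  define V where "V = measure M (space M) powr (p - 1)"
  have int: "integrable M (\<lambda>x. g x * \<psi> x)" if g: "g \<in> lp_space p M" for g :: "'a \<Rightarrow> real"
  proof (rule Bochner_Integration.integrable_bound[OF integrable_mult_left[OF lp_finite_measure(1)[OF g p_gt_1 finite_dom], of B]])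
    show "(\<lambda>x. g x * \<psi> x) \<in> borel_measurable M" using g \<psi>(1) by (auto simp: lp_space_def)
    show "AE x in M. norm (g x * \<psi> x) \<le> norm (g x * B)"
      using \<psi>(2) B by (auto simp: abs_mult intro!: mult_left_mono)
  qed
  have le: "\<bar>(LINT x|M. F n x * \<psi> x) - (LINT x|M. f x * \<psi> x)\<bar> \<le> B * (V * lp_mass p M (\<lambda>x. F n x - f x)) powr (1/p)" for n
  proof -
    have d: "(\<lambda>x. F n x - f x) \<in> lp_space p M" by (intro lp_space_diff F f p_pos)
    note L = lp_finite_measure[OF d p_gt_1 finite_dom]
    have "(LINT x|M. F n x * \<psi> x) - (LINT x|M. f x * \<psi> x) = (LINT x|M. (F n x - f x) * \<psi> x)"
      using int[OF F[of n]] int[OF f] by (simp add: left_diff_distrib)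
    also have "\<bar>\<dots>\<bar> \<le> (LINT x|M. B * norm (F n x - f x))"
    proof (rule order_trans[OF integral_abs_bound integral_mono])
      show "\<bar>(F n x - f x) * \<psi> x\<bar> \<le> B * norm (F n x - f x)" for x
        using mult_right_mono[OF \<psi>(2)[of x] abs_ge_zero[of "F n x - f x"]] by (simp add: abs_mult mult.commute)
    qed (use int[OF d] L in auto)
    also have "\<dots> = B * (LINT x|M. norm (F n x - f x))" by simp
    also have "(LINT x|M. norm (F n x - f x)) = ((LINT x|M. norm (F n x - f x)) powr p) powr (1/p)"
      using p_pos by (simp add: powr_powr)
    also have "B * \<dots> \<le> B * (V * lp_mass p M (\<lambda>x. F n x - f x)) powr (1/p)"
      using L(2) B p_pos by (intro mult_left_mono powr_mono2) (auto simp: V_def)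
    finally show ?thesis .
  qed
  have "(\<lambda>n. B * (V * lp_mass p M (\<lambda>x. F n x - f x)) powr (1/p)) \<longlonglongrightarrow> B * (V * 0) powr (1/p)"
    using p_pos by (intro tendsto_intros tendsto_powr' lim) (auto simp: lp_mass_nonneg V_def)
  then have "(\<lambda>n. B * (V * lp_mass p M (\<lambda>x. F n x - f x)) powr (1/p)) \<longlonglongrightarrow> 0" by simp
  then have "(\<lambda>n. (LINT x|M. F n x * \<psi> x) - (LINT x|M. f x * \<psi> x)) \<longlonglongrightarrow> 0"
    by (rule Lim_null_comparison[rotated]) (simp add: le)
  then show ?thesis by (simp add: LIM_zero_iff)
qed

text \<open>
  The defining identity of a weak gradient passes to the limit, because test functions and their derivatives are
  bounded and convergence in \<open>L\<^sup>p\<close> on a bounded domain implies convergence in \<open>L\<^sup>1\<close>.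
\<close>

lemma W1_closed:
  assumes w: "\<And>n::nat. w n \<in> W1" and u: "u \<in> lp_space p M" and g: "g \<in> lp_space p M"
    and lim: "(\<lambda>n. lp_mass p M (\<lambda>x. w n x - u x)) \<longlonglongrightarrow> 0" "(\<lambda>n. lp_mass p M (\<lambda>x. wgrad (w n) x - g x)) \<longlonglongrightarrow> 0"
  shows "u \<in> W1" "AE x in M. wgrad u x = g x"
proof -
  have "has_weak_gradient \<Omega> u g" unfolding has_weak_gradient_def
  proof (intro conjI allI impI ballI lp_imp_locally_integrable u g)
    fix \<phi> and b :: 'a assume \<phi>: "test_function \<Omega> \<phi>" and b: "b \<in> Basis"
    have sm: "smooth \<phi>" using \<phi> by (rule test_function_smooth)
    let ?K = "closure {x. \<phi> x \<noteq> 0}"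
    have K: "compact ?K" using \<phi> by (simp add: test_function_def)
    obtain B where B: "\<And>x. norm (\<phi> x) \<le> B"
      by (rule continuous_compact_support_bounded[OF smooth_continuous[OF sm] K])
        (use closure_subset[of "{x. \<phi> x \<noteq> 0}"] in auto)
    obtain B' where B': "\<And>x. norm (gradient \<phi> x) \<le> B'"
      by (rule continuous_compact_support_bounded[OF smooth_gradient_continuous[OF sm] K])
        (auto simp: gradient_outside_support)
    have bd: "\<bar>gradient \<phi> x \<bullet> b\<bar> \<le> B'" for x
      using Cauchy_Schwarz_ineq2[of "gradient \<phi> x" b] B'[of x] b by simp
    have m: "\<phi> \<in> borel_measurable M" "(\<lambda>x. gradient \<phi> x \<bullet> b) \<in> borel_measurable M"
      using smooth_borel_measurable[OF sm] by (auto intro!: borel_imp_measurable_M)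
    have 1: "(\<lambda>n. LINT x|M. w n x * (gradient \<phi> x \<bullet> b)) \<longlonglongrightarrow> (LINT x|M. u x * (gradient \<phi> x \<bullet> b))"
      by (rule lp_limit_integral_times_bounded[OF W1D(1)[OF w] u lim(1) m(2) bd])
    have inb: "(\<lambda>x. h x \<bullet> b) \<in> lp_space p M \<and> lp_mass p M (\<lambda>x. h x \<bullet> b) \<le> lp_mass p M h"
      if h: "h \<in> lp_space p M" for h :: "'a \<Rightarrow> 'a"
    proof -
      have [measurable]: "h \<in> borel_measurable M" using h by (simp add: lp_space_def)
      have "norm (h x \<bullet> b) powr p \<le> norm (h x) powr p" for x
        using Cauchy_Schwarz_ineq2[of "h x" b] b p_pos by (intro powr_mono2) auto
      then show ?thesis
        using lp_space_bounded[of "\<lambda>x. h x \<bullet> b" M "\<lambda>x. norm (h x) powr p" p] h by (auto simp: lp_space_def lp_mass_def)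
    qed
    have 2: "(\<lambda>n. LINT x|M. (wgrad (w n) x \<bullet> b) * \<phi> x) \<longlonglongrightarrow> (LINT x|M. (g x \<bullet> b) * \<phi> x)"
    proof (rule lp_limit_integral_times_bounded[OF _ _ _ m(1)])
      show "(\<lambda>n. lp_mass p M (\<lambda>x. wgrad (w n) x \<bullet> b - g x \<bullet> b)) \<longlonglongrightarrow> 0"
      proof (rule tendsto_sandwich[OF _ _ tendsto_const lim(2)])
        show "\<forall>\<^sub>F n in sequentially. lp_mass p M (\<lambda>x. wgrad (w n) x \<bullet> b - g x \<bullet> b) \<le> lp_mass p M (\<lambda>x. wgrad (w n) x - g x)"
          using inb[OF lp_space_diff(1)[OF W1D(3)[OF w] g p_pos]] by (simp add: inner_diff_left)
      qed (simp add: lp_mass_nonneg)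
    qed (use inb W1D(3)[OF w] g B in auto)
    have "(LINT x|M. w n x * (gradient \<phi> x \<bullet> b)) = - (LINT x|M. (wgrad (w n) x \<bullet> b) * \<phi> x)" for n
      using W1D(2)[OF w[of n]] \<phi> b by (simp add: has_weak_gradient_def inner_gradient)
    then have "(\<lambda>n. LINT x|M. w n x * (gradient \<phi> x \<bullet> b)) \<longlonglongrightarrow> - (LINT x|M. (g x \<bullet> b) * \<phi> x)"
      using tendsto_minus[OF 2] by simp
    from LIMSEQ_unique[OF 1 this]
    show "(LINT x|M. u x * frechet_derivative \<phi> (at x) b) = - (LINT x|M. (g x \<bullet> b) * \<phi> x)"
      using b by (simp add: inner_gradient)
  qed
  with u g show "u \<in> W1" "AE x in M. wgrad u x = g x" using W1I by auto
qed

lemma W0_closed: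
  assumes w: "\<And>n::nat. w n \<in> W0" and u: "u \<in> lp_space p M" and g: "g \<in> lp_space p M"
    and lim: "(\<lambda>n. lp_mass p M (\<lambda>x. w n x - u x)) \<longlonglongrightarrow> 0" "(\<lambda>n. lp_mass p M (\<lambda>x. wgrad (w n) x - g x)) \<longlonglongrightarrow> 0"
  shows "u \<in> W0" "AE x in M. wgrad u x = g x"
proof -
  note c = W1_closed[OF W0_imp_W1[OF w] u g lim]
  show "AE x in M. wgrad u x = g x" by (rule c(2))
  show "u \<in> W0" unfolding W0_iff
  proof (intro conjI allI impI)
    show "u \<in> W1" by (rule c(1))
    fix \<epsilon> :: real assume e: "0 < \<epsilon>"
    define \<delta> where "\<delta> = \<epsilon> / (3 * 2 powr p)"
    have d: "0 < \<delta>" using e by (simp add: \<delta>_def)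
    have "\<forall>\<^sub>F n in sequentially. lp_mass p M (\<lambda>x. w n x - u x) < \<delta>"
      "\<forall>\<^sub>F n in sequentially. lp_mass p M (\<lambda>x. wgrad (w n) x - g x) < \<delta>"
      using order_tendstoD(2)[OF lim(1) d] order_tendstoD(2)[OF lim(2) d] by auto
    then have "\<forall>\<^sub>F n in sequentially. lp_mass p M (\<lambda>x. w n x - u x) < \<delta> \<and> lp_mass p M (\<lambda>x. wgrad (w n) x - g x) < \<delta>"
      by (rule eventually_conj)
    then obtain n where n: "lp_mass p M (\<lambda>x. w n x - u x) < \<delta>" "lp_mass p M (\<lambda>x. wgrad (w n) x - g x) < \<delta>"
      unfolding eventually_sequentially by blast
    obtain \<phi> where \<phi>: "test_function \<Omega> \<phi>"
      "lp_mass p M (\<lambda>x. w n x - \<phi> x) + lp_mass p M (\<lambda>x. wgrad (w n) x - gradient \<phi> x) < \<delta>"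
      using w[of n] d unfolding W0_iff by blast
    note tl = test_lp[OF \<phi>(1) p_pos]
    have 1: "lp_mass p M (\<lambda>x. (w n x - \<phi> x) - (w n x - u x)) \<le> 2 powr p * (lp_mass p M (\<lambda>x. w n x - \<phi> x) + lp_mass p M (\<lambda>x. w n x - u x))"
      by (intro lp_space_diff W0D(1)[OF w] tl u p_pos)
    have 2: "lp_mass p M (\<lambda>x. (wgrad (w n) x - gradient \<phi> x) - (wgrad (w n) x - g x))
        \<le> 2 powr p * (lp_mass p M (\<lambda>x. wgrad (w n) x - gradient \<phi> x) + lp_mass p M (\<lambda>x. wgrad (w n) x - g x))"
      by (intro lp_space_diff W0D(3)[OF w] tl g p_pos)
    have "AE x in M. wgrad u x - gradient \<phi> x = g x - gradient \<phi> x" using c(2) by eventually_elim simp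
    then have 3: "lp_mass p M (\<lambda>x. wgrad u x - gradient \<phi> x) = lp_mass p M (\<lambda>x. g x - gradient \<phi> x)"
      by (rule lp_AE_cong(2)[rotated]) (intro lp_space_diff g tl p_pos)
    have "lp_mass p M (\<lambda>x. u x - \<phi> x) + lp_mass p M (\<lambda>x. wgrad u x - gradient \<phi> x)
      \<le> 2 powr p * ((lp_mass p M (\<lambda>x. w n x - \<phi> x) + lp_mass p M (\<lambda>x. wgrad (w n) x - gradient \<phi> x))
          + lp_mass p M (\<lambda>x. w n x - u x) + lp_mass p M (\<lambda>x. wgrad (w n) x - g x))"
      using 1 2 unfolding 3 by (simp add: distrib_left)
    also have "\<dots> < 2 powr p * (\<delta> + \<delta> + \<delta>)"
      using \<phi>(2) n by (intro mult_strict_left_mono) auto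
    also have "\<dots> = \<epsilon>" by (simp add: \<delta>_def)
    finally show "\<exists>\<phi>. test_function \<Omega> \<phi> \<and>
       lp_mass p M (\<lambda>x. u x - \<phi> x) + lp_mass p M (\<lambda>x. wgrad u x - gradient \<phi> x) < \<epsilon>"
      using \<phi>(1) by blast
  qed
qed

lemma lp_lincomb_mass:
  fixes f g :: "'a \<Rightarrow> 'b::euclidean_space"
  assumes "f \<in> lp_space p M" "g \<in> lp_space p M"
  shows "lp_mass p M (\<lambda>x. f x + c *\<^sub>R g x) \<le> 2 powr p * (lp_mass p M f + \<bar>c\<bar> powr p * lp_mass p M g)"
  using lp_space_add(2)[OF assms(1) lp_space_scaleR(1)[OF assms(2) p_pos, of c]] p_pos
    lp_space_scaleR(2)[OF assms(2) p_pos, of c] by simp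

lemma lp_tendsto_lincomb:
  fixes f g :: "'a \<Rightarrow> 'b::euclidean_space"
  assumes "\<And>n. F n \<in> lp_space p M" "f \<in> lp_space p M" "\<And>n. G n \<in> lp_space p M" "g \<in> lp_space p M"
    "(\<lambda>n. lp_mass p M (\<lambda>x. F n x - f x)) \<longlonglongrightarrow> 0" "(\<lambda>n. lp_mass p M (\<lambda>x. G n x - g x)) \<longlonglongrightarrow> 0"
  shows "(\<lambda>n. lp_mass p M (\<lambda>x. (F n x + c *\<^sub>R G n x) - (f x + c *\<^sub>R g x))) \<longlonglongrightarrow> 0"
proof (rule tendsto_sandwich[OF _ _ tendsto_const])
  have "(\<lambda>n. 2 powr p * (lp_mass p M (\<lambda>x. F n x - f x) + \<bar>c\<bar> powr p * lp_mass p M (\<lambda>x. G n x - g x)))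
      \<longlonglongrightarrow> 2 powr p * (0 + \<bar>c\<bar> powr p * 0)"
    by (intro tendsto_intros assms)
  then show "(\<lambda>n. 2 powr p * (lp_mass p M (\<lambda>x. F n x - f x) + \<bar>c\<bar> powr p * lp_mass p M (\<lambda>x. G n x - g x))) \<longlonglongrightarrow> 0"
    by simp
  show "\<forall>\<^sub>F n in sequentially. lp_mass p M (\<lambda>x. (F n x + c *\<^sub>R G n x) - (f x + c *\<^sub>R g x))
      \<le> 2 powr p * (lp_mass p M (\<lambda>x. F n x - f x) + \<bar>c\<bar> powr p * lp_mass p M (\<lambda>x. G n x - g x))"
  proof (intro always_eventually allI)
    fix n
    have "(\<lambda>x. (F n x - f x) + c *\<^sub>R (G n x - g x)) = (\<lambda>x. (F n x + c *\<^sub>R G n x) - (f x + c *\<^sub>R g x))"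
      by (simp add: algebra_simps)
    then show "lp_mass p M (\<lambda>x. (F n x + c *\<^sub>R G n x) - (f x + c *\<^sub>R g x))
      \<le> 2 powr p * (lp_mass p M (\<lambda>x. F n x - f x) + \<bar>c\<bar> powr p * lp_mass p M (\<lambda>x. G n x - g x))"
      using lp_lincomb_mass[OF lp_space_diff(1)[OF assms(1)[of n] assms(2) p_pos] lp_space_diff(1)[OF assms(3)[of n] assms(4) p_pos], of c]
      by simp
  qed
qed (simp add: lp_mass_nonneg)

lemma lp_mass_AE_eq: "AE x in M. f x = g x \<Longrightarrow> g \<in> lp_space p M \<Longrightarrow> lp_mass p M f = lp_mass p M g"
  using lp_AE_cong(2) by blast

lemma W0_limit_of_tests:
  assumes \<phi>: "\<And>n::nat. test_function \<Omega> (\<phi> n)" and u: "u \<in> lp_space p M" and g: "g \<in> lp_space p M"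
    and lim: "(\<lambda>n. lp_mass p M (\<lambda>x. \<phi> n x - u x)) \<longlonglongrightarrow> 0" "(\<lambda>n. lp_mass p M (\<lambda>x. gradient (\<phi> n) x - g x)) \<longlonglongrightarrow> 0"
  shows "u \<in> W0" "AE x in M. wgrad u x = g x"
proof -
  have "lp_mass p M (\<lambda>x. wgrad (\<phi> n) x - g x) = lp_mass p M (\<lambda>x. gradient (\<phi> n) x - g x)" for n
  proof (rule lp_mass_AE_eq)
    show "AE x in M. wgrad (\<phi> n) x - g x = gradient (\<phi> n) x - g x"
      using test_W1(2)[OF \<phi>[of n]] by eventually_elim simp
  qed (intro lp_space_diff test_lp \<phi> g p_pos)
  then show "u \<in> W0" "AE x in M. wgrad u x = g x"
    using W0_closed[OF test_W0[OF \<phi>] u g lim(1)] lim(2) by auto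
qed

lemma W0_lincomb:
  assumes "u \<in> W0" "v \<in> W0"
  shows "(\<lambda>x. u x + c * v x) \<in> W0" "AE x in M. wgrad (\<lambda>x. u x + c * v x) x = wgrad u x + c *\<^sub>R wgrad v x"
proof -
  obtain \<phi> where \<phi>: "\<And>n::nat. test_function \<Omega> (\<phi> n)" "(\<lambda>n. lp_mass p M (\<lambda>x. \<phi> n x - u x)) \<longlonglongrightarrow> 0"
    "(\<lambda>n. lp_mass p M (\<lambda>x. gradient (\<phi> n) x - wgrad u x)) \<longlonglongrightarrow> 0" by (rule W0_test_sequence[OF assms(1)]) (rule that)
  obtain \<psi> where \<psi>: "\<And>n::nat. test_function \<Omega> (\<psi> n)" "(\<lambda>n. lp_mass p M (\<lambda>x. \<psi> n x - v x)) \<longlonglongrightarrow> 0"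
    "(\<lambda>n. lp_mass p M (\<lambda>x. gradient (\<psi> n) x - wgrad v x)) \<longlonglongrightarrow> 0" by (rule W0_test_sequence[OF assms(2)]) (rule that)
  have gr: "gradient (\<lambda>x. \<phi> n x + c * \<psi> n x) = (\<lambda>x. gradient (\<phi> n) x + c *\<^sub>R gradient (\<psi> n) x)" for n
    by (intro ext gradient_linear test_function_smooth[OF \<phi>(1)] test_function_smooth[OF \<psi>(1)])
  note c = W0_limit_of_tests[of "\<lambda>n x. \<phi> n x + c * \<psi> n x" "\<lambda>x. u x + c * v x" "\<lambda>x. wgrad u x + c *\<^sub>R wgrad v x", unfolded gr]
  have t: "test_function \<Omega> (\<lambda>x. \<phi> n x + c * \<psi> n x)" for n by (intro test_function_linear \<phi>(1) \<psi>(1))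
  have 1: "(\<lambda>x. u x + c * v x) \<in> lp_space p M" using lp_lincomb[OF W0D(1)[OF assms(1)] W0D(1)[OF assms(2)], of c] by simp
  have 2: "(\<lambda>x. wgrad u x + c *\<^sub>R wgrad v x) \<in> lp_space p M" by (intro lp_lincomb W0D(3) assms)
  have 3: "(\<lambda>n. lp_mass p M (\<lambda>x. (\<phi> n x + c * \<psi> n x) - (u x + c * v x))) \<longlonglongrightarrow> 0"
    using lp_tendsto_lincomb[OF test_lp(1)[OF \<phi>(1) p_pos] W0D(1)[OF assms(1)] test_lp(1)[OF \<psi>(1) p_pos] W0D(1)[OF assms(2)] \<phi>(2) \<psi>(2), of c]
    by simp
  have 4: "(\<lambda>n. lp_mass p M (\<lambda>x. (gradient (\<phi> n) x + c *\<^sub>R gradient (\<psi> n) x) - (wgrad u x + c *\<^sub>R wgrad v x))) \<longlonglongrightarrow> 0"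
    by (rule lp_tendsto_lincomb[OF test_lp(2)[OF \<phi>(1) p_pos] W0D(3)[OF assms(1)] test_lp(2)[OF \<psi>(1) p_pos] W0D(3)[OF assms(2)] \<phi>(3) \<psi>(3)])
  show "(\<lambda>x. u x + c * v x) \<in> W0" "AE x in M. wgrad (\<lambda>x. u x + c * v x) x = wgrad u x + c *\<^sub>R wgrad v x"
    using c[OF t 1 2 3 4] by auto
qed

lemma lp_tendsto_bounded_times:
  fixes F :: "nat \<Rightarrow> 'a \<Rightarrow> 'b::euclidean_space" and G :: "nat \<Rightarrow> 'a \<Rightarrow> 'c::euclidean_space"
  assumes F: "\<And>n. F n \<in> lp_space p M"
    and lim: "(\<lambda>n. lp_mass p M (F n)) \<longlonglongrightarrow> 0"
    and G: "\<And>n. G n \<in> borel_measurable M" "\<And>n x. norm (G n x) \<le> B * norm (F n x)" and B: "0 \<le> B"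
  shows "\<And>n. G n \<in> lp_space p M" "(\<lambda>n. lp_mass p M (G n)) \<longlonglongrightarrow> 0"
proof -
  have pw: "norm (G n x) powr p \<le> B powr p * norm (F n x) powr p" for n x
    using powr_mono2[OF less_imp_le[OF p_pos] norm_ge_zero G(2)[of n x]] B by (simp add: powr_mult)
  have int: "integrable M (\<lambda>x. B powr p * norm (F n x) powr p)" for n
    using lp_space_integrable[OF F[of n]] by simp
  have ae: "AE x in M. norm (G n x) powr p \<le> B powr p * norm (F n x) powr p" for n using pw by simp
  note b = lp_space_bounded[OF G(1) int ae]
  show "\<And>n. G n \<in> lp_space p M" by (rule b(1))
  show "(\<lambda>n. lp_mass p M (G n)) \<longlonglongrightarrow> 0"
  proof (rule tendsto_sandwich[OF _ _ tendsto_const])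
    show "(\<lambda>n. B powr p * lp_mass p M (F n)) \<longlonglongrightarrow> 0" using tendsto_mult_left[OF lim, of "B powr p"] by simp
    show "\<forall>\<^sub>F n in sequentially. lp_mass p M (G n) \<le> B powr p * lp_mass p M (F n)"
    proof (intro always_eventually allI)
      fix n
      show "lp_mass p M (G n) \<le> B powr p * lp_mass p M (F n)"
        using b(2)[of n] by (simp add: lp_mass_def)
    qed
  qed (simp add: lp_mass_nonneg)
qed

text \<open>
  Products of test functions with \<open>\<eta>\<close> are test functions, and the product rule passes to the limit.
\<close>

lemma W0_mult_smooth:
  assumes u: "u \<in> W0" and \<eta>: "smooth \<eta>" "\<And>x. \<bar>\<eta> x\<bar> \<le> 1" "\<And>x. norm (gradient \<eta> x) \<le> G"
  shows "(\<lambda>x. \<eta> x * u x) \<in> W0" "AE x in M. wgrad (\<lambda>x. \<eta> x * u x) x = \<eta> x *\<^sub>R wgrad u x + u x *\<^sub>R gradient \<eta> x"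
proof -
  obtain \<phi> where \<phi>: "\<And>n::nat. test_function \<Omega> (\<phi> n)" "(\<lambda>n. lp_mass p M (\<lambda>x. \<phi> n x - u x)) \<longlonglongrightarrow> 0"
    "(\<lambda>n. lp_mass p M (\<lambda>x. gradient (\<phi> n) x - wgrad u x)) \<longlonglongrightarrow> 0" by (rule W0_test_sequence[OF u]) (rule that)
  have G: "0 \<le> G" using \<eta>(3)[of undefined] norm_ge_zero order_trans by blast
  have [measurable]: "\<eta> \<in> borel_measurable M" "gradient \<eta> \<in> borel_measurable M"
    "u \<in> borel_measurable M" "wgrad u \<in> borel_measurable M" "\<phi> n \<in> borel_measurable M" "gradient (\<phi> n) \<in> borel_measurable M" for n
    using smooth_borel_measurable[OF \<eta>(1), THEN borel_imp_measurable_M] W0D(1,3)[OF u, THEN lp_space_measurable]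
      smooth_borel_measurable[OF test_function_smooth[OF \<phi>(1)[of n]], THEN borel_imp_measurable_M]
    by simp_all
  have lpd: "(\<lambda>x. \<phi> n x - u x) \<in> lp_space p M" "(\<lambda>x. gradient (\<phi> n) x - wgrad u x) \<in> lp_space p M" for n
    by (intro lp_space_diff test_lp \<phi> W0D u p_pos)+
  have e1: "norm (\<eta> x * a) \<le> 1 * norm a" for x and a :: real
    using mult_right_mono[OF \<eta>(2)[of x] abs_ge_zero[of a]] by (simp add: abs_mult)
  have e2: "norm (\<eta> x *\<^sub>R a) \<le> 1 * norm a" for x and a :: 'a
    using mult_right_mono[OF \<eta>(2)[of x] norm_ge_zero[of a]] by simp
  have e3: "norm (a *\<^sub>R gradient \<eta> x) \<le> G * norm a" for x and a :: real
    using mult_left_mono[OF \<eta>(3)[of x] abs_ge_zero[of a]] by (simp add: mult.commute)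
  have 1: "(\<lambda>n. lp_mass p M (\<lambda>x. \<eta> x * (\<phi> n x - u x))) \<longlonglongrightarrow> 0"
    by (rule lp_tendsto_bounded_times(2)[OF lpd(1) \<phi>(2), of _ 1]) (measurable, rule e1, simp)
  have 2: "(\<lambda>x. \<eta> x *\<^sub>R (gradient (\<phi> n) x - wgrad u x)) \<in> lp_space p M"
    "(\<lambda>n. lp_mass p M (\<lambda>x. \<eta> x *\<^sub>R (gradient (\<phi> n) x - wgrad u x))) \<longlonglongrightarrow> 0" for n
    by (rule lp_tendsto_bounded_times[OF lpd(2) \<phi>(3), of "\<lambda>n x. \<eta> x *\<^sub>R (gradient (\<phi> n) x - wgrad u x)" 1]; (rule e2 | simp | measurable))+
  have 3: "(\<lambda>x. (\<phi> n x - u x) *\<^sub>R gradient \<eta> x) \<in> lp_space p M"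
    "(\<lambda>n. lp_mass p M (\<lambda>x. (\<phi> n x - u x) *\<^sub>R gradient \<eta> x)) \<longlonglongrightarrow> 0" for n
    by (rule lp_tendsto_bounded_times[OF lpd(1) \<phi>(2), of "\<lambda>n x. (\<phi> n x - u x) *\<^sub>R gradient \<eta> x" G]; (rule e3 | rule G | measurable))+
  have in0: "h \<in> lp_space p M \<Longrightarrow> (\<lambda>x. \<eta> x * h x) \<in> lp_space p M" for h :: "'a \<Rightarrow> real"
  proof -
    assume h: "h \<in> lp_space p M"
    then have [measurable]: "h \<in> borel_measurable M" by (rule lp_space_measurable)
    show ?thesis
      by (rule lp_space_bounded[OF _ lp_space_integrable[OF h]])
        (measurable, use e1 p_pos in \<open>auto intro!: powr_mono2 AE_I2\<close>)
  qed
  have in1: "h \<in> lp_space p M \<Longrightarrow> (\<lambda>x. \<eta> x *\<^sub>R h x) \<in> lp_space p M" for h :: "'a \<Rightarrow> 'a"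
  proof -
    assume h: "h \<in> lp_space p M"
    then have [measurable]: "h \<in> borel_measurable M" by (rule lp_space_measurable)
    show ?thesis
      by (rule lp_space_bounded[OF _ lp_space_integrable[OF h]])
        (measurable, use e2 p_pos in \<open>auto intro!: powr_mono2 AE_I2\<close>)
  qed
  have in2: "h \<in> lp_space p M \<Longrightarrow> (\<lambda>x. h x *\<^sub>R gradient \<eta> x) \<in> lp_space p M" for h :: "'a \<Rightarrow> real"
  proof -
    assume h: "h \<in> lp_space p M"
    then have [measurable]: "h \<in> borel_measurable M" by (rule lp_space_measurable)
    have "(\<lambda>x. G *\<^sub>R h x) \<in> lp_space p M" by (rule lp_space_scaleR[OF h p_pos])
    note int = lp_space_integrable[OF this]
    show ?thesis
    proof (rule lp_space_bounded[OF _ int])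
      show "AE x in M. norm (h x *\<^sub>R gradient \<eta> x) powr p \<le> norm (G *\<^sub>R h x) powr p"
      proof (rule AE_I2, rule powr_mono2)
        show "norm (h x *\<^sub>R gradient \<eta> x) \<le> norm (G *\<^sub>R h x)" for x using e3[of "h x" x] G by simp
      qed (use p_pos in auto)
    qed measurable
  qed
  have gr: "gradient (\<lambda>x. \<eta> x * \<phi> n x) = (\<lambda>x. \<eta> x *\<^sub>R gradient (\<phi> n) x + \<phi> n x *\<^sub>R gradient \<eta> x)" for n
    by (intro ext gradient_mult \<eta>(1) test_function_smooth[OF \<phi>(1)])
  note c = W0_limit_of_tests[of "\<lambda>n x. \<eta> x * \<phi> n x" "\<lambda>x. \<eta> x * u x" "\<lambda>x. \<eta> x *\<^sub>R wgrad u x + u x *\<^sub>R gradient \<eta> x", unfolded gr]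
  have A: "test_function \<Omega> (\<lambda>x. \<eta> x * \<phi> n x)" for n by (intro test_function_mult \<phi>(1) \<eta>(1))
  have B: "(\<lambda>x. \<eta> x * u x) \<in> lp_space p M" by (intro in0 W0D u)
  have C: "(\<lambda>x. \<eta> x *\<^sub>R wgrad u x + u x *\<^sub>R gradient \<eta> x) \<in> lp_space p M"
    using p_pos by (intro lp_space_add in1 in2 W0D u) auto
  have D: "(\<lambda>n. lp_mass p M (\<lambda>x. \<eta> x * \<phi> n x - \<eta> x * u x)) \<longlonglongrightarrow> 0" using 1 by (simp add: right_diff_distrib)
  have E: "(\<lambda>n. lp_mass p M (\<lambda>x. (\<eta> x *\<^sub>R gradient (\<phi> n) x + \<phi> n x *\<^sub>R gradient \<eta> x) - (\<eta> x *\<^sub>R wgrad u x + u x *\<^sub>R gradient \<eta> x))) \<longlonglongrightarrow> 0"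
  proof (rule tendsto_sandwich[OF _ _ tendsto_const])
    have "(\<lambda>n. 2 powr p * (lp_mass p M (\<lambda>x. \<eta> x *\<^sub>R (gradient (\<phi> n) x - wgrad u x)) + lp_mass p M (\<lambda>x. (\<phi> n x - u x) *\<^sub>R gradient \<eta> x)))
      \<longlonglongrightarrow> 2 powr p * (0 + 0)" by (intro tendsto_intros 2(2) 3(2))
    then show "(\<lambda>n. 2 powr p * (lp_mass p M (\<lambda>x. \<eta> x *\<^sub>R (gradient (\<phi> n) x - wgrad u x)) + lp_mass p M (\<lambda>x. (\<phi> n x - u x) *\<^sub>R gradient \<eta> x)))
      \<longlonglongrightarrow> 0" by simp
    show "\<forall>\<^sub>F n in sequentially. lp_mass p M (\<lambda>x. (\<eta> x *\<^sub>R gradient (\<phi> n) x + \<phi> n x *\<^sub>R gradient \<eta> x) - (\<eta> x *\<^sub>R wgrad u x + u x *\<^sub>R gradient \<eta> x))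
      \<le> 2 powr p * (lp_mass p M (\<lambda>x. \<eta> x *\<^sub>R (gradient (\<phi> n) x - wgrad u x)) + lp_mass p M (\<lambda>x. (\<phi> n x - u x) *\<^sub>R gradient \<eta> x))"
    proof (intro always_eventually allI)
      fix n
      have eq: "(\<lambda>x. (\<eta> x *\<^sub>R gradient (\<phi> n) x + \<phi> n x *\<^sub>R gradient \<eta> x) - (\<eta> x *\<^sub>R wgrad u x + u x *\<^sub>R gradient \<eta> x))
        = (\<lambda>x. \<eta> x *\<^sub>R (gradient (\<phi> n) x - wgrad u x) + (\<phi> n x - u x) *\<^sub>R gradient \<eta> x)"
        by (simp add: algebra_simps)
      show "lp_mass p M (\<lambda>x. (\<eta> x *\<^sub>R gradient (\<phi> n) x + \<phi> n x *\<^sub>R gradient \<eta> x) - (\<eta> x *\<^sub>R wgrad u x + u x *\<^sub>R gradient \<eta> x))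
        \<le> 2 powr p * (lp_mass p M (\<lambda>x. \<eta> x *\<^sub>R (gradient (\<phi> n) x - wgrad u x)) + lp_mass p M (\<lambda>x. (\<phi> n x - u x) *\<^sub>R gradient \<eta> x))"
        unfolding eq by (rule lp_space_add(2)[OF 2(1) 3(1)]) (use p_pos in simp)
    qed
  qed (simp add: lp_mass_nonneg)
  show "(\<lambda>x. \<eta> x * u x) \<in> W0" "AE x in M. wgrad (\<lambda>x. \<eta> x * u x) x = \<eta> x *\<^sub>R wgrad u x + u x *\<^sub>R gradient \<eta> x"
    using c[OF A B C D E] by auto
qed

section \<open>Midpoint hulls and lower semicontinuity\<close>

text \<open>
  A substitute for the convex hull. Closure under midpoints is what the uniform convexity inequality asks for, and
  bounds by convex functionals propagate by rule induction.
\<close>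

inductive_set midpoint_hull :: "('a \<Rightarrow> real) set \<Rightarrow> ('a \<Rightarrow> real) set" for S where
  base: "u \<in> S \<Longrightarrow> u \<in> midpoint_hull S"
| midpoint: "u \<in> midpoint_hull S \<Longrightarrow> v \<in> midpoint_hull S \<Longrightarrow> (\<lambda>x. (u x + v x) / 2) \<in> midpoint_hull S"

lemma midpoint_hull_mono: "S \<subseteq> T \<Longrightarrow> midpoint_hull S \<subseteq> midpoint_hull T"
proof
  fix u assume "u \<in> midpoint_hull S" and "S \<subseteq> T"
  then show "u \<in> midpoint_hull T" by induction (auto intro: midpoint_hull.intros)
qed

lemma W0_midpoint:
  assumes "u \<in> W0" "v \<in> W0"
  shows "(\<lambda>x. (u x + v x) / 2) \<in> W0"
    "AE x in M. wgrad (\<lambda>x. (u x + v x) / 2) x = (wgrad u x + wgrad v x) /\<^sub>R 2"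
proof -
  have z: "(\<lambda>x. u x - u x) \<in> W0" "AE x in M. wgrad (\<lambda>x. u x - u x) x = 0"
    using W0_lincomb[OF assms(1,1), of "-1"] by auto
  note h = W0_lincomb[OF z(1) assms(1), of "1/2"]
  note m = W0_lincomb[OF h(1) assms(2), of "1/2"]
  have eq: "(\<lambda>x. u x - u x + 1/2 * u x + 1/2 * v x) = (\<lambda>x. (u x + v x) / 2)" by (auto simp: field_simps)
  show "(\<lambda>x. (u x + v x) / 2) \<in> W0" using m(1) unfolding eq .
  show "AE x in M. wgrad (\<lambda>x. (u x + v x) / 2) x = (wgrad u x + wgrad v x) /\<^sub>R 2"
    using m(2)[unfolded eq] h(2) z(2) by eventually_elim (simp add: scaleR_add_right)
qed

lemma midpoint_hull_W0: "u \<in> midpoint_hull S \<Longrightarrow> S \<subseteq> W0 \<Longrightarrow> u \<in> W0"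
  by (induction rule: midpoint_hull.induct) (auto intro: W0_midpoint)

lemma midpoint_hull_dirichlet_on:
  assumes "u \<in> midpoint_hull S" "S \<subseteq> W0" "A \<in> sets M"
    and "\<And>v. v \<in> S \<Longrightarrow> lp_mass p M (\<lambda>x. indicator A x *\<^sub>R wgrad v x) \<le> c"
  shows "lp_mass p M (\<lambda>x. indicator A x *\<^sub>R wgrad u x) \<le> c"
  using assms(1)
proof induction
  case (midpoint u v)
  have W: "u \<in> W0" "v \<in> W0" using midpoint assms(2) midpoint_hull_W0 by blast+
  have in_lp: "(\<lambda>x. indicator A x *\<^sub>R wgrad w x) \<in> lp_space p M" if "w \<in> W0" for w
  proof -
    have [measurable]: "wgrad w \<in> borel_measurable M" using W0D(3)[OF that] by (rule lp_space_measurable)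
    show ?thesis by (rule lp_space_bounded[OF _ lp_space_integrable[OF W0D(3)[OF that]]])
        (use assms(3) p_pos in \<open>auto intro!: AE_I2 powr_mono2 simp: indicator_def\<close>)
  qed
  have "AE x in M. indicator A x *\<^sub>R wgrad (\<lambda>x. (u x + v x) / 2) x
      = (indicator A x *\<^sub>R wgrad u x + indicator A x *\<^sub>R wgrad v x) /\<^sub>R 2"
    using W0_midpoint(2)[OF W] by eventually_elim (simp add: indicator_def)
  then have "lp_mass p M (\<lambda>x. indicator A x *\<^sub>R wgrad (\<lambda>x. (u x + v x) / 2) x)
      = lp_mass p M (\<lambda>x. (indicator A x *\<^sub>R wgrad u x + indicator A x *\<^sub>R wgrad v x) /\<^sub>R 2)"
    by (rule lp_mass_AE_eq) (use p_pos in \<open>auto intro!: lp_space_scaleR lp_space_add in_lp W\<close>)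
  also have "\<dots> \<le> (lp_mass p M (\<lambda>x. indicator A x *\<^sub>R wgrad u x) + lp_mass p M (\<lambda>x. indicator A x *\<^sub>R wgrad v x)) / 2"
    by (intro lp_mass_midpoint_le in_lp W p_gt_1)
  also have "\<dots> \<le> c" using midpoint.IH by simp
  finally show ?case .
qed (use assms(4) in auto)

lemma midpoint_hull_close:
  assumes "w \<in> midpoint_hull S" "S \<subseteq> W0" "u \<in> lp_space p M"
    and "\<And>v. v \<in> S \<Longrightarrow> lp_mass p M (\<lambda>x. v x - u x) \<le> c"
  shows "lp_mass p M (\<lambda>x. w x - u x) \<le> c"
  using assms(1)
proof induction
  case (midpoint v w)
  have W: "v \<in> W0" "w \<in> W0" using midpoint assms(2) midpoint_hull_W0 by blast+
  have "(\<lambda>x. (v x + w x) / 2 - u x) = (\<lambda>x. ((v x - u x) + (w x - u x)) /\<^sub>R 2)" by (auto simp: field_simps)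
  then have "lp_mass p M (\<lambda>x. (v x + w x) / 2 - u x)
      \<le> (lp_mass p M (\<lambda>x. v x - u x) + lp_mass p M (\<lambda>x. w x - u x)) / 2"
    by (simp only:) (intro lp_mass_midpoint_le lp_space_diff W0D W assms(3) p_gt_1 p_pos)
  also have "\<dots> \<le> c" using midpoint.IH by simp
  finally show ?case .
qed (use assms(4) in auto)

text \<open>
  A form of Mazur's lemma. Let \<open>D\<^sub>n\<close> be the infimum of the Dirichlet integral over the hull of the \<open>n\<close>-th tail,
  and \<open>w\<^sub>n\<close> an almost minimal element of it. For \<open>n \<le> m\<close> the midpoint of \<open>w\<^sub>n\<close> and \<open>w\<^sub>m\<close> has energy at least \<open>D\<^sub>n\<close>, and
  \<open>D\<^sub>n\<close> converges; so uniform convexity makes the gradients a Cauchy sequence.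
\<close>

lemma strong_limit_of_midpoints:
  assumes u: "\<And>n::nat. v n \<in> W0" and bd: "\<And>n. dirichlet (v n) \<le> c"
    and l: "l \<in> lp_space p M" and lim: "(\<lambda>n. lp_mass p M (\<lambda>x. v n x - l x)) \<longlonglongrightarrow> 0"
  obtains w where "\<And>n. w n \<in> midpoint_hull (range v)" "\<And>n. w n \<in> W0" "l \<in> W0"
    "(\<lambda>n. lp_mass p M (\<lambda>x. wgrad (w n) x - wgrad l x)) \<longlonglongrightarrow> 0"
proof -
  define K where "K = (\<lambda>n. midpoint_hull (v ` {n..}))"
  have KW: "w \<in> W0" if "w \<in> K n" for w n
    using that midpoint_hull_W0[of w "v ` {n..}"] u by (auto simp: K_def)
  have Kmono: "K n \<subseteq> K m" if "m \<le> n" for m n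
    unfolding K_def using that by (intro midpoint_hull_mono image_mono) auto
  have vK: "v n \<in> K n" for n unfolding K_def by (rule midpoint_hull.base) auto
  define D where "D = (\<lambda>n. INF w\<in>K n. dirichlet w)"
  have bb: "bdd_below (dirichlet ` K n)" for n by (rule bdd_belowI2[of _ 0]) (simp add: lp_mass_nonneg)
  have Dle: "D n \<le> dirichlet w" if "w \<in> K n" for n w unfolding D_def by (rule cINF_lower[OF bb that])
  have Dmono: "D m \<le> D n" if "m \<le> n" for m n unfolding D_def
    using vK[of n] Kmono[OF that] by (intro cINF_superset_mono bb) auto
  have Dc: "D n \<le> c" for n using Dle[OF vK[of n]] bd[of n] by simp
  have "\<exists>w\<in>K n. dirichlet w < D n + inverse (real (Suc n))" for n
  proof -
    have "K n \<noteq> {}" using vK by blast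
    then show ?thesis unfolding D_def using cINF_less_iff[OF _ bb[of n], of "(INF w\<in>K n. dirichlet w) + inverse (real (Suc n))"] by simp
  qed
  then obtain w where w: "\<And>n. w n \<in> K n" "\<And>n. dirichlet (w n) < D n + inverse (real (Suc n))" by metis
  have wW: "w n \<in> W0" for n using KW w(1) by blast
  have D0: "0 \<le> D n" for n unfolding D_def using vK[of n] by (intro cINF_greatest) (auto simp: lp_mass_nonneg)
  have "incseq D" using Dmono by (simp add: incseq_def)
  then obtain Dl where Dl: "D \<longlonglongrightarrow> Dl" by (rule incseq_convergent) (use Dc in auto)
  have Dlim: "dirichlet (w n) \<le> c + 1" for n
    using w(2)[of n] Dc[of n] by (smt (verit) inverse_le_1_iff of_nat_Suc of_nat_0_le_iff)
  have mid: "D n \<le> lp_mass p M (\<lambda>x. (wgrad (w n) x + wgrad (w m) x) /\<^sub>R 2)" if "n \<le> m" for n m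
  proof -
    have "(\<lambda>x. (w n x + w m x) / 2) \<in> K n"
      using w(1)[of n] w(1)[of m] Kmono[OF that] unfolding K_def by (intro midpoint_hull.midpoint) auto
    then have "D n \<le> dirichlet (\<lambda>x. (w n x + w m x) / 2)" by (rule Dle)
    also have "\<dots> = lp_mass p M (\<lambda>x. (wgrad (w n) x + wgrad (w m) x) /\<^sub>R 2)"
      using p_pos by (intro lp_mass_AE_eq W0_midpoint wW lp_space_scaleR lp_space_add W0D) auto
    finally show ?thesis .
  qed
  have cauchy: "\<exists>N. \<forall>m\<ge>N. \<forall>n\<ge>N. lp_mass p M (\<lambda>x. wgrad (w m) x - wgrad (w n) x) < \<epsilon>" if e: "0 < \<epsilon>" for \<epsilon>
  proof -
    have c0: "0 \<le> c" using bd[of 0] lp_mass_nonneg[of p M "wgrad (v 0)"] by linarith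
    define e' where "e' = \<epsilon> / 4 / (c + 1)"
    have e': "0 < e'" using e c0 by (simp add: e'_def)
    obtain C where C: "0 \<le> C" "\<And>f g::'a \<Rightarrow> 'a. f \<in> lp_space p M \<Longrightarrow> g \<in> lp_space p M \<Longrightarrow>
       lp_mass p M (\<lambda>x. f x - g x) \<le> e' * (lp_mass p M f + lp_mass p M g)
        + C * ((lp_mass p M f + lp_mass p M g) / 2 - lp_mass p M (\<lambda>x. (f x + g x) /\<^sub>R 2))"
      by (rule lp_uniform_convexity[OF p_gt_1 e']) (rule that)
    define \<delta> where "\<delta> = \<epsilon> / 4 / (C + 1)"
    have d: "0 < \<delta>" "C * \<delta> < \<epsilon> / 2"
    proof -
      show d0: "0 < \<delta>" using e C(1) by (simp add: \<delta>_def)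
      have "(C + 1) * \<delta> = \<epsilon> / 4" using C(1) unfolding \<delta>_def by (intro nonzero_mult_div_cancel_left[of "C + 1" "\<epsilon> / 4", unfolded times_divide_eq_right[symmetric]]) auto
      then show "C * \<delta> < \<epsilon> / 2" using d0 e by (simp add: distrib_right)
    qed
    obtain N1 where N1: "\<And>n. n \<ge> N1 \<Longrightarrow> \<bar>D n - Dl\<bar> < \<delta> / 4" using LIMSEQ_D[OF Dl, of "\<delta>/4"] d by auto
    obtain N2 where N2: "inverse (real (Suc N2)) < \<delta> / 4" using reals_Archimedean[of "\<delta>/4"] d by auto
    define N where "N = max N1 N2"
    have gap: "(dirichlet (w m) + dirichlet (w n)) / 2 - lp_mass p M (\<lambda>x. (wgrad (w m) x + wgrad (w n) x) /\<^sub>R 2) \<le> \<delta>"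
      if "N \<le> m" "m \<le> n" for m n
    proof -
      have "inverse (real (Suc k)) < \<delta> / 4" if "N2 \<le> k" for k
        using that N2 by (smt (verit) inverse_le_iff_le of_nat_0_less_iff of_nat_mono zero_less_Suc Suc_le_mono)
      then have "dirichlet (w m) < D m + \<delta>/4" "dirichlet (w n) < D n + \<delta>/4"
        using w(2)[of m] w(2)[of n] that by (auto simp: N_def intro: less_trans add_strict_left_mono)
      moreover have "D n \<le> D m + \<delta> / 2"
      proof -
        have "\<bar>D m - Dl\<bar> < \<delta> / 4" "\<bar>D n - Dl\<bar> < \<delta> / 4" using N1 that by (auto simp: N_def)
        then show ?thesis by linarith
      qed
      moreover have "(a + b) / 2 - y \<le> \<delta>"
        if "a < D m + \<delta>/4" "b < D n + \<delta>/4" "D n \<le> D m + \<delta> / 2" "D m \<le> y" for a b y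
      proof -
        have "a + b \<le> 2 * y + 2 * \<delta>" using that d(1) by linarith
        then show ?thesis by (simp add: field_simps)
      qed
      ultimately show ?thesis using mid[OF that(2)] by blast
    qed
    have key: "lp_mass p M (\<lambda>x. wgrad (w m) x - wgrad (w n) x) < \<epsilon>" if "N \<le> m" "m \<le> n" for m n
    proof -
      have "lp_mass p M (\<lambda>x. wgrad (w m) x - wgrad (w n) x) \<le> e' * (dirichlet (w m) + dirichlet (w n))
        + C * ((dirichlet (w m) + dirichlet (w n)) / 2 - lp_mass p M (\<lambda>x. (wgrad (w m) x + wgrad (w n) x) /\<^sub>R 2))"
        by (intro C(2) W0D wW)
      also have "\<dots> \<le> e' * (2 * (c + 1)) + C * \<delta>"
        using gap[OF that] Dlim[of m] Dlim[of n] e' C(1) by (intro add_mono mult_left_mono) auto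
      also have "e' * (2 * (c + 1)) = \<epsilon> / 2"
      proof -
        have "c + 1 \<noteq> 0" using c0 by linarith
        then have "e' * (c + 1) = \<epsilon> / 4" unfolding e'_def by (rule nonzero_eq_divide_eq[THEN iffD1, OF _ refl])
        then show ?thesis by (simp only: mult.left_commute[of e'])
      qed
      finally show ?thesis using d by simp
    qed
    show ?thesis
    proof (intro exI allI impI)
      fix m n assume mn: "N \<le> m" "N \<le> n"
      show "lp_mass p M (\<lambda>x. wgrad (w m) x - wgrad (w n) x) < \<epsilon>"
        using key[of m n] key[of n m] mn lp_mass_minus_commute[of p M "wgrad (w m)" "wgrad (w n)"] by (cases "m \<le> n") auto
    qed
  qed
  obtain g where g: "g \<in> lp_space p M" "(\<lambda>n. lp_mass p M (\<lambda>x. wgrad (w n) x - g x)) \<longlonglongrightarrow> 0"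
    by (rule lp_complete[OF W0D(3)[OF wW] p_pos cauchy]) (assumption, rule that)
  have wl: "(\<lambda>n. lp_mass p M (\<lambda>x. w n x - l x)) \<longlonglongrightarrow> 0"
  proof (rule LIMSEQ_I)
    fix \<epsilon> :: real assume e: "0 < \<epsilon>"
    then obtain N where N: "\<And>n. n \<ge> N \<Longrightarrow> norm (lp_mass p M (\<lambda>x. v n x - l x) - 0) < \<epsilon> / 2"
      using LIMSEQ_D[OF lim, of "\<epsilon>/2"] by auto
    have half: "lp_mass p M (\<lambda>x. w n x - l x) \<le> \<epsilon> / 2" if "n \<ge> N" for n
    proof (rule midpoint_hull_close[OF w(1)[of n, unfolded K_def] _ l])
      fix v' assume "v' \<in> v ` {n..}"
      then obtain k where "k \<ge> n" "v' = v k" by auto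
      then show "lp_mass p M (\<lambda>x. v' x - l x) \<le> \<epsilon> / 2" using N[of k] that by simp
    qed (use u in auto)
    have "norm (lp_mass p M (\<lambda>x. w n x - l x) - 0) < \<epsilon>" if "n \<ge> N" for n
    proof -
      have "\<epsilon> / 2 < \<epsilon>" using e by simp
      with half[OF that] show ?thesis
        by (simp only: diff_zero real_norm_def abs_of_nonneg[OF lp_mass_nonneg])
    qed
    then show "\<exists>no. \<forall>n\<ge>no. norm (lp_mass p M (\<lambda>x. w n x - l x) - 0) < \<epsilon>" by blast
  qed
  note c = W0_closed[OF wW l g(1) wl g(2)]
  have "lp_mass p M (\<lambda>x. wgrad (w n) x - wgrad l x) = lp_mass p M (\<lambda>x. wgrad (w n) x - g x)" for n
  proof (rule lp_mass_AE_eq)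
    show "AE x in M. wgrad (w n) x - wgrad l x = wgrad (w n) x - g x" using c(2) by eventually_elim simp
  qed (intro lp_space_diff W0D wW g p_pos)
  then have "(\<lambda>n. lp_mass p M (\<lambda>x. wgrad (w n) x - wgrad l x)) \<longlonglongrightarrow> 0" using g(2) by simp
  moreover have "w n \<in> midpoint_hull (range v)" for n
    using w(1)[of n] midpoint_hull_mono[of "v ` {n..}" "range v"] by (auto simp: K_def)
  ultimately show ?thesis using that wW c(1) by blast
qed

lemma lp_indicator:
  fixes f :: "'a \<Rightarrow> 'b::euclidean_space"
  assumes "f \<in> lp_space r M" "A \<in> sets M" "0 \<le> r"
  shows "(\<lambda>x. indicator A x *\<^sub>R f x) \<in> lp_space r M" "lp_mass r M (\<lambda>x. indicator A x *\<^sub>R f x) \<le> lp_mass r M f"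
proof -
  have [measurable]: "f \<in> borel_measurable M" using assms(1) by (rule lp_space_measurable)
  have ae: "AE x in M. norm (indicator A x *\<^sub>R f x) powr r \<le> norm (f x) powr r"
    using assms(3) by (auto intro!: AE_I2 powr_mono2 simp: indicator_def)
  show "(\<lambda>x. indicator A x *\<^sub>R f x) \<in> lp_space r M" "lp_mass r M (\<lambda>x. indicator A x *\<^sub>R f x) \<le> lp_mass r M f"
    using lp_space_bounded[OF _ lp_space_integrable[OF assms(1)] ae] assms(2) by (auto simp: lp_mass_def)
qed

text \<open>
  The energy over a subset \<open>A\<close> is convex, hence a bound for the sequence holds on its midpoint hull, where
  gradients converge strongly.
\<close>

lemma dirichlet_on_lower_semicontinuous:
  assumes u: "\<And>n::nat. v n \<in> W0" and bd: "\<And>n. dirichlet (v n) \<le> c"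
    and l: "l \<in> lp_space p M" and lim: "(\<lambda>n. lp_mass p M (\<lambda>x. v n x - l x)) \<longlonglongrightarrow> 0"
  shows "l \<in> W0"
    "A \<in> sets M \<Longrightarrow> (\<And>n. lp_mass p M (\<lambda>x. indicator A x *\<^sub>R wgrad (v n) x) \<le> d) \<Longrightarrow>
       lp_mass p M (\<lambda>x. indicator A x *\<^sub>R wgrad l x) \<le> d"
proof -
  obtain w where w: "\<And>n. w n \<in> midpoint_hull (range v)" "\<And>n. w n \<in> W0" "l \<in> W0"
    "(\<lambda>n. lp_mass p M (\<lambda>x. wgrad (w n) x - wgrad l x)) \<longlonglongrightarrow> 0"
    by (rule strong_limit_of_midpoints[OF u bd l lim]) (rule that)
  show "l \<in> W0" by (rule w(3))
  assume A: "A \<in> sets M" and d: "\<And>n. lp_mass p M (\<lambda>x. indicator A x *\<^sub>R wgrad (v n) x) \<le> d"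
  have le: "lp_mass p M (\<lambda>x. indicator A x *\<^sub>R wgrad (w n) x) \<le> d" for n
    by (rule midpoint_hull_dirichlet_on[OF w(1) _ A]) (use u d in auto)
  note I = lp_indicator[OF _ A less_imp_le[OF p_pos]]
  have "(\<lambda>n. lp_mass p M (\<lambda>x. indicator A x *\<^sub>R wgrad (w n) x - indicator A x *\<^sub>R wgrad l x)) \<longlonglongrightarrow> 0"
  proof (rule tendsto_sandwich[OF _ _ tendsto_const w(4)])
    show "\<forall>\<^sub>F n in sequentially. lp_mass p M (\<lambda>x. indicator A x *\<^sub>R wgrad (w n) x - indicator A x *\<^sub>R wgrad l x)
        \<le> lp_mass p M (\<lambda>x. wgrad (w n) x - wgrad l x)"
      using I(2)[OF lp_space_diff(1)[OF W0D(3)[OF w(2)] W0D(3)[OF w(3)] p_pos]] by (simp add: scaleR_diff_right)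
  qed (simp add: lp_mass_nonneg)
  from lp_mass_tendsto[OF I(1)[OF W0D(3)[OF w(2)]] I(1)[OF W0D(3)[OF w(3)]] p_pos this]
  show "lp_mass p M (\<lambda>x. indicator A x *\<^sub>R wgrad l x) \<le> d"
    by (rule LIMSEQ_le_const2) (use le in auto)
qed

end

section \<open>Compact embedding by dyadic averages\<close>

lemma nn_integral_lborel_translate:
  fixes g :: "'a::euclidean_space \<Rightarrow> ennreal"
  assumes [measurable]: "g \<in> borel_measurable borel"
  shows "(\<integral>\<^sup>+x. g (x + c) \<partial>lborel) = (\<integral>\<^sup>+x. g x \<partial>lborel)"
proof -
  have "(\<integral>\<^sup>+x. g x \<partial>lborel) = (\<integral>\<^sup>+x. g x \<partial>distr lborel borel ((+) c))" by (simp add: lborel_distr_plus)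
  also have "\<dots> = (\<integral>\<^sup>+x. g (c + x) \<partial>lborel)" by (intro nn_integral_distr) auto
  finally show ?thesis by (simp add: add.commute)
qed

text \<open>
  Jensen's inequality for the power \<open>p\<close> on a set of finite measure.
\<close>

lemma set_jensen:
  fixes F :: "'a::euclidean_space \<Rightarrow> real"
  assumes A [measurable]: "A \<in> sets borel" and fin: "emeasure lborel A < \<infinity>"
    and F [measurable]: "F \<in> borel_measurable borel" and B: "\<And>x. x \<in> A \<Longrightarrow> \<bar>F x\<bar> \<le> B" and p: "1 < p"
  shows "ennreal (\<bar>LINT y|lborel. indicator A y * F y\<bar> powr p)
    \<le> ennreal (measure lborel A powr (p - 1)) * (\<integral>\<^sup>+y. ennreal (\<bar>F y\<bar> powr p) * indicator A y \<partial>lborel)"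
proof -
  define MA where "MA = restrict_space lborel A"
  have A': "A \<inter> space lborel \<in> sets lborel" using A by simp
  have sp: "space MA = A" by (simp add: MA_def space_restrict_space)
  have em: "emeasure MA (space MA) = emeasure lborel A"
    unfolding sp unfolding MA_def by (subst emeasure_restrict_space) (use A in auto)
  have fm: "finite_measure MA" by standard (use em fin in auto)
  interpret finite_measure MA by (rule fm)
  have ms: "measure MA (space MA) = measure lborel A" by (simp add: measure_def em)
  have Fm: "F \<in> borel_measurable MA" unfolding MA_def by (intro measurable_restrict_space1) simp
  have FA: "F \<in> lp_space p MA"
  proof (rule lp_space_bounded[OF Fm])
    show "integrable MA (\<lambda>x. B powr p)" by simp
    show "AE x in MA. norm (F x) powr p \<le> B powr p"
      using B p sp by (intro AE_I2 powr_mono2) auto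
  qed
  have "(LINT y|lborel. indicator A y * F y) = (LINT y|MA. F y)"
    unfolding MA_def using integral_restrict_space[OF A', of F] by simp
  then have "\<bar>LINT y|lborel. indicator A y * F y\<bar> powr p \<le> (LINT y|MA. norm (F y)) powr p"
    using p by (intro powr_mono2) (auto intro: integral_abs_bound)
  also have "\<dots> \<le> measure lborel A powr (p - 1) * lp_mass p MA F"
    using lp_finite_measure(2)[OF FA p fm] by (simp add: ms)
  finally have "ennreal (\<bar>LINT y|lborel. indicator A y * F y\<bar> powr p) \<le> ennreal (measure lborel A powr (p - 1)) * ennreal (lp_mass p MA F)"
    by (simp add: ennreal_mult'[symmetric] lp_mass_nonneg)
  also have "ennreal (lp_mass p MA F) = (\<integral>\<^sup>+y. ennreal (norm (F y) powr p) \<partial>MA)"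
    by (rule nn_integral_lp_mass[OF FA, symmetric])
  also have "\<dots> = (\<integral>\<^sup>+y. ennreal (\<bar>F y\<bar> powr p) * indicator A y \<partial>lborel)"
    unfolding MA_def by (subst nn_integral_restrict_space[OF A']) simp
  finally show ?thesis .
qed

lemma increment_powr_le:
  assumes sm: "smooth f" and p: "1 < p"
  shows "ennreal (\<bar>f (x + h) - f x\<bar> powr p)
    \<le> (\<integral>\<^sup>+t. ennreal (norm h powr p) * (ennreal (norm (gradient f (x + t *\<^sub>R h)) powr p) * indicator {0..1} t) \<partial>lborel)"
proof -
  define g where "g = (\<lambda>t::real. gradient f (x + t *\<^sub>R h) \<bullet> h)"
  have c1: "continuous_on UNIV (\<lambda>t::real. gradient f (x + t *\<^sub>R h))"
    by (intro continuous_on_compose2[OF smooth_gradient_continuous[OF sm, of UNIV]] continuous_intros) auto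
  have cg: "continuous_on UNIV g" unfolding g_def
    by (rule continuous_on_inner[OF c1 continuous_on_const])
  have gm [measurable]: "g \<in> borel_measurable borel" by (rule borel_measurable_continuous_onI[OF cg])
  have m1 [measurable]: "(\<lambda>t::real. gradient f (x + t *\<^sub>R h)) \<in> borel_measurable borel"
    by (rule borel_measurable_continuous_onI[OF c1])
  have der: "((\<lambda>t. f (x + t *\<^sub>R h)) has_real_derivative g t) (at t)" for t
  proof -
    have "((\<lambda>t. x + t *\<^sub>R h) has_derivative (\<lambda>s. s *\<^sub>R h)) (at t)"
      by (auto intro!: derivative_eq_intros)
    from has_derivative_compose[OF this smooth_has_gradient[OF sm]]
    show ?thesis by (simp add: has_field_derivative_def mult_commute_abs g_def)
  qed
  have "(LINT t|lborel. g t * indicator {0..1} t) = f (x + 1 *\<^sub>R h) - f (x + 0 *\<^sub>R h)"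
    by (rule integral_FTC_Icc_real[of 0 1 "\<lambda>t. f (x + t *\<^sub>R h)" g])
      (use der cg in \<open>auto simp: continuous_on_eq_continuous_at\<close>)
  then have eq: "f (x + h) - f x = (LINT t|lborel. indicator {0..1} t * g t)" by (simp add: mult.commute)
  have "bounded (g ` {0..1})"
    by (intro compact_imp_bounded compact_continuous_image continuous_on_subset[OF cg]) auto
  then obtain B where B: "\<And>t. t \<in> {0..1} \<Longrightarrow> \<bar>g t\<bar> \<le> B" unfolding bounded_iff by fastforce
  have "ennreal (\<bar>f (x + h) - f x\<bar> powr p) \<le> ennreal (measure lborel {0..1::real} powr (p - 1)) *
      (\<integral>\<^sup>+t. ennreal (\<bar>g t\<bar> powr p) * indicator {0..1} t \<partial>lborel)"
    unfolding eq by (rule set_jensen[OF _ _ gm B p]) auto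
  also have "\<dots> = (\<integral>\<^sup>+t. ennreal (\<bar>g t\<bar> powr p) * indicator {0..1} t \<partial>lborel)" by simp
  also have "\<dots> \<le> (\<integral>\<^sup>+t. ennreal (norm h powr p) * (ennreal (norm (gradient f (x + t *\<^sub>R h)) powr p) * indicator {0..1} t) \<partial>lborel)"
  proof (rule nn_integral_mono)
    fix t :: real
    have "\<bar>g t\<bar> powr p \<le> (norm (gradient f (x + t *\<^sub>R h)) * norm h) powr p"
      using Cauchy_Schwarz_ineq2 p by (intro powr_mono2) (auto simp: g_def)
    also have "\<dots> = norm h powr p * norm (gradient f (x + t *\<^sub>R h)) powr p" by (simp add: powr_mult mult.commute)
    finally have "ennreal (\<bar>g t\<bar> powr p) \<le> ennreal (norm h powr p) * ennreal (norm (gradient f (x + t *\<^sub>R h)) powr p)"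
      by (simp add: ennreal_mult'[symmetric])
    then show "ennreal (\<bar>g t\<bar> powr p) * indicator {0..1} t
        \<le> ennreal (norm h powr p) * (ennreal (norm (gradient f (x + t *\<^sub>R h)) powr p) * indicator {0..1} t)"
      by (simp add: mult.assoc[symmetric] mult_right_mono)
  qed
  finally show ?thesis .
qed

text \<open>
  The increment is the integral of the derivative along the segment; Fubini and translation invariance remove the
  dependence on the position in the segment.
\<close>

lemma translation_estimate:
  fixes f :: "'a::euclidean_space \<Rightarrow> real"
  assumes sm: "smooth f" and p: "1 < p"
  shows "(\<integral>\<^sup>+x. ennreal (\<bar>f (x + h) - f x\<bar> powr p) \<partial>lborel)
    \<le> ennreal (norm h powr p) * (\<integral>\<^sup>+x. ennreal (norm (gradient f x) powr p) \<partial>lborel)"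
proof -
  note [measurable] = smooth_borel_measurable[OF sm]
  let ?G = "\<lambda>x. ennreal (norm (gradient f x) powr p)"
  have "(\<integral>\<^sup>+x. ennreal (\<bar>f (x + h) - f x\<bar> powr p) \<partial>lborel)
    \<le> (\<integral>\<^sup>+x. (\<integral>\<^sup>+t. ennreal (norm h powr p) * (?G (x + t *\<^sub>R h) * indicator {0..1::real} t) \<partial>lborel) \<partial>lborel)"
    by (intro nn_integral_mono increment_powr_le sm p)
  also have "\<dots> = (\<integral>\<^sup>+t. (\<integral>\<^sup>+x. ennreal (norm h powr p) * (?G (x + t *\<^sub>R h) * indicator {0..1::real} t) \<partial>lborel) \<partial>lborel)"
    by (rule lborel_pair.Fubini'[symmetric]) measurable
  also have "\<dots> = (\<integral>\<^sup>+t. ennreal (norm h powr p) * (\<integral>\<^sup>+x. ?G x \<partial>lborel) * indicator {0..1::real} t \<partial>lborel)"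
  proof (rule nn_integral_cong)
    fix t :: real
    have "(\<integral>\<^sup>+x. ennreal (norm h powr p) * (?G (x + t *\<^sub>R h) * indicator {0..1::real} t) \<partial>lborel)
        = ennreal (norm h powr p) * ((\<integral>\<^sup>+x. ?G (x + t *\<^sub>R h) \<partial>lborel) * indicator {0..1::real} t)"
      by (simp add: nn_integral_cmult nn_integral_multc)
    also have "(\<integral>\<^sup>+x. ?G (x + t *\<^sub>R h) \<partial>lborel) = (\<integral>\<^sup>+x. ?G x \<partial>lborel)"
      by (rule nn_integral_lborel_translate) measurable
    finally show "(\<integral>\<^sup>+x. ennreal (norm h powr p) * (?G (x + t *\<^sub>R h) * indicator {0..1::real} t) \<partial>lborel)
      = ennreal (norm h powr p) * (\<integral>\<^sup>+x. ?G x \<partial>lborel) * indicator {0..1::real} t" by (simp add: mult.assoc)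
  qed
  also have "\<dots> = ennreal (norm h powr p) * (\<integral>\<^sup>+x. ?G x \<partial>lborel)"
    by (simp add: nn_integral_cmult_indicator)
  finally show ?thesis .
qed

text \<open>
  The half-open dyadic cube of side \<open>2\<^sup>-\<^sup>m\<close> that contains \<open>x\<close>.
\<close>

definition cell :: "nat \<Rightarrow> 'a::euclidean_space \<Rightarrow> 'a set" where
  "cell m x = {y. \<forall>b\<in>Basis. \<lfloor>2 ^ m * (x \<bullet> b)\<rfloor> = \<lfloor>2 ^ m * (y \<bullet> b)\<rfloor>}"

definition cell_avg :: "nat \<Rightarrow> ('a::euclidean_space \<Rightarrow> real) \<Rightarrow> 'a \<Rightarrow> real" where
  "cell_avg m f x = 2 ^ (m * DIM('a)) * (LINT y|lborel. indicator (cell m x) y * f y)"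

lemma cell_self: "x \<in> cell m x" by (simp add: cell_def)

lemma cell_sym: "y \<in> cell m x \<longleftrightarrow> x \<in> cell m y" by (auto simp: cell_def)

lemma cell_eq: "y \<in> cell m x \<Longrightarrow> cell m y = cell m x" by (auto simp: cell_def)

lemma cell_Suc: "cell (Suc m) x \<subseteq> cell m x"
proof -
  have "\<lfloor>2 ^ m * t\<rfloor> = \<lfloor>2 ^ Suc m * t\<rfloor> div 2" for t :: real
    using floor_divide_real_eq_div[of 2 "2 ^ Suc m * t"] by simp
  then show ?thesis unfolding cell_def by (simp only:) auto
qed

lemma cell_measurable_pred [measurable]:
  "Measurable.pred (borel \<Otimes>\<^sub>M borel) (\<lambda>z::'a::euclidean_space \<times> 'a. snd z \<in> cell m (fst z))"
  unfolding cell_def mem_Collect_eq by measurable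

lemma cell_borel [measurable]: "cell m x \<in> sets borel"
proof -
  have "Measurable.pred borel (\<lambda>y. y \<in> cell m x)" unfolding cell_def mem_Collect_eq by measurable
  then show ?thesis by (simp add: pred_def)
qed

lemma indicator_cell_measurable [measurable]:
  "(\<lambda>z::'a::euclidean_space \<times> 'a. indicator (cell m (fst z)) (snd z) :: 'b::{zero_neq_one, topological_space}) \<in> borel_measurable (borel \<Otimes>\<^sub>M borel)"
proof -
  have "(\<lambda>z::'a \<times> 'a. if snd z \<in> cell m (fst z) then (1::'b) else 0) \<in> borel_measurable (borel \<Otimes>\<^sub>M borel)"
    by measurable
  then show ?thesis by (simp add: indicator_def of_bool_def)
qed

lemma cell_box:
  obtains l u where "box l u \<subseteq> cell m x" "cell m x \<subseteq> cbox l u" "\<And>b. b \<in> Basis \<Longrightarrow> (u - l) \<bullet> b = 1 / 2 ^ m"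
proof -
  define l where "l = (\<Sum>b\<in>Basis. (\<lfloor>2 ^ m * (x \<bullet> b)\<rfloor> / 2 ^ m) *\<^sub>R b)"
  define u where "u = (\<Sum>b\<in>Basis. ((\<lfloor>2 ^ m * (x \<bullet> b)\<rfloor> + 1) / 2 ^ m) *\<^sub>R b)"
  have lu: "l \<bullet> b = \<lfloor>2 ^ m * (x \<bullet> b)\<rfloor> / 2 ^ m" "u \<bullet> b = (\<lfloor>2 ^ m * (x \<bullet> b)\<rfloor> + 1) / 2 ^ m" if "b \<in> Basis" for b
    using that by (simp_all add: l_def u_def inner_sum_left inner_Basis if_distrib cong: if_cong)
  have c: "\<lfloor>2 ^ m * a\<rfloor> = k \<longleftrightarrow> k / 2 ^ m \<le> a \<and> a < (k + 1) / 2 ^ m" for a :: real and k :: int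
    by (simp add: floor_eq_iff field_simps)
  show ?thesis
  proof (rule that[of l u])
    show "box l u \<subseteq> cell m x"
    proof
      fix y assume y: "y \<in> box l u"
      have "\<lfloor>2 ^ m * (y \<bullet> b)\<rfloor> = \<lfloor>2 ^ m * (x \<bullet> b)\<rfloor>" if "b \<in> Basis" for b
        unfolding c using y that by (auto simp: mem_box lu less_imp_le)
      then show "y \<in> cell m x" by (simp add: cell_def)
    qed
    show "cell m x \<subseteq> cbox l u"
    proof
      fix y assume "y \<in> cell m x"
      then have "\<lfloor>2 ^ m * (y \<bullet> b)\<rfloor> = \<lfloor>2 ^ m * (x \<bullet> b)\<rfloor>" if "b \<in> Basis" for b using that by (auto simp: cell_def)
      then show "y \<in> cbox l u" unfolding c by (auto simp: mem_box lu less_imp_le)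
    qed
    show "b \<in> Basis \<Longrightarrow> (u - l) \<bullet> b = 1 / 2 ^ m" for b
      by (simp add: inner_diff_left lu diff_divide_distrib[symmetric])
  qed
qed

lemma emeasure_cell: "emeasure lborel (cell m (x::'a::euclidean_space)) = ennreal (1 / 2 ^ (m * DIM('a)))"
proof -
  obtain l u where lu: "box l u \<subseteq> cell m x" "cell m x \<subseteq> cbox l u" "\<And>b. b \<in> Basis \<Longrightarrow> (u - l) \<bullet> b = 1 / 2 ^ m"
    by (rule cell_box) (rule that)
  have le: "l \<bullet> b \<le> u \<bullet> b" if "b \<in> Basis" for b
  proof -
    have "0 \<le> (u - l) \<bullet> b" using lu(3)[OF that] by simp
    then show ?thesis by (simp add: inner_diff_left)
  qed
  have "(\<Prod>b\<in>(Basis::'a set). (u - l) \<bullet> b) = 1 / 2 ^ (m * DIM('a))"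
    using lu(3) by (simp add: power_one_over power_mult)
  then have "emeasure lborel (box l u) = ennreal (1 / 2 ^ (m * DIM('a)))" "emeasure lborel (cbox l u) = ennreal (1 / 2 ^ (m * DIM('a)))"
    using le by (simp_all only: emeasure_lborel_box emeasure_lborel_cbox)
  then show ?thesis
    using emeasure_mono[OF lu(1), of lborel] emeasure_mono[OF lu(2), of lborel] by (auto intro: antisym)
qed

lemma measure_cell: "measure lborel (cell m (x::'a::euclidean_space)) = 1 / 2 ^ (m * DIM('a))"
  by (simp add: measure_def emeasure_cell)

text \<open>
  Every cell meets a dense set, so countably many points determine all averages.
\<close>

lemma cell_open_subset: "\<exists>S. open S \<and> S \<noteq> {} \<and> S \<subseteq> cell m x"
proof -
  obtain l u where lu: "box l u \<subseteq> cell m x" "\<And>b. b \<in> Basis \<Longrightarrow> (u - l) \<bullet> b = 1 / 2 ^ m"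
    by (rule cell_box) (rule that)
  have "l \<bullet> b < u \<bullet> b" if "b \<in> Basis" for b
  proof -
    have "0 < (u - l) \<bullet> b" using lu(2)[OF that] by simp
    then show ?thesis by (simp add: inner_diff_left)
  qed
  then have "box l u \<noteq> {}" by (simp add: box_ne_empty)
  then show ?thesis using lu(1) open_box by blast
qed

lemma cell_diff:
  assumes "y \<in> cell m x"
  shows "y - x \<in> cbox (- (1 / 2 ^ m) *\<^sub>R One) ((1 / 2 ^ m) *\<^sub>R One)"
proof -
  obtain l u where lu: "cell m x \<subseteq> cbox l u" "\<And>b. b \<in> Basis \<Longrightarrow> (u - l) \<bullet> b = 1 / 2 ^ m"
    by (rule cell_box) (rule that)
  have "x \<in> cbox l u" "y \<in> cbox l u" using lu(1) assms cell_self by auto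
  then have "\<bar>(y - x) \<bullet> b\<bar> \<le> 1 / 2 ^ m" if "b \<in> Basis" for b
    using lu(2)[OF that] that by (auto simp: mem_box inner_diff_left abs_le_iff dest!: bspec[OF _ that])
  then show ?thesis by (force simp: mem_box abs_le_iff)
qed

lemma norm_cbox_One_le:
  fixes h :: "'a::euclidean_space"
  assumes "h \<in> cbox (- c *\<^sub>R One) (c *\<^sub>R One)" shows "norm h \<le> real DIM('a) * c"
proof -
  have "norm h \<le> (\<Sum>b\<in>Basis. \<bar>h \<bullet> b\<bar>)" by (rule norm_le_l1)
  also have "\<dots> \<le> (\<Sum>b\<in>(Basis::'a set). c)" using assms by (intro sum_mono) (auto simp: mem_box abs_le_iff)
  finally show ?thesis by simp
qed

lemma integrable_indicator_cell:
  fixes F :: "'a::euclidean_space \<Rightarrow> real"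
  assumes [measurable]: "F \<in> borel_measurable borel" and B: "\<And>y. y \<in> cell m x \<Longrightarrow> \<bar>F y\<bar> \<le> B"
  shows "integrable lborel (\<lambda>y. indicator (cell m x) y * F y)"
proof (rule Bochner_Integration.integrable_bound[where f = "\<lambda>y. indicator (cell m x) y * B"])
  show "integrable lborel (\<lambda>y. indicator (cell m x) y * B)"
    by (intro integrable_mult_left integrable_real_indicator) (auto simp: emeasure_cell)
  show "AE y in lborel. norm (indicator (cell m x) y * F y) \<le> norm (indicator (cell m x) y * B)"
  proof (rule AE_I2)
    fix y
    show "norm (indicator (cell m x) y * F y) \<le> norm (indicator (cell m x) y * B)"
      using B[of y] abs_ge_self[of B] by (cases "y \<in> cell m x") auto
  qed
qed measurable

lemma cell_avg_bounded:
  fixes F :: "'a::euclidean_space \<Rightarrow> real"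
  assumes F: "F \<in> borel_measurable borel" and B: "\<And>y. y \<in> cell m x \<Longrightarrow> \<bar>F y\<bar> \<le> B"
  shows "\<bar>cell_avg m F x\<bar> \<le> B"
proof -
  have B0: "0 \<le> B" using B[OF cell_self] by linarith
  have "\<bar>LINT y|lborel. indicator (cell m x) y * F y\<bar> \<le> (LINT y|lborel. indicator (cell m x) y * B)"
  proof (rule order_trans[OF integral_abs_bound integral_mono])
    show "integrable lborel (\<lambda>y. \<bar>indicator (cell m x) y * F y\<bar>)"
      by (intro integrable_abs integrable_indicator_cell[OF F B])
    show "integrable lborel (\<lambda>y. indicator (cell m x) y * B)"
      by (rule integrable_indicator_cell[where B = "\<bar>B\<bar>"]) auto
    show "\<bar>indicator (cell m x) y * F y\<bar> \<le> indicator (cell m x) y * B" for y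
      using B[of y] by (cases "y \<in> cell m x") auto
  qed
  also have "\<dots> = 1 / 2 ^ (m * DIM('a)) * B" by (simp add: measure_cell)
  finally show ?thesis by (simp add: cell_avg_def abs_mult field_simps)
qed

lemma cell_avg_measurable [measurable]:
  assumes [measurable]: "F \<in> borel_measurable borel"
  shows "cell_avg m F \<in> borel_measurable borel"
proof -
  have "(\<lambda>x. LINT y|lborel. indicator (cell m x) y * F y) \<in> borel_measurable borel"
    by (rule lborel.borel_measurable_lebesgue_integral) (simp add: split_beta', measurable)
  then show ?thesis unfolding cell_avg_def[abs_def] by measurable
qed

lemma cell_avg_diff:
  assumes "F \<in> borel_measurable borel" "\<And>x. \<bar>F x\<bar> \<le> B" "G \<in> borel_measurable borel" "\<And>x. \<bar>G x\<bar> \<le> B'"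
  shows "cell_avg m (\<lambda>y. F y - G y) x = cell_avg m F x - cell_avg m G x"
  using integrable_indicator_cell[OF assms(1,2), of m x] integrable_indicator_cell[OF assms(3,4), of m x]
  by (simp add: cell_avg_def right_diff_distrib)

lemma cell_avg_const: 
  assumes "\<And>y. y \<in> cell m x \<Longrightarrow> F y = c" shows "cell_avg m F x = c"
proof -
  have "(LINT y|lborel. indicator (cell m x) y * F y) = (LINT y|lborel. indicator (cell m x) y * c)"
    using assms by (intro Bochner_Integration.integral_cong) (auto simp: indicator_def)
  also have "\<dots> = 1 / 2 ^ (m * DIM('a)) * c" by (simp add: measure_cell)
  finally show ?thesis by (simp add: cell_avg_def)
qed

lemma cell_avg_cell: "y \<in> cell m x \<Longrightarrow> cell_avg m F y = cell_avg m F x"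
  by (simp add: cell_avg_def cell_eq)

lemma cell_avg_jensen:
  fixes F :: "'a::euclidean_space \<Rightarrow> real"
  assumes F [measurable]: "F \<in> borel_measurable borel" and B: "\<And>x. \<bar>F x\<bar> \<le> B" and p: "1 < p"
  shows "ennreal (\<bar>cell_avg m F x\<bar> powr p) \<le> ennreal (2 ^ (m * DIM('a))) * (\<integral>\<^sup>+y. ennreal (\<bar>F y\<bar> powr p) * indicator (cell m x) y \<partial>lborel)"
proof -
  define v where "v = (2::real) ^ (m * DIM('a))"
  have v: "0 < v" by (simp add: v_def)
  have "\<bar>cell_avg m F x\<bar> powr p = v powr p * \<bar>LINT y|lborel. indicator (cell m x) y * F y\<bar> powr p"
    using v by (simp add: cell_avg_def v_def[symmetric] abs_mult powr_mult)
  then have "ennreal (\<bar>cell_avg m F x\<bar> powr p) = ennreal (v powr p) * ennreal (\<bar>LINT y|lborel. indicator (cell m x) y * F y\<bar> powr p)"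
    by (simp add: ennreal_mult')
  also have "\<dots> \<le> ennreal (v powr p) * (ennreal ((1 / v) powr (p - 1)) * (\<integral>\<^sup>+y. ennreal (\<bar>F y\<bar> powr p) * indicator (cell m x) y \<partial>lborel))"
    using set_jensen[OF cell_borel _ F _ p, of m x B] B by (intro mult_left_mono) (auto simp: emeasure_cell measure_cell v_def)
  also have "\<dots> = ennreal (v powr p * (1 / v) powr (p - 1)) * (\<integral>\<^sup>+y. ennreal (\<bar>F y\<bar> powr p) * indicator (cell m x) y \<partial>lborel)"
    by (simp add: ennreal_mult' mult.assoc)
  also have "v powr p * (1 / v) powr (p - 1) = v"
    using v by (simp add: powr_divide powr_diff)
  finally show ?thesis by (simp add: v_def)
qed

text \<open>
  The error at \<open>x\<close> is an average of increments \<open>f(x + h) - f(x)\<close> over \<open>h\<close> in a cube of side \<open>2 \<cdot> 2\<^sup>-\<^sup>m\<close>, to which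
  the translation estimate applies.
\<close>

lemma cell_avg_error_p:
  fixes f :: "'a::euclidean_space \<Rightarrow> real"
  assumes sm: "smooth f" and B: "\<And>x. \<bar>f x\<bar> \<le> B" and p: "1 < p"
  shows "(\<integral>\<^sup>+x. ennreal (\<bar>f x - cell_avg m f x\<bar> powr p) \<partial>lborel)
    \<le> ennreal (2 ^ DIM('a) * (real DIM('a) * (1 / 2 ^ m)) powr p) * (\<integral>\<^sup>+x. ennreal (norm (gradient f x) powr p) \<partial>lborel)"
proof -
  note [measurable] = smooth_borel_measurable[OF sm]
  let ?D = "\<integral>\<^sup>+x. ennreal (norm (gradient f x) powr p) \<partial>lborel"
  let ?v = "ennreal (2 ^ (m * DIM('a)))"
  define Q where "Q = cbox (- (1 / 2 ^ m) *\<^sub>R One) ((1 / 2 ^ m) *\<^sub>R One :: 'a)"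
  have Qm [measurable]: "Q \<in> sets borel" by (simp add: Q_def)
  have Qe: "emeasure lborel Q = ennreal ((2 / 2 ^ m) ^ DIM('a))"
  proof -
    have "emeasure lborel Q = ennreal (\<Prod>b\<in>(Basis::'a set). ((1 / 2 ^ m) *\<^sub>R One - (- (1 / 2 ^ m) *\<^sub>R One)) \<bullet> b)"
      unfolding Q_def by (rule emeasure_lborel_cbox) (simp add: inner_minus_left)
    also have "(\<Prod>b\<in>(Basis::'a set). ((1 / 2 ^ m) *\<^sub>R One - (- (1 / 2 ^ m) *\<^sub>R One)) \<bullet> b) = (\<Prod>b\<in>(Basis::'a set). 2 / 2 ^ m)"
      by (intro prod.cong) (auto simp: inner_diff_left inner_add_left inner_minus_left)
    finally show ?thesis by simp
  qed
  have "(\<integral>\<^sup>+x. ennreal (\<bar>f x - cell_avg m f x\<bar> powr p) \<partial>lborel)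
    \<le> (\<integral>\<^sup>+x. ?v * (\<integral>\<^sup>+h. ennreal (\<bar>f (x + h) - f x\<bar> powr p) * indicator Q h \<partial>lborel) \<partial>lborel)"
  proof (rule nn_integral_mono)
    fix x
    have "f x - cell_avg m f x = cell_avg m (\<lambda>y. f x - f y) x"
      using cell_avg_diff[of "\<lambda>y. f x" "\<bar>f x\<bar>" f B m x] B cell_avg_const[of m x "\<lambda>y. f x" "f x"] by simp
    also have "ennreal (\<bar>\<dots>\<bar> powr p) \<le> ?v * (\<integral>\<^sup>+y. ennreal (\<bar>f x - f y\<bar> powr p) * indicator (cell m x) y \<partial>lborel)"
    proof (rule cell_avg_jensen[OF _ _ p])
      show "\<bar>f x - f y\<bar> \<le> \<bar>f x\<bar> + B" for y using B[of y] by linarith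
    qed measurable
    also have "(\<integral>\<^sup>+y. ennreal (\<bar>f x - f y\<bar> powr p) * indicator (cell m x) y \<partial>lborel)
        = (\<integral>\<^sup>+h. ennreal (\<bar>f x - f (h + x)\<bar> powr p) * indicator (cell m x) (h + x) \<partial>lborel)"
      by (rule nn_integral_lborel_translate[symmetric]) measurable
    also have "\<dots> \<le> (\<integral>\<^sup>+h. ennreal (\<bar>f (x + h) - f x\<bar> powr p) * indicator Q h \<partial>lborel)"
    proof (rule nn_integral_mono)
      fix h
      show "ennreal (\<bar>f x - f (h + x)\<bar> powr p) * indicator (cell m x) (h + x) \<le> ennreal (\<bar>f (x + h) - f x\<bar> powr p) * indicator Q h"
        using cell_diff[of "h + x" m x] by (auto simp: indicator_def Q_def add.commute abs_minus_commute)
    qed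
    finally show "ennreal (\<bar>f x - cell_avg m f x\<bar> powr p)
        \<le> ?v * (\<integral>\<^sup>+h. ennreal (\<bar>f (x + h) - f x\<bar> powr p) * indicator Q h \<partial>lborel)"
      by (simp add: mult_left_mono)
  qed
  also have "\<dots> = ?v * (\<integral>\<^sup>+x. (\<integral>\<^sup>+h. ennreal (\<bar>f (x + h) - f x\<bar> powr p) * indicator Q h \<partial>lborel) \<partial>lborel)"
    by (rule nn_integral_cmult) measurable
  also have "(\<integral>\<^sup>+x. (\<integral>\<^sup>+h. ennreal (\<bar>f (x + h) - f x\<bar> powr p) * indicator Q h \<partial>lborel) \<partial>lborel)
     = (\<integral>\<^sup>+h. (\<integral>\<^sup>+x. ennreal (\<bar>f (x + h) - f x\<bar> powr p) * indicator Q h \<partial>lborel) \<partial>lborel)"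
    by (rule lborel_pair.Fubini'[symmetric]) measurable
  also have "\<dots> \<le> (\<integral>\<^sup>+h. (ennreal ((real DIM('a) * (1 / 2 ^ m)) powr p) * ?D) * indicator Q h \<partial>lborel)"
  proof (rule nn_integral_mono)
    fix h :: 'a
    have "(\<integral>\<^sup>+x. ennreal (\<bar>f (x + h) - f x\<bar> powr p) * indicator Q h \<partial>lborel)
        = (\<integral>\<^sup>+x. ennreal (\<bar>f (x + h) - f x\<bar> powr p) \<partial>lborel) * indicator Q h"
      by (rule nn_integral_multc) measurable
    also have "\<dots> \<le> (ennreal (norm h powr p) * ?D) * indicator Q h"
      by (intro mult_right_mono translation_estimate sm p) auto
    also have "\<dots> \<le> (ennreal ((real DIM('a) * (1 / 2 ^ m)) powr p) * ?D) * indicator Q h"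
    proof (cases "h \<in> Q")
      case True
      then have "norm h \<le> real DIM('a) * (1 / 2 ^ m)" unfolding Q_def by (rule norm_cbox_One_le)
      then show ?thesis using p by (intro mult_right_mono ennreal_leI powr_mono2) auto
    qed simp
    finally show "(\<integral>\<^sup>+x. ennreal (\<bar>f (x + h) - f x\<bar> powr p) * indicator Q h \<partial>lborel)
      \<le> (ennreal ((real DIM('a) * (1 / 2 ^ m)) powr p) * ?D) * indicator Q h" .
  qed
  also have "\<dots> = (ennreal ((real DIM('a) * (1 / 2 ^ m)) powr p) * ?D) * ennreal ((2 / 2 ^ m) ^ DIM('a))"
    by (simp add: nn_integral_cmult_indicator Qe)
  also have "?v * \<dots> = (?v * ennreal ((2 / 2 ^ m) ^ DIM('a)) * ennreal ((real DIM('a) * (1 / 2 ^ m)) powr p)) * ?D"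
    by (simp only: mult_ac)
  also have "?v * ennreal ((2 / 2 ^ m) ^ DIM('a)) * ennreal ((real DIM('a) * (1 / 2 ^ m)) powr p)
      = ennreal (2 ^ DIM('a) * (real DIM('a) * (1 / 2 ^ m)) powr p)"
  proof -
    have "(2::real) ^ (m * DIM('a)) * (2 / 2 ^ m) ^ DIM('a) = 2 ^ DIM('a)"
      by (simp add: power_divide power_mult)
    then show ?thesis by (simp add: ennreal_mult'[symmetric] del: power_divide)
  qed
  finally show ?thesis by (simp add: mult_left_mono)
qed

lemma cell_avg_contracts:
  fixes F :: "'a::euclidean_space \<Rightarrow> real"
  assumes F [measurable]: "F \<in> borel_measurable borel" and B: "\<And>x. \<bar>F x\<bar> \<le> B" and p: "1 < p"
  shows "(\<integral>\<^sup>+x. ennreal (\<bar>cell_avg m F x\<bar> powr p) \<partial>lborel) \<le> (\<integral>\<^sup>+x. ennreal (\<bar>F x\<bar> powr p) \<partial>lborel)"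
proof -
  let ?v = "ennreal (2 ^ (m * DIM('a)))"
  have "(\<integral>\<^sup>+x. ennreal (\<bar>cell_avg m F x\<bar> powr p) \<partial>lborel)
      \<le> (\<integral>\<^sup>+x. ?v * (\<integral>\<^sup>+y. ennreal (\<bar>F y\<bar> powr p) * indicator (cell m x) y \<partial>lborel) \<partial>lborel)"
    by (intro nn_integral_mono cell_avg_jensen[OF F B p])
  also have "\<dots> = ?v * (\<integral>\<^sup>+x. (\<integral>\<^sup>+y. ennreal (\<bar>F y\<bar> powr p) * indicator (cell m x) y \<partial>lborel) \<partial>lborel)"
    by (rule nn_integral_cmult) (rule lborel.borel_measurable_nn_integral, simp add: split_beta', measurable)
  also have "(\<integral>\<^sup>+x. (\<integral>\<^sup>+y. ennreal (\<bar>F y\<bar> powr p) * indicator (cell m x) y \<partial>lborel) \<partial>lborel)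
    = (\<integral>\<^sup>+y. (\<integral>\<^sup>+x. ennreal (\<bar>F y\<bar> powr p) * indicator (cell m x) y \<partial>lborel) \<partial>lborel)"
    by (rule lborel_pair.Fubini'[symmetric]) (simp add: split_beta', measurable)
  also have "\<dots> = (\<integral>\<^sup>+y. ennreal (\<bar>F y\<bar> powr p) * ennreal (1 / 2 ^ (m * DIM('a))) \<partial>lborel)"
  proof (rule nn_integral_cong)
    fix y :: 'a
    have "(\<integral>\<^sup>+x. ennreal (\<bar>F y\<bar> powr p) * indicator (cell m x) y \<partial>lborel)
        = (\<integral>\<^sup>+x. ennreal (\<bar>F y\<bar> powr p) * indicator (cell m y) x \<partial>lborel)"
      by (intro nn_integral_cong) (simp add: indicator_def cell_sym[of y])
    then show "(\<integral>\<^sup>+x. ennreal (\<bar>F y\<bar> powr p) * indicator (cell m x) y \<partial>lborel)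
        = ennreal (\<bar>F y\<bar> powr p) * ennreal (1 / 2 ^ (m * DIM('a)))"
      by (simp add: nn_integral_cmult_indicator emeasure_cell)
  qed
  also have "\<dots> = (\<integral>\<^sup>+y. ennreal (\<bar>F y\<bar> powr p) \<partial>lborel) * ennreal (1 / 2 ^ (m * DIM('a)))"
    by (rule nn_integral_multc) measurable
  also have "?v * \<dots> = (?v * ennreal (1 / 2 ^ (m * DIM('a)))) * (\<integral>\<^sup>+y. ennreal (\<bar>F y\<bar> powr p) \<partial>lborel)"
    by (simp only: mult_ac)
  also have "?v * ennreal (1 / 2 ^ (m * DIM('a))) = 1" by (simp add: ennreal_mult'[symmetric])
  finally show ?thesis by simp
qed

lemma cell_avg_sup:
  fixes F :: "'a::euclidean_space \<Rightarrow> real"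
  assumes F [measurable]: "F \<in> borel_measurable borel" and B: "\<And>x. \<bar>F x\<bar> \<le> B" and p: "1 < p"
    and L: "F \<in> lp_space p lborel"
  shows "\<bar>cell_avg m F x\<bar> powr p \<le> 2 ^ (m * DIM('a)) * lp_mass p lborel F"
proof -
  have "ennreal (\<bar>cell_avg m F x\<bar> powr p) \<le> ennreal (2 ^ (m * DIM('a))) * (\<integral>\<^sup>+y. ennreal (\<bar>F y\<bar> powr p) * indicator (cell m x) y \<partial>lborel)"
    by (rule cell_avg_jensen[OF F B p])
  also have "\<dots> \<le> ennreal (2 ^ (m * DIM('a))) * (\<integral>\<^sup>+y. ennreal (norm (F y) powr p) \<partial>lborel)"
    by (intro mult_left_mono nn_integral_mono) (auto simp: indicator_def)
  also have "\<dots> = ennreal (2 ^ (m * DIM('a)) * lp_mass p lborel F)"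
    by (subst nn_integral_lp_mass[OF L]) (simp add: ennreal_mult')
  finally show ?thesis by (simp add: lp_mass_nonneg)
qed

lemma bounded_support_lp:
  fixes F :: "'a::euclidean_space \<Rightarrow> real"
  assumes [measurable]: "F \<in> borel_measurable borel" and B: "\<And>x. \<bar>F x\<bar> \<le> B"
    and R: "\<And>x. R < norm x \<Longrightarrow> F x = 0" and r: "0 < r"
  shows "F \<in> lp_space r lborel"
proof (rule lp_space_bounded[where h = "\<lambda>x. indicator (cball 0 R) x *\<^sub>R (B powr r)"])
  show "integrable lborel (\<lambda>x::'a. indicator (cball 0 R) x *\<^sub>R (B powr r))"
    by (intro borel_integrable_compact) auto
  show "AE x in lborel. norm (F x) powr r \<le> indicator (cball 0 R) x *\<^sub>R (B powr r)"
  proof (rule AE_I2)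
    fix x
    show "norm (F x) powr r \<le> indicator (cball 0 R) x *\<^sub>R (B powr r)"
      using R[of x] B[of x] r by (cases "norm x \<le> R") (auto intro: powr_mono2)
  qed
qed measurable

lemma cell_norm_diff: "y \<in> cell m x \<Longrightarrow> norm (y - x) \<le> real DIM('a) / 2 ^ m"
  for x y :: "'a::euclidean_space"
  using norm_cbox_One_le[OF cell_diff, of y m x] by simp

lemma cell_avg_support:
  fixes F :: "'a::euclidean_space \<Rightarrow> real"
  assumes R: "\<And>x. R < norm x \<Longrightarrow> F x = 0" and x: "R + real DIM('a) < norm x"
  shows "cell_avg m F x = 0"
proof (rule cell_avg_const)
  fix y assume "y \<in> cell m x"
  then have "norm (y - x) \<le> real DIM('a) / 2 ^ m" by (rule cell_norm_diff)
  also have "\<dots> \<le> real DIM('a) / 1" by (intro divide_left_mono) auto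
  finally have "norm (x - y) \<le> real DIM('a)" by (simp add: norm_minus_commute)
  then have "R < norm y" using x norm_triangle_sub[of x y] by linarith
  then show "F y = 0" by (rule R)
qed

text \<open>
  An average over the larger cells is constant on the smaller ones.
\<close>

lemma cell_avg_refine:
  fixes F :: "'a::euclidean_space \<Rightarrow> real"
  assumes F [measurable]: "F \<in> borel_measurable borel" and B: "\<And>x. \<bar>F x\<bar> \<le> B"
  shows "cell_avg (Suc m) F x - cell_avg m F x = cell_avg (Suc m) (\<lambda>y. F y - cell_avg m F y) x"
proof -
  have "cell_avg (Suc m) (cell_avg m F) x = cell_avg m F x"
    by (rule cell_avg_const) (use cell_Suc cell_avg_cell in blast)
  moreover have "\<bar>cell_avg m F y\<bar> \<le> B" for y by (rule cell_avg_bounded[OF F B])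
  ultimately show ?thesis
    using cell_avg_diff[OF F B cell_avg_measurable[OF F], of m B "Suc m" x] by simp
qed

text \<open>
  An average is bounded pointwise by the \<open>L\<^sup>p\<close> norm times a power of the number of cells per unit volume; the
  surplus power \<open>r - p\<close> is estimated by this bound.
\<close>

lemma cell_avg_higher_power:
  fixes F :: "'a::euclidean_space \<Rightarrow> real"
  assumes F [measurable]: "F \<in> borel_measurable borel" and B: "\<And>x. \<bar>F x\<bar> \<le> B"
    and R: "\<And>x. R < norm x \<Longrightarrow> F x = 0" and p: "1 < p" "p \<le> r"
  shows "lp_mass r lborel (cell_avg m F) \<le> (2 ^ (m * DIM('a)) * lp_mass p lborel F) powr ((r - p) / p) * lp_mass p lborel F"
proof -
  let ?A = "cell_avg m F"
  let ?K = "2 ^ (m * DIM('a)) * lp_mass p lborel F"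
  have L: "F \<in> lp_space p lborel" using p by (intro bounded_support_lp[OF F B R]) auto
  have Ab: "\<bar>?A x\<bar> \<le> B" for x by (rule cell_avg_bounded[OF F B])
  have A: "?A \<in> lp_space s lborel" if "0 < s" for s
    by (rule bounded_support_lp[OF cell_avg_measurable[OF F] Ab cell_avg_support[OF R] that])
  have "ennreal (lp_mass p lborel ?A) \<le> ennreal (lp_mass p lborel F)"
    using cell_avg_contracts[OF F B p(1), of m] p nn_integral_lp_mass[OF A, of p] nn_integral_lp_mass[OF L] by simp
  then have contr: "lp_mass p lborel ?A \<le> lp_mass p lborel F" by (simp add: lp_mass_nonneg)
  have pw: "norm (?A x) powr r \<le> ?K powr ((r - p) / p) * norm (?A x) powr p" for x
  proof -
    have "norm (?A x) powr (r - p) = (norm (?A x) powr p) powr ((r - p) / p)" using p by (simp add: powr_powr)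
    also have "\<dots> \<le> ?K powr ((r - p) / p)"
      using cell_avg_sup[OF F B p(1) L, of m x] p by (intro powr_mono2) auto
    finally have "norm (?A x) powr (r - p) * norm (?A x) powr p \<le> ?K powr ((r - p) / p) * norm (?A x) powr p"
      by (rule mult_right_mono) simp
    then show ?thesis by (simp only: powr_add[symmetric]) simp
  qed
  have int: "integrable lborel (\<lambda>x. ?K powr ((r - p) / p) * norm (?A x) powr p)"
    using lp_space_integrable[OF A[of p]] p by simp
  have "lp_mass r lborel ?A \<le> (LINT x|lborel. ?K powr ((r - p) / p) * norm (?A x) powr p)"
    by (rule lp_space_bounded(2)[OF _ int]) (use pw in \<open>auto intro: lp_space_measurable[OF A[of 1]]\<close>)
  also have "\<dots> = ?K powr ((r - p) / p) * lp_mass p lborel ?A" by (simp add: lp_mass_def)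
  also have "\<dots> \<le> ?K powr ((r - p) / p) * lp_mass p lborel F" using contr by (rule mult_left_mono) simp
  finally show ?thesis .
qed

lemma cell_avg_tendsto:
  fixes f :: "'a::euclidean_space \<Rightarrow> real"
  assumes f: "continuous_on UNIV f" and B: "\<And>x. \<bar>f x\<bar> \<le> B"
  shows "(\<lambda>m. cell_avg m f x) \<longlonglongrightarrow> f x"
proof (rule LIMSEQ_I)
  have fm: "f \<in> borel_measurable borel" by (rule borel_measurable_continuous_onI[OF f])
  fix e :: real assume e: "0 < e"
  obtain d where d: "0 < d" "\<And>y. dist y x < d \<Longrightarrow> dist (f y) (f x) < e / 2"
    using f e unfolding continuous_on_iff by (metis UNIV_I half_gt_zero)
  have "(\<lambda>m. real DIM('a) * (1 / 2) ^ m) \<longlonglongrightarrow> real DIM('a) * 0"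
    by (intro tendsto_intros LIMSEQ_power_zero) simp
  then have "\<forall>\<^sub>F m in sequentially. real DIM('a) * (1 / 2) ^ m < d"
    using d(1) by (intro order_tendstoD) auto
  then obtain m0 where m0: "\<And>m. m \<ge> m0 \<Longrightarrow> real DIM('a) * (1 / 2) ^ m < d"
    unfolding eventually_sequentially by blast
  have "norm (cell_avg m f x - f x) < e" if m: "m \<ge> m0" for m
  proof -
    have "cell_avg m f x - f x = cell_avg m (\<lambda>y. f y - f x) x"
      using cell_avg_diff[OF fm B, of "\<lambda>y. f x" "\<bar>f x\<bar>" m x] cell_avg_const[of m x "\<lambda>y. f x" "f x"] by simp
    also have "\<bar>\<dots>\<bar> \<le> e / 2"
    proof (rule cell_avg_bounded)
      show "(\<lambda>y. f y - f x) \<in> borel_measurable borel" using fm by measurable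
      fix y assume "y \<in> cell m x"
      then have "dist y x < d" using cell_norm_diff[of y m x] m0[OF m] by (simp add: dist_norm power_one_over)
      then show "\<bar>f y - f x\<bar> \<le> e / 2" using d(2)[of y] by (simp add: dist_norm)
    qed
    also have "e / 2 < e" using e by simp
    finally show ?thesis by simp
  qed
  then show "\<exists>no. \<forall>n\<ge>no. norm (cell_avg n f x - f x) < e" by blast
qed

text \<open>
  The averages are telescoped. The difference of two consecutive ones is the finer average of the error of the
  coarser one, so its \<open>L\<^sup>r\<close> mass is at most a multiple of
  \<open>2\<^bsup>k N (r-p)/p\<^esup> 2\<^bsup>-k r\<^esup> = 2\<^bsup>-\<kappa> k\<^esup>\<close>, and \<open>\<kappa> > 0\<close> is exactly subcriticality of \<open>r\<close>. The factor
  \<open>1 + \<epsilon> = 2\<^bsup>\<kappa>/2\<^esup>\<close> lost in each step of the quasi-triangle inequality is absorbed by this decay.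
\<close>

lemma cell_avg_error:
  assumes p: "1 < p" and r: "p \<le> r" "r * (real DIM('a) - p) < real DIM('a) * p"
  obtains K \<kappa> where "0 \<le> K" "0 < \<kappa>"
    "\<And>(f::'a::euclidean_space \<Rightarrow> real) m. smooth f \<Longrightarrow> compact (closure {x. f x \<noteq> 0}) \<Longrightarrow>
       lp_mass r lborel (\<lambda>x. f x - cell_avg m f x) \<le> K * 2 powr (- \<kappa> * real m) * lp_mass p lborel (gradient f) powr (r / p)"
proof -
  define N where "N = real DIM('a)"
  define \<kappa> where "\<kappa> = r - N * (r - p) / p"
  have \<kappa>: "0 < \<kappa>"
  proof -
    have "N * (r - p) < r * p" using r(2) by (simp add: N_def algebra_simps)
    then show ?thesis using p by (simp add: \<kappa>_def field_simps)
  qed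
  define A where "A = 2 ^ DIM('a) * N powr p"
  have A: "0 \<le> A" by (simp add: A_def)
  define K0 where "K0 = 2 powr (N * (r - p) / p) * A powr (r / p)"
  define \<epsilon> where "\<epsilon> = 2 powr (\<kappa> / 2) - 1"
  have "1 < (2::real) powr (\<kappa> / 2)" using \<kappa> by (intro gr_one_powr) auto
  then have \<epsilon>: "0 < \<epsilon>" by (simp add: \<epsilon>_def)
  have r0: "0 < r" using p r by simp
  obtain C where C: "0 \<le> C" "\<And>f g::'a \<Rightarrow> real. f \<in> lp_space r lborel \<Longrightarrow> g \<in> lp_space r lborel \<Longrightarrow>
       lp_mass r lborel (\<lambda>x. f x + g x) \<le> (1 + \<epsilon>) * lp_mass r lborel f + C * lp_mass r lborel g"
    by (rule lp_mass_triangle_eps[OF r0 \<epsilon>]) (rule that)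
  define q where "q = 2 powr (- (\<kappa> / 2))"
  have q: "0 < q" "q < 1" using \<kappa> by (auto simp: q_def powr_less_one)
  \<comment> \<open>The fixed point of the recursion \<open>K \<mapsto> K q + C K0\<close> in the telescoping induction.\<close>
  define K where "K = C * K0 / (1 - q)"
  have K: "0 \<le> K" using C(1) q by (simp add: K_def K0_def)
  have Kq: "K * q + C * K0 = K" using q by (simp add: K_def field_simps)
  show ?thesis
  proof (rule that[OF K \<kappa>])
    fix f :: "'a \<Rightarrow> real" and m
    assume sm: "smooth f" and cpt: "compact (closure {x. f x \<noteq> 0})"
    note fm [measurable] = smooth_borel_measurable(1)[OF sm]
    define D where "D = lp_mass p lborel (gradient f)"
    have D: "0 \<le> D" by (simp add: D_def lp_mass_nonneg)
    have f0: "f x = 0" if "x \<notin> closure {x. f x \<noteq> 0}" for x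
      using that closure_subset[of "{x. f x \<noteq> 0}"] by auto
    obtain B where B': "\<And>x. norm (f x) \<le> B"
      by (rule continuous_compact_support_bounded[OF smooth_continuous[OF sm] cpt f0]) (assumption, rule that)
    then have B: "\<bar>f x\<bar> \<le> B" for x by simp
    obtain R where R: "\<And>x. x \<in> closure {x. f x \<noteq> 0} \<Longrightarrow> norm x \<le> R"
      using compact_imp_bounded[OF cpt] unfolding bounded_iff by blast
    have fR: "f x = 0" if "R < norm x" for x
    proof (rule f0)
      show "x \<notin> closure {x. f x \<noteq> 0}" using R[of x] that by linarith
    qed
    have gl: "gradient f \<in> lp_space p lborel"
    proof (rule lp_spaceI)
      show "gradient f \<in> borel_measurable lborel" using smooth_borel_measurable(2)[OF sm] by simp
      have "continuous_on UNIV (\<lambda>x. norm (gradient f x) powr p)"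
        using p by (intro continuous_on_powr' continuous_on_norm smooth_gradient_continuous sm continuous_on_const) auto
      then show "integrable lborel (\<lambda>x. norm (gradient f x) powr p)"
        by (rule integrable_continuous_compact_support[OF _ cpt]) (simp add: gradient_outside_support)
    qed
    have av: "\<bar>cell_avg k f x\<bar> \<le> B" for k x by (rule cell_avg_bounded[OF fm B])
    have avm [measurable]: "cell_avg k f \<in> borel_measurable borel" for k by (rule cell_avg_measurable[OF fm])
    have eb: "\<bar>f x - cell_avg k f x\<bar> \<le> B + B" for k x using B[of x] av[of k x] by linarith
    have avR: "cell_avg k f x = 0" if "R + N < norm x" for k x
      using cell_avg_support[of R f x k] fR that by (simp add: N_def)
    have eR: "f x - cell_avg k f x = 0" if "R + N < norm x" for k x
      using avR[OF that] fR[of x] that by (simp add: N_def)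
    have avl1: "cell_avg k f \<in> lp_space s lborel" if "0 < s" for k s
      by (rule bounded_support_lp[OF avm av avR that])
    have avl2: "(\<lambda>x. f x - cell_avg k f x) \<in> lp_space s lborel" if "0 < s" for k s
      by (rule bounded_support_lp[OF _ eb eR that]) measurable
    note avl = avl1 avl2
    have Ek: "lp_mass p lborel (\<lambda>x. f x - cell_avg k f x) \<le> A * 2 powr (- p * real k) * D" for k
    proof -
      have "ennreal (lp_mass p lborel (\<lambda>x. f x - cell_avg k f x)) = (\<integral>\<^sup>+x. ennreal (\<bar>f x - cell_avg k f x\<bar> powr p) \<partial>lborel)"
        using nn_integral_lp_mass[OF avl(2)[of p k]] p by simp
      also have "\<dots> \<le> ennreal (2 ^ DIM('a) * (real DIM('a) * (1 / 2 ^ k)) powr p) * (\<integral>\<^sup>+x. ennreal (norm (gradient f x) powr p) \<partial>lborel)"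
        by (rule cell_avg_error_p[OF sm B p])
      also have "\<dots> = ennreal (2 ^ DIM('a) * (real DIM('a) * (1 / 2 ^ k)) powr p * D)"
        by (subst nn_integral_lp_mass[OF gl]) (simp add: D_def ennreal_mult')
      finally have "lp_mass p lborel (\<lambda>x. f x - cell_avg k f x) \<le> 2 ^ DIM('a) * (real DIM('a) * (1 / 2 ^ k)) powr p * D"
        using D by simp
      also have "(real DIM('a) * (1 / 2 ^ k)) powr p = N powr p * 2 powr (- p * real k)"
      proof -
        have "(1 / 2 ^ k :: real) = 2 powr (- real k)" by (simp add: powr_minus_divide powr_realpow)
        then have "(1 / 2 ^ k :: real) powr p = 2 powr (- p * real k)" by (simp add: powr_powr mult.commute)
        then show ?thesis by (simp only: powr_mult N_def)
      qed
      finally show ?thesis by (simp add: A_def mult.assoc)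
    qed
    have step: "lp_mass r lborel (\<lambda>x. cell_avg (Suc k) f x - cell_avg k f x) \<le> K0 * 2 powr (- \<kappa> * real k) * D powr (r / p)" for k
    proof -
      let ?E = "lp_mass p lborel (\<lambda>x. f x - cell_avg k f x)"
      have "lp_mass r lborel (\<lambda>x. cell_avg (Suc k) f x - cell_avg k f x)
          \<le> (2 ^ (Suc k * DIM('a)) * ?E) powr ((r - p) / p) * ?E"
        unfolding cell_avg_refine[OF fm B] by (rule cell_avg_higher_power[OF _ eb eR p r(1)]) measurable
      also have "\<dots> = (2 ^ (Suc k * DIM('a))) powr ((r - p) / p) * ?E powr (r / p)"
      proof (cases "?E = 0")
        case False
        then have "0 < ?E" using lp_mass_nonneg[of p lborel] by (simp add: less_le)
        then have "?E powr ((r - p) / p) * ?E = ?E powr ((r - p) / p + 1)" by (simp only: powr_add powr_one')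
        also have "(r - p) / p + 1 = r / p" using p by (simp add: diff_divide_distrib)
        finally show ?thesis by (simp only: powr_mult mult.assoc)
      qed (use r0 p in simp)
      also have "\<dots> \<le> (2 ^ (Suc k * DIM('a))) powr ((r - p) / p) * (A * 2 powr (- p * real k) * D) powr (r / p)"
        using Ek r0 p by (intro mult_left_mono powr_mono2) (auto simp: lp_mass_nonneg)
      also have "\<dots> = K0 * 2 powr (- \<kappa> * real k) * D powr (r / p)"
      proof -
        have 1: "((2::real) ^ (Suc k * DIM('a))) powr ((r - p) / p) = 2 powr (N * (r - p) / p) * 2 powr (real k * (N * (r - p) / p))"
        proof -
          have "((2::real) ^ (Suc k * DIM('a))) = 2 powr (real (Suc k * DIM('a)))" by (simp only: powr_realpow zero_less_numeral)
          also have "real (Suc k * DIM('a)) = real (Suc k) * N" by (simp only: of_nat_mult N_def)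
          finally have "((2::real) ^ (Suc k * DIM('a))) = 2 powr (real (Suc k) * N)" .
          then have "((2::real) ^ (Suc k * DIM('a))) powr ((r - p) / p) = 2 powr (real (Suc k) * N * ((r - p) / p))"
            by (simp only: powr_powr)
          also have "real (Suc k) * N * ((r - p) / p) = N * (r - p) / p + real k * (N * (r - p) / p)"
            by (simp only: of_nat_Suc distrib_right mult_1 times_divide_eq_right mult.assoc add_divide_distrib)
          finally show ?thesis by (simp only: powr_add)
        qed
        have 2: "(A * 2 powr (- p * real k) * D) powr (r / p) = A powr (r / p) * 2 powr (- r * real k) * D powr (r / p)"
          using A D p by (simp add: powr_mult powr_powr mult.commute)
        have 3: "(2::real) powr (real k * (N * (r - p) / p)) * 2 powr (- r * real k) = 2 powr (- \<kappa> * real k)"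
          by (simp add: powr_add[symmetric] \<kappa>_def algebra_simps)
        show ?thesis unfolding 1 2 K0_def 3[symmetric] by (simp only: mult_ac)
      qed
      finally show ?thesis .
    qed
    define T where "T = D powr (r / p)"
    have T: "0 \<le> T" by (simp add: T_def)
    have dif: "(\<lambda>x. cell_avg j f x - cell_avg k f x) \<in> lp_space r lborel" for j k
      by (intro lp_space_diff avl r0)
    have tele: "lp_mass r lborel (\<lambda>x. cell_avg (m + j) f x - cell_avg m f x) \<le> K * 2 powr (- \<kappa> * real m) * T" for j m
    proof (induction j arbitrary: m)
      case 0
      then show ?case using K T by (simp add: lp_mass_def)
    next
      case (Suc j)
      have "lp_mass r lborel (\<lambda>x. cell_avg (m + Suc j) f x - cell_avg m f x)
          = lp_mass r lborel (\<lambda>x. (cell_avg (Suc m + j) f x - cell_avg (Suc m) f x) + (cell_avg (Suc m) f x - cell_avg m f x))"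
        by simp
      also have "\<dots> \<le> (1 + \<epsilon>) * lp_mass r lborel (\<lambda>x. cell_avg (Suc m + j) f x - cell_avg (Suc m) f x)
          + C * lp_mass r lborel (\<lambda>x. cell_avg (Suc m) f x - cell_avg m f x)"
        by (intro C(2) dif)
      also have "\<dots> \<le> (1 + \<epsilon>) * (K * 2 powr (- \<kappa> * real (Suc m)) * T) + C * (K0 * 2 powr (- \<kappa> * real m) * T)"
        using Suc.IH[of "Suc m"] step[of m] \<epsilon> C(1) by (intro add_mono mult_left_mono) (auto simp: T_def)
      also have "(1 + \<epsilon>) * (K * 2 powr (- \<kappa> * real (Suc m)) * T) = K * q * 2 powr (- \<kappa> * real m) * T"
      proof -
        have "(1 + \<epsilon>) * 2 powr (- \<kappa> * real (Suc m)) = 2 powr (\<kappa> / 2 + - \<kappa> * real (Suc m))"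
          by (simp only: powr_add \<epsilon>_def diff_add_cancel add_diff_cancel_left' add.commute[of 1])
        also have "\<kappa> / 2 + - \<kappa> * real (Suc m) = - (\<kappa> / 2) + - \<kappa> * real m" by (simp add: field_simps)
        also have "2 powr \<dots> = q * 2 powr (- \<kappa> * real m)" by (simp only: powr_add q_def)
        finally have e: "(1 + \<epsilon>) * 2 powr (- \<kappa> * real (Suc m)) = q * 2 powr (- \<kappa> * real m)" .
        have "(1 + \<epsilon>) * (K * 2 powr (- \<kappa> * real (Suc m)) * T) = K * ((1 + \<epsilon>) * 2 powr (- \<kappa> * real (Suc m))) * T"
          by (simp only: mult_ac)
        also have "\<dots> = K * q * 2 powr (- \<kappa> * real m) * T" unfolding e by (simp only: mult_ac)
        finally show ?thesis .
      qed
      also have "K * q * 2 powr (- \<kappa> * real m) * T + C * (K0 * 2 powr (- \<kappa> * real m) * T) = (K * q + C * K0) * 2 powr (- \<kappa> * real m) * T"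
        by (simp add: algebra_simps)
      finally show ?case by (simp only: Kq)
    qed
    have "lp_mass r lborel (\<lambda>x. f x - cell_avg m f x) \<le> K * 2 powr (- \<kappa> * real m) * T"
    proof (rule lp_fatou(2)[OF dif tele _ r0])
      show "(\<lambda>x. f x - cell_avg m f x) \<in> borel_measurable lborel" by measurable
      have "(\<lambda>n. cell_avg (m + n) f x) \<longlonglongrightarrow> f x" for x
        using LIMSEQ_ignore_initial_segment[OF cell_avg_tendsto[OF smooth_continuous[OF sm] B, of x], where k = m] by (simp add: add.commute)
      then show "AE x in lborel. (\<lambda>n. cell_avg (m + n) f x - cell_avg m f x) \<longlonglongrightarrow> f x - cell_avg m f x"
        by (intro AE_I2 tendsto_diff tendsto_const)
    qed
    then show "lp_mass r lborel (\<lambda>x. f x - cell_avg m f x) \<le> K * 2 powr (- \<kappa> * real m) * lp_mass p lborel (gradient f) powr (r / p)"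
      by (simp add: T_def D_def)
  qed
qed

lemma diagonal_cell_avg_convergent:
  fixes f :: "nat \<Rightarrow> 'a::euclidean_space \<Rightarrow> real"
  assumes bd: "\<And>m n x. \<bar>cell_avg m (f n) x\<bar> \<le> B m" and B: "\<And>m. 0 < B m"
  obtains \<sigma> :: "nat \<Rightarrow> nat" where "strict_mono \<sigma>" "\<And>m x. convergent (\<lambda>n. cell_avg m (f (\<sigma> n)) x)"
proof -
  obtain D :: "'a set" where D: "countable D" "\<And>X. open X \<Longrightarrow> X \<noteq> {} \<Longrightarrow> \<exists>d\<in>D. d \<in> X"
    using countable_dense_exists by metis
  define g where "g = (\<lambda>n (z::nat \<times> 'a). cell_avg (fst z) (f n) (snd z) / B (fst z))"
  have cS: "countable ((UNIV :: nat set) \<times> D)" using D(1) by simp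
  have g1: "norm (g n z) \<le> 1" for n z
    using bd[of "fst z" n "snd z"] B[of "fst z"] by (simp add: g_def abs_divide)
  obtain \<sigma> :: "nat \<Rightarrow> nat" where \<sigma>: "strict_mono \<sigma>"
    "\<And>z. z \<in> UNIV \<times> D \<Longrightarrow> \<exists>l. (\<lambda>n. g (\<sigma> n) z) \<longlonglongrightarrow> l"
    by (rule function_convergent_subsequence[OF cS g1]) (rule that)
  have "convergent (\<lambda>n. cell_avg m (f (\<sigma> n)) x)" for m x
  proof -
    obtain S where "open S" "S \<noteq> {}" "S \<subseteq> cell m x" using cell_open_subset by blast
    then obtain d where d: "d \<in> D" "d \<in> cell m x" using D(2)[of S] by blast
    obtain l where "(\<lambda>n. g (\<sigma> n) (m, d)) \<longlonglongrightarrow> l" using \<sigma>(2)[of "(m, d)"] d by auto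
    then have "(\<lambda>n. B m * g (\<sigma> n) (m, d)) \<longlonglongrightarrow> B m * l" by (intro tendsto_intros)
    moreover have "B m * g n (m, d) = cell_avg m (f n) x" for n
      using B[of m] cell_avg_cell[OF d(2)] by (simp add: g_def)
    ultimately show ?thesis by (auto simp: convergent_def)
  qed
  with \<sigma>(1) that show ?thesis by blast
qed

context sobolev_setting
begin

lemma lp_lborel_iff:
  fixes f :: "'a \<Rightarrow> 'b::euclidean_space"
  assumes f: "f \<in> borel_measurable borel" "\<And>x. x \<notin> \<Omega> \<Longrightarrow> f x = 0" and r: "0 < r"
  shows "f \<in> lp_space r M \<longleftrightarrow> f \<in> lp_space r lborel" "lp_mass r M f = lp_mass r lborel f"
proof -
  have m: "(\<lambda>x. norm (f x) powr r) \<in> borel_measurable borel" using f(1) by measurable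
  have z: "norm (f x) powr r = 0" if "x \<notin> \<Omega>" for x using f(2)[OF that] by simp
  note e = lebesgue_on_integral_eq_lborel[OF open_dom m z]
  show "lp_mass r M f = lp_mass r lborel f" using e(1) by (simp add: lp_mass_def)
  show "f \<in> lp_space r M \<longleftrightarrow> f \<in> lp_space r lborel"
    using e(2) f(1) borel_imp_measurable_M[OF f(1)] by (simp add: lp_space_def)
qed

text \<open>
  Exponents from \<open>p\<close> up to, and not including, the Sobolev exponent \<open>N p/(N - p)\<close>.
\<close>

definition subcritical :: "real \<Rightarrow> bool" where
  "subcritical r \<longleftrightarrow> p \<le> r \<and> r * (real DIM('a) - p) < real DIM('a) * p"

text \<open>
  At each dyadic level the averages of a subsequence converge pointwise and boundedly, hence in every \<open>L\<^sup>r\<close>; the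
  distance to the averages is small uniformly along the sequence.
\<close>

lemma subcritical_cauchy_subsequence:
  assumes \<phi>: "\<And>n. test_function \<Omega> (\<phi> n)"
    and bd: "\<And>n. lp_mass p M (\<phi> n) \<le> c" "\<And>n. lp_mass p M (gradient (\<phi> n)) \<le> c"
  obtains \<sigma> :: "nat \<Rightarrow> nat" where "strict_mono \<sigma>"
    "\<And>r \<epsilon>. subcritical r \<Longrightarrow> 0 < \<epsilon> \<Longrightarrow>
      \<exists>n0. \<forall>m\<ge>n0. \<forall>n\<ge>n0. lp_mass r M (\<lambda>x. \<phi> (\<sigma> m) x - \<phi> (\<sigma> n) x) < \<epsilon>"
proof -
  note sm = test_function_smooth[OF \<phi>]
  note fm [measurable] = smooth_borel_measurable(1)[OF sm]
  have cpt: "compact (closure {x. \<phi> n x \<noteq> 0})" for n using \<phi>[of n] by (simp add: test_function_def)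
  have c0: "0 \<le> c" using bd(1)[of 0] lp_mass_nonneg[of p M "\<phi> 0"] by linarith
  obtain R where R: "\<And>x. x \<in> \<Omega> \<Longrightarrow> norm x \<le> R" using bounded_dom unfolding bounded_iff by blast
  have out: "\<phi> n x = 0" if "x \<notin> \<Omega>" for n x using test_function_outside(1)[OF \<phi> that] .
  have outR: "\<phi> n x = 0" if "R < norm x" for n x
  proof (rule out)
    show "x \<notin> \<Omega>" using R[of x] that by linarith
  qed
  have "\<exists>b. \<forall>x. \<bar>\<phi> n x\<bar> \<le> b" for n
  proof -
    have z: "\<phi> n x = 0" if "x \<notin> closure {x. \<phi> n x \<noteq> 0}" for x
      using that closure_subset[of "{x. \<phi> n x \<noteq> 0}"] by auto
    obtain b where "\<And>x. norm (\<phi> n x) \<le> b"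
      by (rule continuous_compact_support_bounded[OF smooth_continuous[OF sm] cpt z]) (assumption, rule that)
    then show ?thesis by auto
  qed
  then obtain b where b: "\<And>n x. \<bar>\<phi> n x\<bar> \<le> b n" by metis
  have L: "\<phi> n \<in> lp_space r lborel" "lp_mass r M (\<phi> n) = lp_mass r lborel (\<phi> n)" if "0 < r" for n r
    using lp_lborel_iff[OF fm out that] bounded_support_lp[OF fm b outR that] by auto
  have grad: "lp_mass p lborel (gradient (\<phi> n)) \<le> c" for n
    using lp_lborel_iff(2)[OF smooth_borel_measurable(2)[OF sm] test_function_outside(2)[OF \<phi>] p_pos, of n] bd(2)[of n] by simp
  define B where "B = (\<lambda>m. (2 ^ (m * DIM('a)) * (c + 1)) powr (1 / p))"
  have B: "0 < B m" for m using c0 by (simp add: B_def)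
  have bdB: "\<bar>cell_avg m (\<phi> n) x\<bar> \<le> B m" for m n x
  proof -
    have "\<bar>cell_avg m (\<phi> n) x\<bar> powr p \<le> 2 ^ (m * DIM('a)) * lp_mass p lborel (\<phi> n)"
      by (rule cell_avg_sup[OF fm b p_gt_1 L(1)[OF p_pos]])
    also have "\<dots> \<le> 2 ^ (m * DIM('a)) * (c + 1)" using bd(1)[of n] L(2)[OF p_pos, of n] by (intro mult_left_mono) auto
    finally have "(\<bar>cell_avg m (\<phi> n) x\<bar> powr p) powr (1 / p) \<le> B m"
      unfolding B_def using p_pos by (intro powr_mono2) auto
    then show ?thesis using p_pos by (simp add: powr_powr)
  qed
  obtain \<sigma> :: "nat \<Rightarrow> nat" where \<sigma>: "strict_mono \<sigma>" "\<And>m x. convergent (\<lambda>n. cell_avg m (\<phi> (\<sigma> n)) x)"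
    by (rule diagonal_cell_avg_convergent[of \<phi> B]) (rule bdB, rule B, rule that)
  define a where "a = (\<lambda>m n x. cell_avg m (\<phi> (\<sigma> n)) x)"
  define l where "l = (\<lambda>m x. lim (\<lambda>n. a m n x))"
  have am [measurable]: "a m n \<in> borel_measurable borel" for m n unfolding a_def by (rule cell_avg_measurable[OF fm])
  have lim: "(\<lambda>n. a m n x) \<longlonglongrightarrow> l m x" for m x
    using \<sigma>(2)[of m x] unfolding l_def a_def by (simp add: convergent_LIMSEQ_iff)
  have ab: "\<bar>a m n x\<bar> \<le> B m" for m n x unfolding a_def by (rule bdB)
  have aR: "a m n x = 0" if "R + real DIM('a) < norm x" for m n x
    unfolding a_def by (rule cell_avg_support[of R]) (use outR that in auto)
  have lm [measurable]: "l m \<in> borel_measurable borel" for m unfolding l_def by measurable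
  have lb: "\<bar>l m x\<bar> \<le> B m" for m x
    by (rule tendsto_upperbound[OF tendsto_rabs[OF lim]]) (use ab in auto)
  have lR: "l m x = 0" if "R + real DIM('a) < norm x" for m x
    using lim[of m x] aR[OF that] by (simp add: LIMSEQ_const_iff)
  have al1: "a m n \<in> lp_space r lborel" if "0 < r" for m n r
    by (rule bounded_support_lp[OF am ab aR that])
  have al2: "l m \<in> lp_space r lborel" if "0 < r" for m r
    by (rule bounded_support_lp[OF lm lb lR that])
  note al = al1 al2
  have conv: "(\<lambda>n. lp_mass r lborel (\<lambda>x. a m n x - l m x)) \<longlonglongrightarrow> 0" if r: "0 < r" for m r
  proof -
    have "(\<lambda>n. LINT x|lborel. norm (a m n x - l m x) powr r) \<longlonglongrightarrow> (LINT x|(lborel::'a measure). 0)"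
    proof (rule integral_dominated_convergence[where w = "\<lambda>x. indicator (cball 0 (R + real DIM('a))) x *\<^sub>R ((B m + B m) powr r)"])
      show "integrable lborel (\<lambda>x::'a. indicator (cball 0 (R + real DIM('a))) x *\<^sub>R ((B m + B m) powr r))"
        by (intro borel_integrable_compact) auto
      show "AE x in lborel. (\<lambda>n. norm (a m n x - l m x) powr r) \<longlonglongrightarrow> 0"
      proof (rule AE_I2)
        fix x
        have "(\<lambda>n. norm (a m n x - l m x) powr r) \<longlonglongrightarrow> norm (l m x - l m x) powr r"
          using r by (intro tendsto_powr' tendsto_norm tendsto_diff lim tendsto_const) auto
        then show "(\<lambda>n. norm (a m n x - l m x) powr r) \<longlonglongrightarrow> 0" by simp
      qed
      show "AE x in lborel. norm (norm (a m n x - l m x) powr r) \<le> indicator (cball 0 (R + real DIM('a))) x *\<^sub>R ((B m + B m) powr r)" for n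
      proof (rule AE_I2)
        fix x
        have "norm (a m n x - l m x) \<le> B m + B m" using ab[of m n x] lb[of m x] by (simp only: real_norm_def)
        then show "norm (norm (a m n x - l m x) powr r) \<le> indicator (cball 0 (R + real DIM('a))) x *\<^sub>R ((B m + B m) powr r)"
          using aR[of x m n] lR[of x m] r by (cases "norm x \<le> R + real DIM('a)") (auto intro: powr_mono2)
      qed
    qed measurable
    then show ?thesis by (simp add: lp_mass_def)
  qed
  show ?thesis
  proof (rule that[OF \<sigma>(1)])
    fix r \<epsilon> :: real assume r: "subcritical r" and e: "0 < \<epsilon>"
    have r0: "0 < r" using r p_pos by (simp add: subcritical_def)
    obtain K \<kappa> where K: "0 \<le> K" "0 < \<kappa>"
      "\<And>(f::'a \<Rightarrow> real) m. smooth f \<Longrightarrow> compact (closure {x. f x \<noteq> 0}) \<Longrightarrow>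
       lp_mass r lborel (\<lambda>x. f x - cell_avg m f x) \<le> K * 2 powr (- \<kappa> * real m) * lp_mass p lborel (gradient f) powr (r / p)"
      using cell_avg_error[OF p_gt_1, of r] r unfolding subcritical_def by blast
    \<comment> \<open>The quasi-triangle inequality is used twice and costs a factor \<open>2\<^sup>r\<close> each time.\<close>
    define \<delta> where "\<delta> = \<epsilon> / (8 * (2 powr r * 2 powr r))"
    have d: "0 < \<delta>" using e by (simp add: \<delta>_def)
    have "(\<lambda>m. K * (2 powr (- \<kappa>)) ^ m * c powr (r / p)) \<longlonglongrightarrow> K * 0 * c powr (r / p)"
      using K(2) by (intro tendsto_intros LIMSEQ_power_zero) (auto simp: powr_less_one)
    then have "\<forall>\<^sub>F m in sequentially. K * (2 powr (- \<kappa>)) ^ m * c powr (r / p) < \<delta>"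
      using d by (intro order_tendstoD) auto
    then obtain m where m: "K * (2 powr (- \<kappa>)) ^ m * c powr (r / p) < \<delta>"
      unfolding eventually_sequentially by blast
    have e1: "lp_mass r lborel (\<lambda>x. \<phi> n x - cell_avg m (\<phi> n) x) < \<delta>" for n
    proof -
      have "lp_mass r lborel (\<lambda>x. \<phi> n x - cell_avg m (\<phi> n) x) \<le> K * 2 powr (- \<kappa> * real m) * lp_mass p lborel (gradient (\<phi> n)) powr (r / p)"
        by (rule K(3)[OF sm cpt])
      also have "\<dots> \<le> K * 2 powr (- \<kappa> * real m) * c powr (r / p)"
        using K(1) grad[of n] r0 p_pos by (intro mult_left_mono powr_mono2) (auto simp: lp_mass_nonneg)
      also have "2 powr (- \<kappa> * real m) = (2 powr (- \<kappa>)) ^ m" by (simp add: powr_realpow[symmetric] powr_powr)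
      finally show ?thesis using m by simp
    qed
    obtain n0 where n0: "\<And>n. n \<ge> n0 \<Longrightarrow> lp_mass r lborel (\<lambda>x. a m n x - l m x) < \<delta>"
      using order_tendstoD(2)[OF conv[OF r0] d] unfolding eventually_sequentially by blast
    have close: "lp_mass r lborel (\<lambda>x. \<phi> (\<sigma> n) x - l m x) < 2 powr r * (\<delta> + \<delta>)" "(\<lambda>x. \<phi> (\<sigma> n) x - l m x) \<in> lp_space r lborel" if n: "n \<ge> n0" for n
    proof -
      have "lp_mass r lborel (\<lambda>x. (\<phi> (\<sigma> n) x - a m n x) + (a m n x - l m x))
          \<le> 2 powr r * (lp_mass r lborel (\<lambda>x. \<phi> (\<sigma> n) x - a m n x) + lp_mass r lborel (\<lambda>x. a m n x - l m x))"
        using r0 by (intro lp_space_add lp_space_diff L al) auto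
      also have "\<dots> < 2 powr r * (\<delta> + \<delta>)"
        using e1[of "\<sigma> n"] n0[OF n] by (intro mult_strict_left_mono add_strict_mono) (auto simp: a_def)
      finally show "lp_mass r lborel (\<lambda>x. \<phi> (\<sigma> n) x - l m x) < 2 powr r * (\<delta> + \<delta>)" by simp
      show "(\<lambda>x. \<phi> (\<sigma> n) x - l m x) \<in> lp_space r lborel" by (intro lp_space_diff L al r0)
    qed
    show "\<exists>n0. \<forall>m\<ge>n0. \<forall>n\<ge>n0. lp_mass r M (\<lambda>x. \<phi> (\<sigma> m) x - \<phi> (\<sigma> n) x) < \<epsilon>"
    proof (intro exI allI impI)
      fix j k assume jk: "n0 \<le> j" "n0 \<le> k"
      have "lp_mass r M (\<lambda>x. \<phi> (\<sigma> j) x - \<phi> (\<sigma> k) x) = lp_mass r lborel (\<lambda>x. \<phi> (\<sigma> j) x - \<phi> (\<sigma> k) x)"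
        by (rule lp_lborel_iff(2)[OF _ _ r0]) (measurable, simp add: out)
      also have "\<dots> = lp_mass r lborel (\<lambda>x. (\<phi> (\<sigma> j) x - l m x) - (\<phi> (\<sigma> k) x - l m x))" by simp
      also have "\<dots> \<le> 2 powr r * (lp_mass r lborel (\<lambda>x. \<phi> (\<sigma> j) x - l m x) + lp_mass r lborel (\<lambda>x. \<phi> (\<sigma> k) x - l m x))"
        by (intro lp_space_diff close(2) jk r0)
      also have "\<dots> < 2 powr r * (2 powr r * (\<delta> + \<delta>) + 2 powr r * (\<delta> + \<delta>))"
        using close(1)[OF jk(1)] close(1)[OF jk(2)] by (intro mult_strict_left_mono add_strict_mono) auto
      also have "\<dots> = 4 * (2 powr r * 2 powr r) * \<delta>" by (simp add: algebra_simps)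
      also have "\<dots> = \<epsilon> / 2" by (simp add: \<delta>_def)
      also have "\<epsilon> / 2 < \<epsilon>" using e by simp
      finally show "lp_mass r M (\<lambda>x. \<phi> (\<sigma> j) x - \<phi> (\<sigma> k) x) < \<epsilon>" .
    qed
  qed
qed

lemma rellich_test:
  assumes \<phi>: "\<And>n. test_function \<Omega> (\<phi> n)"
    and bd: "\<And>n. lp_mass p M (\<phi> n) \<le> c" "\<And>n. lp_mass p M (gradient (\<phi> n)) \<le> c"
    and N: "p < real DIM('a)"
  obtains \<sigma> :: "nat \<Rightarrow> nat" and u where "strict_mono \<sigma>"
    "\<And>r. subcritical r \<Longrightarrow> u \<in> lp_space r M"
    "\<And>r. subcritical r \<Longrightarrow> (\<lambda>n. lp_mass r M (\<lambda>x. \<phi> (\<sigma> n) x - u x)) \<longlonglongrightarrow> 0"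
proof -
  obtain \<sigma> :: "nat \<Rightarrow> nat" where \<sigma>: "strict_mono \<sigma>"
    "\<And>r \<epsilon>. subcritical r \<Longrightarrow> 0 < \<epsilon> \<Longrightarrow>
      \<exists>n0. \<forall>m\<ge>n0. \<forall>n\<ge>n0. lp_mass r M (\<lambda>x. \<phi> (\<sigma> m) x - \<phi> (\<sigma> n) x) < \<epsilon>"
    by (rule subcritical_cauchy_subsequence[OF \<phi> bd]) (rule that)
  have sp: "subcritical p" unfolding subcritical_def using p_gt_1 N by simp
  have tl: "\<phi> n \<in> lp_space r M" if "subcritical r" for n r
    using test_lp(1)[OF \<phi>] that p_pos by (simp add: subcritical_def)
  obtain u \<rho> where u: "u \<in> lp_space p M" "(\<lambda>n. lp_mass p M (\<lambda>x. \<phi> (\<sigma> n) x - u x)) \<longlonglongrightarrow> 0"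
    "strict_mono (\<rho> :: nat \<Rightarrow> nat)" "AE x in M. (\<lambda>k. \<phi> (\<sigma> (\<rho> k)) x) \<longlonglongrightarrow> u x"
    by (rule lp_complete[OF tl[OF sp] p_pos \<sigma>(2)[OF sp]]) (assumption, rule that)
  have all: "u \<in> lp_space r M \<and> (\<lambda>n. lp_mass r M (\<lambda>x. \<phi> (\<sigma> n) x - u x)) \<longlonglongrightarrow> 0" if r: "subcritical r" for r
  proof -
    have r0: "0 < r" using r p_pos by (simp add: subcritical_def)
    obtain w where w: "w \<in> lp_space r M" "(\<lambda>n. lp_mass r M (\<lambda>x. \<phi> (\<sigma> n) x - w x)) \<longlonglongrightarrow> 0"
      by (rule lp_complete[OF tl[OF r] r0 \<sigma>(2)[OF r]]) (assumption, rule that)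
    have "(\<lambda>k. lp_mass r M (\<lambda>x. \<phi> (\<sigma> (\<rho> k)) x - w x)) \<longlonglongrightarrow> 0"
      using LIMSEQ_subseq_LIMSEQ[OF w(2) u(3)] by (simp add: o_def)
    from lp_convergent_AE_subseq[OF tl[OF r] w(1) r0 this]
    obtain \<tau> where \<tau>: "strict_mono (\<tau> :: nat \<Rightarrow> nat)" "AE x in M. (\<lambda>k. \<phi> (\<sigma> (\<rho> (\<tau> k))) x) \<longlonglongrightarrow> w x" by metis
    have "AE x in M. u x = w x" using u(4) \<tau>(2)
    proof eventually_elim
      case (elim x)
      have "(\<lambda>k. \<phi> (\<sigma> (\<rho> (\<tau> k))) x) \<longlonglongrightarrow> u x"
        using LIMSEQ_subseq_LIMSEQ[OF elim(1) \<tau>(1)] by (simp add: o_def)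
      then show ?case using elim(2) LIMSEQ_unique by blast
    qed
    then have "u \<in> lp_space r M" by (rule lp_AE_cong(1)[OF w(1)])
    moreover have "lp_mass r M (\<lambda>x. \<phi> (\<sigma> n) x - u x) = lp_mass r M (\<lambda>x. \<phi> (\<sigma> n) x - w x)" for n
    proof (rule lp_AE_cong(2)[OF lp_space_diff(1)[OF tl[OF r] w(1) r0]])
      show "AE x in M. \<phi> (\<sigma> n) x - u x = \<phi> (\<sigma> n) x - w x" using \<open>AE x in M. u x = w x\<close> by eventually_elim simp
    qed
    ultimately show ?thesis using w(2) by simp
  qed
  show ?thesis by (rule that[OF \<sigma>(1)]) (use all in auto)
qed

end

section \<open>The Hardy-Sobolev inequality and its consequences\<close>

text \<open>
  The numbers \<open>q\<close> and \<open>N\<close> are parameters with defining equations, because they depend on the space only through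
  its type. With a positive best constant the Hardy-Sobolev inequality holds by definition.
\<close>

locale hs_setting = sobolev_setting \<Omega> p for \<Omega> :: "'a::euclidean_space set" and p :: real +
  fixes s q N :: real
  assumes N_eq: "N = real DIM('a)" and q_eq: "q = hs_exponent TYPE('a) p s"
    and p_less: "p < N" and s_pos: "0 < s" and s_less: "s < p"
    and zero_in: "0 \<in> \<Omega>" and mu_pos: "0 < hs_constant p s \<Omega>"
begin

abbreviation "\<mu> \<equiv> hs_constant p s \<Omega>"

text \<open>
  The root \<open>|x|\<^bsup>-s/q\<^esup>\<close> of the singular weight. Multiplication by it turns weighted integrals of \<open>|u|\<^sup>q\<close> into
  \<open>L\<^sup>q\<close> masses.
\<close>

definition hw :: "'a \<Rightarrow> real" where "hw x = norm x powr (- s / q)"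

definition hs_mass :: "('a \<Rightarrow> real) \<Rightarrow> real" where "hs_mass u = lp_mass q M (\<lambda>x. hw x * u x)"

lemma q_def: "q = (N - s) * p / (N - p)" by (simp add: q_eq hs_exponent_def N_eq)

lemma p_less_q: "p < q"
proof -
  have "p * (N - p) < (N - s) * p" using p_pos s_less by (simp add: mult.commute)
  then show ?thesis using p_less by (simp add: q_def pos_less_divide_eq)
qed

lemma q_gt_1: "1 < q" using p_less_q p_gt_1 by simp

lemma q_pos: "0 < q" using q_gt_1 by simp

lemma exponents: "q / p > 1" "q / (q - p) > 1" "1 / (q / p) + 1 / (q / (q - p)) = 1" "(p - s) / (N - s) = (q - p) / q"
  "s * p / (q - p) = (N - p) * s / (p - s)"
proof -
  show "q / p > 1" "q / (q - p) > 1" using p_less_q p_pos by auto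
  show "1 / (q / p) + 1 / (q / (q - p)) = 1" using p_less_q p_pos by (simp add: field_simps)
  have nz: "N - p \<noteq> 0" "N - s \<noteq> 0" "p \<noteq> 0" "p - s \<noteq> 0" using p_less s_less p_pos by auto
  have qp: "q - p = p * (p - s) / (N - p)" unfolding q_def using nz by (simp add: field_simps)
  show "(p - s) / (N - s) = (q - p) / q" unfolding qp unfolding q_def using nz by simp
  show "s * p / (q - p) = (N - p) * s / (p - s)" unfolding qp using nz by simp
qed

lemma q_subcritical: "subcritical q" "subcritical p"
proof -
  have "q * (N - p) = (N - s) * p" using p_less by (simp add: q_def)
  also have "\<dots> < N * p" using s_pos p_pos by (intro mult_strict_right_mono) auto
  finally show "subcritical q" using p_less_q by (simp add: subcritical_def N_eq)
  show "subcritical p" using p_less p_pos by (simp add: subcritical_def N_eq mult.commute)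
qed

lemma hw_nonneg: "0 \<le> hw x" by (simp add: hw_def)

lemma hw_measurable [measurable]: "hw \<in> borel_measurable borel" unfolding hw_def[abs_def] by measurable

lemma hw_measurable_M: "hw \<in> borel_measurable M" by (rule borel_imp_measurable_M[OF hw_measurable])

lemma hw_powr: "hw x powr q = 1 / norm x powr s"
proof -
  have "hw x powr q = norm x powr (- s / q * q)" by (simp only: hw_def powr_powr)
  also have "- s / q * q = - s" using q_pos by simp
  finally show ?thesis by (simp add: powr_minus_divide)
qed

lemma hs_integrand: "\<bar>t\<bar> powr q / norm x powr s = norm (hw x * t) powr q"
  by (simp add: abs_mult powr_mult abs_of_nonneg[OF hw_nonneg] hw_powr)

lemma hs_mass_eq: "(LINT x|M. \<bar>u x\<bar> powr q / norm x powr s) = hs_mass u"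
  by (simp only: hs_mass_def lp_mass_def hs_integrand)

lemma hs_mass_nonneg: "0 \<le> hs_mass u" by (simp add: hs_mass_def lp_mass_nonneg)

lemma lp_zero_AE:
  fixes f :: "'a \<Rightarrow> 'b::euclidean_space"
  assumes "AE x in M. f x = 0" shows "f \<in> lp_space r M" "lp_mass r M f = 0"
proof -
  have z: "(\<lambda>x. 0::'b) \<in> lp_space r M" by (simp add: lp_space_def)
  show "f \<in> lp_space r M" "lp_mass r M f = 0" using lp_AE_cong[OF z assms] by (auto simp: lp_mass_def)
qed

text \<open>
  A quotient bounded below by a positive constant has a nonzero denominator, so the weighted integral of a
  nontrivial function exists.
\<close>

lemma hs_inequality:
  assumes u: "u \<in> W0"
  shows "(\<lambda>x. hw x * u x) \<in> lp_space q M" "\<mu> * hs_mass u powr (p / q) \<le> dirichlet u"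
proof -
  have "(\<lambda>x. hw x * u x) \<in> lp_space q M \<and> \<mu> * hs_mass u powr (p / q) \<le> dirichlet u"
  proof (cases "nontrivial_on \<Omega> u")
    case True
    have eq: "\<mu> = (INF u \<in> {u \<in> W0. nontrivial_on \<Omega> u}. dirichlet u / hs_mass u powr (p / q))"
      unfolding hs_constant_def q_eq[symmetric] hs_mass_eq by (simp add: lp_mass_def)
    have "\<mu> \<le> dirichlet u / hs_mass u powr (p / q)" unfolding eq
      by (rule cINF_lower) (use u True in \<open>auto intro!: bdd_belowI2[of _ 0] simp: lp_mass_nonneg\<close>)
    moreover from this have ne: "hs_mass u \<noteq> 0" using mu_pos by auto
    moreover have "(\<lambda>x. hw x * u x) \<in> lp_space q M"
    proof (rule lp_spaceI)
      show "(\<lambda>x. hw x * u x) \<in> borel_measurable M"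
        by (intro borel_measurable_times hw_measurable_M lp_space_measurable[OF W0D(1)[OF u]])
      show "integrable M (\<lambda>x. norm (hw x * u x) powr q)"
        using ne not_integrable_integral_eq unfolding hs_mass_def lp_mass_def by blast
    qed
    ultimately show ?thesis using hs_mass_nonneg[of u] by (simp add: pos_le_divide_eq)
  next
    case False
    then have "AE x in M. u x = 0" by (simp add: nontrivial_on_def)
    then have "AE x in M. hw x * u x = 0" by eventually_elim simp
    from lp_zero_AE[OF this] show ?thesis by (simp add: hs_mass_def lp_mass_nonneg)
  qed
  then show "(\<lambda>x. hw x * u x) \<in> lp_space q M" "\<mu> * hs_mass u powr (p / q) \<le> dirichlet u" by auto
qed

lemma AE_nonzero: "AE x in M. x \<noteq> 0"
proof -
  have "AE x in lebesgue. x \<noteq> (0::'a)" by (rule AE_completion) (rule AE_lborel_singleton)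
  then show ?thesis using dom_lebesgue by (subst AE_restrict_space_iff) (auto elim: eventually_mono)
qed

abbreviation "hexp \<equiv> (N - p) * s / (p - s)"
abbreviation "hvol \<equiv> hs_volume p s \<Omega> powr ((p - s) / (N - s))"

lemma hexp_pos: "0 < hexp" using p_less s_pos s_less by simp

lemma norm_bound: obtains R where "0 < R" "\<And>x. x \<in> \<Omega> \<Longrightarrow> norm x \<le> R"
proof -
  obtain R where "\<And>x. x \<in> \<Omega> \<Longrightarrow> norm x \<le> R" using bounded_dom unfolding bounded_iff by blast
  then show ?thesis by (intro that[of "max R 1"]) (auto simp: le_max_iff_disj)
qed

text \<open>
  Hoelder's inequality for \<open>|u|\<^sup>p = (|u|\<^sup>p |x|\<^bsup>-s p/q\<^esup>) |x|\<^bsup>s p/q\<^esup>\<close> with exponents \<open>q/p\<close> and \<open>q/(q - p)\<close>. The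
  set \<open>A\<close> is the whole domain for the bound on \<open>\<lambda>\<^sub>1 - \<lambda>\<close>, and a small ball for the cutoff error.
\<close>

lemma holder_weighted:
  assumes u: "u \<in> lp_space p M" "(\<lambda>x. hw x * u x) \<in> lp_space q M" and A: "A \<in> sets M"
  shows "lp_mass p M (\<lambda>x. indicator A x *\<^sub>R u x)
    \<le> (LINT x|M. indicator A x * norm x powr hexp) powr ((p - s) / (N - s)) * hs_mass (\<lambda>x. indicator A x *\<^sub>R u x) powr (p / q)"
proof -
  obtain R where R: "0 < R" "\<And>x. x \<in> \<Omega> \<Longrightarrow> norm x \<le> R" by (rule norm_bound) (rule that)
  define f where "f = (\<lambda>x. norm (hw x * (indicator A x *\<^sub>R u x)) powr p)"
  define g where "g = (\<lambda>x. indicator A x * norm x powr (s * p / q))"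
  have eqf: "(\<lambda>x. hw x * (indicator A x *\<^sub>R u x)) = (\<lambda>x. indicator A x *\<^sub>R (hw x * u x))" by auto
  have L: "(\<lambda>x. hw x * (indicator A x *\<^sub>R u x)) \<in> lp_space q M"
    unfolding eqf using q_pos by (intro lp_indicator u A) simp
  have [measurable]: "(\<lambda>x. hw x * (indicator A x *\<^sub>R u x)) \<in> borel_measurable M" using L by (rule lp_space_measurable)
  have nm [measurable]: "(\<lambda>x::'a. norm x) \<in> borel_measurable M" by (rule borel_imp_measurable_M) measurable
  have fl: "f \<in> lp_space (q / p) M" "lp_mass (q / p) M f = hs_mass (\<lambda>x. indicator A x *\<^sub>R u x)"
    using L p_pos unfolding f_def by (auto simp: lp_space_def lp_mass_def hs_mass_def powr_powr)
  have gp: "norm (g x) powr (q / (q - p)) = indicator A x * norm x powr hexp" for x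
    using exponents(5) q_pos p_less_q by (auto simp: g_def indicator_def powr_powr)
  interpret finite_measure M by (rule finite_dom)
  have gm [measurable]: "g \<in> borel_measurable M" unfolding g_def using A by measurable
  have gl: "g \<in> lp_space (q / (q - p)) M"
  proof (rule lp_space_bounded(1)[OF gm])
    show "integrable M (\<lambda>x. R powr hexp)" by simp
    show "AE x in M. norm (g x) powr (q / (q - p)) \<le> R powr hexp" unfolding gp
    proof (rule AE_I2)
      fix x assume "x \<in> space M"
      then have "norm x powr hexp \<le> R powr hexp" using R hexp_pos space_M by (intro powr_mono2) auto
      then show "indicator A x * norm x powr hexp \<le> R powr hexp" by (simp add: indicator_def)
    qed
  qed
  have gmass: "lp_mass (q / (q - p)) M g = (LINT x|M. indicator A x * norm x powr hexp)"
    by (simp only: lp_mass_def gp)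
  have "AE x in M. norm (indicator A x *\<^sub>R u x) powr p = norm (f x) * norm (g x)"
    using AE_nonzero
  proof eventually_elim
    case (elim x)
    have "hw x powr p * norm x powr (s * p / q) = 1"
      using elim by (simp add: hw_def powr_powr powr_add[symmetric])
    then have h: "hw x powr p * t * norm x powr (s * p / q) = t" for t by (metis mult.assoc mult.commute mult_1)
    show ?case
      by (cases "x \<in> A") (simp_all add: f_def g_def abs_mult powr_mult abs_of_nonneg[OF hw_nonneg] h)
  qed
  then have "lp_mass p M (\<lambda>x. indicator A x *\<^sub>R u x) = (LINT x|M. norm (f x) * norm (g x))"
    unfolding lp_mass_def
  proof (rule integral_cong_AE[rotated 2])
    have [measurable]: "u \<in> borel_measurable M" "f \<in> borel_measurable M"
      using lp_space_measurable[OF u(1)] lp_space_measurable[OF fl(1)] by auto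
    show "(\<lambda>x. norm (indicator A x *\<^sub>R u x) powr p) \<in> borel_measurable M" using A by measurable
    show "(\<lambda>x. norm (f x) * norm (g x)) \<in> borel_measurable M" by measurable
  qed
  also have "\<dots> \<le> lp_mass (q / p) M f powr (1 / (q / p)) * lp_mass (q / (q - p)) M g powr (1 / (q / (q - p)))"
    by (rule lp_holder(2)[OF fl(1) gl exponents(1-3)])
  finally show ?thesis unfolding fl(2) gmass using exponents(4) by (simp add: mult.commute)
qed

lemma indicator_dom_mass:
  fixes f :: "'a \<Rightarrow> 'b::euclidean_space"
  shows "lp_mass r M (\<lambda>x. indicator \<Omega> x *\<^sub>R f x) = lp_mass r M f"
  unfolding lp_mass_def by (intro Bochner_Integration.integral_cong) (auto simp: space_M)

lemma holder_global:
  assumes u: "u \<in> W0"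
  shows "lp_mass p M u \<le> hvol * hs_mass u powr (p / q)"
proof -
  have \<Omega>: "\<Omega> \<in> sets M" using sets.top[of M] space_M by simp
  have "(LINT x|M. indicator \<Omega> x * norm x powr hexp) = hs_volume p s \<Omega>"
    unfolding hs_volume_def N_eq by (intro Bochner_Integration.integral_cong) (auto simp: space_M)
  moreover have "hs_mass (\<lambda>x. indicator \<Omega> x *\<^sub>R u x) = hs_mass u"
    unfolding hs_mass_def lp_mass_def by (intro Bochner_Integration.integral_cong) (auto simp: space_M)
  ultimately show ?thesis
    using holder_weighted[OF W0D(1)[OF u] hs_inequality(1)[OF u] \<Omega>] indicator_dom_mass[of p u] by simp
qed

lemma W0_scale:
  assumes u: "u \<in> W0"
  shows "(\<lambda>x. c * u x) \<in> W0" "dirichlet (\<lambda>x. c * u x) = \<bar>c\<bar> powr p * dirichlet u"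
    "lp_mass p M (\<lambda>x. c * u x) = \<bar>c\<bar> powr p * lp_mass p M u" "hs_mass (\<lambda>x. c * u x) = \<bar>c\<bar> powr q * hs_mass u"
    "AE x in M. wgrad (\<lambda>x. c * u x) x = c *\<^sub>R wgrad u x"
proof -
  have z: "(\<lambda>x. u x - u x) \<in> W0" "AE x in M. wgrad (\<lambda>x. u x - u x) x = 0"
    using W0_lincomb[OF u u, of "-1"] by auto
  note l = W0_lincomb[OF z(1) u, of c]
  show "(\<lambda>x. c * u x) \<in> W0" using l(1) by simp
  have e: "AE x in M. wgrad (\<lambda>x. c * u x) x = c *\<^sub>R wgrad u x"
    using l(2) z(2) by eventually_elim simp
  then show "AE x in M. wgrad (\<lambda>x. c * u x) x = c *\<^sub>R wgrad u x" .
  have "dirichlet (\<lambda>x. c * u x) = lp_mass p M (\<lambda>x. c *\<^sub>R wgrad u x)"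
    by (rule lp_mass_AE_eq[OF e]) (rule lp_space_scaleR(1)[OF W0D(3)[OF u] p_pos])
  then show "dirichlet (\<lambda>x. c * u x) = \<bar>c\<bar> powr p * dirichlet u"
    using lp_space_scaleR(2)[OF W0D(3)[OF u] p_pos, of c] by simp
  show "lp_mass p M (\<lambda>x. c * u x) = \<bar>c\<bar> powr p * lp_mass p M u"
    using lp_space_scaleR(2)[OF W0D(1)[OF u] p_pos, of c] by simp
  show "hs_mass (\<lambda>x. c * u x) = \<bar>c\<bar> powr q * hs_mass u"
    using lp_space_scaleR(2)[OF hs_inequality(1)[OF u] q_pos, of c] by (simp add: hs_mass_def mult.left_commute)
qed

lemma nontrivial_iff: "u \<in> W0 \<Longrightarrow> nontrivial_on \<Omega> u \<longleftrightarrow> 0 < lp_mass p M u"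
  using lp_mass_eq_0_iff[OF W0D(1)] lp_mass_nonneg[of p M u] by (auto simp: nontrivial_on_def less_le)

lemma nontrivial_hs_mass: "u \<in> W0 \<Longrightarrow> nontrivial_on \<Omega> u \<Longrightarrow> 0 < hs_mass u"
  using holder_global[of u] hs_mass_nonneg[of u] nontrivial_iff[of u] by (cases "hs_mass u = 0") auto

lemma exists_nontrivial: "\<exists>u \<in> W0. nontrivial_on \<Omega> u"
proof -
  obtain a b where ab: "cbox a b \<subseteq> \<Omega>" "0 \<in> box a b" using open_contains_cbox[OF open_dom zero_in] by metis
  let ?\<phi> = "box_bump a b 0"
  have t: "test_function \<Omega> ?\<phi>" by (rule test_function_box_bump[OF ab(1)])
  have "nontrivial_on \<Omega> ?\<phi>" unfolding nontrivial_on_def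
  proof
    assume "AE x in M. ?\<phi> x = 0"
    then have "AE x in lebesgue. x \<in> \<Omega> \<longrightarrow> ?\<phi> x = 0" using dom_lebesgue by (subst (asm) AE_restrict_space_iff) auto
    then have "AE x in lebesgue. x \<notin> box a b"
    proof eventually_elim
      case (elim x)
      show ?case using elim box_bump_bounds(3)[of a b 0 x] ab(1) box_subset_cbox[of a b] by force
    qed
    then have "box a b \<in> null_sets lebesgue" by (simp add: AE_iff_null_sets)
    then have "negligible (box a b)" by (simp add: negligible_iff_null_sets)
    then show False using ab(2) negligible_interval(2) by blast
  qed
  then show ?thesis using test_W0[OF t] by blast
qed

lemma inv_pow_root: "0 < m \<Longrightarrow> 0 < r \<Longrightarrow> \<bar>m powr (- 1 / r)\<bar> powr r = 1 / m" for m r :: real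
proof -
  assume "0 < m" "0 < r"
  have "\<bar>m powr (- 1 / r)\<bar> powr r = m powr (- 1 / r * r)" by (simp only: abs_of_nonneg[OF powr_ge_zero] powr_powr)
  also have "- 1 / r * r = - 1" using \<open>0 < r\<close> by simp
  finally show ?thesis using \<open>0 < m\<close> by (simp add: powr_minus_divide)
qed

text \<open>
  The sequence is replaced by test functions that are close in the Sobolev norm. By the Hardy-Sobolev inequality,
  whose weight is bounded below on a bounded domain, they are close in \<open>L\<^sup>q\<close> as well.
\<close>

lemma rellich_W0:
  assumes v: "\<And>n. v n \<in> W0" and bd: "\<And>n. lp_mass p M (v n) \<le> c" "\<And>n. dirichlet (v n) \<le> c"
  obtains \<sigma> :: "nat \<Rightarrow> nat" and u where "strict_mono \<sigma>" "u \<in> W0" "u \<in> lp_space q M"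
    "(\<lambda>n. lp_mass p M (\<lambda>x. v (\<sigma> n) x - u x)) \<longlonglongrightarrow> 0" "\<And>n. v n \<in> lp_space q M"
    "(\<lambda>n. lp_mass q M (\<lambda>x. v (\<sigma> n) x - u x)) \<longlonglongrightarrow> 0"
proof -
  obtain R where R: "0 < R" "\<And>x. x \<in> \<Omega> \<Longrightarrow> norm x \<le> R" by (rule norm_bound) (rule that)
  have emb: "w \<in> lp_space q M \<and> lp_mass q M w \<le> R powr s * hs_mass w" if w: "w \<in> W0" for w
  proof -
    have int: "integrable M (\<lambda>x. R powr s * norm (hw x * w x) powr q)"
      using lp_space_integrable[OF hs_inequality(1)[OF w]] by simp
    have "AE x in M. x \<in> \<Omega>" using AE_space[of M] space_M by simp
    then have ae: "AE x in M. norm (w x) powr q \<le> R powr s * norm (hw x * w x) powr q"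
      using AE_nonzero
    proof eventually_elim
      case (elim x)
      have "norm x powr s \<le> R powr s" using R elim s_pos by (intro powr_mono2) auto
      moreover have "0 < norm x powr s" using elim by simp
      ultimately have "1 \<le> R powr s * (1 / norm x powr s)" by simp
      then have "norm (w x) powr q * 1 \<le> norm (w x) powr q * (R powr s * (1 / norm x powr s))" by (intro mult_left_mono) auto
      then show ?case unfolding hs_integrand[symmetric] by (simp add: mult_ac)
    qed
    show ?thesis
      using lp_space_bounded[OF lp_space_measurable[OF W0D(1)[OF w]] int ae] by (simp add: hs_mass_def lp_mass_def)
  qed
  have emb2: "lp_mass q M w \<le> R powr s * (dirichlet w / \<mu>) powr (q / p)" if w: "w \<in> W0" for w
  proof -
    have "hs_mass w powr (p / q) \<le> dirichlet w / \<mu>"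
      using hs_inequality(2)[OF w] mu_pos by (simp add: pos_le_divide_eq mult.commute)
    then have "(hs_mass w powr (p / q)) powr (q / p) \<le> (dirichlet w / \<mu>) powr (q / p)"
      using p_pos q_pos by (intro powr_mono2) auto
    then have "hs_mass w \<le> (dirichlet w / \<mu>) powr (q / p)" using p_pos q_pos hs_mass_nonneg[of w] by (simp add: powr_powr)
    then show ?thesis using emb[OF w] by (meson mult_left_mono order_trans powr_ge_zero)
  qed
  have "\<exists>\<phi>. test_function \<Omega> \<phi> \<and> lp_mass p M (\<lambda>x. v n x - \<phi> x) + lp_mass p M (\<lambda>x. wgrad (v n) x - gradient \<phi> x)
      < inverse (real (Suc n))" for n
    using v[of n] unfolding W0_iff by simp
  then obtain \<phi> where \<phi>: "\<And>n. test_function \<Omega> (\<phi> n)"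
    "\<And>n. lp_mass p M (\<lambda>x. v n x - \<phi> n x) + lp_mass p M (\<lambda>x. wgrad (v n) x - gradient (\<phi> n) x) < inverse (real (Suc n))"
    by metis
  have b: "lp_mass p M (\<lambda>x. v n x - \<phi> n x) \<le> inverse (real (Suc n))"
    "lp_mass p M (\<lambda>x. wgrad (v n) x - gradient (\<phi> n) x) \<le> inverse (real (Suc n))" for n
    using \<phi>(2)[of n] lp_mass_nonneg[of p M "\<lambda>x. v n x - \<phi> n x"]
      lp_mass_nonneg[of p M "\<lambda>x. wgrad (v n) x - gradient (\<phi> n) x"] by linarith+
  have i1: "inverse (real (Suc n)) \<le> 1" for n by (simp add: inverse_le_1_iff)
  have bd': "lp_mass p M (\<phi> n) \<le> 2 powr p * (c + 1)" "lp_mass p M (gradient (\<phi> n)) \<le> 2 powr p * (c + 1)" for n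
  proof -
    have "lp_mass p M (\<lambda>x. v n x - (v n x - \<phi> n x)) \<le> 2 powr p * (lp_mass p M (v n) + lp_mass p M (\<lambda>x. v n x - \<phi> n x))"
      by (intro lp_space_diff W0D v test_lp \<phi> p_pos)
    also have "\<dots> \<le> 2 powr p * (c + 1)" using bd(1)[of n] order_trans[OF b(1) i1, of n] by (intro mult_left_mono add_mono) auto
    finally show "lp_mass p M (\<phi> n) \<le> 2 powr p * (c + 1)" by simp
    have "lp_mass p M (\<lambda>x. wgrad (v n) x - (wgrad (v n) x - gradient (\<phi> n) x)) \<le> 2 powr p * (dirichlet (v n) + lp_mass p M (\<lambda>x. wgrad (v n) x - gradient (\<phi> n) x))"
      by (intro lp_space_diff W0D v test_lp \<phi> p_pos)
    also have "\<dots> \<le> 2 powr p * (c + 1)" using bd(2)[of n] order_trans[OF b(2) i1, of n] by (intro mult_left_mono add_mono) auto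
    finally show "lp_mass p M (gradient (\<phi> n)) \<le> 2 powr p * (c + 1)" by simp
  qed
  obtain \<sigma> :: "nat \<Rightarrow> nat" and u where \<sigma>: "strict_mono \<sigma>"
    and u: "\<And>r. subcritical r \<Longrightarrow> u \<in> lp_space r M"
    "\<And>r. subcritical r \<Longrightarrow> (\<lambda>n. lp_mass r M (\<lambda>x. \<phi> (\<sigma> n) x - u x)) \<longlonglongrightarrow> 0"
    by (rule rellich_test[OF \<phi>(1) bd' p_less[unfolded N_eq]]) (rule that)
  have inv: "(\<lambda>n. inverse (real (Suc (\<sigma> n)))) \<longlonglongrightarrow> 0"
    using LIMSEQ_subseq_LIMSEQ[OF LIMSEQ_inverse_real_of_nat \<sigma>] by (simp add: o_def)
  have comb: "(\<lambda>n. lp_mass r M (\<lambda>x. v (\<sigma> n) x - u x)) \<longlonglongrightarrow> 0"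
    if r: "subcritical r" and d: "\<And>n. v n \<in> lp_space r M" and l: "(\<lambda>n. lp_mass r M (\<lambda>x. v (\<sigma> n) x - \<phi> (\<sigma> n) x)) \<longlonglongrightarrow> 0" for r
  proof (rule tendsto_sandwich[OF _ _ tendsto_const])
    have r0: "0 < r" using r p_pos by (simp add: subcritical_def)
    show "(\<lambda>n. 2 powr r * (lp_mass r M (\<lambda>x. v (\<sigma> n) x - \<phi> (\<sigma> n) x) + lp_mass r M (\<lambda>x. \<phi> (\<sigma> n) x - u x))) \<longlonglongrightarrow> 0"
      using tendsto_mult_left[OF tendsto_add[OF l u(2)[OF r]], of "2 powr r"] by simp
    show "\<forall>\<^sub>F n in sequentially. lp_mass r M (\<lambda>x. v (\<sigma> n) x - u x) \<le>
        2 powr r * (lp_mass r M (\<lambda>x. v (\<sigma> n) x - \<phi> (\<sigma> n) x) + lp_mass r M (\<lambda>x. \<phi> (\<sigma> n) x - u x))"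
    proof (intro always_eventually allI)
      fix n
      have "lp_mass r M (\<lambda>x. (v (\<sigma> n) x - \<phi> (\<sigma> n) x) + (\<phi> (\<sigma> n) x - u x)) \<le>
        2 powr r * (lp_mass r M (\<lambda>x. v (\<sigma> n) x - \<phi> (\<sigma> n) x) + lp_mass r M (\<lambda>x. \<phi> (\<sigma> n) x - u x))"
        using r0 by (intro lp_space_add lp_space_diff d test_lp \<phi> u(1)[OF r]) auto
      then show "lp_mass r M (\<lambda>x. v (\<sigma> n) x - u x) \<le>
        2 powr r * (lp_mass r M (\<lambda>x. v (\<sigma> n) x - \<phi> (\<sigma> n) x) + lp_mass r M (\<lambda>x. \<phi> (\<sigma> n) x - u x))" by simp
    qed
  qed (simp add: lp_mass_nonneg)
  have 1: "(\<lambda>n. lp_mass p M (\<lambda>x. v (\<sigma> n) x - u x)) \<longlonglongrightarrow> 0"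
  proof (rule comb[OF q_subcritical(2) W0D(1)[OF v]])
    show "(\<lambda>n. lp_mass p M (\<lambda>x. v (\<sigma> n) x - \<phi> (\<sigma> n) x)) \<longlonglongrightarrow> 0"
      by (rule tendsto_sandwich[OF _ _ tendsto_const inv]) (use b(1) in \<open>auto simp: lp_mass_nonneg simp del: of_nat_Suc\<close>)
  qed
  have diffW: "(\<lambda>x. v n x - \<phi> n x) \<in> W0" for n using W0_lincomb(1)[OF v[of n] test_W0[OF \<phi>(1)[of n]], of "-1"] by simp
  have 2: "(\<lambda>n. lp_mass q M (\<lambda>x. v (\<sigma> n) x - u x)) \<longlonglongrightarrow> 0"
  proof (rule comb[OF q_subcritical(1)])
    show "v n \<in> lp_space q M" for n using emb[OF v] by blast
    show "(\<lambda>n. lp_mass q M (\<lambda>x. v (\<sigma> n) x - \<phi> (\<sigma> n) x)) \<longlonglongrightarrow> 0"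
    proof (rule tendsto_sandwich[OF _ _ tendsto_const])
      have "(\<lambda>n. R powr s * (inverse (real (Suc (\<sigma> n))) / \<mu>) powr (q / p)) \<longlonglongrightarrow> R powr s * (0 / \<mu>) powr (q / p)"
        using mu_pos q_pos p_pos by (intro tendsto_intros tendsto_powr' inv) auto
      then show "(\<lambda>n. R powr s * (inverse (real (Suc (\<sigma> n))) / \<mu>) powr (q / p)) \<longlonglongrightarrow> 0" by simp
      show "\<forall>\<^sub>F n in sequentially. lp_mass q M (\<lambda>x. v (\<sigma> n) x - \<phi> (\<sigma> n) x) \<le> R powr s * (inverse (real (Suc (\<sigma> n))) / \<mu>) powr (q / p)"
      proof (intro always_eventually allI)
        fix n
        have "dirichlet (\<lambda>x. v (\<sigma> n) x - \<phi> (\<sigma> n) x) \<le> inverse (real (Suc (\<sigma> n)))"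
          using b(2)[of "\<sigma> n"] W1_minus_test[OF W0_imp_W1[OF v] \<phi>(1), of "\<sigma> n" "\<sigma> n"] by simp
        then have "(dirichlet (\<lambda>x. v (\<sigma> n) x - \<phi> (\<sigma> n) x) / \<mu>) powr (q / p) \<le> (inverse (real (Suc (\<sigma> n))) / \<mu>) powr (q / p)"
          using mu_pos q_pos p_pos by (intro powr_mono2 divide_right_mono) (auto simp: lp_mass_nonneg)
        then show "lp_mass q M (\<lambda>x. v (\<sigma> n) x - \<phi> (\<sigma> n) x) \<le> R powr s * (inverse (real (Suc (\<sigma> n))) / \<mu>) powr (q / p)"
          using emb2[OF diffW[of "\<sigma> n"]] by (meson mult_left_mono order_trans powr_ge_zero)
      qed
    qed (simp add: lp_mass_nonneg)
  qed
  have "u \<in> W0" by (rule dirichlet_on_lower_semicontinuous(1)[OF v bd(2) u(1)[OF q_subcritical(2)] 1])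
  then show ?thesis using that[OF \<sigma> _ u(1)[OF q_subcritical(1)] 1 _ 2] emb[OF v] by blast
qed

end

section \<open>Concentration at the origin\<close>

context hs_setting
begin

lemma lp_dominated:
  fixes f :: "'a \<Rightarrow> 'b::euclidean_space" and g :: "'a \<Rightarrow> 'c::euclidean_space"
  assumes "f \<in> borel_measurable M" "g \<in> lp_space r M" "0 < r" "\<And>x. x \<in> \<Omega> \<Longrightarrow> norm (f x) \<le> norm (g x)"
  shows "f \<in> lp_space r M" "lp_mass r M f \<le> lp_mass r M g"
proof -
  have ae: "AE x in M. norm (f x) powr r \<le> norm (g x) powr r"
    using assms(3,4) space_M by (intro AE_I2 powr_mono2) auto
  show "f \<in> lp_space r M" "lp_mass r M f \<le> lp_mass r M g"
    using lp_space_bounded[OF assms(1) lp_space_integrable[OF assms(2)] ae] by (auto simp: lp_mass_def)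
qed

abbreviation "near r \<equiv> {x \<in> space M. norm x < r}"
abbreviation "far r \<equiv> {x \<in> space M. \<not> norm x < r}"

lemma norm_measurable_M: "(\<lambda>x::'a. norm x) \<in> borel_measurable M"
  by (rule borel_imp_measurable_M) measurable

lemma near_far_sets [measurable]: "near r \<in> sets M" "far r \<in> sets M"
  using norm_measurable_M by measurable

lemma near_far_split:
  fixes f :: "'a \<Rightarrow> 'b::euclidean_space"
  assumes f: "f \<in> lp_space t M" and t: "0 < t"
  shows "lp_mass t M (\<lambda>x. indicator (near r) x *\<^sub>R f x) + lp_mass t M (\<lambda>x. indicator (far r) x *\<^sub>R f x) = lp_mass t M f"
proof -
  note I = lp_indicator(1)[OF f _ less_imp_le[OF t], THEN lp_space_integrable]
  have "lp_mass t M f = (LINT x|M. norm (indicator (near r) x *\<^sub>R f x) powr t + norm (indicator (far r) x *\<^sub>R f x) powr t)"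
    unfolding lp_mass_def using t by (intro Bochner_Integration.integral_cong) (auto simp: indicator_def)
  then show ?thesis using I[OF near_far_sets(1), of r] I[OF near_far_sets(2), of r] by (simp add: lp_mass_def)
qed

lemma near_mass_vanishes:
  fixes f :: "'a \<Rightarrow> 'b::euclidean_space"
  assumes f: "f \<in> lp_space t M" and t: "0 < t"
  shows "(\<lambda>k. lp_mass t M (\<lambda>x. indicator (near (2 * inverse (real (Suc k)))) x *\<^sub>R f x)) \<longlonglongrightarrow> 0"
proof -
  have [measurable]: "f \<in> borel_measurable M" using f by (rule lp_space_measurable)
  have "(\<lambda>k. LINT x|M. norm (indicator (near (2 * inverse (real (Suc k)))) x *\<^sub>R f x) powr t) \<longlonglongrightarrow> (LINT x|M. 0)"
  proof (rule integral_dominated_convergence[where w = "\<lambda>x. norm (f x) powr t"])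
    show "integrable M (\<lambda>x. norm (f x) powr t)" by (rule lp_space_integrable[OF f])
    show "AE x in M. norm (norm (indicator (near (2 * inverse (real (Suc k)))) x *\<^sub>R f x) powr t) \<le> norm (f x) powr t" for k
      using t by (intro AE_I2) (auto simp: indicator_def)
    show "AE x in M. (\<lambda>k. norm (indicator (near (2 * inverse (real (Suc k)))) x *\<^sub>R f x) powr t) \<longlonglongrightarrow> 0"
      using AE_nonzero
    proof eventually_elim
      case (elim x)
      have "(\<lambda>k. 2 * inverse (real (Suc k))) \<longlonglongrightarrow> 2 * 0" by (intro tendsto_intros LIMSEQ_inverse_real_of_nat)
      then have "\<forall>\<^sub>F k in sequentially. 2 * inverse (real (Suc k)) < norm x"
        by (rule order_tendstoD(2)) (use elim in simp)
      then have "\<forall>\<^sub>F k in sequentially. norm (indicator (near (2 * inverse (real (Suc k)))) x *\<^sub>R f x) powr t = 0"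
        by eventually_elim (simp add: indicator_def)
      then show ?case by (rule tendsto_eventually)
    qed
  qed measurable
  then show ?thesis by (simp add: lp_mass_def)
qed

text \<open>
  The weighted volume of a ball, raised to this power, scales like \<open>r\<^sup>p\<close>. This balances the factor \<open>r\<^sup>-\<^sup>p\<close> that
  comes from the gradient of the cutoff function.
\<close>

lemma near_weight:
  assumes r: "0 < r"
  shows "(LINT x|M. indicator (near r) x * norm x powr hexp) powr ((p - s) / (N - s)) \<le> (2 * r) powr p"
proof -
  interpret finite_measure M by (rule finite_dom)
  have "(LINT x|M. indicator (near r) x * norm x powr hexp) \<le> (LINT x|M. indicator (near r) x * r powr hexp)"
  proof (rule integral_mono)
    have b: "norm (indicator (near r) x * norm x powr hexp) \<le> r powr hexp" for x
      using hexp_pos by (auto simp: indicator_def intro: powr_mono2)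
    show "integrable M (\<lambda>x. indicator (near r) x * norm x powr hexp)"
    proof (rule integrable_const_bound[where B = "r powr hexp"])
      note [measurable] = norm_measurable_M
      show "(\<lambda>x. indicator (near r) x * norm x powr hexp) \<in> borel_measurable M" by measurable
    qed (use b in auto)
    show "integrable M (\<lambda>x. indicator (near r) x * r powr hexp)"
      by (intro integrable_mult_left integrable_real_indicator near_far_sets) (simp add: emeasure_eq_measure)
    show "indicator (near r) x * norm x powr hexp \<le> indicator (near r) x * r powr hexp" for x
      using hexp_pos by (auto simp: indicator_def intro: powr_mono2)
  qed
  also have "\<dots> = measure M (near r) * r powr hexp"
  proof -
    have "near r \<inter> space M = near r" by auto
    then show ?thesis by simp
  qed
  also have "measure M (near r) \<le> (2 * r) powr N"
  proof -
    have sub: "near r \<subseteq> cbox (- r *\<^sub>R One) (r *\<^sub>R One)"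
    proof
      fix x assume "x \<in> near r"
      then have "\<bar>x \<bullet> b\<bar> \<le> r" if "b \<in> Basis" for b using Basis_le_norm[OF that, of x] by simp
      then show "x \<in> cbox (- r *\<^sub>R One) (r *\<^sub>R One)" by (force simp: mem_box abs_le_iff)
    qed
    have "measure M (near r) = measure lebesgue (near r)"
      using dom_lebesgue space_M by (intro measure_restrict_space) auto
    also have "\<dots> \<le> measure lebesgue (cbox (- r *\<^sub>R One) (r *\<^sub>R One :: 'a))"
    proof (rule measure_mono_fmeasurable[OF sub])
      show "near r \<in> sets lebesgue" using near_far_sets(1) dom_lebesgue by (auto simp: sets_restrict_space_iff)
    qed simp
    also have "\<dots> = (\<Prod>b\<in>(Basis::'a set). (r *\<^sub>R One - (- r *\<^sub>R One)) \<bullet> b)"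
    proof -
      have "measure lebesgue (cbox (- r *\<^sub>R One) (r *\<^sub>R One :: 'a)) = measure lborel (cbox (- r *\<^sub>R One) (r *\<^sub>R One :: 'a))"
        by (rule measure_completion) simp
      also have "\<dots> = (\<Prod>b\<in>(Basis::'a set). (r *\<^sub>R One) \<bullet> b - (- r *\<^sub>R One) \<bullet> b)"
        by (rule content_cbox) (use r in \<open>simp add: inner_minus_left\<close>)
      finally show ?thesis by (simp only: inner_diff_left)
    qed
    also have "\<dots> = (\<Prod>b\<in>(Basis::'a set). 2 * r)"
      by (intro prod.cong) (auto simp: inner_minus_left inner_diff_left inner_add_left)
    also have "\<dots> = (2 * r) powr N" using r by (simp add: N_eq powr_realpow)
    finally show ?thesis .
  qed
  then have "measure M (near r) * r powr hexp \<le> (2 * r) powr N * (2 * r) powr hexp"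
    using r hexp_pos by (intro mult_mono powr_mono2) auto
  also have "\<dots> = (2 * r) powr (N + hexp)" by (simp only: powr_add)
  finally have "(LINT x|M. indicator (near r) x * norm x powr hexp) powr ((p - s) / (N - s)) \<le> ((2 * r) powr (N + hexp)) powr ((p - s) / (N - s))"
    using p_less s_less by (intro powr_mono2) (auto intro!: integral_nonneg)
  also have "\<dots> = (2 * r) powr ((N + hexp) * ((p - s) / (N - s)))" by (simp only: powr_powr)
  also have "(N + hexp) * ((p - s) / (N - s)) = p"
  proof -
    have nz: "p - s \<noteq> 0" "N - s \<noteq> 0" using s_less p_less by auto
    have "N + hexp = p * (N - s) / (p - s)" using nz by (simp add: field_simps)
    then show ?thesis using nz by simp
  qed
  finally show ?thesis .
qed

text \<open>
  The Hardy-Sobolev inequality for \<open>\<eta> v\<close>, where \<open>\<eta>\<close> is the cutoff function for the ball of radius \<open>r\<close>. Its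
  gradient is \<open>\<eta> \<nabla>v + v \<nabla>\<eta>\<close>; the second term is of lower order.
\<close>

lemma cutoff_estimate:
  assumes d: "0 < \<delta>"
  obtains C where "0 \<le> C"
    "\<And>v r. v \<in> W0 \<Longrightarrow> 0 < r \<Longrightarrow>
       \<mu> * (hs_mass v - lp_mass q M (\<lambda>x. indicator (far r) x *\<^sub>R (hw x * v x))) powr (p / q)
        \<le> (1 + \<delta>) * lp_mass p M (\<lambda>x. indicator (near (2 * r)) x *\<^sub>R wgrad v x)
          + C / r powr p * lp_mass p M (\<lambda>x. indicator (near (2 * r)) x *\<^sub>R v x)"
proof -
  obtain G where G: "0 \<le> G" "\<And>r. 0 < r \<Longrightarrow> \<exists>\<eta>::'a \<Rightarrow> real. smooth \<eta> \<and>
    (\<forall>x. 0 \<le> \<eta> x \<and> \<eta> x \<le> 1 \<and> norm (gradient \<eta> x) \<le> G / r) \<and>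
    (\<forall>x. norm x \<le> r \<longrightarrow> \<eta> x = 1) \<and> (\<forall>x. 2 * r \<le> norm x \<longrightarrow> \<eta> x = 0 \<and> gradient \<eta> x = 0)"
    by (rule cutoff_exists) (rule that)
  obtain C where C: "0 \<le> C" "\<And>f g::'a \<Rightarrow> 'a. f \<in> lp_space p M \<Longrightarrow> g \<in> lp_space p M \<Longrightarrow>
       lp_mass p M (\<lambda>x. f x + g x) \<le> (1 + \<delta>) * lp_mass p M f + C * lp_mass p M g"
    by (rule lp_mass_triangle_eps[OF p_pos d]) (rule that)
  show ?thesis
  proof (rule that[of "C * G powr p"])
    show "0 \<le> C * G powr p" using C(1) by simp
    fix v r assume v: "v \<in> W0" and r: "(0::real) < r"
    obtain \<eta> :: "'a \<Rightarrow> real" where \<eta>: "smooth \<eta>" "\<And>x. 0 \<le> \<eta> x" "\<And>x. \<eta> x \<le> 1" "\<And>x. norm (gradient \<eta> x) \<le> G / r"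
      "\<And>x. norm x \<le> r \<Longrightarrow> \<eta> x = 1" "\<And>x. 2 * r \<le> norm x \<Longrightarrow> \<eta> x = 0" "\<And>x. 2 * r \<le> norm x \<Longrightarrow> gradient \<eta> x = 0"
      using G(2)[OF r] by blast
    have abs1: "\<bar>\<eta> x\<bar> \<le> 1" for x using \<eta>(2,3)[of x] by simp
    note m = W0_mult_smooth[OF v \<eta>(1) abs1 \<eta>(4)]
    have [measurable]: "\<eta> \<in> borel_measurable M" "gradient \<eta> \<in> borel_measurable M" "v \<in> borel_measurable M"
      "wgrad v \<in> borel_measurable M" "hw \<in> borel_measurable M"
      using smooth_borel_measurable[OF \<eta>(1), THEN borel_imp_measurable_M] W0D(1,3)[OF v, THEN lp_space_measurable] hw_measurable_M
      by simp_all
    let ?nw = "\<lambda>x. indicator (near (2 * r)) x *\<^sub>R wgrad v x"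
    let ?nv = "\<lambda>x. indicator (near (2 * r)) x *\<^sub>R v x"
    have nw: "?nw \<in> lp_space p M" and nv: "?nv \<in> lp_space p M"
      using lp_indicator(1)[OF W0D(3)[OF v] near_far_sets(1)] lp_indicator(1)[OF W0D(1)[OF v] near_far_sets(1)] p_pos by auto
    have 1: "(\<lambda>x. \<eta> x *\<^sub>R wgrad v x) \<in> lp_space p M" "lp_mass p M (\<lambda>x. \<eta> x *\<^sub>R wgrad v x) \<le> lp_mass p M ?nw"
    proof -
      have pw: "norm (\<eta> x *\<^sub>R wgrad v x) \<le> norm (?nw x)" if "x \<in> \<Omega>" for x
        using \<eta>(6)[of x] abs1[of x] that space_M by (cases "norm x < 2 * r") (auto intro: mult_left_le_one_le)
      show "(\<lambda>x. \<eta> x *\<^sub>R wgrad v x) \<in> lp_space p M" "lp_mass p M (\<lambda>x. \<eta> x *\<^sub>R wgrad v x) \<le> lp_mass p M ?nw"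
        by (rule lp_dominated[OF _ nw p_pos pw]; measurable)+
    qed
    have 2: "(\<lambda>x. v x *\<^sub>R gradient \<eta> x) \<in> lp_space p M" "lp_mass p M (\<lambda>x. v x *\<^sub>R gradient \<eta> x) \<le> (G / r) powr p * lp_mass p M ?nv"
    proof -
      have sc: "(\<lambda>x. (G / r) *\<^sub>R ?nv x) \<in> lp_space p M" "lp_mass p M (\<lambda>x. (G / r) *\<^sub>R ?nv x) = (G / r) powr p * lp_mass p M ?nv"
        using lp_space_scaleR[OF nv p_pos, of "G / r"] G(1) r by auto
      have pw: "norm (v x *\<^sub>R gradient \<eta> x) \<le> norm ((G / r) *\<^sub>R ?nv x)" if "x \<in> \<Omega>" for x
      proof (cases "norm x < 2 * r")
        case True
        have "\<bar>v x\<bar> * norm (gradient \<eta> x) \<le> \<bar>v x\<bar> * (G / r)" by (intro mult_left_mono \<eta>(4)) simp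
        then show ?thesis using True that space_M G(1) r by (simp add: mult.commute abs_mult)
      qed (use \<eta>(7)[of x] in auto)
      show "(\<lambda>x. v x *\<^sub>R gradient \<eta> x) \<in> lp_space p M" by (rule lp_dominated(1)[OF _ sc(1) p_pos pw]) measurable
      show "lp_mass p M (\<lambda>x. v x *\<^sub>R gradient \<eta> x) \<le> (G / r) powr p * lp_mass p M ?nv"
        unfolding sc(2)[symmetric] by (rule lp_dominated(2)[OF _ sc(1) p_pos pw]) measurable
    qed
    have hv: "(\<lambda>x. hw x * v x) \<in> lp_space q M" by (rule hs_inequality(1)[OF v])
    have hm: "(\<lambda>x. hw x * (\<eta> x * v x)) \<in> lp_space q M" by (rule hs_inequality(1)[OF m(1)])
    have 3: "lp_mass q M (\<lambda>x. indicator (near r) x *\<^sub>R (hw x * v x)) \<le> hs_mass (\<lambda>x. \<eta> x * v x)"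
      unfolding hs_mass_def
    proof (rule lp_dominated(2)[OF _ hm q_pos])
      show "norm (indicator (near r) x *\<^sub>R (hw x * v x)) \<le> norm (hw x * (\<eta> x * v x))" for x
        using \<eta>(5)[of x] by (cases "norm x < r") (auto simp: indicator_def)
    qed measurable
    have "hs_mass v - lp_mass q M (\<lambda>x. indicator (far r) x *\<^sub>R (hw x * v x)) = lp_mass q M (\<lambda>x. indicator (near r) x *\<^sub>R (hw x * v x))"
      using near_far_split[OF hv q_pos, of r] by (simp add: hs_mass_def)
    then have "\<mu> * (hs_mass v - lp_mass q M (\<lambda>x. indicator (far r) x *\<^sub>R (hw x * v x))) powr (p / q) \<le> \<mu> * hs_mass (\<lambda>x. \<eta> x * v x) powr (p / q)"
      using 3 mu_pos p_pos q_pos by (simp only:) (intro mult_left_mono powr_mono2, auto simp: lp_mass_nonneg)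
    also have "\<dots> \<le> dirichlet (\<lambda>x. \<eta> x * v x)" by (rule hs_inequality(2)[OF m(1)])
    also have "\<dots> = lp_mass p M (\<lambda>x. \<eta> x *\<^sub>R wgrad v x + v x *\<^sub>R gradient \<eta> x)"
      by (rule lp_mass_AE_eq[OF m(2)]) (use 1 2 p_pos in \<open>auto intro: lp_space_add\<close>)
    also have "\<dots> \<le> (1 + \<delta>) * lp_mass p M (\<lambda>x. \<eta> x *\<^sub>R wgrad v x) + C * lp_mass p M (\<lambda>x. v x *\<^sub>R gradient \<eta> x)"
      by (rule C(2)[OF 1(1) 2(1)])
    also have "\<dots> \<le> (1 + \<delta>) * lp_mass p M ?nw + C * ((G / r) powr p * lp_mass p M ?nv)"
      using 1(2) 2(2) C(1) d by (intro add_mono mult_left_mono) auto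
    also have "C * ((G / r) powr p * lp_mass p M ?nv) = C * G powr p / r powr p * lp_mass p M ?nv"
      using G(1) r by (simp add: powr_divide)
    finally show "\<mu> * (hs_mass v - lp_mass q M (\<lambda>x. indicator (far r) x *\<^sub>R (hw x * v x))) powr (p / q)
        \<le> (1 + \<delta>) * lp_mass p M ?nw + C * G powr p / r powr p * lp_mass p M ?nv" .
  qed
qed

text \<open>
  Otherwise a tail of the sequence would contradict lower semicontinuity.
\<close>

lemma dirichlet_far_frequently:
  assumes v: "\<And>n::nat. v n \<in> W0" and bd: "\<And>n. dirichlet (v n) \<le> c"
    and u: "u \<in> lp_space p M" and lim: "(\<lambda>n. lp_mass p M (\<lambda>x. v n x - u x)) \<longlonglongrightarrow> 0"
    and A: "A \<in> sets M" and e: "0 < \<epsilon>"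
  shows "\<exists>n\<ge>n0. lp_mass p M (\<lambda>x. indicator A x *\<^sub>R wgrad u x) - \<epsilon> < lp_mass p M (\<lambda>x. indicator A x *\<^sub>R wgrad (v n) x)"
proof (rule ccontr)
  assume "\<not> ?thesis"
  then have le: "lp_mass p M (\<lambda>x. indicator A x *\<^sub>R wgrad (v (n + n0)) x) \<le> lp_mass p M (\<lambda>x. indicator A x *\<^sub>R wgrad u x) - \<epsilon>" for n
    by (auto simp: not_less)
  have "lp_mass p M (\<lambda>x. indicator A x *\<^sub>R wgrad u x) \<le> lp_mass p M (\<lambda>x. indicator A x *\<^sub>R wgrad u x) - \<epsilon>"
    by (rule dirichlet_on_lower_semicontinuous(2)[where v = "\<lambda>n. v (n + n0)", OF v bd u LIMSEQ_ignore_initial_segment[OF lim] A le])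
  then show False using e by simp
qed

text \<open>
  Away from the origin the constraint is continuous and the energy lower semicontinuous along the sequence.
  Near the origin the cutoff estimate bounds the lost part of the constraint by the remaining energy. Then the
  radius and finally \<open>\<delta>\<close> tend to 0.
\<close>

lemma concentration_bound:
  assumes v: "\<And>n::nat. v n \<in> W0" and one: "\<And>n. hs_mass (v n) = 1" and bd: "\<And>n. dirichlet (v n) \<le> c"
    and D: "\<And>n. dirichlet (v n) \<le> D n" "D \<longlonglongrightarrow> T"
    and u: "u \<in> W0" "u \<in> lp_space q M" and vq: "\<And>n. v n \<in> lp_space q M"
    and lim: "(\<lambda>n. lp_mass p M (\<lambda>x. v n x - u x)) \<longlonglongrightarrow> 0" "(\<lambda>n. lp_mass q M (\<lambda>x. v n x - u x)) \<longlonglongrightarrow> 0"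
    and u1: "hs_mass u \<le> 1"
  shows "\<mu> * (1 - hs_mass u) powr (p / q) \<le> T - dirichlet u"
proof -
  define g where "g = (\<lambda>r. lp_mass p M (\<lambda>x. indicator (far (2 * r)) x *\<^sub>R wgrad u x))"
  define m where "m = (\<lambda>r. lp_mass p M (\<lambda>x. indicator (near (2 * r)) x *\<^sub>R u x))"
  have hu: "(\<lambda>x. hw x * u x) \<in> lp_space q M" by (rule hs_inequality(1)[OF u(1)])
  have hv: "(\<lambda>x. hw x * v n x) \<in> lp_space q M" for n by (rule hs_inequality(1)[OF v])
  have main: "\<mu> * (1 - hs_mass u) powr (p / q) \<le> (1 + \<delta>) * (T - dirichlet u)" if d: "0 < \<delta>" for \<delta>
  proof -
    obtain C where C: "0 \<le> C" "\<And>v r. v \<in> W0 \<Longrightarrow> 0 < r \<Longrightarrow>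
       \<mu> * (hs_mass v - lp_mass q M (\<lambda>x. indicator (far r) x *\<^sub>R (hw x * v x))) powr (p / q)
        \<le> (1 + \<delta>) * lp_mass p M (\<lambda>x. indicator (near (2 * r)) x *\<^sub>R wgrad v x)
          + C / r powr p * lp_mass p M (\<lambda>x. indicator (near (2 * r)) x *\<^sub>R v x)"
      by (rule cutoff_estimate[OF d]) (rule that)
    \<comment> \<open>The slack allowed in lower semicontinuity is \<open>r\<close> itself, so that it vanishes together with the radius.\<close>
    have fixed_r: "\<mu> * (1 - hs_mass u) powr (p / q) \<le> (1 + \<delta>) * (T - g r + r) + C / r powr p * m r" if r: "0 < r" for r
    proof -
      define b where "b = (\<lambda>w. lp_mass q M (\<lambda>x. indicator (far r) x *\<^sub>R (hw x * w x)))"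
      define mm where "mm = (\<lambda>n. lp_mass p M (\<lambda>x. indicator (near (2 * r)) x *\<^sub>R v n x))"
      have fl: "(\<lambda>x. indicator (far r) x *\<^sub>R (hw x * v n x)) \<in> lp_space q M" "(\<lambda>x. indicator (far r) x *\<^sub>R (hw x * u x)) \<in> lp_space q M" for n
        using lp_indicator(1)[OF hv near_far_sets(2)] lp_indicator(1)[OF hu near_far_sets(2)] q_pos by auto
      have b1: "b w \<le> hs_mass w" if "(\<lambda>x. hw x * w x) \<in> lp_space q M" for w
        using lp_indicator(2)[OF that near_far_sets(2)] q_pos by (simp add: b_def hs_mass_def)
      have blim: "(\<lambda>n. b (v n)) \<longlonglongrightarrow> b u" unfolding b_def
      proof (rule lp_mass_tendsto[OF fl q_pos])
        show "(\<lambda>n. lp_mass q M (\<lambda>x. indicator (far r) x *\<^sub>R (hw x * v n x) - indicator (far r) x *\<^sub>R (hw x * u x))) \<longlonglongrightarrow> 0"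
        proof (rule tendsto_sandwich[OF _ _ tendsto_const])
          show "(\<lambda>n. \<bar>r powr (- s / q)\<bar> powr q * lp_mass q M (\<lambda>x. v n x - u x)) \<longlonglongrightarrow> 0"
            using tendsto_mult_left[OF lim(2), of "\<bar>r powr (- s / q)\<bar> powr q"] by simp
          show "\<forall>\<^sub>F n in sequentially. lp_mass q M (\<lambda>x. indicator (far r) x *\<^sub>R (hw x * v n x) - indicator (far r) x *\<^sub>R (hw x * u x))
              \<le> \<bar>r powr (- s / q)\<bar> powr q * lp_mass q M (\<lambda>x. v n x - u x)"
          proof (intro always_eventually allI)
            fix n
            have dl: "(\<lambda>x. v n x - u x) \<in> lp_space q M" by (intro lp_space_diff vq u q_pos)
            note sc = lp_space_scaleR[OF dl q_pos, of "r powr (- s / q)"]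
            have pw: "norm (indicator (far r) x *\<^sub>R (hw x * v n x) - indicator (far r) x *\<^sub>R (hw x * u x))
                \<le> norm (r powr (- s / q) *\<^sub>R (v n x - u x))" for x
            proof (cases "x \<in> far r")
              case True
              then have "hw x \<le> r powr (- s / q)" unfolding hw_def using r s_pos q_pos by (intro powr_mono2') auto
              then have "hw x * \<bar>v n x - u x\<bar> \<le> r powr (- s / q) * \<bar>v n x - u x\<bar>" by (rule mult_right_mono) simp
              then show ?thesis using True by (simp add: right_diff_distrib[symmetric] abs_mult abs_of_nonneg[OF hw_nonneg])
            qed simp
            show "lp_mass q M (\<lambda>x. indicator (far r) x *\<^sub>R (hw x * v n x) - indicator (far r) x *\<^sub>R (hw x * u x))
              \<le> \<bar>r powr (- s / q)\<bar> powr q * lp_mass q M (\<lambda>x. v n x - u x)"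
              unfolding sc(2)[symmetric]
              by (rule lp_dominated(2)[OF lp_space_measurable[OF lp_space_diff(1)[OF fl q_pos]] sc(1) q_pos pw])
          qed
        qed (simp add: lp_mass_nonneg)
      qed
      have nl: "(\<lambda>x. indicator (near (2 * r)) x *\<^sub>R v n x) \<in> lp_space p M" "(\<lambda>x. indicator (near (2 * r)) x *\<^sub>R u x) \<in> lp_space p M" for n
        using lp_indicator(1)[OF W0D(1)[OF v] near_far_sets(1)] lp_indicator(1)[OF W0D(1)[OF u(1)] near_far_sets(1)] p_pos by auto
      have mlim: "mm \<longlonglongrightarrow> m r" unfolding m_def mm_def
      proof (rule lp_mass_tendsto[OF nl p_pos])
        show "(\<lambda>n. lp_mass p M (\<lambda>x. indicator (near (2 * r)) x *\<^sub>R v n x - indicator (near (2 * r)) x *\<^sub>R u x)) \<longlonglongrightarrow> 0"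
        proof (rule tendsto_sandwich[OF _ _ tendsto_const lim(1)])
          show "\<forall>\<^sub>F n in sequentially. lp_mass p M (\<lambda>x. indicator (near (2 * r)) x *\<^sub>R v n x - indicator (near (2 * r)) x *\<^sub>R u x)
              \<le> lp_mass p M (\<lambda>x. v n x - u x)"
          proof (intro always_eventually allI)
            fix n
            have dl: "(\<lambda>x. v n x - u x) \<in> lp_space p M" by (intro lp_space_diff W0D v u p_pos)
            show "lp_mass p M (\<lambda>x. indicator (near (2 * r)) x *\<^sub>R v n x - indicator (near (2 * r)) x *\<^sub>R u x) \<le> lp_mass p M (\<lambda>x. v n x - u x)"
              by (rule lp_dominated(2)[OF lp_space_measurable[OF lp_space_diff(1)[OF nl p_pos]] dl p_pos]) (auto simp: indicator_def)
          qed
        qed (simp add: lp_mass_nonneg)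
      qed
      \<comment> \<open>Semicontinuity yields \<open>X n \<ge> 0\<close> for infinitely many \<open>n\<close> only, which is enough for the sign of the limit.\<close>
      define X where "X = (\<lambda>n. (1 + \<delta>) * (D n - g r + r) + C / r powr p * mm n - \<mu> * (1 - b (v n)) powr (p / q))"
      have Xlim: "X \<longlonglongrightarrow> (1 + \<delta>) * (T - g r + r) + C / r powr p * m r - \<mu> * (1 - b u) powr (p / q)"
        unfolding X_def using p_pos q_pos b1[OF hv] one
        by (intro tendsto_intros tendsto_powr' D(2) mlim blim always_eventually allI disjI2 conjI) auto
      have "0 \<le> (1 + \<delta>) * (T - g r + r) + C / r powr p * m r - \<mu> * (1 - b u) powr (p / q)"
      proof (rule ccontr)
        assume "\<not> ?thesis"
        then have "\<forall>\<^sub>F n in sequentially. X n < 0" by (intro order_tendstoD(2)[OF Xlim]) simp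
        then obtain n0 where n0: "\<And>n. n \<ge> n0 \<Longrightarrow> X n < 0" unfolding eventually_sequentially by blast
        obtain n where n: "n \<ge> n0" "g r - r < lp_mass p M (\<lambda>x. indicator (far (2 * r)) x *\<^sub>R wgrad (v n) x)"
          using dirichlet_far_frequently[OF v bd W0D(1)[OF u(1)] lim(1) near_far_sets(2) r, of n0] unfolding g_def by blast
        have "lp_mass p M (\<lambda>x. indicator (near (2 * r)) x *\<^sub>R wgrad (v n) x) \<le> D n - g r + r"
          using near_far_split[OF W0D(3)[OF v] p_pos, of "2 * r" n] n(2) D(1)[of n] by linarith
        then have "(1 + \<delta>) * lp_mass p M (\<lambda>x. indicator (near (2 * r)) x *\<^sub>R wgrad (v n) x) \<le> (1 + \<delta>) * (D n - g r + r)"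
          using d by (intro mult_left_mono) auto
        then have "0 \<le> X n" using C(2)[OF v r, of n] unfolding X_def mm_def b_def one by linarith
        then show False using n0[OF n(1)] by simp
      qed
      moreover have "\<mu> * (1 - hs_mass u) powr (p / q) \<le> \<mu> * (1 - b u) powr (p / q)"
        using b1[OF hu] u1 mu_pos p_pos q_pos by (intro mult_left_mono powr_mono2) auto
      ultimately show ?thesis by linarith
    qed
    define \<rho> where "\<rho> = (\<lambda>k. inverse (real (Suc k)))"
    have \<rho>: "0 < \<rho> k" for k by (simp add: \<rho>_def)
    have \<rho>lim: "\<rho> \<longlonglongrightarrow> 0" unfolding \<rho>_def by (rule LIMSEQ_inverse_real_of_nat)
    have glim: "(\<lambda>k. g (\<rho> k)) \<longlonglongrightarrow> dirichlet u"
    proof -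
      have "g r = dirichlet u - lp_mass p M (\<lambda>x. indicator (near (2 * r)) x *\<^sub>R wgrad u x)" for r
        using near_far_split[OF W0D(3)[OF u(1)] p_pos, of "2 * r"] by (simp add: g_def)
      moreover have "(\<lambda>k. dirichlet u - lp_mass p M (\<lambda>x. indicator (near (2 * \<rho> k)) x *\<^sub>R wgrad u x)) \<longlonglongrightarrow> dirichlet u - 0"
        unfolding \<rho>_def by (intro tendsto_diff tendsto_const near_mass_vanishes W0D u p_pos)
      ultimately show ?thesis by simp
    qed
    have mlim: "(\<lambda>k. C / \<rho> k powr p * m (\<rho> k)) \<longlonglongrightarrow> 0"
    proof (rule tendsto_sandwich[OF _ _ tendsto_const])
      let ?h = "\<lambda>k. hs_mass (\<lambda>x. indicator (near (2 * \<rho> k)) x *\<^sub>R u x)"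
      have heq: "?h k = lp_mass q M (\<lambda>x. indicator (near (2 * \<rho> k)) x *\<^sub>R (hw x * u x))" for k
        unfolding hs_mass_def by (simp add: mult.left_commute)
      have hl: "?h \<longlonglongrightarrow> 0" unfolding heq unfolding \<rho>_def by (rule near_mass_vanishes[OF hu q_pos])
      have "(\<lambda>k. C * 4 powr p * ?h k powr (p / q)) \<longlonglongrightarrow> C * 4 powr p * 0 powr (p / q)"
        using p_pos q_pos by (intro tendsto_intros tendsto_powr' hl always_eventually allI disjI2 conjI hs_mass_nonneg) auto
      then show "(\<lambda>k. C * 4 powr p * ?h k powr (p / q)) \<longlonglongrightarrow> 0" by simp
      show "\<forall>\<^sub>F k in sequentially. C / \<rho> k powr p * m (\<rho> k) \<le> C * 4 powr p * ?h k powr (p / q)"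
      proof (intro always_eventually allI)
        fix k
        have "m (\<rho> k) \<le> (2 * (2 * \<rho> k)) powr p * ?h k powr (p / q)"
          unfolding m_def using holder_weighted[OF W0D(1)[OF u(1)] hu near_far_sets(1), of "2 * \<rho> k"]
            mult_right_mono[OF near_weight[of "2 * \<rho> k"], of "?h k powr (p / q)"] \<rho>[of k] by simp
        also have "(2 * (2 * \<rho> k)) powr p = 4 powr p * \<rho> k powr p" using \<rho>[of k] by (simp add: powr_mult[symmetric])
        finally have "C / \<rho> k powr p * m (\<rho> k) \<le> C / \<rho> k powr p * (4 powr p * \<rho> k powr p * ?h k powr (p / q))"
          using C(1) by (intro mult_left_mono) auto
        also have "\<dots> = C * 4 powr p * ?h k powr (p / q)" using \<rho>[of k] by simp
        finally show "C / \<rho> k powr p * m (\<rho> k) \<le> C * 4 powr p * ?h k powr (p / q)" .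
      qed
    qed (use C(1) in \<open>auto simp: m_def lp_mass_nonneg\<close>)
    have "(\<lambda>k. (1 + \<delta>) * (T - g (\<rho> k) + \<rho> k) + C / \<rho> k powr p * m (\<rho> k)) \<longlonglongrightarrow> (1 + \<delta>) * (T - dirichlet u + 0) + 0"
      by (intro tendsto_intros glim \<rho>lim mlim)
    then show ?thesis using fixed_r[OF \<rho>] by (intro LIMSEQ_le_const) auto
  qed
  have "(\<lambda>k. (1 + inverse (real (Suc k))) * (T - dirichlet u)) \<longlonglongrightarrow> (1 + 0) * (T - dirichlet u)"
    by (intro tendsto_intros LIMSEQ_inverse_real_of_nat)
  then have "(\<lambda>k. (1 + inverse (real (Suc k))) * (T - dirichlet u)) \<longlonglongrightarrow> T - dirichlet u" by simp
  then show ?thesis by (rule LIMSEQ_le_const) (use main in auto)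
qed

end

section \<open>The first eigenvalue and the minimisers\<close>

context hs_setting
begin

abbreviation "mass u \<equiv> lp_mass p M u"

lemma dirichlet_line:
  assumes "u \<in> W0" "v \<in> W0"
  shows "dirichlet (\<lambda>x. u x + t * v x) = lp_mass p M (\<lambda>x. wgrad u x + t *\<^sub>R wgrad v x)"
  by (rule lp_mass_AE_eq[OF W0_lincomb(2)[OF assms] lp_lincomb[OF W0D(3)[OF assms(1)] W0D(3)[OF assms(2)]]])

definition grad_pairing :: "('a \<Rightarrow> real) \<Rightarrow> ('a \<Rightarrow> real) \<Rightarrow> real" where
  "grad_pairing u v = (LINT x|M. power_flux p (wgrad u x) \<bullet> wgrad v x)"

definition mass_pairing :: "('a \<Rightarrow> real) \<Rightarrow> ('a \<Rightarrow> real) \<Rightarrow> real" where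
  "mass_pairing u v = (LINT x|M. power_flux p (u x) \<bullet> v x)"

definition hs_pairing :: "('a \<Rightarrow> real) \<Rightarrow> ('a \<Rightarrow> real) \<Rightarrow> real" where
  "hs_pairing u v = (LINT x|M. power_flux q (hw x * u x) \<bullet> (hw x * v x))"

lemma line_derivatives:
  assumes u: "u \<in> W0" and v: "v \<in> W0"
  shows "((\<lambda>t. dirichlet (\<lambda>x. u x + t * v x)) has_real_derivative p * grad_pairing u v) (at 0)"
    "((\<lambda>t. mass (\<lambda>x. u x + t * v x)) has_real_derivative p * mass_pairing u v) (at 0)"
    "((\<lambda>t. hs_mass (\<lambda>x. u x + t * v x)) has_real_derivative q * hs_pairing u v) (at 0)"
proof -
  show "((\<lambda>t. dirichlet (\<lambda>x. u x + t * v x)) has_real_derivative p * grad_pairing u v) (at 0)"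
    unfolding dirichlet_line[OF u v] grad_pairing_def
    by (rule lp_mass_directional_derivative[OF W0D(3)[OF u] W0D(3)[OF v] p_gt_1])
  show "((\<lambda>t. mass (\<lambda>x. u x + t * v x)) has_real_derivative p * mass_pairing u v) (at 0)"
    using lp_mass_directional_derivative[OF W0D(1)[OF u] W0D(1)[OF v] p_gt_1] by (simp add: mass_pairing_def)
  have "(\<lambda>x. hw x * (u x + t * v x)) = (\<lambda>x. hw x * u x + t *\<^sub>R (hw x * v x))" for t by (simp add: algebra_simps)
  then show "((\<lambda>t. hs_mass (\<lambda>x. u x + t * v x)) has_real_derivative q * hs_pairing u v) (at 0)"
    using lp_mass_directional_derivative[OF hs_inequality(1)[OF u] hs_inequality(1)[OF v] q_gt_1]
    by (simp only: hs_mass_def hs_pairing_def)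
qed

lemma line_zero: "(\<lambda>x. u x + 0 * v x) = u" for u v :: "'a \<Rightarrow> real" by simp

lemma dirichlet_lsc:
  assumes v: "\<And>n::nat. v n \<in> W0" and bd: "\<And>n. dirichlet (v n) \<le> c"
    and D: "\<And>n. dirichlet (v n) \<le> D n" "D \<longlonglongrightarrow> T"
    and u: "u \<in> lp_space p M" and lim: "(\<lambda>n. lp_mass p M (\<lambda>x. v n x - u x)) \<longlonglongrightarrow> 0"
  shows "dirichlet u \<le> T"
proof (rule field_le_epsilon)
  fix e :: real assume e: "0 < e"
  have "\<forall>\<^sub>F n in sequentially. D n < T + e / 2" using e by (intro order_tendstoD(2)[OF D(2)]) simp
  then obtain n0 where n0: "\<And>n. n \<ge> n0 \<Longrightarrow> D n < T + e / 2" unfolding eventually_sequentially by blast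
  have \<Omega>: "\<Omega> \<in> sets M" using sets.top[of M] space_M by simp
  have "0 < e / 2" using e by simp
  from dirichlet_far_frequently[OF v bd u lim \<Omega> this, of n0]
  obtain n where n: "n \<ge> n0" "dirichlet u - e / 2 < dirichlet (v n)"
    unfolding indicator_dom_mass by auto
  show "dirichlet u \<le> T + e" using n(2) D(1)[of n] n0[OF n(1)] by (simp add: field_simps)
qed

text \<open>
  The minimum of the Rayleigh quotient, identified below with the first eigenvalue.
\<close>

definition ray :: real where
  "ray = (INF u \<in> {u \<in> W0. nontrivial_on \<Omega> u}. dirichlet u / mass u)"

lemma trivial_masses:
  assumes "\<not> nontrivial_on \<Omega> u" shows "mass u = 0" "hs_mass u = 0"
proof -
  have ae: "AE x in M. u x = 0" using assms by (simp add: nontrivial_on_def)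
  then have hae: "AE x in M. hw x * u x = 0" by eventually_elim simp
  show "mass u = 0" by (rule lp_zero_AE(2)[OF ae])
  show "hs_mass u = 0" unfolding hs_mass_def by (rule lp_zero_AE(2)[OF hae])
qed

lemma ray_bdd: "bdd_below ((\<lambda>u. dirichlet u / mass u) ` {u \<in> W0. nontrivial_on \<Omega> u})"
  by (rule bdd_belowI2[of _ 0]) (simp add: lp_mass_nonneg)

lemma ray_nonneg: "0 \<le> ray"
  unfolding ray_def using exists_nontrivial by (intro cINF_greatest) (auto simp: lp_mass_nonneg)

lemma ray_le:
  assumes u: "u \<in> W0" shows "ray * mass u \<le> dirichlet u"
proof (cases "nontrivial_on \<Omega> u")
  case True
  have "ray \<le> dirichlet u / mass u" unfolding ray_def using u True by (intro cINF_lower[OF ray_bdd]) auto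
  then show ?thesis using nontrivial_iff[OF u] True by (simp add: pos_le_divide_eq)
qed (simp add: trivial_masses lp_mass_nonneg)

lemma ray_attained:
  obtains e where "e \<in> W0" "nontrivial_on \<Omega> e" "dirichlet e = ray * mass e"
proof -
  have "\<exists>w\<in>W0. mass w = 1 \<and> dirichlet w < ray + inverse (real (Suc n))" for n
  proof -
    have "\<exists>w\<in>{u \<in> W0. nontrivial_on \<Omega> u}. dirichlet w / mass w < ray + inverse (real (Suc n))"
      unfolding ray_def using exists_nontrivial by (intro cINF_less_iff[THEN iffD1] ray_bdd) auto
    then obtain w where w: "w \<in> W0" "nontrivial_on \<Omega> w" "dirichlet w / mass w < ray + inverse (real (Suc n))" by blast
    have m: "0 < mass w" using w nontrivial_iff by blast
    note sc = W0_scale[OF w(1), of "mass w powr (- 1 / p)"]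
    have "mass (\<lambda>x. mass w powr (- 1 / p) * w x) = 1" "dirichlet (\<lambda>x. mass w powr (- 1 / p) * w x) = dirichlet w / mass w"
      unfolding sc(2,3) inv_pow_root[OF m p_pos] using m by auto
    then show ?thesis using sc(1) w(3) by (intro bexI[of _ "\<lambda>x. mass w powr (- 1 / p) * w x"]) auto
  qed
  then obtain v where v: "\<And>n. v n \<in> W0" "\<And>n. mass (v n) = 1" "\<And>n. dirichlet (v n) < ray + inverse (real (Suc n))"
    by metis
  have i1: "inverse (real (Suc n)) \<le> 1" for n by (simp add: inverse_le_1_iff)
  have bd: "mass (v n) \<le> ray + 1" "dirichlet (v n) \<le> ray + 1" for n
    using v(2)[of n] v(3)[of n] i1[of n] ray_nonneg by linarith+
  obtain \<sigma> :: "nat \<Rightarrow> nat" and u where \<sigma>: "strict_mono \<sigma>" and u: "u \<in> W0"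
    "(\<lambda>n. lp_mass p M (\<lambda>x. v (\<sigma> n) x - u x)) \<longlonglongrightarrow> 0"
    by (rule rellich_W0[OF v(1) bd]) (rule that)
  have "(\<lambda>n. mass (v (\<sigma> n))) \<longlonglongrightarrow> mass u" by (rule lp_mass_tendsto[OF W0D(1)[OF v(1)] W0D(1)[OF u(1)] p_pos u(2)])
  then have m1: "mass u = 1" by (simp add: v(2) LIMSEQ_const_iff)
  have "(\<lambda>n. ray + inverse (real (Suc (\<sigma> n)))) \<longlonglongrightarrow> ray + 0"
    using LIMSEQ_subseq_LIMSEQ[OF LIMSEQ_inverse_real_of_nat \<sigma>] by (intro tendsto_intros) (simp add: o_def)
  then have Dl: "(\<lambda>n. ray + inverse (real (Suc (\<sigma> n)))) \<longlonglongrightarrow> ray" by simp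
  have "dirichlet u \<le> ray"
    by (rule dirichlet_lsc[OF v(1) bd(2) _ Dl W0D(1)[OF u(1)] u(2)]) (rule less_imp_le[OF v(3)])
  then have "dirichlet u = ray * mass u" using ray_le[OF u(1)] m1 by simp
  moreover have "nontrivial_on \<Omega> u" using nontrivial_iff[OF u(1)] m1 by simp
  ultimately show ?thesis using that u(1) by blast
qed

lemma power_flux_real: "power_flux r t = \<bar>t\<bar> powr (r - 2) * t" for t :: real
  by (simp add: power_flux_def)

text \<open>
  A minimiser of the Rayleigh quotient is an eigenfunction, since its first variation vanishes. Conversely, testing
  an eigenfunction with itself bounds its eigenvalue below by the minimum.
\<close>

lemma first_eigenvalue_eq: "first_eigenvalue p \<Omega> = ray"
  unfolding first_eigenvalue_def
proof (rule Least_equality)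
  obtain e where e: "e \<in> W0" "nontrivial_on \<Omega> e" "dirichlet e = ray * mass e" by (rule ray_attained)
  have "weak_solution p \<Omega> (\<lambda>x t. ray * (\<bar>t\<bar> powr (p - 2) * t)) e" unfolding weak_solution_def
  proof (intro conjI ballI e(1))
    fix v assume v: "v \<in> W0"
    have eq: "ray * (\<bar>e x\<bar> powr (p - 2) * e x) * v x = ray * (power_flux p (e x) \<bullet> v x)" for x
      by (simp add: power_flux_real)
    have int: "integrable M (\<lambda>x. power_flux p (e x) \<bullet> v x)"
      by (rule power_flux_pairing(3)[OF W0D(1)[OF e(1)] W0D(1)[OF v] p_gt_1])
    show "integrable M (\<lambda>x. ray * (\<bar>e x\<bar> powr (p - 2) * e x) * v x)" unfolding eq using int by simp
    define h where "h = (\<lambda>t. dirichlet (\<lambda>x. e x + t * v x) - ray * mass (\<lambda>x. e x + t * v x))"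
    have "(h has_real_derivative p * grad_pairing e v - ray * (p * mass_pairing e v)) (at 0)"
      unfolding h_def by (intro DERIV_diff DERIV_cmult line_derivatives e(1) v)
    moreover have "\<forall>y. \<bar>0 - y\<bar> < 1 \<longrightarrow> h 0 \<le> h y"
      using ray_le[OF W0_lincomb(1)[OF e(1) v]] e(3) unfolding h_def line_zero by auto
    ultimately have "p * grad_pairing e v - ray * (p * mass_pairing e v) = 0"
      by (rule DERIV_local_min[OF _ zero_less_one])
    then have "p * (grad_pairing e v - ray * mass_pairing e v) = 0" by (simp add: right_diff_distrib mult.left_commute)
    then have "grad_pairing e v = ray * mass_pairing e v" using p_pos by simp
    then show "(LINT x|M. norm (wgrad e x) powr (p - 2) * (wgrad e x \<bullet> wgrad v x)) = (LINT x|M. ray * (\<bar>e x\<bar> powr (p - 2) * e x) * v x)"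
      unfolding eq by (simp add: grad_pairing_def mass_pairing_def power_flux_def)
  qed
  then show "p_laplace_eigenvalue p \<Omega> ray" using e(2) by (auto simp: p_laplace_eigenvalue_def)
next
  fix lam assume "p_laplace_eigenvalue p \<Omega> lam"
  then obtain u where w: "weak_solution p \<Omega> (\<lambda>x t. lam * (\<bar>t\<bar> powr (p - 2) * t)) u" and nt: "nontrivial_on \<Omega> u"
    by (auto simp: p_laplace_eigenvalue_def)
  have u: "u \<in> W0" using w by (simp add: weak_solution_def)
  have g1: "norm (wgrad u x) powr (p - 2) * (wgrad u x \<bullet> wgrad u x) = norm (wgrad u x) powr p" for x
    using inner_power_flux_self[of p "wgrad u x"] by (simp add: power_flux_def)
  have g2: "lam * (\<bar>u x\<bar> powr (p - 2) * u x) * u x = lam * norm (u x) powr p" for x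
    using inner_power_flux_self[of p "u x"] by (simp add: power_flux_def)
  have "(LINT x|M. norm (wgrad u x) powr (p - 2) * (wgrad u x \<bullet> wgrad u x)) = (LINT x|M. lam * (\<bar>u x\<bar> powr (p - 2) * u x) * u x)"
    using w u unfolding weak_solution_def by blast
  then have "dirichlet u = lam * mass u"
    unfolding g1 g2 by (simp add: lp_mass_def)
  then have "ray * mass u \<le> lam * mass u" using ray_le[OF u] by simp
  then show "ray \<le> lam" using nontrivial_iff[OF u] nt by simp
qed

section \<open>Critical points\<close>

lemma energy_eq:
  assumes w: "w \<in> W0"
  shows "hs_energy p s \<Omega> lam w = 1 / p * (dirichlet w - lam * mass w) - 1 / q * hs_mass w"
  unfolding hs_energy_def q_eq[symmetric] hs_integrand hs_mass_def lp_mass_def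
  using lp_space_integrable[OF W0D(1)[OF w]] lp_space_integrable[OF W0D(3)[OF w]] lp_space_integrable[OF hs_inequality(1)[OF w]]
  by simp

lemma norms_le_sobolev:
  assumes v: "v \<in> W0"
  shows "dirichlet v powr (1/p) \<le> sobolev_norm p \<Omega> v" "mass v powr (1/p) \<le> sobolev_norm p \<Omega> v"
    "hs_mass v powr (1/q) \<le> (1 / \<mu>) powr (1/p) * sobolev_norm p \<Omega> v"
proof -
  show d: "dirichlet v powr (1/p) \<le> sobolev_norm p \<Omega> v" and "mass v powr (1/p) \<le> sobolev_norm p \<Omega> v"
    unfolding sobolev_norm_eq using p_pos by (auto intro!: powr_mono2 simp: lp_mass_nonneg)
  have "hs_mass v powr (p / q) \<le> 1 / \<mu> * dirichlet v"
    using hs_inequality(2)[OF v] mu_pos by (simp add: pos_le_divide_eq mult.commute)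
  then have "(hs_mass v powr (p / q)) powr (1/p) \<le> (1 / \<mu> * dirichlet v) powr (1/p)" using p_pos by (intro powr_mono2) auto
  also have "\<dots> = (1 / \<mu>) powr (1/p) * dirichlet v powr (1/p)" by (rule powr_mult)
  also have "\<dots> \<le> (1 / \<mu>) powr (1/p) * sobolev_norm p \<Omega> v" using d by (rule mult_left_mono) simp
  finally show "hs_mass v powr (1/q) \<le> (1 / \<mu>) powr (1/p) * sobolev_norm p \<Omega> v" using p_pos by (simp add: powr_powr)
qed

text \<open>
  The three parts of the energy are Frechet differentiable in their own Lebesgue norms, all of which are
  controlled by the Sobolev norm. Their linear terms cancel by the weak equation.
\<close>

lemma critical_point_of_weak_equation:
  assumes U: "U \<in> W0" and eq: "\<And>v. v \<in> W0 \<Longrightarrow> grad_pairing U v = lam * mass_pairing U v + hs_pairing U v"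
  shows "critical_point p \<Omega> (hs_energy p s \<Omega> lam) U"
  unfolding critical_point_def
proof (intro conjI allI impI U)
  fix \<epsilon> :: real assume e: "0 < \<epsilon>"
  define k where "k = (1 / \<mu>) powr (1/p)"
  have k: "0 \<le> k" by (simp add: k_def)
  define e1 where "e1 = \<epsilon> / (1 + \<bar>lam\<bar> + k)"
  have s1: "0 < 1 + \<bar>lam\<bar> + k" using k by simp
  have e1: "0 < e1" "e1 * (1 + \<bar>lam\<bar> + k) = \<epsilon>" using e s1 by (auto simp: e1_def)
  obtain d1 where d1: "0 < d1" "\<And>h. h \<in> lp_space p M \<Longrightarrow> lp_mass p M h powr (1/p) < d1 \<Longrightarrow>
       \<bar>lp_mass p M (\<lambda>x. wgrad U x + h x) - dirichlet U - p * (LINT x|M. power_flux p (wgrad U x) \<bullet> h x)\<bar> \<le> e1 * lp_mass p M h powr (1/p)"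
    by (rule lp_mass_frechet[OF W0D(3)[OF U] p_gt_1 e1(1)]) (rule that)
  obtain d2 where d2: "0 < d2" "\<And>h. h \<in> lp_space p M \<Longrightarrow> lp_mass p M h powr (1/p) < d2 \<Longrightarrow>
       \<bar>mass (\<lambda>x. U x + h x) - mass U - p * (LINT x|M. power_flux p (U x) \<bullet> h x)\<bar> \<le> e1 * lp_mass p M h powr (1/p)"
    by (rule lp_mass_frechet[OF W0D(1)[OF U] p_gt_1 e1(1)]) (rule that)
  obtain d3 where d3: "0 < d3" "\<And>h. h \<in> lp_space q M \<Longrightarrow> lp_mass q M h powr (1/q) < d3 \<Longrightarrow>
       \<bar>lp_mass q M (\<lambda>x. hw x * U x + h x) - lp_mass q M (\<lambda>x. hw x * U x) - q * (LINT x|M. power_flux q (hw x * U x) \<bullet> h x)\<bar> \<le> e1 * lp_mass q M h powr (1/q)"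
    by (rule lp_mass_frechet[OF hs_inequality(1)[OF U] q_gt_1 e1(1)]) (rule that)
  show "\<exists>\<delta>>0. \<forall>v\<in>W0. sobolev_norm p \<Omega> v < \<delta> \<longrightarrow>
      \<bar>hs_energy p s \<Omega> lam (\<lambda>x. U x + v x) - hs_energy p s \<Omega> lam U\<bar> \<le> \<epsilon> * sobolev_norm p \<Omega> v"
  proof (intro exI conjI ballI impI)
    show "0 < min d1 (min d2 (d3 / (k + 1)))" using d1 d2 d3 k by simp
    fix v assume v: "v \<in> W0" and lt: "sobolev_norm p \<Omega> v < min d1 (min d2 (d3 / (k + 1)))"
    define n where "n = sobolev_norm p \<Omega> v"
    have n0: "0 \<le> n" by (simp add: n_def sobolev_norm_eq)
    have nl: "n < d1" "n < d2" "n < d3 / (k + 1)" using lt by (auto simp: n_def)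
    have kn: "k * n < d3"
    proof -
      have "n * (k + 1) < d3" using nl(3) k by (simp add: pos_less_divide_eq)
      then show ?thesis using n0 by (simp add: distrib_left mult.commute)
    qed
    note nv = norms_le_sobolev[OF v, folded n_def k_def]
    have Uv: "(\<lambda>x. U x + v x) \<in> W0" and line: "dirichlet (\<lambda>x. U x + v x) = lp_mass p M (\<lambda>x. wgrad U x + wgrad v x)"
      using W0_lincomb(1)[OF U v, of 1] dirichlet_line[OF U v, of 1] by simp_all
    have hsum: "hs_mass (\<lambda>x. U x + v x) = lp_mass q M (\<lambda>x. hw x * U x + hw x * v x)" by (simp add: hs_mass_def distrib_left)
    define x1 where "x1 = dirichlet (\<lambda>x. U x + v x) - dirichlet U - p * grad_pairing U v"
    define x2 where "x2 = mass (\<lambda>x. U x + v x) - mass U - p * mass_pairing U v"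
    define x3 where "x3 = hs_mass (\<lambda>x. U x + v x) - hs_mass U - q * hs_pairing U v"
    have b1: "\<bar>x1\<bar> \<le> e1 * n"
      using d1(2)[OF W0D(3)[OF v] le_less_trans[OF nv(1) nl(1)]] mult_left_mono[OF nv(1) less_imp_le[OF e1(1)]]
      unfolding x1_def line grad_pairing_def by linarith
    have b2: "\<bar>x2\<bar> \<le> e1 * n"
      using d2(2)[OF W0D(1)[OF v] le_less_trans[OF nv(2) nl(2)]] mult_left_mono[OF nv(2) less_imp_le[OF e1(1)]]
      unfolding x2_def mass_pairing_def by linarith
    have b3: "\<bar>x3\<bar> \<le> e1 * (k * n)"
      using d3(2)[OF hs_inequality(1)[OF v]] le_less_trans[OF nv(3) kn] mult_left_mono[OF nv(3) less_imp_le[OF e1(1)]]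
      unfolding x3_def hsum hs_pairing_def unfolding hs_mass_def by linarith
    have "hs_energy p s \<Omega> lam (\<lambda>x. U x + v x) - hs_energy p s \<Omega> lam U
        = x1 / p - lam * (x2 / p) - x3 / q + (grad_pairing U v - lam * mass_pairing U v - hs_pairing U v)"
      unfolding energy_eq[OF Uv] energy_eq[OF U] x1_def x2_def x3_def using p_pos q_pos by (simp add: field_simps)
    also have "\<dots> = x1 / p - lam * (x2 / p) - x3 / q" using eq[OF v] by simp
    also have "\<bar>\<dots>\<bar> \<le> \<bar>x1 / p\<bar> + \<bar>lam * (x2 / p)\<bar> + \<bar>x3 / q\<bar>" by linarith
    also have "\<dots> \<le> e1 * n + \<bar>lam\<bar> * (e1 * n) + e1 * (k * n)"
    proof (intro add_mono)
      have dv: "\<bar>x / r\<bar> \<le> \<bar>x\<bar>" if "1 < r" for x r :: real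
        using that by (simp add: abs_divide pos_divide_le_eq mult_right_mono[of 1 r "\<bar>x\<bar>", simplified] mult_le_cancel_left1)
      show "\<bar>x1 / p\<bar> \<le> e1 * n" using dv[OF p_gt_1, of x1] b1 by linarith
      show "\<bar>lam * (x2 / p)\<bar> \<le> \<bar>lam\<bar> * (e1 * n)" unfolding abs_mult
        using dv[OF p_gt_1, of x2] b2 by (intro mult_left_mono) auto
      show "\<bar>x3 / q\<bar> \<le> e1 * (k * n)" using dv[OF q_gt_1, of x3] b3 by linarith
    qed
    also have "\<dots> = (e1 * (1 + \<bar>lam\<bar> + k)) * n" by (simp add: algebra_simps)
    finally show "\<bar>hs_energy p s \<Omega> lam (\<lambda>x. U x + v x) - hs_energy p s \<Omega> lam U\<bar> \<le> \<epsilon> * sobolev_norm p \<Omega> v"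
      by (simp only: e1(2) n_def)
  qed
qed

text \<open>
  With \<open>S = \<beta>\<^bsup>1-p/q\<^esup>\<close> the function \<open>E(w) - S B(w)\<^bsup>p/q\<^esup>\<close> is nonnegative and vanishes at \<open>U\<close>, so its derivative
  along each line through \<open>U\<close> is 0. Since \<open>B(U) = \<beta>\<close>, the Lagrange multiplier is 1.
\<close>

lemma hs_solution_of_optimal:
  assumes U: "U \<in> W0" and \<beta>: "0 < \<beta>" "dirichlet U - lam * mass U = \<beta>" "hs_mass U = \<beta>"
    and opt: "\<And>w. w \<in> W0 \<Longrightarrow> \<beta> powr (1 - p / q) * hs_mass w powr (p / q) \<le> dirichlet w - lam * mass w"
  shows "hs_solution p s \<Omega> lam U"
proof -
  define S where "S = \<beta> powr (1 - p / q)"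
  have eq: "grad_pairing U v = lam * mass_pairing U v + hs_pairing U v" if v: "v \<in> W0" for v
  proof -
    define h where "h = (\<lambda>t. dirichlet (\<lambda>x. U x + t * v x) - lam * mass (\<lambda>x. U x + t * v x) - S * hs_mass (\<lambda>x. U x + t * v x) powr (p / q))"
    have pw: "((\<lambda>t. hs_mass (\<lambda>x. U x + t * v x) powr (p / q)) has_real_derivative
        p / q * hs_mass (\<lambda>x. U x + 0 * v x) powr (p / q - of_nat 1) * (q * hs_pairing U v)) (at 0)"
      by (rule DERIV_fun_powr[OF line_derivatives(3)[OF U v]]) (simp add: \<beta>)
    have der: "(h has_real_derivative p * grad_pairing U v - lam * (p * mass_pairing U v)
        - S * (p / q * hs_mass (\<lambda>x. U x + 0 * v x) powr (p / q - of_nat 1) * (q * hs_pairing U v))) (at 0)"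
      unfolding h_def by (intro DERIV_diff DERIV_cmult line_derivatives(1,2) U v pw)
    have h0: "h 0 = 0"
    proof -
      have "S * \<beta> powr (p / q) = \<beta>" using \<beta>(1) by (simp add: S_def powr_add[symmetric])
      then show ?thesis unfolding h_def line_zero using \<beta>(2,3) by simp
    qed
    have min: "\<forall>y. \<bar>0 - y\<bar> < 1 \<longrightarrow> h 0 \<le> h y"
      unfolding h0 using opt[OF W0_lincomb(1)[OF U v]] by (auto simp: h_def S_def)
    have "S * \<beta> powr (p / q - 1) = 1" using \<beta>(1) by (simp add: S_def powr_add[symmetric])
    then have Sb: "S * (p / q * \<beta> powr (p / q - 1) * (q * x)) = p * x" for x
    proof -
      have "S * (p / q * \<beta> powr (p / q - 1) * (q * x)) = (S * \<beta> powr (p / q - 1)) * (p / q * q) * x" by (simp only: mult_ac)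
      also have "\<dots> = p * x" unfolding \<open>S * \<beta> powr (p / q - 1) = 1\<close> using q_pos by simp
      finally show ?thesis .
    qed
    have "p * grad_pairing U v - lam * (p * mass_pairing U v) - p * hs_pairing U v = 0"
      using DERIV_local_min[OF der zero_less_one min] unfolding line_zero \<beta>(3) by (simp only: of_nat_1 Sb)
    then have "p * (grad_pairing U v - lam * mass_pairing U v - hs_pairing U v) = 0" by (simp add: algebra_simps)
    then show ?thesis using p_pos by simp
  qed
  have "weak_solution p \<Omega> (\<lambda>x t. lam * (\<bar>t\<bar> powr (p - 2) * t) + \<bar>t\<bar> powr (q - 2) / norm x powr s * t) U"
    unfolding weak_solution_def
  proof (intro conjI ballI U)
    fix v assume v: "v \<in> W0"
    have pt: "(lam * (\<bar>U x\<bar> powr (p - 2) * U x) + \<bar>U x\<bar> powr (q - 2) / norm x powr s * U x) * v x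
        = lam * (power_flux p (U x) \<bullet> v x) + power_flux q (hw x * U x) \<bullet> (hw x * v x)" for x
    \<comment> \<open>At the origin both forms of the weight have the value 0.\<close>
    proof (cases "x = 0")
      case True
      then have "hw x = 0" by (simp add: hw_def)
      then show ?thesis using True by (simp add: power_flux_real)
    next
      case False
      then have h: "0 < hw x" by (simp add: hw_def)
      have "hw x powr (q - 2) * hw x * hw x = hw x powr (q - 2) * hw x powr 2" using h by (simp add: power2_eq_square)
      also have "\<dots> = hw x powr q" by (simp only: powr_add[symmetric]) simp
      finally have e: "hw x powr (q - 2) * hw x * hw x = 1 / norm x powr s" by (simp only: hw_powr)
      have "power_flux q (hw x * U x) \<bullet> (hw x * v x) = (hw x powr (q - 2) * hw x * hw x) * (\<bar>U x\<bar> powr (q - 2) * U x * v x)"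
        using h by (simp add: power_flux_real abs_mult powr_mult mult_ac)
      then show ?thesis unfolding e by (simp add: power_flux_real distrib_right)
    qed
    have i1: "integrable M (\<lambda>x. power_flux p (U x) \<bullet> v x)"
      by (rule power_flux_pairing(3)[OF W0D(1)[OF U] W0D(1)[OF v] p_gt_1])
    have i2: "integrable M (\<lambda>x. power_flux q (hw x * U x) \<bullet> (hw x * v x))"
      by (rule power_flux_pairing(3)[OF hs_inequality(1)[OF U] hs_inequality(1)[OF v] q_gt_1])
    show "integrable M (\<lambda>x. (lam * (\<bar>U x\<bar> powr (p - 2) * U x) + \<bar>U x\<bar> powr (q - 2) / norm x powr s * U x) * v x)"
      unfolding pt using i1 i2 by simp
    have "(LINT x|M. lam * (power_flux p (U x) \<bullet> v x) + power_flux q (hw x * U x) \<bullet> (hw x * v x)) = lam * mass_pairing U v + hs_pairing U v"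
      unfolding mass_pairing_def hs_pairing_def by (subst Bochner_Integration.integral_add) (use i1 i2 in auto)
    moreover have "(LINT x|M. norm (wgrad U x) powr (p - 2) * (wgrad U x \<bullet> wgrad v x)) = grad_pairing U v"
      by (simp add: grad_pairing_def power_flux_def)
    ultimately show "(LINT x|M. norm (wgrad U x) powr (p - 2) * (wgrad U x \<bullet> wgrad v x))
        = (LINT x|M. (lam * (\<bar>U x\<bar> powr (p - 2) * U x) + \<bar>U x\<bar> powr (q - 2) / norm x powr s * U x) * v x)"
      unfolding pt using eq[OF v] by simp
  qed
  then show ?thesis
    unfolding hs_solution_def q_eq[symmetric] using critical_point_of_weak_equation[OF U eq] by blast
qed

text \<open>
  Let \<open>\<theta> = B(u)\<close> for the limit \<open>u\<close> of a minimising sequence. The concentration bound and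
  \<open>1 - \<theta>\<^bsup>p/q\<^esup> \<le> (1 - \<theta>)\<^bsup>p/q\<^esup>\<close> are compatible with \<open>S < \<mu>\<close> only for \<open>\<theta> = 1\<close>.
\<close>

lemma minimiser_exists:
  assumes lam: "0 < lam" "lam < ray" "(ray - lam) * hvol < \<mu>"
  obtains S u where "0 < S" "S \<le> (ray - lam) * hvol" "u \<in> W0" "hs_mass u = 1" "dirichlet u - lam * mass u = S"
    "\<And>w. w \<in> W0 \<Longrightarrow> S * hs_mass w powr (p / q) \<le> dirichlet w - lam * mass w"
proof -
  define E where "E = (\<lambda>w. dirichlet w - lam * mass w)"
  define \<kappa> where "\<kappa> = 1 - lam / ray"
  have ray0: "0 < ray" and \<kappa>: "0 < \<kappa>" using lam by (auto simp: \<kappa>_def)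
  have mass_le: "mass w \<le> dirichlet w / ray" if "w \<in> W0" for w
    using ray_le[OF that] ray0 by (simp add: pos_le_divide_eq mult.commute)
  have E_coercive: "\<kappa> * dirichlet w \<le> E w" if "w \<in> W0" for w
    using mult_left_mono[OF mass_le[OF that], of lam] lam by (simp add: E_def \<kappa>_def left_diff_distrib)
  let ?I = "{u \<in> W0. nontrivial_on \<Omega> u}"
  define S where "S = (INF w \<in> ?I. E w / hs_mass w powr (p / q))"
  have low: "\<kappa> * \<mu> \<le> E w / hs_mass w powr (p / q)" if "w \<in> ?I" for w
  proof -
    have w: "w \<in> W0" "0 < hs_mass w" using that nontrivial_hs_mass by auto
    have "\<kappa> * (\<mu> * hs_mass w powr (p / q)) \<le> \<kappa> * dirichlet w" using hs_inequality(2)[OF w(1)] \<kappa> by (intro mult_left_mono) auto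
    also have "\<dots> \<le> E w" by (rule E_coercive[OF w(1)])
    finally show ?thesis using w(2) by (simp add: pos_le_divide_eq mult.assoc)
  qed
  have bdd: "bdd_below ((\<lambda>w. E w / hs_mass w powr (p / q)) ` ?I)" by (rule bdd_belowI2[OF low])
  have ne: "?I \<noteq> {}" using exists_nontrivial by blast
  have "\<kappa> * \<mu> \<le> S" unfolding S_def by (rule cINF_greatest[OF ne low])
  then have S0: "0 < S" using \<kappa> mu_pos by (meson less_le_trans mult_pos_pos)
  have S_le: "S * hs_mass w powr (p / q) \<le> E w" if w: "w \<in> W0" for w
  proof (cases "nontrivial_on \<Omega> w")
    case True
    have "S \<le> E w / hs_mass w powr (p / q)" unfolding S_def using w True by (intro cINF_lower[OF bdd]) auto
    then show ?thesis using nontrivial_hs_mass[OF w True] by (simp add: pos_le_divide_eq)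
  next
    case False
    then show ?thesis using p_pos q_pos by (simp add: E_def trivial_masses lp_mass_nonneg)
  qed
  have S_up: "S \<le> (ray - lam) * hvol"
  proof -
    obtain e where e: "e \<in> W0" "nontrivial_on \<Omega> e" "dirichlet e = ray * mass e" by (rule ray_attained)
    have h: "0 < hs_mass e powr (p / q)" using nontrivial_hs_mass[OF e(1,2)] by simp
    have "S * hs_mass e powr (p / q) \<le> (ray - lam) * mass e" using S_le[OF e(1)] e(3) by (simp add: E_def left_diff_distrib)
    also have "\<dots> \<le> (ray - lam) * (hvol * hs_mass e powr (p / q))" using holder_global[OF e(1)] lam by (intro mult_left_mono) auto
    finally have "S * hs_mass e powr (p / q) \<le> ((ray - lam) * hvol) * hs_mass e powr (p / q)" by (simp only: mult.assoc)
    then show ?thesis using h by (rule mult_right_le_imp_le)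
  qed
  have "\<exists>w\<in>W0. hs_mass w = 1 \<and> E w < S + inverse (real (Suc n))" for n
  proof -
    have "\<exists>w\<in>?I. E w / hs_mass w powr (p / q) < S + inverse (real (Suc n))"
      unfolding S_def using ne by (intro cINF_less_iff[THEN iffD1] bdd) auto
    then obtain w where w: "w \<in> W0" "nontrivial_on \<Omega> w" "E w / hs_mass w powr (p / q) < S + inverse (real (Suc n))" by blast
    have h: "0 < hs_mass w" by (rule nontrivial_hs_mass[OF w(1,2)])
    define c where "c = hs_mass w powr (- 1 / q)"
    note sc = W0_scale[OF w(1), of c]
    have cq: "\<bar>c\<bar> powr q = 1 / hs_mass w" unfolding c_def by (rule inv_pow_root[OF h q_pos])
    have cp: "\<bar>c\<bar> powr p = 1 / hs_mass w powr (p / q)"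
    proof -
      have "\<bar>c\<bar> powr p = hs_mass w powr (- 1 / q * p)" unfolding c_def by (simp only: abs_of_nonneg[OF powr_ge_zero] powr_powr)
      also have "- 1 / q * p = - (p / q)" by simp
      finally show ?thesis by (simp add: powr_minus_divide)
    qed
    have "E (\<lambda>x. c * w x) = E w / hs_mass w powr (p / q)"
      unfolding E_def sc(2,3) cp by (simp add: diff_divide_distrib)
    moreover have "hs_mass (\<lambda>x. c * w x) = 1" unfolding sc(4) cq using h by simp
    ultimately show ?thesis using sc(1) w(3) by (intro bexI[of _ "\<lambda>x. c * w x"]) auto
  qed
  then obtain v where v: "\<And>n. v n \<in> W0" "\<And>n. hs_mass (v n) = 1" "\<And>n. E (v n) < S + inverse (real (Suc n))"
    by metis
  have i1: "inverse (real (Suc n)) \<le> 1" for n by (simp add: inverse_le_1_iff)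
  define c where "c = (S + 1) / \<kappa> + (S + 1) / \<kappa> / ray"
  have c0: "0 \<le> (S + 1) / \<kappa>" "0 \<le> (S + 1) / \<kappa> / ray" using S0 \<kappa> ray0 by auto
  have dv: "dirichlet (v n) \<le> (S + 1) / \<kappa>" for n
  proof -
    have "dirichlet (v n) * \<kappa> \<le> S + 1" using E_coercive[OF v(1)[of n]] v(3)[of n] i1[of n] by (simp only: mult.commute[of "dirichlet (v n)"])
    then show ?thesis using \<kappa> by (simp add: pos_le_divide_eq)
  qed
  have bd: "mass (v n) \<le> c" "dirichlet (v n) \<le> c" for n
  proof -
    have "mass (v n) \<le> (S + 1) / \<kappa> / ray"
      using mass_le[OF v(1)[of n]] divide_right_mono[OF dv[of n], of ray] ray0 by linarith
    then show "mass (v n) \<le> c" "dirichlet (v n) \<le> c" using dv[of n] c0 unfolding c_def by linarith+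
  qed
  obtain \<sigma> :: "nat \<Rightarrow> nat" and u where \<sigma>: "strict_mono \<sigma>" and u: "u \<in> W0" "u \<in> lp_space q M"
    "(\<lambda>n. lp_mass p M (\<lambda>x. v (\<sigma> n) x - u x)) \<longlonglongrightarrow> 0" "\<And>n. v n \<in> lp_space q M"
    "(\<lambda>n. lp_mass q M (\<lambda>x. v (\<sigma> n) x - u x)) \<longlonglongrightarrow> 0"
    by (rule rellich_W0[OF v(1) bd]) (rule that)
  define \<theta> where "\<theta> = hs_mass u"
  have \<theta>0: "0 \<le> \<theta>" by (simp add: \<theta>_def hs_mass_nonneg)
  have \<theta>1: "\<theta> \<le> 1"
  proof -
    obtain r where r: "strict_mono (r :: nat \<Rightarrow> nat)" "AE x in M. (\<lambda>k. v (\<sigma> (r k)) x) \<longlonglongrightarrow> u x"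
      by (rule lp_convergent_AE_subseq[OF W0D(1)[OF v(1)] W0D(1)[OF u(1)] p_pos u(3)]) (rule that)
    have ae: "AE x in M. (\<lambda>k. hw x * v (\<sigma> (r k)) x) \<longlonglongrightarrow> hw x * u x"
      using r(2) by eventually_elim (intro tendsto_intros)
    show ?thesis unfolding \<theta>_def hs_mass_def
    proof (rule lp_fatou(2)[OF hs_inequality(1)[OF v(1)] _ lp_space_measurable[OF hs_inequality(1)[OF u(1)]] q_pos ae])
      show "lp_mass q M (\<lambda>x. hw x * v (\<sigma> (r k)) x) \<le> 1" for k
        using v(2)[of "\<sigma> (r k)"] by (simp add: hs_mass_def)
    qed
  qed
  have massl: "(\<lambda>n. mass (v (\<sigma> n))) \<longlonglongrightarrow> mass u"
    by (rule lp_mass_tendsto[OF W0D(1)[OF v(1)] W0D(1)[OF u(1)] p_pos u(3)])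
  have "(\<lambda>n. S + inverse (real (Suc (\<sigma> n))) + lam * mass (v (\<sigma> n))) \<longlonglongrightarrow> S + 0 + lam * mass u"
    using LIMSEQ_subseq_LIMSEQ[OF LIMSEQ_inverse_real_of_nat \<sigma>] by (intro tendsto_intros massl) (simp add: o_def)
  then have Dl: "(\<lambda>n. S + inverse (real (Suc (\<sigma> n))) + lam * mass (v (\<sigma> n))) \<longlonglongrightarrow> S + lam * mass u" by simp
  have "\<mu> * (1 - hs_mass u) powr (p / q) \<le> (S + lam * mass u) - dirichlet u"
  proof (rule concentration_bound[OF v(1) v(2) bd(2) _ Dl u(1,2,4,3,5)])
    show "dirichlet (v (\<sigma> n)) \<le> S + inverse (real (Suc (\<sigma> n))) + lam * mass (v (\<sigma> n))" for n
      using v(3)[of "\<sigma> n"] unfolding E_def by linarith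
    show "hs_mass u \<le> 1" using \<theta>1 by (simp add: \<theta>_def)
  qed
  then have key: "\<mu> * (1 - \<theta>) powr (p / q) \<le> S - E u" by (simp add: \<theta>_def E_def)
  have Eu: "S * \<theta> powr (p / q) \<le> E u" using S_le[OF u(1)] by (simp add: \<theta>_def)
  have a: "0 < p / q" "p / q < 1" using p_pos q_pos p_less_q by auto
  have pw: "x \<le> x powr (p / q)" if "0 \<le> x" "x \<le> 1" for x :: real
    using powr_mono'[of "p / q" 1 x] that a by (cases "x = 0") auto
  have "\<theta> = 1"
  proof (rule ccontr)
    assume "\<theta> \<noteq> 1"
    then have pos: "0 < (1 - \<theta>) powr (p / q)" using \<theta>1 by simp
    have "1 - \<theta> powr (p / q) \<le> (1 - \<theta>) powr (p / q)" using pw[of \<theta>] pw[of "1 - \<theta>"] \<theta>0 \<theta>1 by simp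
    then have "S * (1 - \<theta> powr (p / q)) \<le> S * (1 - \<theta>) powr (p / q)" using S0 by (intro mult_left_mono) auto
    also have "\<dots> < \<mu> * (1 - \<theta>) powr (p / q)" using S_up lam(3) pos by (intro mult_strict_right_mono) auto
    finally show False using key Eu by (simp add: right_diff_distrib)
  qed
  then have "E u = S" using key Eu by simp
  then show ?thesis using that[OF S0 S_up u(1)] \<open>\<theta> = 1\<close> S_le unfolding E_def \<theta>_def by blast
qed

text \<open>
  A bound for the Sobolev norm of the solution, from \<open>S \<le> (\<lambda>\<^sub>1 - \<lambda>) V\<close>.
\<close>

definition norm_bound_fn :: "real \<Rightarrow> real" where
  "norm_bound_fn lam = (((ray - lam) * hvol) powr (q / (q - p))
     + (1 + ray) * (hvol * ((ray - lam) * hvol) powr (p / (q - p)))) powr (1 / p)"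

lemma solution_exists:
  assumes lam: "0 < lam" "lam < ray" "(ray - lam) * hvol < \<mu>"
  obtains U where "nontrivial_on \<Omega> U" "hs_solution p s \<Omega> lam U" "hs_solution p s \<Omega> lam (\<lambda>x. - U x)"
    "sobolev_norm p \<Omega> U \<le> norm_bound_fn lam"
proof -
  obtain S u where S: "0 < S" "S \<le> (ray - lam) * hvol" and u: "u \<in> W0" "hs_mass u = 1" "dirichlet u - lam * mass u = S"
    and opt: "\<And>w. w \<in> W0 \<Longrightarrow> S * hs_mass w powr (p / q) \<le> dirichlet w - lam * mass w"
    by (rule minimiser_exists[OF lam]) (rule that)
  have d: "0 < q - p" using p_less_q by simp
  define c where "c = S powr (1 / (q - p))"
  define \<beta> where "\<beta> = S powr (q / (q - p))"
  have c: "0 < c" "c powr p = S powr (p / (q - p))" "c powr q = \<beta>" using S by (auto simp: c_def \<beta>_def powr_powr)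
  have \<beta>: "0 < \<beta>" using S by (simp add: \<beta>_def)
  have cS: "c powr p * S = \<beta>"
  proof -
    have "c powr p * S = S powr (p / (q - p) + 1)" using S c(2) by (simp add: powr_add)
    also have "p / (q - p) + 1 = q / (q - p)" using d by (simp add: field_simps)
    finally show ?thesis by (simp add: \<beta>_def)
  qed
  have \<beta>S: "\<beta> powr (1 - p / q) = S"
  proof -
    have "\<beta> powr (1 - p / q) = S powr (q / (q - p) * (1 - p / q))" by (simp only: \<beta>_def powr_powr)
    also have "q / (q - p) * (1 - p / q) = 1" using d q_pos by (simp add: field_simps)
    finally show ?thesis using S by simp
  qed
  have \<beta>pq: "\<beta> powr (p / q) = S powr (p / (q - p))" using q_pos by (simp add: \<beta>_def powr_powr)
  have sol: "hs_solution p s \<Omega> lam (\<lambda>x. t * u x)" if t: "\<bar>t\<bar> = c" for t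
  proof (rule hs_solution_of_optimal[OF _ \<beta>])
    note sc = W0_scale[OF u(1), of t]
    show "(\<lambda>x. t * u x) \<in> W0" by (rule sc(1))
    have "dirichlet (\<lambda>x. t * u x) - lam * mass (\<lambda>x. t * u x) = c powr p * (dirichlet u - lam * mass u)"
      unfolding sc(2,3) t by (simp add: algebra_simps)
    then show "dirichlet (\<lambda>x. t * u x) - lam * mass (\<lambda>x. t * u x) = \<beta>" using cS u(3) by simp
    show "hs_mass (\<lambda>x. t * u x) = \<beta>" unfolding sc(4) t u(2) using c(3) by simp
    show "\<beta> powr (1 - p / q) * hs_mass w powr (p / q) \<le> dirichlet w - lam * mass w" if "w \<in> W0" for w
      unfolding \<beta>S by (rule opt[OF that])
  qed
  define U where "U = (\<lambda>x. c * u x)"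
  note sc = W0_scale[OF u(1), of c, folded U_def]
  have hU: "hs_mass U = \<beta>" unfolding sc(4) u(2) using c by simp
  have nt: "nontrivial_on \<Omega> U" using hU \<beta> trivial_masses(2)[of U] by force
  have EU: "dirichlet U - lam * mass U = \<beta>"
  proof -
    have "dirichlet U - lam * mass U = c powr p * (dirichlet u - lam * mass u)" unfolding sc(2,3) using c(1) by (simp add: algebra_simps)
    then show ?thesis using cS u(3) by simp
  qed
  have mU: "mass U \<le> hvol * S powr (p / (q - p))" using holder_global[OF sc(1)] unfolding hU \<beta>pq .
  let ?X = "(ray - lam) * hvol"
  have 1: "\<beta> \<le> ?X powr (q / (q - p))" unfolding \<beta>_def using S d q_pos by (intro powr_mono2) auto
  have "S powr (p / (q - p)) \<le> ?X powr (p / (q - p))" using S d p_pos by (intro powr_mono2) auto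
  then have 2: "mass U \<le> hvol * ?X powr (p / (q - p))" using mU mult_left_mono[of "S powr (p / (q - p))" "?X powr (p / (q - p))" hvol] by (meson order_trans powr_ge_zero)
  have "mass U + dirichlet U = \<beta> + (1 + lam) * mass U" using EU by (simp add: algebra_simps)
  also have "\<dots> \<le> ?X powr (q / (q - p)) + (1 + ray) * (hvol * ?X powr (p / (q - p)))"
    using 1 2 lam lp_mass_nonneg[of p M U] by (intro add_mono mult_mono) auto
  finally have "sobolev_norm p \<Omega> U \<le> norm_bound_fn lam"
    unfolding sobolev_norm_eq norm_bound_fn_def using p_pos by (intro powr_mono2) (auto simp: lp_mass_nonneg)
  then show ?thesis using that[OF nt] sol[of c] sol[of "- c"] c(1) by (simp add: U_def)
qed

lemma norm_bound_tendsto: "(norm_bound_fn \<longlongrightarrow> 0) (at_left ray)"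
proof -
  have d: "0 < q - p" using p_less_q by simp
  have x: "((\<lambda>lam. (ray - lam) * hvol) \<longlongrightarrow> (ray - ray) * hvol) (at_left ray)"
    by (intro tendsto_intros)
  have ev: "\<forall>\<^sub>F lam in at_left ray. 0 \<le> (ray - lam) * hvol"
    by (auto simp: eventually_at_left_field intro!: exI[of _ "ray - 1"])
  have "((\<lambda>lam. (((ray - lam) * hvol) powr (q / (q - p))
     + (1 + ray) * (hvol * ((ray - lam) * hvol) powr (p / (q - p)))) powr (1 / p)) \<longlongrightarrow>
     (((ray - ray) * hvol) powr (q / (q - p)) + (1 + ray) * (hvol * ((ray - ray) * hvol) powr (p / (q - p)))) powr (1 / p)) (at_left ray)"
    using d p_pos q_pos ray_nonneg
    by (intro tendsto_powr' tendsto_add tendsto_mult tendsto_const x disjI2 conjI ev always_eventually allI add_nonneg_nonneg mult_nonneg_nonneg) auto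
  then show ?thesis using p_pos unfolding norm_bound_fn_def[abs_def] by simp
qed

end

lemma (in sobolev_setting) sobolev_norm_zero: "sobolev_norm p \<Omega> (\<lambda>x. 0) = 0"
proof -
  have z: "(\<lambda>x::'a. 0::'b::euclidean_space) \<in> lp_space p M" by (simp add: lp_space_def)
  have "has_weak_gradient \<Omega> (\<lambda>x. 0) (\<lambda>x. 0)"
    using lp_imp_locally_integrable[OF z] by (simp add: has_weak_gradient_def locally_integrable_def)
  from lp_mass_AE_eq[OF wgrad_AE_eq[OF this]] have "dirichlet (\<lambda>x. 0) = lp_mass p M (\<lambda>x. 0::'a)"
    by (simp add: lp_space_def)
  then show ?thesis by (simp add: sobolev_norm_eq lp_mass_def)
qed

theorem theorem1p6:
  fixes \<Omega> :: "'a::euclidean_space set" and p s :: real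
  assumes "open \<Omega>" and "connected \<Omega>" and "bounded \<Omega>" and "0 \<in> \<Omega>"
    and "1 < p" and "p < real DIM('a)" and "0 < s" and "s < p"
  shows "\<exists>u :: real \<Rightarrow> 'a \<Rightarrow> real.
    (\<forall>lam. 0 < lam \<and>
        first_eigenvalue p \<Omega>
          - hs_constant p s \<Omega> / hs_volume p s \<Omega> powr ((p - s) / (real DIM('a) - s)) < lam \<and>
        lam < first_eigenvalue p \<Omega> \<longrightarrow>
      nontrivial_on \<Omega> (u lam) \<and>
      hs_solution p s \<Omega> lam (u lam) \<and>
      hs_solution p s \<Omega> lam (\<lambda>x. - u lam x)) \<and>
    ((\<lambda>lam. sobolev_norm p \<Omega> (u lam)) \<longlongrightarrow> 0) (at_left (first_eigenvalue p \<Omega>))"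
proof -
  let ?V = "hs_volume p s \<Omega> powr ((p - s) / (real DIM('a) - s))"
  interpret sobolev_setting \<Omega> p using assms by unfold_locales auto
  show ?thesis
  proof (cases "0 < hs_constant p s \<Omega>")
    case False
    then have "hs_constant p s \<Omega> / ?V \<le> 0" by (intro divide_nonpos_nonneg) auto
    then show ?thesis
      by (intro exI[of _ "\<lambda>lam x. 0"]) (auto simp: sobolev_norm_zero)
  next
    case True
    interpret hs_setting \<Omega> p s "hs_exponent TYPE('a) p s" "real DIM('a)"
      using assms True by unfold_locales auto
    define good where "good = (\<lambda>lam. 0 < lam \<and> ray - hs_constant p s \<Omega> / ?V < lam \<and> lam < ray)"
    have "\<exists>U. nontrivial_on \<Omega> U \<and> hs_solution p s \<Omega> lam U \<and> hs_solution p s \<Omega> lam (\<lambda>x. - U x) \<and> sobolev_norm p \<Omega> U \<le> norm_bound_fn lam"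
      if "good lam" for lam
    proof -
      have l: "0 < lam" "ray - hs_constant p s \<Omega> / ?V < lam" "lam < ray" using that by (auto simp: good_def)
      \<comment> \<open>Division by 0 gives 0, so for \<open>?V = 0\<close> the interval of admissible \<open>lam\<close> would be empty.\<close>
      have "?V \<noteq> 0" using l by auto
      then have V: "0 < ?V" by (simp add: less_le)
      have "ray - lam < hs_constant p s \<Omega> / ?V" using l by linarith
      then have "(ray - lam) * ?V < hs_constant p s \<Omega>" using V by (simp only: pos_less_divide_eq)
      from solution_exists[OF l(1,3) this] show ?thesis by metis
    qed
    then obtain U where U: "\<And>lam. good lam \<Longrightarrow> nontrivial_on \<Omega> (U lam) \<and> hs_solution p s \<Omega> lam (U lam) \<and>
      hs_solution p s \<Omega> lam (\<lambda>x. - U lam x) \<and> sobolev_norm p \<Omega> (U lam) \<le> norm_bound_fn lam" by metis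
    define u where "u = (\<lambda>lam. if good lam then U lam else (\<lambda>x. 0))"
    have bound: "sobolev_norm p \<Omega> (u lam) \<le> norm_bound_fn lam" for lam
      using U[of lam] by (auto simp: u_def sobolev_norm_zero norm_bound_fn_def)
    have "((\<lambda>lam. sobolev_norm p \<Omega> (u lam)) \<longlongrightarrow> 0) (at_left ray)"
    proof (rule tendsto_sandwich[OF _ _ tendsto_const norm_bound_tendsto])
      show "\<forall>\<^sub>F lam in at_left ray. 0 \<le> sobolev_norm p \<Omega> (u lam)" by (simp add: sobolev_norm_eq)
      show "\<forall>\<^sub>F lam in at_left ray. sobolev_norm p \<Omega> (u lam) \<le> norm_bound_fn lam"
        using bound by (intro always_eventually allI)
    qed
    then show ?thesis
      unfolding first_eigenvalue_eq using U by (intro exI[of _ u]) (auto simp: u_def good_def)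
  qed
qed

end
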